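(* Let $\lambda>0$, $T>0$, $n\in\mathbb{N}$. Assume that $x_0$ is smooth and $2\pi$-periodic and that the elastic-flow problem $$x_{t} = -\nabla_{s}^{2} y -\tfrac{1}{2} |y|^{2} y + \lambda \frac{x_{uu}}{|x_{u}|}, \qquad y = \frac{1}{|x_{u}|} \Big( \frac{x_{u}}{|x_{u}|} \Big)_{u},\qquad x(0,\cdot)=x_0,$$ has a smooth solution $x:[0,T]\times[0,2\pi]\to\mathbb{R}^n$, $2\pi$-periodic in $u$, and that there are constants $0<c_0\le C_0$ with $c_0\le|x_u|\le C_0$ and $|y|\le C_0$ in $[0,T]\times[0,2\pi]$. Consider partitions of $[0,2\pi]$ of mesh size $h$ satisfying the mesh conditions given in the context with fixed constants $\hat c,\bar c$. Then there exists $h_0>0$ such that for all $0<h\le h_0$ the semi-discrete problem (stated in the context) has a unique solution $(x_h,y_h)$ on $[0,T]$, and $$\sup_{t \in [0,T]} \| x(t, \cdot) - x_{h} (t, \cdot) \|^{2}_{H^{1}} + \int_{0}^{T} \| x_{t} (t, \cdot) - x_{ht} (t, \cdot) \|^{2}_{L^{2}}\, dt \leq Ch^{2},$$ $$\sup_{t \in [0,T]} \| y(t, \cdot) - y_{h} (t, \cdot) \|^{2}_{L^{2}} + \int_{0}^{T} \| y_{u} (t, \cdot) - y_{hu} (t, \cdot) \|^{2}_{L^{2}}\, dt \leq Ch^{2},$$ where the constant $C$ is independent of $h$ and depends (besides the fixed mesh constants $\hat c,\bar c$) only on $T$, $c_0$, $C_0$, $\lambda$ and on higher norms of the solution $x$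 of the continuous problem.
   Context: Subscripts $t,u$ denote partial derivatives; $\tau=x_u/|x_u|$ is the unit tangent, $\partial_s=|x_u|^{-1}\partial_u$ the arc-length derivative, and $\nabla_s\phi=\partial_s\phi-(\partial_s\phi\cdot\tau)\tau$ for vector fields $\phi$ along the curve; $y$ is the curvature vector. Norms $\|\cdot\|_{L^2},\|\cdot\|_{H^1}$ are over $u\in(0,2\pi)$. Mesh: $0=u_0<u_1<\dots<u_N=2\pi$, $I_j=[u_{j-1},u_j]$, $h_j=u_j-u_{j-1}$, $h=\max_j h_j$, with $h\le\hat c\,h_j$ and $|h_{j+1}-h_j|\le\bar c\,h^2$ for $j=1,\dots,N$ (with $h_{N+1}=h_1$), where $\hat c,\bar c>0$ are independent of $h$. Finite element space: $X_h=\{\eta_h\in C^0([0,2\pi]):\eta_h|_{I_j}\text{ is linear for }j=1,\dots,N,\ \eta_h(0)=\eta_h(2\pi)\}$; $I_h$ is the nodal Lagrange interpolation operator onto continuous piecewise linear functions on this mesh (applied componentwise). Semi-discrete problem: find $x_h,y_h:[0,T]\times[0,2\pi]\to\mathbb{R}^n$ with $x_h(t,\cdot),y_h(t,\cdot)\in X_h^n$ (with $t$-differentiable nodal values and $x_{hu}\neq0$ on each $I_j$) such that for all $\phi_h,\psi_h\in X_h^n$ and $t\in[0,T]$ $$\int_{0}^{2\pi}I_{h} (x_{ht} \cdot \phi_{h} ) |x_{hu}| - \int_{0}^{2\pi} \frac{P_{h} y_{hu} \cdot \phi_{hu}}{|x_{hu}|} -\frac{1}{2}\int_{0}^{2\pi}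 I_{h}(|y_{h}|^{2}) (\tau_{h} \cdot \phi_{hu} ) + \lambda \int_{0}^{2\pi} x_{hu} \cdot \phi_{hu} =0,$$ $$\int_{0}^{2\pi} I_{h}(y_{h} \cdot \psi_{h}) |x_{hu}| + \int_{0}^{2\pi} \tau_{h} \cdot \psi_{hu} =0,\qquad x_h(0,\cdot)=I_hx_0,$$ where all integrals are with respect to $u$, $\tau_h=x_{hu}/|x_{hu}|$ and $P_h=I-\tau_h\otimes\tau_h$ (defined piecewise on the $I_j$). *)

theory Defs
  imports "HOL-Analysis.Analysis"
begin

text \<open>
  Time-dependent curves are functions \<open>f t u\<close>.  Only \<open>t \<in> {0..T}\<close> is relevant, so the
  \<open>t\<close>-derivative is taken within \<open>{0..T}\<close> (one-sided at the end points).  Periodic functions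
  live on the whole real line in \<open>u\<close>, so their \<open>u\<close>-derivative is two-sided.  For piecewise
  linear functions \<open>du\<close> is the slope in the interior of each mesh interval; its value at the
  finitely many nodes is irrelevant because it only occurs there under integrals.
\<close>

definition du :: "(real \<Rightarrow> 'a::real_normed_vector) \<Rightarrow> real \<Rightarrow> 'a" where
  "du g u = vector_derivative g (at u)"

definition pdu :: "(real \<Rightarrow> real \<Rightarrow> 'a::real_normed_vector) \<Rightarrow> real \<Rightarrow> real \<Rightarrow> 'a" where
  "pdu f t u = du (f t) u"

definition pdt :: "real \<Rightarrow> (real \<Rightarrow> real \<Rightarrow> 'a::real_normed_vector) \<Rightarrow> real \<Rightarrow> real \<Rightarrow> 'a" where
  "pdt T f t u = vector_derivative (\<lambda>s. f s u) (at t within {0..T})"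

primrec Ck_on_strip ::
  "real \<Rightarrow> nat \<Rightarrow> (real \<Rightarrow> real \<Rightarrow> 'a::real_normed_vector) \<Rightarrow> bool" where
  "Ck_on_strip T 0 f \<longleftrightarrow> continuous_on ({0..T} \<times> UNIV) (\<lambda>(t, u). f t u)"
| "Ck_on_strip T (Suc k) f \<longleftrightarrow>
     continuous_on ({0..T} \<times> UNIV) (\<lambda>(t, u). f t u) \<and>
     (\<forall>t\<in>{0..T}. \<forall>u. (\<lambda>s. f s u) differentiable (at t within {0..T}) \<and> f t differentiable (at u)) \<and>
     Ck_on_strip T k (pdt T f) \<and> Ck_on_strip T k (pdu f)"

definition smooth_on_strip :: "real \<Rightarrow> (real \<Rightarrow> real \<Rightarrow> 'a::real_normed_vector) \<Rightarrow> bool" where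
  "smooth_on_strip T f \<longleftrightarrow> (\<forall>k. Ck_on_strip T k f)"

definition smooth_curve :: "(real \<Rightarrow> 'a::real_normed_vector) \<Rightarrow> bool" where
  "smooth_curve g \<longleftrightarrow> (\<forall>k u. (du ^^ k) g differentiable (at u))"

definition periodic_2pi :: "(real \<Rightarrow> 'a) \<Rightarrow> bool" where
  "periodic_2pi g \<longleftrightarrow> (\<forall>u. g (u + 2 * pi) = g u)"

text \<open>The norm of \<open>C\<^sup>k([0,T] \<times> [0,2\<pi>])\<close>; the supremum is finite for smooth functions.\<close>

definition Ck_norm ::
  "real \<Rightarrow> nat \<Rightarrow> (real \<Rightarrow> real \<Rightarrow> 'a::real_normed_vector) \<Rightarrow> real" where
  "Ck_norm T k f =
     Sup {norm ((pdt T ^^ i) ((pdu ^^ j) f) t u) | i j t u.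
            i + j \<le> k \<and> t \<in> {0..T} \<and> u \<in> {0..2 * pi}}"

text \<open>
  Squared norms on \<open>(0,2\<pi>)\<close>, with values in the extended non-negative reals so that
  a bound includes the finiteness of the norm.
\<close>

definition L2_sq :: "(real \<Rightarrow> 'a::real_normed_vector) \<Rightarrow> ennreal" where
  "L2_sq g = (\<integral>\<^sup>+ u \<in> {0..2 * pi}. ennreal ((norm (g u))\<^sup>2) \<partial>lborel)"

definition H1_sq :: "(real \<Rightarrow> 'a::real_normed_vector) \<Rightarrow> ennreal" where
  "H1_sq g = L2_sq g + L2_sq (du g)"

definition tangent :: "(real \<Rightarrow> 'a::real_inner) \<Rightarrow> real \<Rightarrow> 'a" where
  "tangent \<gamma> u = du \<gamma> u /\<^sub>R norm (du \<gamma> u)"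

definition curvature_vec :: "(real \<Rightarrow> 'a::real_inner) \<Rightarrow> real \<Rightarrow> 'a" where
  "curvature_vec \<gamma> u = du (tangent \<gamma>) u /\<^sub>R norm (du \<gamma> u)"

definition arc_deriv :: "(real \<Rightarrow> 'a::real_inner) \<Rightarrow> (real \<Rightarrow> 'a) \<Rightarrow> real \<Rightarrow> 'a" where
  "arc_deriv \<gamma> \<phi> u = du \<phi> u /\<^sub>R norm (du \<gamma> u)"

definition nabla_s :: "(real \<Rightarrow> 'a::real_inner) \<Rightarrow> (real \<Rightarrow> 'a) \<Rightarrow> real \<Rightarrow> 'a" where
  "nabla_s \<gamma> \<phi> u = arc_deriv \<gamma> \<phi> u - (arc_deriv \<gamma> \<phi> u \<bullet> tangent \<gamma> u) *\<^sub>R tangent \<gamma> u"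

definition elastic_flow_solution ::
  "real \<Rightarrow> real \<Rightarrow> (real \<Rightarrow> 'a::real_inner) \<Rightarrow> (real \<Rightarrow> real \<Rightarrow> 'a) \<Rightarrow> bool" where
  "elastic_flow_solution T lam x0 x \<longleftrightarrow>
     smooth_on_strip T x \<and>
     (\<forall>t\<in>{0..T}. periodic_2pi (x t)) \<and>
     (\<forall>t\<in>{0..T}. \<forall>u.
        pdt T x t u =
          - nabla_s (x t) (nabla_s (x t) (curvature_vec (x t))) u
          - (1 / 2 * (norm (curvature_vec (x t) u))\<^sup>2) *\<^sub>R curvature_vec (x t) u
          + lam *\<^sub>R (du (du (x t)) u /\<^sub>R norm (du (x t) u))) \<and>
     (\<forall>u. x 0 u = x0 u)"

definition partition_2pi :: "nat \<Rightarrow> (nat \<Rightarrow> real) \<Rightarrow> bool" where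
  "partition_2pi N U \<longleftrightarrow> U 0 = 0 \<and> U N = 2 * pi \<and> (\<forall>j\<in>{1..N}. U (j - 1) < U j)"

text \<open>The mesh widths, with the cyclic convention \<open>h\<^bsub>N+1\<^esub> = h\<^sub>1\<close>.\<close>

definition mesh_width :: "nat \<Rightarrow> (nat \<Rightarrow> real) \<Rightarrow> nat \<Rightarrow> real" where
  "mesh_width N U j = (if j = N + 1 then U 1 - U 0 else U j - U (j - 1))"

definition mesh_size :: "nat \<Rightarrow> (nat \<Rightarrow> real) \<Rightarrow> real" where
  "mesh_size N U = Max (mesh_width N U ` {1..N})"

definition admissible_mesh :: "real \<Rightarrow> real \<Rightarrow> nat \<Rightarrow> (nat \<Rightarrow> real) \<Rightarrow> bool" where
  "admissible_mesh chat cbar N U \<longleftrightarrow>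
     partition_2pi N U \<and>
     (\<forall>j\<in>{1..N}.
        mesh_size N U \<le> chat * mesh_width N U j \<and>
        \<bar>mesh_width N U (j + 1) - mesh_width N U j\<bar> \<le> cbar * (mesh_size N U)\<^sup>2)"

definition fe_space :: "nat \<Rightarrow> (nat \<Rightarrow> real) \<Rightarrow> (real \<Rightarrow> real) set" where
  "fe_space N U =
     {\<eta>. continuous_on {0..2 * pi} \<eta> \<and>
         (\<forall>j\<in>{1..N}. \<exists>a b. \<forall>v\<in>{U (j - 1)..U j}. \<eta> v = a + b * v) \<and>
         \<eta> 0 = \<eta> (2 * pi)}"

definition fe_space_vec :: "nat \<Rightarrow> (nat \<Rightarrow> real) \<Rightarrow> (real \<Rightarrow> real ^ 'n) set" where
  "fe_space_vec N U = {\<phi>. \<forall>i. (\<lambda>v. \<phi> v $ i) \<in> fe_space N U}"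

text \<open>
  For \<open>v \<in> [0,2\<pi>]\<close> the index \<open>j\<close> below is that of a mesh interval containing \<open>v\<close>.
  The formula is linear in the nodal values, hence acts componentwise on vectors.
\<close>

definition interp ::
  "nat \<Rightarrow> (nat \<Rightarrow> real) \<Rightarrow> (real \<Rightarrow> 'a::real_vector) \<Rightarrow> real \<Rightarrow> 'a" where
  "interp N U f v =
     (let j = (LEAST j. 1 \<le> j \<and> v \<le> U j)
      in f (U (j - 1)) +
         ((v - U (j - 1)) / mesh_width N U j) *\<^sub>R (f (U j) - f (U (j - 1))))"

text \<open>The projection \<open>(I - \<tau> \<otimes> \<tau>) a\<close>.\<close>

definition normal_proj :: "'a::real_inner \<Rightarrow> 'a \<Rightarrow> 'a" where
  "normal_proj \<tau> a = a - (\<tau> \<bullet> a) *\<^sub>R \<tau>"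

definition semidiscrete_solution ::
  "real \<Rightarrow> real \<Rightarrow> (real \<Rightarrow> real ^ 'n) \<Rightarrow> nat \<Rightarrow> (nat \<Rightarrow> real) \<Rightarrow>
   (real \<Rightarrow> real \<Rightarrow> real ^ 'n) \<Rightarrow> (real \<Rightarrow> real \<Rightarrow> real ^ 'n) \<Rightarrow> bool" where
  "semidiscrete_solution T lam x0 N U xh yh \<longleftrightarrow>
     (\<forall>t\<in>{0..T}. xh t \<in> fe_space_vec N U \<and> yh t \<in> fe_space_vec N U) \<and>
     (\<forall>j\<in>{0..N}. \<forall>t\<in>{0..T}.
        (\<lambda>s. xh s (U j)) differentiable (at t within {0..T}) \<and>
        (\<lambda>s. yh s (U j)) differentiable (at t within {0..T})) \<and>
     (\<forall>t\<in>{0..T}. \<forall>j\<in>{1..N}. \<forall>v\<in>{U (j - 1)<..<U j}. du (xh t) v \<noteq> 0) \<and>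
     (\<forall>t\<in>{0..T}. \<forall>\<phi>\<in>fe_space_vec N U.
        integral {0..2 * pi}
          (\<lambda>v. interp N U (\<lambda>w. pdt T xh t w \<bullet> \<phi> w) v * norm (du (xh t) v))
        - integral {0..2 * pi}
          (\<lambda>v. (normal_proj (tangent (xh t) v) (du (yh t) v) \<bullet> du \<phi> v) / norm (du (xh t) v))
        - 1 / 2 * integral {0..2 * pi}
          (\<lambda>v. interp N U (\<lambda>w. (norm (yh t w))\<^sup>2) v * (tangent (xh t) v \<bullet> du \<phi> v))
        + lam * integral {0..2 * pi} (\<lambda>v. du (xh t) v \<bullet> du \<phi> v) = 0) \<and>
     (\<forall>t\<in>{0..T}. \<forall>\<psi>\<in>fe_space_vec N U.
        integral {0..2 * pi}
          (\<lambda>v. interp N U (\<lambda>w. yh t w \<bullet> \<psi> w) v * norm (du (xh t) v))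
        + integral {0..2 * pi} (\<lambda>v. tangent (xh t) v \<bullet> du \<psi> v) = 0) \<and>
     (\<forall>v\<in>{0..2 * pi}. xh 0 v = interp N U x0 v)"

end

theory Submission
  imports Defs
begin

text \<open>
  Testing with hat functions turns the semi-discrete problem into a nodal scheme for closed polygons:
  the nodal field \<open>y\<close> is the discrete curvature and the nodal velocity times the nodal mass is a
  difference of discrete fluxes. The nodes of the exact solution satisfy this scheme up to a
  flux perturbation of order \<open>h\<close> and a remainder of order \<open>h\<^sup>2\<close>, also after one
  differentiation in time; the mesh condition on neighbouring widths enters here.

  The difference of two polygons is controlled by an energy consisting of the curvature error, the edge error
  and the nodal error. The terms that are linear in the errors of the edges are, up to terms
  quadratic in the error, the time derivative of a function that is lower order with respect to the
  energy, so Gronwall's inequality gives an energy of order \<open>h\<^sup>2\<close> as long as edge lengths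
  and curvatures of the discrete solution stay bounded. By inverse estimates they stay bounded for small
  \<open>h\<close>, and the scheme with truncated edge lengths, which is globally Lipschitz, provides existence.
\<close>

text \<open>The energy identity comes from testing with the velocity error \<open>e'\<close>: the
  curvature relation differentiated in time turns the normal flux of the curvature error, up to
  sign, into the time derivative of its square. The remaining flux difference is tested with the
  edges of \<open>e'\<close>, which nothing controls, since the dissipation is only a nodal L2 norm
  of \<open>e'\<close>. Such terms cannot be estimated and must be integrated in time. This produces
  \<Psi>, and it is also why the flux perturbation needs a time derivative: the difference of its
  neighbouring values is known only to order \<open>h\<close>, so it has to stay inside the flux.
  \<Psi> has no sign and contains the square of \<tau> - T with a coefficient that is not small. It
  is lower order because the edge error tested with \<tau> - T bounds that square and, after
  summation by parts, becomes a product with the position error. The flux sees only the normal part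
  of the curvature slopes. The tangential part follows from unit tangents, as y_s . tau = -|y|^2
  does for curves, so testing with the curvature error recovers the full slopes.\<close>

definition idx :: "nat => nat set" where
 "idx N = {1..N}"

lemma finite_idx [simp]: "finite (idx N)"
 by (simp add: idx_def)

definition prv :: "nat => nat => nat" where
 "prv N j = (if j = 1 then N else j - 1)"

definition nxt :: "nat => nat => nat" where
 "nxt N j = (if j = N then 1 else j + 1)"

lemma prv_in [simp]: "j \<in> idx N ==> prv N j \<in> idx N"
 and nxt_in [simp]: "j \<in> idx N ==> nxt N j \<in> idx N"
 and nxt_prv [simp]: "j \<in> idx N ==> nxt N (prv N j) = j"
 and prv_nxt [simp]: "j \<in> idx N ==> prv N (nxt N j) = j"
 by (auto simp: prv_def nxt_def idx_def)

lemma sum_nxt: "(\<Sum>j\<in>idx N. f (nxt N j)) = (\<Sum>j\<in>idx N. f j)"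
 by (rule sum.reindex_bij_witness[where i = "prv N" and j = "nxt N"]) auto

lemma sum_prv: "(\<Sum>j\<in>idx N. f (prv N j)) = (\<Sum>j\<in>idx N. f j)"
 by (rule sum.reindex_bij_witness[where i = "nxt N" and j = "prv N"]) auto

section \<open>Closed polygons and summation by parts\<close>

definition edge :: "nat => (nat => 'a::real_vector) => nat => 'a" where
 "edge N z j = z j - z (prv N j)"

lemma edge_diff: "edge N (%i. f i - g i) j = edge N f j - edge N g j"
 by (simp add: edge_def)

text \<open>The index is cyclic, so there are no boundary terms. This passes between a flux tested
  on edges, as in the weak formulation, and the flux differences of the nodal scheme.\<close>

lemma sum_by_parts:
 fixes v f :: "nat => 'a::real_inner"
 shows "(\<Sum>j\<in>idx N. v j \<bullet> edge N f j) = (\<Sum>j\<in>idx N. (v j - v (nxt N j)) \<bullet> f j)"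
proof -
 have "(\<Sum>j\<in>idx N. v j \<bullet> f (prv N j)) = (\<Sum>j\<in>idx N. v (nxt N j) \<bullet> f (prv N (nxt N j)))"
  by (rule sum_nxt[symmetric])
 also have "... = (\<Sum>j\<in>idx N. v (nxt N j) \<bullet> f j)"
  by (rule sum.cong) auto
 finally show ?thesis
  by (simp add: edge_def inner_diff_left inner_diff_right sum_subtractf)
qed

text \<open>A closed polygon moving with velocity \<open>z'\<close>: \<open>l\<close>, \<open>\<tau>\<close>, \<open>m\<close> and \<open>y\<close> are the edge lengths,
 the tangents, the lumped masses and the discrete curvature vectors, and a dash marks a time
 derivative.\<close>

locale polygon =
 fixes N :: nat and z z' :: "nat => 'a::real_inner"
  and l m :: "nat => real" and \<tau> y :: "nat => 'a"
  and l' m' :: "nat => real" and \<tau>' y' :: "nat => 'a"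
 assumes edge: "j \<in> idx N ==> edge N z j = l j *\<^sub>R \<tau> j"
  and len_pos: "j \<in> idx N ==> l j > 0"
  and norm_tan: "j \<in> idx N ==> norm (\<tau> j) = 1"
  and mass: "j \<in> idx N ==> m j = (l j + l (nxt N j)) / 2"
  and curv: "j \<in> idx N ==> m j *\<^sub>R y j = \<tau> (nxt N j) - \<tau> j"
  and len': "j \<in> idx N ==> l' j = \<tau> j \<bullet> edge N z' j"
  and tan': "j \<in> idx N ==> l j *\<^sub>R \<tau>' j = edge N z' j - l' j *\<^sub>R \<tau> j"
  and mass': "j \<in> idx N ==> m' j = (l' j + l' (nxt N j)) / 2"
  and curv': "j \<in> idx N ==> m' j *\<^sub>R y j + m j *\<^sub>R y' j = \<tau>' (nxt N j) - \<tau>' j"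
begin

lemma tan_tan: "j \<in> idx N ==> \<tau> j \<bullet> \<tau> j = 1"
 using norm_tan[of j] by (simp add: norm_eq_1)

lemma tan_tan': assumes "j \<in> idx N" shows "\<tau> j \<bullet> \<tau>' j = 0"
proof -
 have "l j * (\<tau> j \<bullet> \<tau>' j) = \<tau> j \<bullet> (l j *\<^sub>R \<tau>' j)" by simp
 also have "... = 0" using assms tan_tan[OF assms] by (simp add: tan' inner_diff_right len')
 finally show ?thesis using len_pos[OF assms] by simp
qed

lemma mass_pos: "j \<in> idx N ==> m j > 0"
 using len_pos[of j] len_pos[of "nxt N j"] by (simp add: mass)

text \<open>Weak form of the curvature relation, the discrete counterpart of integrating tau . f_u
  by parts.\<close>

lemma sum_tan: "(\<Sum>j\<in>idx N. \<tau> j \<bullet> edge N f j) = - (\<Sum>j\<in>idx N. m j * (y j \<bullet> f j))"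
proof -
 have "(\<tau> j - \<tau> (nxt N j)) \<bullet> f j = - (m j * (y j \<bullet> f j))" if "j \<in> idx N" for j
  using curv[OF that] by (metis inner_minus_left inner_scaleR_left minus_diff_eq)
 then have "(\<Sum>j\<in>idx N. (\<tau> j - \<tau> (nxt N j)) \<bullet> f j) = (\<Sum>j\<in>idx N. - (m j * (y j \<bullet> f j)))"
  by (rule sum.cong[OF refl])
 then show ?thesis by (simp only: sum_by_parts sum_negf)
qed

text \<open>The same relation differentiated in time with the test field frozen. It trades the
  velocity of the tangents for the velocity of the curvature, which is how the curvature energy
  appears.\<close>

lemma sum_tan':
 "(\<Sum>j\<in>idx N. \<tau>' j \<bullet> edge N f j)
  = - (\<Sum>j\<in>idx N. m' j * (y j \<bullet> f j) + m j * (y' j \<bullet> f j))"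
proof -
 have "(\<tau>' j - \<tau>' (nxt N j)) \<bullet> f j = - (m' j * (y j \<bullet> f j) + m j * (y' j \<bullet> f j))"
  if "j \<in> idx N" for j
  using curv'[OF that]
  by (metis inner_minus_left inner_scaleR_left minus_diff_eq inner_add_left)
 then have "(\<Sum>j\<in>idx N. (\<tau>' j - \<tau>' (nxt N j)) \<bullet> f j)
   = (\<Sum>j\<in>idx N. - (m' j * (y j \<bullet> f j) + m j * (y' j \<bullet> f j)))"
  by (rule sum.cong[OF refl])
 then show ?thesis by (simp only: sum_by_parts sum_negf)
qed

text \<open>A nodal mass is the mean of the two adjacent lengths, so a cyclic shift moves the mean
  onto \<open>g\<close>.\<close>

lemma sum_mass': "(\<Sum>j\<in>idx N. m' j * g j) = (\<Sum>j\<in>idx N. (g j + g (prv N j)) / 2 * l' j)"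
proof -
 have "(\<Sum>j\<in>idx N. l' (nxt N j) * g j) = (\<Sum>j\<in>idx N. l' (nxt N j) * g (prv N (nxt N j)))"
  by (rule sum.cong) auto
 also have "... = (\<Sum>j\<in>idx N. l' j * g (prv N j))"
  by (rule sum_nxt)
 finally have "(\<Sum>j\<in>idx N. l' j * g j + l' (nxt N j) * g j)
   = (\<Sum>j\<in>idx N. l' j * g j + l' j * g (prv N j))"
  by (simp add: sum.distrib)
 moreover have "(\<Sum>j\<in>idx N. m' j * g j) = (\<Sum>j\<in>idx N. l' j * g j + l' (nxt N j) * g j) / 2"
  unfolding sum_divide_distrib by (rule sum.cong) (auto simp: mass' field_simps)
 moreover have "(\<Sum>j\<in>idx N. (g j + g (prv N j)) / 2 * l' j)
   = (\<Sum>j\<in>idx N. l' j * g j + l' j * g (prv N j)) / 2"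
  unfolding sum_divide_distrib by (rule sum.cong) (auto simp: field_simps)
 ultimately show ?thesis by simp
qed

text \<open>Discrete form of y_s . tau = -|y|^2. The two tangents at a node have length one, so the
  jump between them has tangential component minus half its square. Hence the tangential part of a
  curvature difference is of order \<open>h\<close> and involves values of the curvature
  only.\<close>

lemma tan_edge_curv:
 assumes j: "j \<in> idx N"
 shows "\<tau> j \<bullet> edge N y j = - (m j * (norm (y j))^2 + m (prv N j) * (norm (y (prv N j)))^2) / 2"
proof -
 have left: "\<tau> i \<bullet> y i = - (m i * (norm (y i))^2) / 2" if i: "i \<in> idx N" for i
 proof -
  have "m i * (m i * (norm (y i))^2) = (\<tau> (nxt N i) - \<tau> i) \<bullet> (\<tau> (nxt N i) - \<tau> i)"
   unfolding curv[OF i, symmetric] by (simp add: power2_norm_eq_inner)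
  also have "... = - 2 * (\<tau> i \<bullet> (\<tau> (nxt N i) - \<tau> i))"
   using i by (simp add: inner_diff_left inner_diff_right tan_tan inner_commute)
  also have "... = m i * (- 2 * (\<tau> i \<bullet> y i))"
   unfolding curv[OF i, symmetric] by simp
  finally have "m i * (norm (y i))^2 = - 2 * (\<tau> i \<bullet> y i)"
   using mass_pos[OF i] by (simp only: mult_cancel_left) simp
  then show ?thesis by simp
 qed
 have right: "\<tau> j \<bullet> y i = m i * (norm (y i))^2 / 2" if i: "i = prv N j" for i
 proof -
  have ii: "i \<in> idx N" "nxt N i = j" using j i by auto
  have "\<tau> j \<bullet> y i = \<tau> i \<bullet> y i + (m i *\<^sub>R y i) \<bullet> y i"
   unfolding curv[OF ii(1)] ii by (simp add: inner_diff_left)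
  then show ?thesis using left[OF ii(1)] by (simp add: power2_norm_eq_inner)
 qed
 show ?thesis using left[OF j] right[OF refl] by (simp add: edge_def inner_diff_right field_simps)
qed

end

text \<open>For w the edge of the exact curvature, \<open>w0\<close>, \<open>W0\<close>,
  \<open>w1\<close>, \<open>W1\<close> stand for the inner products of w with \<tau>, T, \<tau>',
  T', and \<open>v0\<close>, \<open>V0\<close> for those of the edge of \<open>Y'\<close> with
  \<tau>, T; \<open>A\<close>, \<open>A1\<close>, \<open>A2\<close> are \<tau> . T, \<tau>' . T,
  \<tau> . T'. The first bracket on the right becomes \<Psi>', the second one \<open>Q\<close>. The
  terms with \<open>c'\<close>, \<open>v0\<close>, \<open>V0\<close> cancel between the brackets:
  \<Psi> depends on time also through \<open>Y\<close>, and \<open>Q\<close> takes that dependence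
  back.\<close>

lemma flux_variation_scalar:
 fixes l L l' L' A A1 A2 c c' w0 W0 w1 W1 v0 V0 :: real
 assumes "l ~= 0" "L ~= 0"
 shows "(l * w1 - L' * (W0 - w0 * A) - L * (W1 - w0 * A2)) / l
   + c * (l' - L' * A - L * A2)
   - (l' * (w0 - W0 * A) + l * (w1 - W0 * A1) - L * W1) / L
   - c * (l' * A + l * A1 - L')
  = (c' * l * (1 - A) + c * l' * (1 - A) + c * l * (- (A1 + A2))
    - (l' * L - l * L') / L^2 * (w0 - W0)
    + (1 - l / L) * ((v0 - V0) + (w1 - W1))
    - (l' * L - l * L') / L^2 * W0 * (1 - A)
    - l / L * (V0 + W1) * (1 - A)
    - l / L * W0 * (- (A1 + A2)))
  + (- c' * l * (1 - A) + c * L' * (1 - A) + c * (l - L) * A2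
    + (v0 - V0) * (l / L - 1) + l / L * (1 - A) * V0
    + W1 * (l / L * (1 - A) - (l / L - 1)^2 / (l / L))
    + A2 * ((w0 - W0) / (l / L) + (1 / (l / L) - l / L) * W0)
    + L' / L * ((w0 - W0) * (1 / (l / L) - l / L)
      - (1 - A) * w0 / (l / L) - l / L * (1 - A) * W0))"
 using assms by (simp add: field_simps power2_eq_square)

section \<open>Variation of the flux between two polygons\<close>

text \<open>All quantities of the second polygon are written in capitals.\<close>

locale polygon_pair =
 cur: polygon N x x' l m \<tau> y l' m' \<tau>' y' + ex: polygon N X X' L M T Y L' M' T' Y'
 for N :: nat and x x' :: "nat => 'a::real_inner"
  and l m \<tau> y l' m' \<tau>' y' and X X' :: "nat => 'a" and L M T Y L' M' T' Y'
begin

definition a where "a j = y j - Y j"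
definition a' where "a' j = y' j - Y' j"
definition \<theta> where "\<theta> j = \<tau> j - T j"
definition \<rho> where "\<rho> j = l j / L j"
definition \<sigma> where "\<sigma> j = (norm (\<theta> j))^2 / 2"
definition c where "c j = ((norm (Y j))^2 + (norm (Y (prv N j)))^2) / 4"
definition c' where "c' j = (Y j \<bullet> Y' j + Y (prv N j) \<bullet> Y' (prv N j)) / 2"
definition cy where "cy j = ((norm (y j))^2 + (norm (y (prv N j)))^2) / 4"
definition e where "e j = x j - X j"
definition e' where "e' j = x' j - X' j"
text \<open>The rate of turning that the exact velocity induces on the discrete edge, minus the one
  on the exact edge. It vanishes when tangents and lengths agree.\<close>

definition \<kappa> where "\<kappa> j = normal_proj (\<tau> j) (edge N X' j) /\<^sub>R l j - T' j"

text \<open>Every summand is quadratic in the errors of tangent and length, so its time derivative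
  consists of products of an error with the velocity of an error and of harmless quadratic terms. It
  is built so that the former are exactly those occurring in \<open>flux_variation\<close>.\<close>

definition \<Psi> where
 "\<Psi> j = c j * l j * \<sigma> j + (1 - \<rho> j) * (edge N Y j \<bullet> \<theta> j) - \<rho> j * (edge N Y j \<bullet> T j) * \<sigma> j"

definition \<sigma>' where "\<sigma>' j = - (\<tau>' j \<bullet> T j + \<tau> j \<bullet> T' j)"
definition \<rho>' where "\<rho>' j = (l' j * L j - l j * L' j) / (L j)^2"

text \<open>The locale describes a single instant, so this is only the formal time derivative of
  \<Psi>. \<open>Psi_has_real_derivative\<close> justifies it for moving polygons.\<close>

definition \<Psi>' where
 "\<Psi>' j = c' j * l j * \<sigma> j + c j * l' j * \<sigma> j + c j * l j * \<sigma>' j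
   - \<rho>' j * (edge N Y j \<bullet> \<theta> j)
   + (1 - \<rho> j) * (edge N Y' j \<bullet> \<theta> j + edge N Y j \<bullet> (\<tau>' j - T' j))
   - \<rho>' j * (edge N Y j \<bullet> T j) * \<sigma> j
   - \<rho> j * (edge N Y' j \<bullet> T j + edge N Y j \<bullet> T' j) * \<sigma> j
   - \<rho> j * (edge N Y j \<bullet> T j) * \<sigma>' j"

definition Q where
 "Q j = - c' j * l j * \<sigma> j + c j * L' j * \<sigma> j + c j * (l j - L j) * (\<theta> j \<bullet> T' j)
   + (edge N Y' j \<bullet> \<theta> j) * (\<rho> j - 1) + \<rho> j * \<sigma> j * (edge N Y' j \<bullet> T j)
   + (edge N Y j \<bullet> T' j) * (\<rho> j * \<sigma> j - (\<rho> j - 1)^2 / \<rho> j)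
   + (\<theta> j \<bullet> T' j) * ((edge N Y j \<bullet> \<theta> j) / \<rho> j + (1 / \<rho> j - \<rho> j) * (edge N Y j \<bullet> T j))
   + L' j / L j * ((edge N Y j \<bullet> \<theta> j) * (1 / \<rho> j - \<rho> j)
     - \<sigma> j * (edge N Y j \<bullet> \<tau> j) / \<rho> j - \<rho> j * \<sigma> j * (edge N Y j \<bullet> T j))"

definition flux where
 "flux j = normal_proj (\<tau> j) (edge N y j) /\<^sub>R l j + cy j *\<^sub>R \<tau> j"
definition Flux where
 "Flux j = normal_proj (T j) (edge N Y j) /\<^sub>R L j + c j *\<^sub>R T j"

lemma \<sigma>_eq: "j \<in> idx N ==> \<sigma> j = 1 - \<tau> j \<bullet> T j"
 unfolding \<sigma>_def \<theta>_def power2_norm_eq_inner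
 by (simp add: inner_diff_left inner_diff_right cur.tan_tan ex.tan_tan inner_commute)

text \<open>The flux on the left has the geometry of the discrete edge but the exact curvature
  \<open>Y\<close>, so the comparison isolates the errors of tangents and lengths. The error of the
  curvature enters in \<open>energy_variation\<close>.\<close>

lemma flux_variation:
 assumes j: "j \<in> idx N"
 shows "((normal_proj (\<tau> j) (edge N Y j) /\<^sub>R l j + c j *\<^sub>R \<tau> j) - Flux j) \<bullet> edge N e' j
   = \<Psi>' j + Q j"
proof -
 have pos: "l j ~= 0" "L j ~= 0" using cur.len_pos[OF j] ex.len_pos[OF j] by auto
 have ex': "edge N x' j = l' j *\<^sub>R \<tau> j + l j *\<^sub>R \<tau>' j" and eX': "edge N X' j = L' j *\<^sub>R T j + L j *\<^sub>R T' j"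
  using cur.tan'[OF j] ex.tan'[OF j] by (auto simp: algebra_simps)
 have ee: "edge N e' j = (l' j *\<^sub>R \<tau> j + l j *\<^sub>R \<tau>' j) - (L' j *\<^sub>R T j + L j *\<^sub>R T' j)"
  unfolding ex'[symmetric] eX'[symmetric] by (simp add: edge_def e'_def)
 note s = cur.tan_tan[OF j] cur.tan_tan'[OF j] ex.tan_tan[OF j] ex.tan_tan'[OF j]
 define w where "w = edge N Y j"
 have "((normal_proj (\<tau> j) w /\<^sub>R l j + c j *\<^sub>R \<tau> j)
    - (normal_proj (T j) w /\<^sub>R L j + c j *\<^sub>R T j))
    \<bullet> ((l' j *\<^sub>R \<tau> j + l j *\<^sub>R \<tau>' j) - (L' j *\<^sub>R T j + L j *\<^sub>R T' j))
   = (l j * (w \<bullet> \<tau>' j) - L' j * (w \<bullet> T j - (w \<bullet> \<tau> j) * (\<tau> j \<bullet> T j))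
    - L j * (w \<bullet> T' j - (w \<bullet> \<tau> j) * (\<tau> j \<bullet> T' j))) / l j
   + c j * (l' j - L' j * (\<tau> j \<bullet> T j) - L j * (\<tau> j \<bullet> T' j))
   - (l' j * (w \<bullet> \<tau> j - (w \<bullet> T j) * (\<tau> j \<bullet> T j))
     + l j * (w \<bullet> \<tau>' j - (w \<bullet> T j) * (\<tau>' j \<bullet> T j)) - L j * (w \<bullet> T' j)) / L j
   - c j * (l' j * (\<tau> j \<bullet> T j) + l j * (\<tau>' j \<bullet> T j) - L' j)"
  using pos unfolding normal_proj_def
  by (simp add: inner_simps s inner_commute divide_inverse) (simp add: field_simps)
 then show ?thesis
  unfolding ee Flux_def w_def \<Psi>'_def Q_def \<sigma>_eq[OF j] \<sigma>'_def \<rho>_def \<rho>'_def \<theta>_def inner_diff_right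
   inner_diff_left[of "\<tau> j" "T j" "T' j"] ex.tan_tan'[OF j] diff_zero
  by (simp only: flux_variation_scalar[OF pos])
qed

text \<open>On a discrete edge the normal part of the edge of \<open>x'\<close> is \<open>l\<close>
  times \<tau>'. So the slope part of the flux error, tested with \<open>e'\<close>, is \<tau>' - T'
  against the edges of the curvature error, up to \<kappa>. \<open>sum_tan'\<close> for both
  polygons turns this into curvature velocities, and the quadratic part of the flux supplies the
  derivative of the mass.\<close>

lemma energy_variation:
 "(\<Sum>j\<in>idx N. flux j \<bullet> edge N e' j)
   + (\<Sum>j\<in>idx N. m' j * (norm (a j))^2 / 2 + m j * (a j \<bullet> a' j))
  = (\<Sum>j\<in>idx N. (normal_proj (\<tau> j) (edge N Y j) /\<^sub>R l j + c j *\<^sub>R \<tau> j) \<bullet> edge N e' j)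
   + (\<Sum>j\<in>idx N. (M j - m j) * (Y' j \<bullet> a j) - M' j * (norm (a j))^2 / 2)
   + (\<Sum>j\<in>idx N. (c j - cy j) * (\<theta> j \<bullet> edge N X' j) - \<kappa> j \<bullet> edge N a j)"
proof -
 have edge_term: "(flux j - (normal_proj (\<tau> j) (edge N Y j) /\<^sub>R l j + c j *\<^sub>R \<tau> j)) \<bullet> edge N e' j
   = \<tau>' j \<bullet> edge N a j - T' j \<bullet> edge N a j + (cy j - c j) * (l' j - L' j)
    + ((c j - cy j) * (\<theta> j \<bullet> edge N X' j) - \<kappa> j \<bullet> edge N a j)" if j: "j \<in> idx N" for j
 proof -
  have pos: "l j ~= 0" using cur.len_pos[OF j] by auto
  have ex': "edge N x' j = l' j *\<^sub>R \<tau> j + l j *\<^sub>R \<tau>' j"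
   using cur.tan'[OF j] by (auto simp: algebra_simps)
  have ee: "edge N e' j = (l' j *\<^sub>R \<tau> j + l j *\<^sub>R \<tau>' j) - edge N X' j"
   unfolding ex'[symmetric] by (simp add: edge_def e'_def)
  have ea: "edge N y j - edge N Y j = edge N a j" by (simp add: edge_def a_def)
  have "flux j - (normal_proj (\<tau> j) (edge N Y j) /\<^sub>R l j + c j *\<^sub>R \<tau> j)
    = normal_proj (\<tau> j) (edge N a j) /\<^sub>R l j + (cy j - c j) *\<^sub>R \<tau> j"
   unfolding flux_def ea[symmetric] normal_proj_def by (simp add: algebra_simps inner_diff_right)
  moreover have "(normal_proj (\<tau> j) (edge N a j) /\<^sub>R l j + (cy j - c j) *\<^sub>R \<tau> j) \<bullet> edge N e' j
   = \<tau>' j \<bullet> edge N a j - T' j \<bullet> edge N a j + (cy j - c j) * (l' j - L' j)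
    + ((c j - cy j) * (\<theta> j \<bullet> edge N X' j) - \<kappa> j \<bullet> edge N a j)"
   unfolding ee \<kappa>_def \<theta>_def normal_proj_def ex.len'[OF j] using pos
   by (simp add: inner_simps cur.tan_tan[OF j] cur.tan_tan'[OF j] inner_commute algebra_simps)
  ultimately show ?thesis by simp
 qed
 have S: "(\<Sum>j\<in>idx N. (cy j - c j) * (l' j - L' j))
  = (\<Sum>j\<in>idx N. (m' j - M' j) * ((norm (y j))^2 - (norm (Y j))^2) / 2)"
 proof -
  define g where "g j = ((norm (y j))^2 - (norm (Y j))^2) / 2" for j
  have g: "cy j - c j = (g j + g (prv N j)) / 2" for j
   by (simp add: cy_def c_def g_def field_simps)
  show ?thesis
   using cur.sum_mass'[of g] ex.sum_mass'[of g]
   by (simp add: g right_diff_distrib left_diff_distrib sum_subtractf g_def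
     diff_divide_distrib sum_divide_distrib[symmetric])
 qed
 \<comment> \<open>The coefficient of \<open>m'\<close> is -(y . a) + (|y|^2 - |Y|^2) / 2 + |a|^2 /
   2 = 0, so no velocity of the discrete lengths survives.\<close>
 have node: "- (m' j * (y j \<bullet> a j) + m j * (y' j \<bullet> a j)) + (M' j * (Y j \<bullet> a j) + M j * (Y' j \<bullet> a j))
   + (m' j - M' j) * ((norm (y j))^2 - (norm (Y j))^2) / 2
   + (m' j * (norm (a j))^2 / 2 + m j * (a j \<bullet> a' j))
  = (M j - m j) * (Y' j \<bullet> a j) - M' j * (norm (a j))^2 / 2" for j
  unfolding a_def a'_def power2_norm_eq_inner
  by (simp add: inner_simps inner_commute field_simps)
 let ?P = "%j. normal_proj (\<tau> j) (edge N Y j) /\<^sub>R l j + c j *\<^sub>R \<tau> j"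
 let ?R = "%j. (c j - cy j) * (\<theta> j \<bullet> edge N X' j) - \<kappa> j \<bullet> edge N a j"
 have "(\<Sum>j\<in>idx N. flux j \<bullet> edge N e' j) - (\<Sum>j\<in>idx N. ?P j \<bullet> edge N e' j)
   = (\<Sum>j\<in>idx N. (flux j - ?P j) \<bullet> edge N e' j)"
  by (simp only: sum_subtractf[symmetric] inner_diff_left)
 also have "... = (\<Sum>j\<in>idx N. \<tau>' j \<bullet> edge N a j - T' j \<bullet> edge N a j + (cy j - c j) * (l' j - L' j) + ?R j)"
  by (rule sum.cong[OF refl edge_term])
 also have "... = (\<Sum>j\<in>idx N. - (m' j * (y j \<bullet> a j) + m j * (y' j \<bullet> a j))
   + (M' j * (Y j \<bullet> a j) + M j * (Y' j \<bullet> a j))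
   + (m' j - M' j) * ((norm (y j))^2 - (norm (Y j))^2) / 2) + (\<Sum>j\<in>idx N. ?R j)"
  by (simp only: sum.distrib sum_subtractf cur.sum_tan' ex.sum_tan' S sum_negf)
 finally have 1: "(\<Sum>j\<in>idx N. flux j \<bullet> edge N e' j)
   = (\<Sum>j\<in>idx N. ?P j \<bullet> edge N e' j) + (\<Sum>j\<in>idx N. ?R j)
   + (\<Sum>j\<in>idx N. - (m' j * (y j \<bullet> a j) + m j * (y' j \<bullet> a j))
   + (M' j * (Y j \<bullet> a j) + M j * (Y' j \<bullet> a j))
   + (m' j - M' j) * ((norm (y j))^2 - (norm (Y j))^2) / 2)"
  by linarith
 have 2: "(\<Sum>j\<in>idx N. - (m' j * (y j \<bullet> a j) + m j * (y' j \<bullet> a j))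
   + (M' j * (Y j \<bullet> a j) + M j * (Y' j \<bullet> a j))
   + (m' j - M' j) * ((norm (y j))^2 - (norm (Y j))^2) / 2)
   + (\<Sum>j\<in>idx N. m' j * (norm (a j))^2 / 2 + m j * (a j \<bullet> a' j))
  = (\<Sum>j\<in>idx N. (M j - m j) * (Y' j \<bullet> a j) - M' j * (norm (a j))^2 / 2)"
  unfolding sum.distrib[symmetric] using node by (intro sum.cong[OF refl]) simp
 show ?thesis using 1 2 by linarith
qed

end

section \<open>Elementary inequalities\<close>

lemma abs_mult_le: "\<bar>a\<bar> <= b ==> \<bar>c\<bar> <= d ==> \<bar>a * c\<bar> <= b * d" for a b c d :: real
 unfolding abs_mult by (rule mult_mono) auto

lemma abs_mean_le: "\<bar>a\<bar> <= b ==> \<bar>c\<bar> <= d ==> \<bar>(a + c) / 2\<bar> <= (b + d) / 2" for a b c d :: real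
 by (auto simp: abs_le_iff field_simps)

lemma abs_inner_le: "norm u <= b ==> norm v <= d ==> \<bar>u \<bullet> v\<bar> <= b * d"
 by (rule order_trans[OF Cauchy_Schwarz_ineq2]) (rule mult_mono; auto intro: order_trans[OF norm_ge_zero])

lemma norm_normal_proj_diff:
 assumes "norm \<tau> = 1" "norm \<tau>0 = 1"
 shows "norm (normal_proj \<tau> v - normal_proj \<tau>0 v) <= 2 * norm (\<tau> - \<tau>0) * norm v"
proof -
 have "normal_proj \<tau> v - normal_proj \<tau>0 v = - ((\<tau> \<bullet> v) *\<^sub>R (\<tau> - \<tau>0) + ((\<tau> - \<tau>0) \<bullet> v) *\<^sub>R \<tau>0)"
  by (simp add: normal_proj_def algebra_simps inner_diff_left)
 also have "norm ... <= norm ((\<tau> \<bullet> v) *\<^sub>R (\<tau> - \<tau>0)) + norm (((\<tau> - \<tau>0) \<bullet> v) *\<^sub>R \<tau>0)"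
  unfolding norm_minus_cancel by (rule norm_triangle_ineq)
 also have "... <= (norm \<tau> * norm v) * norm (\<tau> - \<tau>0) + norm (\<tau> - \<tau>0) * norm v"
  unfolding norm_scaleR using assms
  using Cauchy_Schwarz_ineq2[of \<tau> v] Cauchy_Schwarz_ineq2[of "\<tau> - \<tau>0" v]
  by (intro add_mono mult_right_mono) auto
 finally show ?thesis using assms by (simp add: mult_ac)
qed

lemma inner_normal_proj:
 assumes "norm \<tau> = 1"
 shows "normal_proj \<tau> v \<bullet> v = (norm (normal_proj \<tau> v))^2"
  and "(norm v)^2 = (norm (normal_proj \<tau> v))^2 + (\<tau> \<bullet> v)^2"
  and "norm (normal_proj \<tau> v) <= norm v"
proof -
 have t: "\<tau> \<bullet> \<tau> = 1" using assms by (simp add: norm_eq_1)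
 show 1: "normal_proj \<tau> v \<bullet> v = (norm (normal_proj \<tau> v))^2"
  unfolding power2_norm_eq_inner normal_proj_def
  by (simp add: inner_diff_left inner_diff_right t inner_commute)
 show 2: "(norm v)^2 = (norm (normal_proj \<tau> v))^2 + (\<tau> \<bullet> v)^2"
  unfolding power2_norm_eq_inner normal_proj_def
  by (simp add: inner_diff_left inner_diff_right t inner_commute power2_eq_square)
 have "(norm (normal_proj \<tau> v))^2 <= (norm v)^2" unfolding 2 by simp
 then show "norm (normal_proj \<tau> v) <= norm v" by (simp add: power2_le_iff_abs_le)
qed

lemma young: "0 < \<delta> ==> a * b <= \<delta> * a^2 + b^2 / (4 * \<delta>)" for a b \<delta> :: real
proof -
 assume d: "0 < \<delta>"
 have "0 <= (2 * \<delta> * a - b)^2 / (4 * \<delta>)" using d by simp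
 also have "... = \<delta> * a^2 + b^2 / (4 * \<delta>) - a * b"
  using d by (simp add: power2_eq_square field_simps)
 finally show ?thesis by simp
qed

text \<open>In \<open>W_coercive\<close> the squared slope and curvature errors come with the
  coefficients lam / 4 and 1 / (2 A). The interpolation estimate costs half of this constant, so one
  and a half times it has to fit below both.\<close>

definition coercivity :: "real => real => real" where
 "coercivity A lam = min (lam / 8) (1 / (4 * A))"

text \<open>The two summands of \<Psi> with \<sigma> contribute at most 3/4 A^3. The product of
  length error and tangent error is split by \<open>young\<close> with weight lam / 8, which gives 2
  A^4 / lam.\<close>

definition psi_const :: "real => real => real" where
 "psi_const A lam = 2 * A ^ 4 / lam + A ^ 3"

text \<open>The weight of the lower order term in the energy is chosen to absorb the part of \<open>\<Psi>\<close> that is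
 controlled only through the interpolation estimate for \<open>\<tau> - T\<close>.\<close>

definition weight :: "real => real => real" where
 "weight A lam = 2 * A * (psi_const A lam * A ^ 4 / (coercivity A lam / psi_const A lam) + coercivity A lam)"

text \<open>The bracket is the local constant of \<open>diss_terms\<close>, in which 6 A^4 + lam A
  bounds the flux terms other than the curvature slopes. Summation contributes the factor 3 A, and
  absorbing a quarter of \<open>Z\<close> the factor 4/3.\<close>

definition diss_const :: "real => real => real" where
 "diss_const A lam = 4 * A * (4 * A^2 * (6 * A ^ 4 + lam * A)^2 + 50 * A ^ 5)"

text \<open>The constant of \<open>W'_bound\<close> plus the price of eliminating \<open>Z\<close>
  by \<open>dissipation\<close>.\<close>

definition growth_const :: "real => real => real" where
 "growth_const A lam = 3 * A * (45 * A ^ 8 + 3 * A * (weight A lam)^2) + diss_const A lam"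

section \<open>Energy estimates at a fixed time\<close>

text \<open>The first polygon solves the scheme, the second one solves it up to the consistency errors
 \<open>r0\<close> (in the flux) and \<open>r\<close>.\<close>

locale scheme_error = polygon_pair +
 fixes A h lam :: real and hh :: "nat => real" and r0 r0' r :: "nat => 'a"
 assumes A: "1 <= A" and lam: "0 < lam" and h: "0 < h" "h <= 1" and card: "real N * h <= A"
  and hh: "j \<in> idx N ==> h <= A * hh j" "j \<in> idx N ==> hh j <= h"
  and l: "j \<in> idx N ==> h <= A * l j" "j \<in> idx N ==> l j <= A * h"
  and L: "j \<in> idx N ==> h <= A * L j" "j \<in> idx N ==> L j <= A * h"
  and y: "j \<in> idx N ==> norm (y j) <= A"
  and Y: "j \<in> idx N ==> norm (Y j) <= A" and Y': "j \<in> idx N ==> norm (Y' j) <= A"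
  and dY: "j \<in> idx N ==> norm (edge N Y j) <= A * h"
  and dY': "j \<in> idx N ==> norm (edge N Y' j) <= A * h"
  and T': "j \<in> idx N ==> norm (T' j) <= A" and L': "j \<in> idx N ==> \<bar>L' j\<bar> <= A * h"
  and X': "j \<in> idx N ==> norm (X' j) <= A"
  and dX': "j \<in> idx N ==> norm (edge N X' j) <= A * h"
  and r0: "j \<in> idx N ==> norm (r0 j) <= A * h" and r0': "j \<in> idx N ==> norm (r0' j) <= A * h"
  and r: "j \<in> idx N ==> norm (r j) <= A * h^2"
  and scheme: "j \<in> idx N ==> m j *\<^sub>R x' j
    = (flux j - (lam / hh j) *\<^sub>R edge N x j)
     - (flux (nxt N j) - (lam / hh (nxt N j)) *\<^sub>R edge N x (nxt N j))"
  and exact: "j \<in> idx N ==> M j *\<^sub>R X' j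
    = (Flux j - (lam / hh j) *\<^sub>R edge N X j + r0 j)
     - (Flux (nxt N j) - (lam / hh (nxt N j)) *\<^sub>R edge N X (nxt N j) + r0 (nxt N j)) + r j"
begin

text \<open>Edge error in the scale of a slope, so that \<open>Se\<close> is a squared discrete L2
  norm of a derivative.\<close>

definition \<epsilon> where "\<epsilon> j = norm (edge N e j) / h"

lemma eps: "0 <= \<epsilon> j" "norm (edge N e j) = h * \<epsilon> j"
 using h by (auto simp: \<epsilon>_def)

lemma A_pos: "0 < A" and A_ge0: "0 <= A" and h_ge0: "0 <= h"
 using A h by auto

lemma A_pow: "k <= n ==> A ^ k <= A ^ n"
 by (rule power_increasing[OF _ A])

lemma len_eq: "j \<in> idx N ==> l j = norm (edge N x j)" "j \<in> idx N ==> L j = norm (edge N X j)"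
 using cur.norm_tan[of j] cur.len_pos[of j] ex.norm_tan[of j] ex.len_pos[of j]
 by (simp_all add: cur.edge ex.edge)

lemma len_diff: "j \<in> idx N ==> \<bar>l j - L j\<bar> <= h * \<epsilon> j"
proof -
 assume j: "j \<in> idx N"
 have "edge N e j = edge N x j - edge N X j" by (simp add: edge_def e_def)
 then show ?thesis using norm_triangle_ineq3[of "edge N x j" "edge N X j"] len_eq[OF j] eps(2)[of j]
  by simp
qed

lemma inv_L: "j \<in> idx N ==> 1 / L j <= A / h" and inv_l: "j \<in> idx N ==> 1 / l j <= A / h"
 using L(1)[of j] l(1)[of j] ex.len_pos[of j] cur.len_pos[of j] h by (auto simp: field_simps)

lemma theta: "j \<in> idx N ==> norm (\<theta> j) <= 2 * A * \<epsilon> j"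
proof -
 assume j: "j \<in> idx N"
 have e: "edge N e j = edge N x j - edge N X j" by (simp add: edge_def e_def)
 have "L j *\<^sub>R \<theta> j = edge N e j - (l j - L j) *\<^sub>R \<tau> j"
  unfolding e \<theta>_def by (simp add: cur.edge[OF j] ex.edge[OF j] algebra_simps)
 then have "L j * norm (\<theta> j) = norm (edge N e j - (l j - L j) *\<^sub>R \<tau> j)"
  using ex.len_pos[OF j] by (metis abs_of_pos norm_scaleR)
 also have "... <= norm (edge N e j) + norm ((l j - L j) *\<^sub>R \<tau> j)"
  by (rule norm_triangle_ineq4)
 also have "... <= h * \<epsilon> j + h * \<epsilon> j"
  using len_diff[OF j] cur.norm_tan[OF j] by (intro add_mono) (auto simp: eps(2))
 finally have "L j * norm (\<theta> j) <= 2 * (h * \<epsilon> j)" by simp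
 then have "norm (\<theta> j) <= (1 / L j) * (2 * (h * \<epsilon> j))"
  using ex.len_pos[OF j] by (simp add: field_simps)
 also have "... <= (A / h) * (2 * (h * \<epsilon> j))"
  using inv_L[OF j] h eps(1)[of j] by (intro mult_right_mono) auto
 also have "... = 2 * A * \<epsilon> j" using h by simp
 finally show ?thesis .
qed

lemma rho_bounds:
 assumes j: "j \<in> idx N"
 shows "\<bar>\<rho> j - 1\<bar> <= A * \<epsilon> j" "0 < \<rho> j" "\<rho> j <= A^2" "1 / \<rho> j <= A^2" "\<bar>1 / \<rho> j - \<rho> j\<bar> <= 2 * A ^ 3 * \<epsilon> j"
proof -
 have "\<bar>\<rho> j - 1\<bar> = (1 / L j) * \<bar>l j - L j\<bar>"
  using ex.len_pos[OF j] by (simp add: \<rho>_def field_simps abs_if)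
 also have "... <= (A / h) * (h * \<epsilon> j)"
  using inv_L[OF j] len_diff[OF j] ex.len_pos[OF j] h A by (intro mult_mono) auto
 finally show 1: "\<bar>\<rho> j - 1\<bar> <= A * \<epsilon> j" using h by simp
 show 2: "0 < \<rho> j" using ex.len_pos[OF j] cur.len_pos[OF j] by (simp add: \<rho>_def)
 have "\<rho> j = (1 / L j) * l j" by (simp add: \<rho>_def)
 also have "... <= (A / h) * (A * h)"
  using inv_L[OF j] l(2)[OF j] cur.len_pos[OF j] h A by (intro mult_mono) auto
 finally show 3: "\<rho> j <= A^2" using h by (simp add: power2_eq_square)
 have "1 / \<rho> j = (1 / l j) * L j" by (simp add: \<rho>_def)
 also have "... <= (A / h) * (A * h)"
  using inv_l[OF j] L(2)[OF j] ex.len_pos[OF j] h A by (intro mult_mono) auto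
 finally show 4: "1 / \<rho> j <= A^2" using h by (simp add: power2_eq_square)
 have "1 / \<rho> j - \<rho> j = - ((\<rho> j - 1) * (1 / \<rho> j + 1))" using 2 by (simp add: field_simps)
 moreover have "\<bar>(\<rho> j - 1) * (1 / \<rho> j + 1)\<bar> <= (A * \<epsilon> j) * (A^2 + A^2)"
 proof (intro abs_mult_le 1)
  have "1 <= A^2" "0 < 1 / \<rho> j" using A_pow[of 0 2] 2 by auto
  then show "\<bar>1 / \<rho> j + 1\<bar> <= A^2 + A^2" using 4 by linarith
 qed
 ultimately show "\<bar>1 / \<rho> j - \<rho> j\<bar> <= 2 * A ^ 3 * \<epsilon> j"
  by (simp add: power3_eq_cube power2_eq_square algebra_simps)
qed

lemma sigma: "j \<in> idx N ==> \<bar>\<sigma> j\<bar> <= 2 * A^2 * (\<epsilon> j)^2" "0 <= \<sigma> j"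
proof -
 assume j: "j \<in> idx N"
 have "(norm (\<theta> j))^2 <= (2 * A * \<epsilon> j)^2" using theta[OF j] by (intro power_mono) auto
 then show "\<bar>\<sigma> j\<bar> <= 2 * A^2 * (\<epsilon> j)^2" by (simp add: \<sigma>_def power_mult_distrib)
qed (simp add: \<sigma>_def)

lemma c_bounds: "j \<in> idx N ==> \<bar>c j\<bar> <= A^2 / 2" "j \<in> idx N ==> \<bar>c' j\<bar> <= A^2"
proof -
 assume j: "j \<in> idx N"
 have "(norm (Y j))^2 <= A^2" "(norm (Y (prv N j)))^2 <= A^2"
  using Y[OF j] Y[of "prv N j"] j by (auto intro!: power_mono)
 then show "\<bar>c j\<bar> <= A^2 / 2" by (simp add: c_def)
 have "\<bar>Y j \<bullet> Y' j\<bar> <= A * A" "\<bar>Y (prv N j) \<bullet> Y' (prv N j)\<bar> <= A * A"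
  using j by (auto intro!: abs_inner_le Y Y')
 then show "\<bar>c' j\<bar> <= A^2" using abs_mean_le[of _ "A * A" _ "A * A"] unfolding c'_def power2_eq_square by fastforce
qed

lemma mass_bounds: "j \<in> idx N ==> m j <= A * h" "j \<in> idx N ==> h <= A * m j" "j \<in> idx N ==> \<bar>M' j\<bar> <= A * h"
 "j \<in> idx N ==> \<bar>m j - M j\<bar> <= h * (\<epsilon> j + \<epsilon> (nxt N j)) / 2"
proof -
 assume j: "j \<in> idx N"
 have j': "nxt N j \<in> idx N" using j by simp
 show "m j <= A * h" "h <= A * m j" "\<bar>M' j\<bar> <= A * h"
  using l[OF j] l[OF j'] L'[OF j] L'[OF j'] by (auto simp: cur.mass[OF j] ex.mass'[OF j] field_simps abs_if split: if_splits)
 show "\<bar>m j - M j\<bar> <= h * (\<epsilon> j + \<epsilon> (nxt N j)) / 2"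
  using abs_mean_le[OF len_diff[OF j] len_diff[OF j']]
  by (simp add: cur.mass[OF j] ex.mass[OF j] field_simps)
qed

lemma proj_diff:
 assumes j: "j \<in> idx N" and v: "norm v <= A * h"
 shows "norm (normal_proj (\<tau> j) v /\<^sub>R l j - normal_proj (T j) v /\<^sub>R L j) <= 5 * A ^ 4 * \<epsilon> j"
proof -
 let ?P = "normal_proj (\<tau> j) v" and ?R = "normal_proj (T j) v"
 have pos: "l j > 0" "L j > 0" using cur.len_pos[OF j] ex.len_pos[OF j] .
 have "?P /\<^sub>R l j - ?R /\<^sub>R L j = (1 / l j) *\<^sub>R (?P - ?R) + (1 / l j - 1 / L j) *\<^sub>R ?R"
  by (simp add: algebra_simps inverse_eq_divide)
 also have "norm ... <= (1 / l j) * norm (?P - ?R) + \<bar>1 / l j - 1 / L j\<bar> * norm ?R"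
  using norm_triangle_ineq[of "(1 / l j) *\<^sub>R (?P - ?R)" "(1 / l j - 1 / L j) *\<^sub>R ?R"] pos by simp
 also have "... <= (A / h) * (2 * (2 * A * \<epsilon> j) * (A * h)) + (A / h) * (A / h) * (h * \<epsilon> j) * (A * h)"
 proof (intro add_mono mult_mono)
  show "norm (?P - ?R) <= 2 * (2 * A * \<epsilon> j) * (A * h)"
   by (rule order_trans[OF norm_normal_proj_diff[OF cur.norm_tan[OF j] ex.norm_tan[OF j]]])
    (intro mult_mono, use theta[OF j] v A_ge0 h eps(1) in \<open>auto simp: \<theta>_def\<close>)
  have "\<bar>1 / l j - 1 / L j\<bar> = (1 / l j) * (1 / L j) * \<bar>l j - L j\<bar>"
   using pos by (simp add: field_simps abs_if)
  also have "... <= (A / h) * (A / h) * (h * \<epsilon> j)"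
   using inv_l[OF j] inv_L[OF j] len_diff[OF j] pos h A_ge0 by (intro mult_mono) auto
  finally show "\<bar>1 / l j - 1 / L j\<bar> <= (A / h) * (A / h) * (h * \<epsilon> j)" .
  show "norm ?R <= A * h" using inner_normal_proj(3)[OF ex.norm_tan[OF j], of v] v by linarith
 qed (use inv_l[OF j] h A_ge0 eps(1) in auto)
 also have "... = 5 * A ^ 3 * \<epsilon> j"
  using h by (simp add: power2_eq_square power3_eq_cube algebra_simps)
 also have "... <= 5 * A ^ 4 * \<epsilon> j"
  using A_pow[of 3 4] eps(1)[of j] by (intro mult_right_mono) auto
 finally show ?thesis .
qed

lemma kappa: "j \<in> idx N ==> norm (\<kappa> j) <= 5 * A ^ 4 * \<epsilon> j"
proof -
 assume j: "j \<in> idx N"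
 have "normal_proj (T j) (edge N X' j) = L j *\<^sub>R T' j"
  unfolding normal_proj_def ex.tan'[OF j] ex.len'[OF j] ..
 then have "\<kappa> j = normal_proj (\<tau> j) (edge N X' j) /\<^sub>R l j - normal_proj (T j) (edge N X' j) /\<^sub>R L j"
  unfolding \<kappa>_def using ex.len_pos[OF j] by simp
 then show ?thesis using proj_diff[OF j dX'[OF j]] by simp
qed

text \<open>Every summand of \<open>Q\<close> contains \<sigma> or two factors of first order in
  \<epsilon>, and a factor \<open>h\<close> from a length or an edge of \<open>Y\<close> or
  \<open>Y'\<close>, as the weight in \<open>Se\<close> requires. The powers of \<open>A\<close> are
  raised to the seventh; the numerical coefficients add up to 27.\<close>

lemma Q_bound:
 assumes j: "j \<in> idx N" shows "\<bar>Q j\<bar> <= 30 * A ^ 7 * (h * (\<epsilon> j)^2)"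
proof -
 define D where "D = h * (\<epsilon> j)^2"
 have D: "0 <= D" using h by (simp add: D_def)
 have pw: "A ^ k * D <= A ^ 7 * D" if "k <= 7" for k
  using A_pow[OF that] D by (rule mult_right_mono)
 have l1: "\<bar>l j\<bar> <= A * h" using l(2)[OF j] cur.len_pos[OF j] by simp
 have th: "\<bar>edge N Y j \<bullet> \<theta> j\<bar> <= A * h * (2 * A * \<epsilon> j)" by (rule abs_inner_le[OF dY[OF j] theta[OF j]])
 have th': "\<bar>edge N Y' j \<bullet> \<theta> j\<bar> <= A * h * (2 * A * \<epsilon> j)" by (rule abs_inner_le[OF dY'[OF j] theta[OF j]])
 have nT: "norm (T j) <= 1" "norm (\<tau> j) <= 1" using ex.norm_tan[OF j] cur.norm_tan[OF j] by auto
 have wT: "\<bar>edge N Y j \<bullet> T j\<bar> <= A * h * 1" "\<bar>edge N Y' j \<bullet> T j\<bar> <= A * h * 1" "\<bar>edge N Y j \<bullet> \<tau> j\<bar> <= A * h * 1"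
  "\<bar>edge N Y j \<bullet> T' j\<bar> <= A * h * A" "\<bar>\<theta> j \<bullet> T' j\<bar> <= (2 * A * \<epsilon> j) * A"
  using nT by (auto intro!: abs_inner_le dY dY' theta T' j simp del: mult_1_right)
 have ro: "\<bar>\<rho> j\<bar> <= A^2" "\<bar>1 / \<rho> j\<bar> <= A^2" using rho_bounds(2-4)[OF j] by auto
 note r1 = rho_bounds(1)[OF j] and r5 = rho_bounds(5)[OF j]
 have LL: "\<bar>L' j / L j\<bar> <= A^2"
 proof -
  have "\<bar>L' j * (1 / L j)\<bar> <= (A * h) * (A / h)"
   using inv_L[OF j] ex.len_pos[OF j] by (intro abs_mult_le L' j) auto
  then show ?thesis using h by (simp add: power2_eq_square)
 qed
 have t1: "\<bar>c' j * l j * \<sigma> j\<bar> <= A^2 * (A * h) * (2 * A^2 * (\<epsilon> j)^2)"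
  by (intro abs_mult_le c_bounds j l1 sigma)
 have t2: "\<bar>c j * L' j * \<sigma> j\<bar> <= A^2 / 2 * (A * h) * (2 * A^2 * (\<epsilon> j)^2)"
  by (intro abs_mult_le c_bounds j L' sigma)
 have t3: "\<bar>c j * (l j - L j) * (\<theta> j \<bullet> T' j)\<bar> <= A^2 / 2 * (h * \<epsilon> j) * ((2 * A * \<epsilon> j) * A)"
  by (intro abs_mult_le c_bounds j len_diff wT)
 have t4: "\<bar>(edge N Y' j \<bullet> \<theta> j) * (\<rho> j - 1)\<bar> <= A * h * (2 * A * \<epsilon> j) * (A * \<epsilon> j)"
  by (intro abs_mult_le th' r1)
 have t5: "\<bar>\<rho> j * \<sigma> j * (edge N Y' j \<bullet> T j)\<bar> <= A^2 * (2 * A^2 * (\<epsilon> j)^2) * (A * h * 1)"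
  by (intro abs_mult_le ro j sigma wT)
 have t6a: "\<bar>\<rho> j * \<sigma> j\<bar> <= A^2 * (2 * A^2 * (\<epsilon> j)^2)"
  by (intro abs_mult_le ro j sigma)
 have t6b: "\<bar>(\<rho> j - 1) * (\<rho> j - 1) * (1 / \<rho> j)\<bar> <= (A * \<epsilon> j) * (A * \<epsilon> j) * A^2"
  by (intro abs_mult_le ro r1)
 have "\<bar>\<rho> j * \<sigma> j - (\<rho> j - 1)^2 / \<rho> j\<bar> <= 3 * A ^ 4 * (\<epsilon> j)^2"
 proof -
  have e: "A^2 * (2 * A^2 * (\<epsilon> j)^2) = 2 * (A ^ 4 * (\<epsilon> j)^2)" "(A * \<epsilon> j) * (A * \<epsilon> j) * A^2 = A ^ 4 * (\<epsilon> j)^2"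
   "(\<rho> j - 1) * (\<rho> j - 1) * (1 / \<rho> j) = (\<rho> j - 1)^2 / \<rho> j"
   by (simp_all add: power_def numeral_eq_Suc mult_ac)
  show ?thesis using abs_triangle_ineq4[of "\<rho> j * \<sigma> j" "(\<rho> j - 1)^2 / \<rho> j"] t6a t6b
   unfolding e by linarith
 qed
 then have t6: "\<bar>(edge N Y j \<bullet> T' j) * (\<rho> j * \<sigma> j - (\<rho> j - 1)^2 / \<rho> j)\<bar> <= (A * h * A) * (3 * A ^ 4 * (\<epsilon> j)^2)"
  by (intro abs_mult_le wT)
 have t7a: "\<bar>(edge N Y j \<bullet> \<theta> j) * (1 / \<rho> j)\<bar> <= A * h * (2 * A * \<epsilon> j) * A^2"
  by (intro abs_mult_le th ro)
 have t7b: "\<bar>(1 / \<rho> j - \<rho> j) * (edge N Y j \<bullet> T j)\<bar> <= (2 * A ^ 3 * \<epsilon> j) * (A * h * 1)"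
  by (intro abs_mult_le r5 wT)
 have "\<bar>(edge N Y j \<bullet> \<theta> j) / \<rho> j + (1 / \<rho> j - \<rho> j) * (edge N Y j \<bullet> T j)\<bar> <= 4 * A ^ 4 * (h * \<epsilon> j)"
  by (rule order_trans[OF abs_triangle_ineq])
   (use t7a t7b in \<open>simp add: power2_eq_square power3_eq_cube power4_eq_xxxx mult_ac\<close>)
 then have t7: "\<bar>(\<theta> j \<bullet> T' j) * ((edge N Y j \<bullet> \<theta> j) / \<rho> j + (1 / \<rho> j - \<rho> j) * (edge N Y j \<bullet> T j))\<bar>
   <= (2 * A * \<epsilon> j) * A * (4 * A ^ 4 * (h * \<epsilon> j))"
  by (intro abs_mult_le wT)
 have t8a: "\<bar>(edge N Y j \<bullet> \<theta> j) * (1 / \<rho> j - \<rho> j)\<bar> <= A * h * (2 * A * \<epsilon> j) * (2 * A ^ 3 * \<epsilon> j)"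
  by (intro abs_mult_le th r5)
 have t8b: "\<bar>\<sigma> j * (edge N Y j \<bullet> \<tau> j) * (1 / \<rho> j)\<bar> <= (2 * A^2 * (\<epsilon> j)^2) * (A * h * 1) * A^2"
  by (intro abs_mult_le j sigma wT ro)
 have t8c: "\<bar>\<rho> j * \<sigma> j * (edge N Y j \<bullet> T j)\<bar> <= A^2 * (2 * A^2 * (\<epsilon> j)^2) * (A * h * 1)"
  by (intro abs_mult_le ro j sigma wT)
 have "\<bar>(edge N Y j \<bullet> \<theta> j) * (1 / \<rho> j - \<rho> j)
     - \<sigma> j * (edge N Y j \<bullet> \<tau> j) / \<rho> j - \<rho> j * \<sigma> j * (edge N Y j \<bullet> T j)\<bar> <= 8 * A ^ 5 * D"
 proof -
  have e: "A * h * (2 * A * \<epsilon> j) * (2 * A ^ 3 * \<epsilon> j) = 4 * (A ^ 5 * D)"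
   "(2 * A^2 * (\<epsilon> j)^2) * (A * h * 1) * A^2 = 2 * (A ^ 5 * D)"
   "A^2 * (2 * A^2 * (\<epsilon> j)^2) * (A * h * 1) = 2 * (A ^ 5 * D)"
   by (simp_all add: D_def power_def numeral_eq_Suc mult_ac)
  have "\<bar>u - v - w\<bar> <= \<bar>u\<bar> + \<bar>v\<bar> + \<bar>w\<bar>" for u v w :: real by linarith
  from this[of "(edge N Y j \<bullet> \<theta> j) * (1 / \<rho> j - \<rho> j)" "\<sigma> j * (edge N Y j \<bullet> \<tau> j) * (1 / \<rho> j)" "\<rho> j * \<sigma> j * (edge N Y j \<bullet> T j)"]
  show ?thesis using t8a[unfolded e] t8b[unfolded e] t8c[unfolded e]
   unfolding times_divide_eq_right mult_1_right by linarith
 qed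
 then have t8: "\<bar>L' j / L j * ((edge N Y j \<bullet> \<theta> j) * (1 / \<rho> j - \<rho> j)
     - \<sigma> j * (edge N Y j \<bullet> \<tau> j) / \<rho> j - \<rho> j * \<sigma> j * (edge N Y j \<bullet> T j))\<bar> <= A^2 * (8 * A ^ 5 * D)"
  by (intro abs_mult_le LL)
 have e: "A^2 * (A * h) * (2 * A^2 * (\<epsilon> j)^2) = 2 * (A ^ 5 * D)"
   "A^2 / 2 * (A * h) * (2 * A^2 * (\<epsilon> j)^2) = A ^ 5 * D"
   "A^2 / 2 * (h * \<epsilon> j) * ((2 * A * \<epsilon> j) * A) = A ^ 4 * D"
   "A * h * (2 * A * \<epsilon> j) * (A * \<epsilon> j) = 2 * (A ^ 3 * D)"
   "A^2 * (2 * A^2 * (\<epsilon> j)^2) * (A * h * 1) = 2 * (A ^ 5 * D)"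
   "(A * h * A) * (3 * A ^ 4 * (\<epsilon> j)^2) = 3 * (A ^ 6 * D)"
   "(2 * A * \<epsilon> j) * A * (4 * A ^ 4 * (h * \<epsilon> j)) = 8 * (A ^ 6 * D)"
   "A^2 * (8 * A ^ 5 * D) = 8 * (A ^ 7 * D)"
  by (simp_all add: D_def power_def numeral_eq_Suc mult_ac)
 have "\<bar>Q j\<bar> <= 2 * (A ^ 5 * D) + A ^ 5 * D + A ^ 4 * D + 2 * (A ^ 3 * D) + 2 * (A ^ 5 * D)
   + 3 * (A ^ 6 * D) + 8 * (A ^ 6 * D) + 8 * (A ^ 7 * D)"
 proof -
  have gen: "\<bar>- x1 + x2 + x3 + x4 + x5 + x6 + x7 + x8\<bar> <= b1 + b2 + b3 + b4 + b5 + b6 + b7 + b8"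
   if "\<bar>x1\<bar> <= b1" "\<bar>x2\<bar> <= b2" "\<bar>x3\<bar> <= b3" "\<bar>x4\<bar> <= b4" "\<bar>x5\<bar> <= b5" "\<bar>x6\<bar> <= b6" "\<bar>x7\<bar> <= b7" "\<bar>x8\<bar> <= b8"
   for x1 x2 x3 x4 x5 x6 x7 x8 b1 b2 b3 b4 b5 b6 b7 b8 :: real
   using that unfolding abs_le_iff by linarith
  show ?thesis
   using gen[OF t1[unfolded e] t2[unfolded e] t3[unfolded e] t4[unfolded e] t5[unfolded e] t6[unfolded e]
    t7[unfolded e] t8[unfolded e]] unfolding Q_def mult_minus_left .
 qed
 also have "... <= 30 * (A ^ 7 * D)"
 proof -
  have "0 <= A ^ 7 * D" using D A_ge0 by simp
  then show ?thesis using pw[of 3] pw[of 4] pw[of 5] pw[of 6] by linarith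
 qed
 finally show ?thesis by (simp add: D_def mult_ac)
qed

text \<open>Squared discrete L2 norms of the errors of curvature, slope, position, velocity and
  curvature slope. The first three form the energy; \<open>Sd\<close> and \<open>Z\<close> are
  available only after integration in time.\<close>

definition Sa where "Sa = (\<Sum>j\<in>idx N. h * (norm (a j))^2)"
definition Se where "Se = (\<Sum>j\<in>idx N. h * (\<epsilon> j)^2)"
definition S0 where "S0 = (\<Sum>j\<in>idx N. h * (norm (e j))^2)"
definition Sd where "Sd = (\<Sum>j\<in>idx N. h * (norm (e' j))^2)"
definition Z where "Z = (\<Sum>j\<in>idx N. h * (norm (edge N a j) / h)^2)"
text \<open>\<Psi> and \<open>r0\<close> are included because otherwise their counterparts would be
  tested with the edges of \<open>e'\<close>. Neither term has a sign: a share of the slope term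
  pays for \<open>r0\<close>, and the last term covers the part of \<Psi> that is left after
  interpolation.\<close>

definition W where
 "W = (\<Sum>j\<in>idx N. m j * (norm (a j))^2 / 2 + lam / (2 * hh j) * (norm (edge N e j))^2 - \<Psi> j
   + r0 j \<bullet> edge N e j + weight A lam * hh j * (norm (e j))^2 / 2)"
definition W' where
 "W' = (\<Sum>j\<in>idx N. (m' j * (norm (a j))^2 / 2 + m j * (a j \<bullet> a' j))
   + lam / hh j * (edge N e j \<bullet> edge N e' j) - \<Psi>' j
   + (r0' j \<bullet> edge N e j + r0 j \<bullet> edge N e' j) + weight A lam * hh j * (e j \<bullet> e' j))"

lemma sums_nonneg: "0 <= Sa" "0 <= Se" "0 <= S0" "0 <= Sd" "0 <= Z"
 using h by (auto simp: Sa_def Se_def S0_def Sd_def Z_def intro!: sum_nonneg)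

lemma sum_const_le: "0 <= k ==> (\<Sum>j\<in>idx N. h * k) <= A * k"
proof -
 assume k: "0 <= k"
 have "(\<Sum>j\<in>idx N. h * k) = real N * h * k" by (simp add: idx_def)
 also have "... <= A * k" by (rule mult_right_mono[OF card k])
 finally show ?thesis .
qed

text \<open>For unit vectors, \<theta> tested with the edge of \<open>e\<close> is (l + L) \<sigma>,
  so it bounds |\<theta>|^2 from above. Summed by parts with \<open>sum_tan\<close> it becomes the
  difference of \<open>m\<close> y and \<open>M\<close> Y tested with the position error
  \<open>e\<close>. Thus the tangent error is bounded by a geometric mean of energy and position
  error.\<close>

lemma theta_interpolation:
 assumes mu: "0 < \<mu>"
 shows "(\<Sum>j\<in>idx N. h * (norm (\<theta> j))^2) <= \<mu> * (Sa + Se) + A ^ 4 / (2 * \<mu>) * S0"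
proof -
 \<comment> \<open>The slope errors of the two edges at a node enter with weight one half each, so
   that the cyclic shift recombines them to a single \<open>Se\<close>.\<close>
 have A4: "A * (A * (g * (s + 1 / 2 * (t + t')))) <= \<mu> * (s^2 + (t^2 + t'^2) / 2) + A ^ 4 / (2 * \<mu>) * g^2"
  for s t t' g :: real
 proof -
  have 1: "s * (A^2 * g) <= \<mu> * s^2 + (A^2 * g)^2 / (4 * \<mu>)" by (rule young[OF mu])
  have 2: "u * (A^2 * g) / 2 <= (\<mu> * u^2 + (A^2 * g)^2 / (4 * \<mu>)) / 2" for u
   using young[OF mu, of u "A^2 * g"] by simp
  have 3: "(A^2 * g)^2 / (4 * \<mu>) = A ^ 4 / (4 * \<mu>) * g^2"
   by (simp add: power_mult_distrib flip: power_mult)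
  have "A * (A * (g * (s + 1 / 2 * (t + t')))) = s * (A^2 * g) + t * (A^2 * g) / 2 + t' * (A^2 * g) / 2"
   by (simp add: power2_eq_square field_simps)
  also have "... <= \<mu> * s^2 + \<mu> * t^2 / 2 + \<mu> * t'^2 / 2 + 2 * (A ^ 4 / (4 * \<mu>) * g^2)"
   using 1 2[of t] 2[of t'] unfolding 3 add_divide_distrib by linarith
  also have "... = \<mu> * (s^2 + (t^2 + t'^2) / 2) + A ^ 4 / (2 * \<mu>) * g^2"
   by (simp add: distrib_left add_divide_distrib)
  finally show ?thesis .
 qed
 have id: "\<theta> j \<bullet> edge N e j = (l j + L j) * \<sigma> j" if j: "j \<in> idx N" for j
 proof -
  have e: "edge N e j = l j *\<^sub>R \<tau> j - L j *\<^sub>R T j"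
   unfolding cur.edge[OF j, symmetric] ex.edge[OF j, symmetric] by (simp add: edge_def e_def)
  show ?thesis unfolding e \<theta>_def \<sigma>_eq[OF j]
   by (simp add: inner_simps cur.tan_tan[OF j] ex.tan_tan[OF j] inner_commute algebra_simps)
 qed
 have "(\<Sum>j\<in>idx N. h * (norm (\<theta> j))^2) <= (\<Sum>j\<in>idx N. A * (\<theta> j \<bullet> edge N e j))"
 proof (rule sum_mono)
  fix j assume j: "j \<in> idx N"
  have "h <= A * ((l j + L j) / 2)" using l(1)[OF j] L(1)[OF j] by (simp add: field_simps)
  then have "h * (norm (\<theta> j))^2 <= A * ((l j + L j) / 2) * (norm (\<theta> j))^2" by (rule mult_right_mono) simp
  then show "h * (norm (\<theta> j))^2 <= A * (\<theta> j \<bullet> edge N e j)"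
   unfolding id[OF j] by (simp add: \<sigma>_def)
 qed
 also have "... = A * ((\<Sum>j\<in>idx N. \<tau> j \<bullet> edge N e j) - (\<Sum>j\<in>idx N. T j \<bullet> edge N e j))"
  by (simp add: \<theta>_def inner_diff_left sum_subtractf sum_distrib_left right_diff_distrib)
 also have "... = (\<Sum>j\<in>idx N. - (A * (m j * (a j \<bullet> e j) + (m j - M j) * (Y j \<bullet> e j))))"
  unfolding cur.sum_tan ex.sum_tan a_def
  by (simp add: inner_diff_left sum_subtractf sum.distrib sum_negf sum_distrib_left algebra_simps)
 also have "... <= (\<Sum>j\<in>idx N. h * (\<mu> * ((norm (a j))^2 + ((\<epsilon> j)^2 + (\<epsilon> (nxt N j))^2) / 2)
    + A ^ 4 / (2 * \<mu>) * (norm (e j))^2))"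
 proof (rule sum_mono)
  fix j assume j: "j \<in> idx N"
  have "\<bar>m j * (a j \<bullet> e j)\<bar> <= (A * h) * (norm (a j) * norm (e j))"
   using mass_bounds(1)[OF j] cur.mass_pos[OF j] by (intro abs_mult_le Cauchy_Schwarz_ineq2) simp
  moreover have "\<bar>(m j - M j) * (Y j \<bullet> e j)\<bar> <= (h * (\<epsilon> j + \<epsilon> (nxt N j)) / 2) * (A * norm (e j))"
   by (intro abs_mult_le abs_inner_le mass_bounds Y j) simp
  ultimately have "- (m j * (a j \<bullet> e j) + (m j - M j) * (Y j \<bullet> e j))
    <= (A * h) * (norm (a j) * norm (e j)) + (h * (\<epsilon> j + \<epsilon> (nxt N j)) / 2) * (A * norm (e j))"
   by linarith
  then have "A * - (m j * (a j \<bullet> e j) + (m j - M j) * (Y j \<bullet> e j))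
    <= A * ((A * h) * (norm (a j) * norm (e j)) + (h * (\<epsilon> j + \<epsilon> (nxt N j)) / 2) * (A * norm (e j)))"
   using A_ge0 by (rule mult_left_mono)
  also have "... = h * (A * (A * (norm (e j) * (norm (a j) + 1 / 2 * (\<epsilon> j + \<epsilon> (nxt N j))))))"
   by (simp add: field_simps)
  also have "... <= h * (\<mu> * ((norm (a j))^2 + ((\<epsilon> j)^2 + (\<epsilon> (nxt N j))^2) / 2)
    + A ^ 4 / (2 * \<mu>) * (norm (e j))^2)"
   using h by (intro mult_left_mono A4) simp
  finally show "- (A * (m j * (a j \<bullet> e j) + (m j - M j) * (Y j \<bullet> e j))) <=
   h * (\<mu> * ((norm (a j))^2 + ((\<epsilon> j)^2 + (\<epsilon> (nxt N j))^2) / 2) + A ^ 4 / (2 * \<mu>) * (norm (e j))^2)"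
   unfolding mult_minus_right .
 qed
 also have "... = (\<Sum>j\<in>idx N. \<mu> * (h * (norm (a j))^2) + \<mu> / 2 * (h * (\<epsilon> j)^2)
   + \<mu> / 2 * (h * (\<epsilon> (nxt N j))^2) + A ^ 4 / (2 * \<mu>) * (h * (norm (e j))^2))"
  by (rule sum.cong[OF refl]) (simp add: field_simps)
 also have "... = \<mu> * (Sa + Se) + A ^ 4 / (2 * \<mu>) * S0"
 proof -
  have nx: "(\<Sum>j\<in>idx N. \<mu> / 2 * (h * (\<epsilon> (nxt N j))^2)) = (\<Sum>j\<in>idx N. \<mu> / 2 * (h * (\<epsilon> j)^2))"
   by (rule sum_nxt)
  show ?thesis
   unfolding sum.distrib nx unfolding sum_distrib_left[symmetric] distrib_left Sa_def Se_def S0_def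
   by simp
 qed
 finally show ?thesis .
qed

text \<open>Only the summand with 1 - \<rho> is not already quadratic in \<theta>.
  \<open>young\<close> gives the slope error in it the factor lam / 8, small enough for the slope
  term of the energy.\<close>

lemma Psi_bound:
 assumes j: "j \<in> idx N"
 shows "\<bar>\<Psi> j\<bar> <= h * (lam / 8 * (\<epsilon> j)^2 + psi_const A lam * (norm (\<theta> j))^2)"
proof -
 have l1: "\<bar>l j\<bar> <= A * h" using l(2)[OF j] cur.len_pos[OF j] by simp
 have nT: "norm (T j) <= 1" using ex.norm_tan[OF j] by auto
 have s: "\<bar>\<sigma> j\<bar> <= (norm (\<theta> j))^2 / 2" by (simp add: \<sigma>_def)
 have 1: "\<bar>c j * l j * \<sigma> j\<bar> <= A^2 / 2 * (A * h) * ((norm (\<theta> j))^2 / 2)"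
  by (intro abs_mult_le c_bounds j l1 s)
 have 2: "\<bar>(1 - \<rho> j) * (edge N Y j \<bullet> \<theta> j)\<bar> <= (A * \<epsilon> j) * (A * h * norm (\<theta> j))"
  using rho_bounds(1)[OF j] by (intro abs_mult_le abs_inner_le dY j) auto
 have 3: "\<bar>\<rho> j * (edge N Y j \<bullet> T j) * \<sigma> j\<bar> <= A^2 * (A * h * 1) * ((norm (\<theta> j))^2 / 2)"
  using rho_bounds(2,3)[OF j] by (intro abs_mult_le abs_inner_le dY j nT s) auto
 have y: "\<epsilon> j * (A^2 * norm (\<theta> j)) <= lam / 8 * (\<epsilon> j)^2 + (A^2 * norm (\<theta> j))^2 / (4 * (lam / 8))"
  using lam by (intro young) simp
 have y2: "(A^2 * norm (\<theta> j))^2 / (4 * (lam / 8)) = 2 * A ^ 4 / lam * (norm (\<theta> j))^2"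
  by (simp add: power_mult_distrib flip: power_mult)
 have "\<bar>\<Psi> j\<bar> <= A^2 / 2 * (A * h) * ((norm (\<theta> j))^2 / 2) + (A * \<epsilon> j) * (A * h * norm (\<theta> j))
   + A^2 * (A * h * 1) * ((norm (\<theta> j))^2 / 2)"
  unfolding \<Psi>_def using 1 2 3 by linarith
 also have "... = h * (\<epsilon> j * (A^2 * norm (\<theta> j)) + 3 / 4 * (A ^ 3 * (norm (\<theta> j))^2))"
  by (simp add: power2_eq_square power3_eq_cube field_simps)
 also have "... <= h * (lam / 8 * (\<epsilon> j)^2 + psi_const A lam * (norm (\<theta> j))^2)"
 proof (rule mult_left_mono)
  have "0 <= A ^ 3 * (norm (\<theta> j))^2" using A_ge0 by simp
  then show "\<epsilon> j * (A^2 * norm (\<theta> j)) + 3 / 4 * (A ^ 3 * (norm (\<theta> j))^2)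
   <= lam / 8 * (\<epsilon> j)^2 + psi_const A lam * (norm (\<theta> j))^2"
   using y unfolding y2 psi_const_def distrib_right by linarith
 qed (use h in simp)
 finally show ?thesis .
qed

text \<open>Of the lam / 2 that the slope term provides, lam / 8 goes to \<Psi> and lam / 8 to
  \<open>r0\<close>; the latter leaves the term with h^2. The interpolation estimate is used with
  \<mu> = q / (2 k), which costs half of the coercivity, and \<open>weight\<close> is exactly what
  then remains to be covered by the position error.\<close>

lemma W_coercive: "coercivity A lam * (Sa + Se + S0) - 2 * A ^ 3 / lam * h^2 <= W"
proof -
 define q where "q = coercivity A lam"
 define k where "k = psi_const A lam"
 define K where "K = weight A lam"
 have q: "0 < q" "q <= lam / 8" "q <= 1 / (4 * A)" using lam A by (auto simp: q_def coercivity_def)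
 have k: "0 < k" unfolding k_def psi_const_def using lam A by (intro add_pos_pos) auto
 have K: "K / (2 * A) = k * A ^ 4 / (q / k) + q" "0 <= K"
  unfolding K_def weight_def k_def[symmetric] q_def[symmetric] using A k q by auto
 have pt: "h * ((norm (a j))^2 / (2 * A) + lam / 4 * (\<epsilon> j)^2 - k * (norm (\<theta> j))^2
    - 2 * A^2 / lam * h^2 + K / (2 * A) * (norm (e j))^2)
  <= m j * (norm (a j))^2 / 2 + lam / (2 * hh j) * (norm (edge N e j))^2 - \<Psi> j
   + r0 j \<bullet> edge N e j + K * hh j * (norm (e j))^2 / 2" if j: "j \<in> idx N" for j
 proof -
  have 1: "h * ((norm (a j))^2 / (2 * A)) <= m j * (norm (a j))^2 / 2"
   using mult_right_mono[OF mass_bounds(2)[OF j], of "(norm (a j))^2"] A by (simp add: field_simps)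
  have hp: "0 < hh j" using hh(1)[OF j] h A_pos by (meson less_le_trans zero_less_mult_pos)
  have "1 <= h / hh j" using hh(2)[OF j] hp by simp
  then have "1 * (lam / 2 * (h * (\<epsilon> j)^2)) <= h / hh j * (lam / 2 * (h * (\<epsilon> j)^2))"
   using h lam by (intro mult_right_mono) auto
  then have 2: "lam / 2 * (h * (\<epsilon> j)^2) <= lam / (2 * hh j) * (norm (edge N e j))^2"
   unfolding eps(2) by (simp add: power2_eq_square field_simps)
  have 3: "\<Psi> j <= h * (lam / 8 * (\<epsilon> j)^2 + k * (norm (\<theta> j))^2)"
   using Psi_bound[OF j] by (simp add: k_def)
  have "\<bar>r0 j \<bullet> edge N e j\<bar> <= (A * h) * (h * \<epsilon> j)"
   by (intro abs_inner_le r0 j) (simp add: eps(2))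
  moreover have "(A * h) * (h * \<epsilon> j) <= h * (lam / 8 * (\<epsilon> j)^2 + 2 * A^2 / lam * h^2)"
  proof -
   have "\<epsilon> j * (A * h) <= lam / 8 * (\<epsilon> j)^2 + (A * h)^2 / (4 * (lam / 8))"
    using lam by (intro young) simp
   also have "... = lam / 8 * (\<epsilon> j)^2 + 2 * A^2 / lam * h^2" by (simp add: power_mult_distrib)
   finally have "h * (\<epsilon> j * (A * h)) <= h * (lam / 8 * (\<epsilon> j)^2 + 2 * A^2 / lam * h^2)"
    using h by (intro mult_left_mono) auto
   then show ?thesis by (simp add: mult_ac)
  qed
  ultimately have 4: "- (h * (lam / 8 * (\<epsilon> j)^2 + 2 * A^2 / lam * h^2)) <= r0 j \<bullet> edge N e j"
   by linarith
  have "h / A <= hh j" using hh(1)[OF j] A by (simp add: field_simps)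
  then have "h / A * (K * (norm (e j))^2 / 2) <= hh j * (K * (norm (e j))^2 / 2)"
   using K by (intro mult_right_mono) auto
  then have 5: "h * (K / (2 * A) * (norm (e j))^2) <= K * hh j * (norm (e j))^2 / 2"
   by (simp add: mult_ac)
  have 6: "h * ((norm (a j))^2 / (2 * A) + lam / 4 * (\<epsilon> j)^2 - k * (norm (\<theta> j))^2
    - 2 * A^2 / lam * h^2 + K / (2 * A) * (norm (e j))^2)
   = h * ((norm (a j))^2 / (2 * A)) + lam / 2 * (h * (\<epsilon> j)^2) - h * (lam / 8 * (\<epsilon> j)^2 + k * (norm (\<theta> j))^2)
    - h * (lam / 8 * (\<epsilon> j)^2 + 2 * A^2 / lam * h^2) + h * (K / (2 * A) * (norm (e j))^2)"
   by (simp add: algebra_simps)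
  show ?thesis unfolding 6 using 1 2 3 4 5 by linarith
 qed
 have "(1 / (2 * A)) * Sa + lam / 4 * Se - k * (\<Sum>j\<in>idx N. h * (norm (\<theta> j))^2)
   - (\<Sum>j\<in>idx N. h * (2 * A^2 / lam * h^2)) + K / (2 * A) * S0 <= W"
 proof -
  have "(1 / (2 * A)) * Sa + lam / 4 * Se - k * (\<Sum>j\<in>idx N. h * (norm (\<theta> j))^2)
   - (\<Sum>j\<in>idx N. h * (2 * A^2 / lam * h^2)) + K / (2 * A) * S0
   = (\<Sum>j\<in>idx N. h * ((norm (a j))^2 / (2 * A) + lam / 4 * (\<epsilon> j)^2 - k * (norm (\<theta> j))^2
    - 2 * A^2 / lam * h^2 + K / (2 * A) * (norm (e j))^2))"
   unfolding Sa_def Se_def S0_def sum_distrib_left sum_subtractf[symmetric] sum.distrib[symmetric]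
   by (rule sum.cong[OF refl]) (simp add: algebra_simps)
  also have "... <= W" unfolding W_def K_def[symmetric] by (rule sum_mono[OF pt])
  finally show ?thesis .
 qed
 moreover have "k * (\<Sum>j\<in>idx N. h * (norm (\<theta> j))^2) <= q / 2 * (Sa + Se) + k * A ^ 4 / (q / k) * S0"
 proof -
  have "k * (\<Sum>j\<in>idx N. h * (norm (\<theta> j))^2)
    <= k * (q / (2 * k) * (Sa + Se) + A ^ 4 / (2 * (q / (2 * k))) * S0)"
   using q k by (intro mult_left_mono theta_interpolation) auto
  also have "... = q / 2 * (Sa + Se) + k * A ^ 4 / (q / k) * S0"
   using q k by (simp add: distrib_left)
  finally show ?thesis .
 qed
 moreover have "(\<Sum>j\<in>idx N. h * (2 * A^2 / lam * h^2)) <= A * (2 * A^2 / lam * h^2)"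
  using lam by (intro sum_const_le) simp
 moreover have "A * (2 * A^2 / lam * h^2) = 2 * A ^ 3 / lam * h^2"
  by (simp add: power2_eq_square power3_eq_cube)
 moreover have "q * Sa + q / 2 * Sa <= 1 / (2 * A) * Sa"
 proof -
  have "0 <= q * Sa" "1 / (2 * A) * Sa = 2 * (1 / (4 * A) * Sa)" "q / 2 * Sa = q * Sa / 2"
   using q sums_nonneg(1) by auto
  then show ?thesis using mult_right_mono[OF q(3) sums_nonneg(1)] by linarith
 qed
 moreover have "q * Se + q / 2 * Se <= lam / 4 * Se"
 proof -
  have "3 / 2 * q * Se <= 3 / 2 * (lam / 8) * Se" using q sums_nonneg(2) by (intro mult_right_mono) auto
  moreover have "0 <= lam * Se" using lam sums_nonneg(2) by simp
  ultimately show ?thesis by (simp add: algebra_simps)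
 qed
 moreover have "K / (2 * A) * S0 = k * A ^ 4 / (q / k) * S0 + q * S0"
  unfolding K(1) by (rule distrib_right)
 ultimately show ?thesis
  unfolding q_def[symmetric] distrib_left[of q] distrib_left[of "q/2"] by linarith
qed

text \<open>The difference of the two schemes is again a difference of neighbouring values of one
  flux, hence can be tested by parts. \<open>W'_bound\<close> takes the velocity error for \<phi>,
  \<open>dissipation\<close> the curvature error.\<close>

lemma tested_scheme:
 "(\<Sum>j\<in>idx N. (flux j - Flux j) \<bullet> edge N \<phi> j)
  = (\<Sum>j\<in>idx N. (m j *\<^sub>R x' j - M j *\<^sub>R X' j) \<bullet> \<phi> j)
   + (\<Sum>j\<in>idx N. lam / hh j * (edge N e j \<bullet> edge N \<phi> j)) + (\<Sum>j\<in>idx N. r0 j \<bullet> edge N \<phi> j)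
   + (\<Sum>j\<in>idx N. r j \<bullet> \<phi> j)"
proof -
 define F where "F j = flux j - Flux j - (lam / hh j) *\<^sub>R edge N e j - r0 j" for j
 have F: "m j *\<^sub>R x' j - M j *\<^sub>R X' j + r j = F j - F (nxt N j)" if j: "j \<in> idx N" for j
  unfolding scheme[OF j] exact[OF j] F_def e_def edge_diff by (simp add: algebra_simps)
 have "(\<Sum>j\<in>idx N. F j \<bullet> edge N \<phi> j) = (\<Sum>j\<in>idx N. (F j - F (nxt N j)) \<bullet> \<phi> j)"
  by (rule sum_by_parts)
 also have "... = (\<Sum>j\<in>idx N. (m j *\<^sub>R x' j - M j *\<^sub>R X' j + r j) \<bullet> \<phi> j)"
  by (rule sum.cong[OF refl]) (simp add: F)
 finally show ?thesis
  by (simp add: F_def inner_diff_left inner_add_left sum_subtractf sum.distrib algebra_simps)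
qed

text \<open>The squared errors that an estimate at \<open>j\<close> may involve, neighbours
  included. Cyclic shifts preserve the sums, which explains the multiplicities in
  \<open>sum_s\<close>.\<close>

definition s where
 "s j = (\<epsilon> j)^2 + (\<epsilon> (nxt N j))^2 + (\<epsilon> (prv N j))^2 + (norm (a j))^2 + (norm (a (prv N j)))^2
   + (norm (e j))^2"

lemma sum_s: "(\<Sum>j\<in>idx N. h * s j) = 3 * Se + 2 * Sa + S0"
 unfolding s_def distrib_left sum.distrib sum_nxt[of "%j. h * (\<epsilon> j)^2"] sum_prv[of "%j. h * (\<epsilon> j)^2"]
  sum_prv[of "%j. h * (norm (a j))^2"]
 by (simp add: Sa_def Se_def S0_def)

lemma s_ge: "(\<epsilon> j)^2 <= s j" "(\<epsilon> j)^2 + (\<epsilon> (nxt N j))^2 <= s j" "(norm (a j))^2 <= s j" "(norm (e j))^2 <= s j"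
 "(norm (a j))^2 + (norm (a (prv N j)))^2 + (\<epsilon> j)^2 <= s j"
 "(\<epsilon> j)^2 + (\<epsilon> (nxt N j))^2 + (norm (a j))^2 <= s j"
 "(\<epsilon> j)^2 + (\<epsilon> (nxt N j))^2 + (\<epsilon> (prv N j))^2 + (norm (a j))^2 + (norm (a (prv N j)))^2 <= s j" "0 <= s j"
 by (simp_all add: s_def)

lemma sum_bound:
 assumes k: "0 <= k" and f: "!!j. j \<in> idx N ==> f j <= h * (kb * (norm (e' j))^2 + kd * (norm (edge N a j) / h)^2
   + k * (s j + h^2))"
 shows "(\<Sum>j\<in>idx N. f j) <= kb * Sd + kd * Z + 3 * A * k * (Sa + Se + S0 + h^2)"
proof -
 have "(\<Sum>j\<in>idx N. f j) <= (\<Sum>j\<in>idx N. kb * (h * (norm (e' j))^2) + kd * (h * (norm (edge N a j) / h)^2)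
   + k * (h * s j) + k * (h * h^2))"
  by (rule sum_mono, rule order_trans[OF f]) (simp_all add: algebra_simps)
 also have "... = kb * Sd + kd * Z + k * (3 * Se + 2 * Sa + S0) + k * (\<Sum>j\<in>idx N. h * h^2)"
  unfolding sum.distrib sum_s[symmetric] sum_distrib_left Sd_def Z_def ..
 also have "... <= kb * Sd + kd * Z + k * (3 * (A * (Sa + Se + S0))) + k * (3 * (A * h^2))"
 proof -
  have "1 * (Sa + Se + S0) <= A * (Sa + Se + S0)"
   using A sums_nonneg by (intro mult_right_mono) auto
  then have "3 * (1 * (Sa + Se + S0)) <= 3 * (A * (Sa + Se + S0))" by (rule mult_left_mono) simp
  moreover have "3 * Se + 2 * Sa + S0 <= 3 * (1 * (Sa + Se + S0))" using sums_nonneg by simp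
  ultimately have 1: "3 * Se + 2 * Sa + S0 <= 3 * (A * (Sa + Se + S0))" by linarith
  have "(\<Sum>j\<in>idx N. h * h^2) <= A * h^2" by (rule sum_const_le) simp
  moreover have "0 <= A * h^2" using A_ge0 by simp
  ultimately have 2: "(\<Sum>j\<in>idx N. h * h^2) <= 3 * (A * h^2)" by linarith
  show ?thesis using mult_left_mono[OF 1 k] mult_left_mono[OF 2 k] by linarith
 qed
 finally show ?thesis by (simp add: algebra_simps)
qed

lemma cy_diff:
 assumes j: "j \<in> idx N" shows "\<bar>c j - cy j\<bar> <= A / 2 * (norm (a j) + norm (a (prv N j)))"
proof -
 have sq: "\<bar>(norm (Y i))^2 - (norm (y i))^2\<bar> <= 2 * A * norm (a i)" if i: "i \<in> idx N" for i
 proof -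
  have "\<bar>(norm (Y i) - norm (y i)) * (norm (Y i) + norm (y i))\<bar> <= norm (a i) * (2 * A)"
   using norm_triangle_ineq3[of "y i" "Y i"] Y[OF i] y[OF i] by (intro abs_mult_le) (auto simp: a_def)
  then show ?thesis by (simp add: power2_eq_square algebra_simps)
 qed
 have "c j - cy j = (((norm (Y j))^2 - (norm (y j))^2) + ((norm (Y (prv N j)))^2 - (norm (y (prv N j)))^2)) / 2 / 2"
  by (simp add: c_def cy_def field_simps)
 then have "\<bar>c j - cy j\<bar> = \<bar>(((norm (Y j))^2 - (norm (y j))^2) + ((norm (Y (prv N j)))^2 - (norm (y (prv N j)))^2)) / 2\<bar> / 2"
  by (simp only: abs_divide abs_numeral)
 also have "... <= (2 * A * norm (a j) + 2 * A * norm (a (prv N j))) / 2 / 2"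
  using abs_mean_le[OF sq[OF j] sq[OF prv_in[OF j]]] by (rule divide_right_mono) simp
 finally show ?thesis by (simp add: algebra_simps)
qed

lemma mass_diff_inner:
 assumes j: "j \<in> idx N" and v: "norm v <= A"
 shows "\<bar>(m j - M j) * (v \<bullet> w)\<bar> <= h * (norm w * (A * (\<epsilon> j + \<epsilon> (nxt N j)) / 2))"
proof -
 have "\<bar>(m j - M j) * (v \<bullet> w)\<bar> <= (h * (\<epsilon> j + \<epsilon> (nxt N j)) / 2) * (A * norm w)"
  by (intro abs_mult_le abs_inner_le mass_bounds v j) simp
 then show ?thesis by (simp add: mult_ac)
qed

lemma eps_sq: "(\<epsilon> i + \<epsilon> k)^2 <= 2 * ((\<epsilon> i)^2 + (\<epsilon> k)^2)"
 using sum_squares_bound[of "\<epsilon> i" "\<epsilon> k"] by (simp add: power2_sum)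

text \<open>The good term is minus the mass times |e'|^2; the others are split by
  \<open>young\<close>. The slope of the curvature error enters only through \<kappa>. It is not
  part of the energy and keeps the coefficient 1 until \<open>dissipation\<close> removes
  it.\<close>

lemma growth_terms:
 assumes j: "j \<in> idx N" and K: "K = weight A lam"
 shows "Q j + ((M j - m j) * (Y' j \<bullet> a j) - M' j * (norm (a j))^2 / 2)
   + ((c j - cy j) * (\<theta> j \<bullet> edge N X' j) - \<kappa> j \<bullet> edge N a j)
   - (m j *\<^sub>R x' j - M j *\<^sub>R X' j) \<bullet> e' j - r j \<bullet> e' j + r0' j \<bullet> edge N e j
   + K * hh j * (e j \<bullet> e' j)
  <= h * (- (3 / (4 * A)) * (norm (e' j))^2 + 1 * (norm (edge N a j) / h)^2
    + (45 * A ^ 8 + 3 * A * K^2) * (s j + h^2))"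
proof -
 define \<alpha> \<alpha>p \<beta> \<gamma> D where "\<alpha> = norm (a j)" and "\<alpha>p = norm (a (prv N j))" and "\<beta> = norm (e' j)"
  and "\<gamma> = norm (e j)" and "D = norm (edge N a j) / h"
 \<comment> \<open>The error of the mass, the residual \<open>r\<close> and the weight term each
   take d |e'|^2. With this d they leave 3 / (4 A) of the 1 / A that the mass provides.\<close>
 define d where "d = 1 / (12 * A)"
 have d: "0 < d" "4 * d = 1 / (3 * A)" using A by (auto simp: d_def)
 have nD: "norm (edge N a j) = h * D" using h by (simp add: D_def)
 have K0: "0 <= K" unfolding K weight_def psi_const_def coercivity_def using lam A by auto
 have 1: "Q j <= h * (30 * A ^ 7 * (\<epsilon> j)^2)" using Q_bound[OF j] by (simp add: mult_ac)
 have "\<bar>(m j - M j) * (Y' j \<bullet> a j)\<bar> <= h * (\<alpha> * (A * (\<epsilon> j + \<epsilon> (nxt N j)) / 2))"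
  unfolding \<alpha>_def by (rule mass_diff_inner[OF j Y'[OF j]])
 then have "(M j - m j) * (Y' j \<bullet> a j) <= h * (\<alpha> * (A * (\<epsilon> j + \<epsilon> (nxt N j)) / 2))"
  using minus_mult_left[of "m j - M j"] unfolding minus_diff_eq by (metis abs_le_D2)
 moreover have "\<alpha> * (A * (\<epsilon> j + \<epsilon> (nxt N j)) / 2) <= A * ((\<epsilon> j)^2 + (\<epsilon> (nxt N j))^2 + \<alpha>^2)"
 proof -
  have "\<alpha> * (\<epsilon> j + \<epsilon> (nxt N j)) <= 1 / 2 * \<alpha>^2 + (\<epsilon> j + \<epsilon> (nxt N j))^2 / (4 * (1 / 2))" by (rule young) simp
  moreover have "p <= 2 * (v + u)"
   if "p <= 1 / 2 * u + q / (4 * (1 / 2))" "q <= 2 * v" "0 <= u" "0 <= v" for p u q v :: real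
   using that by simp
  ultimately have "\<alpha> * (\<epsilon> j + \<epsilon> (nxt N j)) <= 2 * (((\<epsilon> j)^2 + (\<epsilon> (nxt N j))^2) + \<alpha>^2)"
   using eps_sq[of j "nxt N j"] by (meson sum_power2_ge_zero zero_le_power2)
  from mult_left_mono[OF this A_ge0] show ?thesis by (simp add: algebra_simps)
 qed
 ultimately have 2: "(M j - m j) * (Y' j \<bullet> a j) <= h * (A * ((\<epsilon> j)^2 + (\<epsilon> (nxt N j))^2 + \<alpha>^2))"
  using h by (meson mult_left_mono order_trans less_imp_le)
 have "- M' j * \<alpha>^2 <= A * h * \<alpha>^2" using mass_bounds(3)[OF j] by (intro mult_right_mono) auto
 then have 3: "- M' j * \<alpha>^2 / 2 <= h * (A / 2 * \<alpha>^2)" by (simp add: mult_ac)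
 have "\<bar>(c j - cy j) * (\<theta> j \<bullet> edge N X' j)\<bar> <= (A / 2 * (\<alpha> + \<alpha>p)) * ((2 * A * \<epsilon> j) * (A * h))"
  unfolding \<alpha>_def \<alpha>p_def by (intro abs_mult_le abs_inner_le cy_diff theta dX' j)
 also have "... = h * (A ^ 3 * ((\<alpha> + \<alpha>p) * \<epsilon> j))" by (simp add: power3_eq_cube)
 also have "... <= h * (A ^ 3 * (\<alpha>^2 + \<alpha>p^2 + (\<epsilon> j)^2))"
 proof (intro mult_left_mono)
  have "\<alpha> * \<epsilon> j <= 1 * \<alpha>^2 + (\<epsilon> j)^2 / (4 * 1)" "\<alpha>p * \<epsilon> j <= 1 * \<alpha>p^2 + (\<epsilon> j)^2 / (4 * 1)" by (rule young, simp)+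
  then show "(\<alpha> + \<alpha>p) * \<epsilon> j <= \<alpha>^2 + \<alpha>p^2 + (\<epsilon> j)^2"
   unfolding distrib_right using zero_le_power2[of "\<epsilon> j"] by linarith
 qed (use h A in auto)
 finally have 4: "(c j - cy j) * (\<theta> j \<bullet> edge N X' j) <= h * (A ^ 3 * (\<alpha>^2 + \<alpha>p^2 + (\<epsilon> j)^2))" by simp
 have "\<bar>\<kappa> j \<bullet> edge N a j\<bar> <= (5 * A ^ 4 * \<epsilon> j) * (h * D)"
  by (intro abs_inner_le kappa j) (simp add: nD)
 also have "... = h * (D * (5 * A ^ 4 * \<epsilon> j))" by (simp add: mult_ac)
 also have "... <= h * (1 * D^2 + (5 * A ^ 4 * \<epsilon> j)^2 / (4 * 1))"
  using h by (intro mult_left_mono young) auto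
 also have "(5 * A ^ 4 * \<epsilon> j)^2 / (4 * 1) = 25 / 4 * (A ^ 8 * (\<epsilon> j)^2)"
  by (simp add: power_mult_distrib flip: power_mult)
 finally have 5: "- (\<kappa> j \<bullet> edge N a j) <= h * (1 * D^2 + 25 / 4 * (A ^ 8 * (\<epsilon> j)^2))" by simp
 have mm: "(m j *\<^sub>R x' j - M j *\<^sub>R X' j) \<bullet> e' j = m j * \<beta>^2 + (m j - M j) * (X' j \<bullet> e' j)"
  unfolding \<beta>_def power2_norm_eq_inner e'_def by (simp add: inner_simps algebra_simps)
 have 6: "h * (1 / A * \<beta>^2) <= m j * \<beta>^2"
  using mult_right_mono[OF mass_bounds(2)[OF j], of "\<beta>^2"] A by (simp add: field_simps)
 have "\<bar>(m j - M j) * (X' j \<bullet> e' j)\<bar> <= h * (\<beta> * (A * (\<epsilon> j + \<epsilon> (nxt N j)) / 2))"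
  unfolding \<beta>_def by (rule mass_diff_inner[OF j X'[OF j]])
 also have "... <= h * (d * \<beta>^2 + (A * (\<epsilon> j + \<epsilon> (nxt N j)) / 2)^2 / (4 * d))"
  using h by (intro mult_left_mono young d) auto
 also have "... <= h * (d * \<beta>^2 + 3 / 2 * (A ^ 3 * ((\<epsilon> j)^2 + (\<epsilon> (nxt N j))^2)))"
 proof (intro mult_left_mono add_left_mono)
  have "(A * (\<epsilon> j + \<epsilon> (nxt N j)) / 2)^2 / (4 * d) = 3 / 4 * (A ^ 3 * (\<epsilon> j + \<epsilon> (nxt N j))^2)"
   unfolding d(2) by (simp add: power2_eq_square power3_eq_cube)
  also have "... <= 3 / 4 * (A ^ 3 * (2 * ((\<epsilon> j)^2 + (\<epsilon> (nxt N j))^2)))"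
   using A by (intro mult_left_mono eps_sq) auto
  also have "... = 3 / 2 * (A ^ 3 * ((\<epsilon> j)^2 + (\<epsilon> (nxt N j))^2))" by simp
  finally show "(A * (\<epsilon> j + \<epsilon> (nxt N j)) / 2)^2 / (4 * d) <= 3 / 2 * (A ^ 3 * ((\<epsilon> j)^2 + (\<epsilon> (nxt N j))^2))" .
 qed (use h in simp)
 finally have 7: "- ((m j - M j) * (X' j \<bullet> e' j)) <= h * (d * \<beta>^2 + 3 / 2 * (A ^ 3 * ((\<epsilon> j)^2 + (\<epsilon> (nxt N j))^2)))"
  by simp
 have "\<bar>r j \<bullet> e' j\<bar> <= (A * h^2) * \<beta>"
  unfolding \<beta>_def by (intro abs_inner_le r j) simp
 also have "... = h * (\<beta> * (A * h))" by (simp add: power2_eq_square)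
 also have "... <= h * (d * \<beta>^2 + (A * h)^2 / (4 * d))"
  using h by (intro mult_left_mono young d) auto
 also have "(A * h)^2 / (4 * d) = 3 * (A ^ 3 * h^2)"
  unfolding d(2) by (simp add: power2_eq_square power3_eq_cube)
 finally have 8: "- (r j \<bullet> e' j) <= h * (d * \<beta>^2 + 3 * (A ^ 3 * h^2))" by simp
 have "\<bar>r0' j \<bullet> edge N e j\<bar> <= (A * h) * (h * \<epsilon> j)"
  by (intro abs_inner_le r0' j) (simp add: eps(2))
 also have "... = h * (\<epsilon> j * (A * h))" by (simp add: mult_ac)
 also have "... <= h * (1 * (\<epsilon> j)^2 + (A * h)^2 / (4 * 1))"
  using h by (intro mult_left_mono young) auto
 finally have 9: "r0' j \<bullet> edge N e j <= h * (1 * (\<epsilon> j)^2 + 1 / 4 * (A^2 * h^2))"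
  by (simp add: power_mult_distrib)
 have hp: "0 < hh j" using hh(1)[OF j] h A_pos by (meson less_le_trans zero_less_mult_pos)
 have "\<bar>K * hh j * (e j \<bullet> e' j)\<bar> <= (K * h) * (\<gamma> * \<beta>)"
  unfolding \<gamma>_def \<beta>_def using K0 hh(2)[OF j] hp
  by (intro abs_mult_le Cauchy_Schwarz_ineq2) auto
 also have "... = h * (\<beta> * (K * \<gamma>))" by (simp add: mult_ac)
 also have "... <= h * (d * \<beta>^2 + (K * \<gamma>)^2 / (4 * d))"
  using h by (intro mult_left_mono young d) auto
 also have "(K * \<gamma>)^2 / (4 * d) = 3 * (A * K^2) * \<gamma>^2"
  unfolding d(2) by (simp add: power2_eq_square)
 finally have 10: "K * hh j * (e j \<bullet> e' j) <= h * (d * \<beta>^2 + 3 * (A * K^2) * \<gamma>^2)" by simp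
 define R where "R = 30 * A ^ 7 * (\<epsilon> j)^2 + A * ((\<epsilon> j)^2 + (\<epsilon> (nxt N j))^2 + \<alpha>^2) + A / 2 * \<alpha>^2
   + A ^ 3 * (\<alpha>^2 + \<alpha>p^2 + (\<epsilon> j)^2) + 25 / 4 * (A ^ 8 * (\<epsilon> j)^2) + 3 / 2 * (A ^ 3 * ((\<epsilon> j)^2 + (\<epsilon> (nxt N j))^2))
   + 3 * (A ^ 3 * h^2) + 1 * (\<epsilon> j)^2 + 1 / 4 * (A^2 * h^2) + 3 * (A * K^2) * \<gamma>^2"
 have eq: "h * (- (1 / A * \<beta>^2) + 3 * (d * \<beta>^2) + 1 * D^2 + R)
   = h * (30 * A ^ 7 * (\<epsilon> j)^2) + h * (A * ((\<epsilon> j)^2 + (\<epsilon> (nxt N j))^2 + \<alpha>^2)) + h * (A / 2 * \<alpha>^2)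
   + h * (A ^ 3 * (\<alpha>^2 + \<alpha>p^2 + (\<epsilon> j)^2)) + h * (1 * D^2 + 25 / 4 * (A ^ 8 * (\<epsilon> j)^2))
   - h * (1 / A * \<beta>^2) + h * (d * \<beta>^2 + 3 / 2 * (A ^ 3 * ((\<epsilon> j)^2 + (\<epsilon> (nxt N j))^2)))
   + h * (d * \<beta>^2 + 3 * (A ^ 3 * h^2)) + h * (1 * (\<epsilon> j)^2 + 1 / 4 * (A^2 * h^2))
   + h * (d * \<beta>^2 + 3 * (A * K^2) * \<gamma>^2)"
  unfolding R_def by (simp add: algebra_simps)
 have "Q j + ((M j - m j) * (Y' j \<bullet> a j) - M' j * (norm (a j))^2 / 2)
   + ((c j - cy j) * (\<theta> j \<bullet> edge N X' j) - \<kappa> j \<bullet> edge N a j)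
   - (m j *\<^sub>R x' j - M j *\<^sub>R X' j) \<bullet> e' j - r j \<bullet> e' j + r0' j \<bullet> edge N e j
   + K * hh j * (e j \<bullet> e' j)
  <= h * (- (1 / A * \<beta>^2) + 3 * (d * \<beta>^2) + 1 * D^2 + R)"
  unfolding mm eq using 1 2 3 4 5 6 7 8 9 10 unfolding \<alpha>_def[symmetric] by linarith
 also have "... <= h * (- (3 / (4 * A)) * \<beta>^2 + 1 * D^2 + (45 * A ^ 8 + 3 * A * K^2) * (s j + h^2))"
 proof (intro mult_left_mono)
  have b: "- (1 / A * \<beta>^2) + 3 * (d * \<beta>^2) = - (3 / (4 * A)) * \<beta>^2"
   using A by (simp add: d_def field_simps)
  have pw: "A ^ k * t <= A ^ 8 * (s j + h^2)" if "k <= 8" "t <= s j \<or> t <= h^2" "0 <= t" for k t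
  proof (rule mult_mono[OF A_pow])
   show "t <= s j + h^2" using that(2) s_ge(8)[of j] zero_le_power2[of h] by linarith
  qed (use that A_ge0 in auto)
  \<comment> \<open>Every coefficient is written as a power of \<open>A\<close>, with
    \<open>A ^ 0\<close> for the bare term, so that \<open>pw\<close> applies. The numerical
    factors, apart from the weight term, add up to 44.5.\<close>
  have Req: "R = 30 * (A ^ 7 * (\<epsilon> j)^2) + A ^ 1 * ((\<epsilon> j)^2 + (\<epsilon> (nxt N j))^2 + \<alpha>^2) + 1 / 2 * (A ^ 1 * \<alpha>^2)
   + A ^ 3 * (\<alpha>^2 + \<alpha>p^2 + (\<epsilon> j)^2) + 25 / 4 * (A ^ 8 * (\<epsilon> j)^2) + 3 / 2 * (A ^ 3 * ((\<epsilon> j)^2 + (\<epsilon> (nxt N j))^2))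
   + 3 * (A ^ 3 * h^2) + A ^ 0 * (\<epsilon> j)^2 + 1 / 4 * (A ^ 2 * h^2) + 3 * (A * K^2) * \<gamma>^2"
   unfolding R_def by simp
  have gen: "30 * p1 + p2 + 1 / 2 * p3 + p4 + 25 / 4 * p5 + 3 / 2 * p6 + 3 * p7 + p8 + 1 / 4 * p9 + q <= 45 * B + q"
   if "p1 <= B" "p2 <= B" "p3 <= B" "p4 <= B" "p5 <= B" "p6 <= B" "p7 <= B" "p8 <= B" "p9 <= B" "0 <= B"
   for p1 p2 p3 p4 p5 p6 p7 p8 p9 q B :: real
   using that by linarith
  have "0 <= A ^ 8 * (s j + h^2)" using A_ge0 s_ge(8)[of j] by simp
  then have "R <= 45 * (A ^ 8 * (s j + h^2)) + 3 * (A * K^2) * \<gamma>^2"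
   unfolding Req by (intro gen pw) (use s_ge[of j] in \<open>simp_all add: \<alpha>_def \<alpha>p_def\<close>)
  moreover have "3 * (A * K^2) * \<gamma>^2 <= 3 * (A * K^2) * (s j + h^2)"
   using A_ge0 add_increasing2[OF zero_le_power2[of h] s_ge(4)[of j]] unfolding \<gamma>_def
   by (intro mult_left_mono) auto
  ultimately show "- (1 / A * \<beta>^2) + 3 * (d * \<beta>^2) + 1 * D^2 + R
   <= - (3 / (4 * A)) * \<beta>^2 + 1 * D^2 + (45 * A ^ 8 + 3 * A * K^2) * (s j + h^2)"
   unfolding b by (simp add: distrib_right)
 qed (use h in simp)
 finally show ?thesis by (simp add: \<beta>_def D_def)
qed

text \<open>Testing with \<open>e'\<close> and inserting \<open>energy_variation\<close> and
  \<open>flux_variation\<close>, the terms with \<Psi>', with the edge products and with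
  \<open>r0\<close> cancel against their counterparts in \<open>W'\<close>; only terms without edges
  of \<open>e'\<close> remain.\<close>

lemma W'_bound:
 "W' <= - (3 / (4 * A)) * Sd + Z
   + 3 * A * (45 * A ^ 8 + 3 * A * (weight A lam)^2) * (Sa + Se + S0 + h^2)"
proof -
 define K where "K = weight A lam"
 have fv: "(\<Sum>j\<in>idx N. (normal_proj (\<tau> j) (edge N Y j) /\<^sub>R l j + c j *\<^sub>R \<tau> j) \<bullet> edge N e' j)
   = (\<Sum>j\<in>idx N. Flux j \<bullet> edge N e' j) + (\<Sum>j\<in>idx N. \<Psi>' j) + (\<Sum>j\<in>idx N. Q j)"
  unfolding sum.distrib[symmetric]
 proof (rule sum.cong[OF refl])
  fix j assume "j \<in> idx N"
  from flux_variation[OF this]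
  show "(normal_proj (\<tau> j) (edge N Y j) /\<^sub>R l j + c j *\<^sub>R \<tau> j) \<bullet> edge N e' j
   = Flux j \<bullet> edge N e' j + \<Psi>' j + Q j"
   unfolding inner_diff_left by linarith
 qed
 have flux_split: "(\<Sum>j\<in>idx N. (flux j - Flux j) \<bullet> edge N e' j)
   = (\<Sum>j\<in>idx N. flux j \<bullet> edge N e' j) - (\<Sum>j\<in>idx N. Flux j \<bullet> edge N e' j)"
  by (simp add: inner_diff_left sum_subtractf)
 have Wsplit: "W' = (\<Sum>j\<in>idx N. m' j * (norm (a j))^2 / 2 + m j * (a j \<bullet> a' j))
   + (\<Sum>j\<in>idx N. lam / hh j * (edge N e j \<bullet> edge N e' j)) - (\<Sum>j\<in>idx N. \<Psi>' j)
   + ((\<Sum>j\<in>idx N. r0' j \<bullet> edge N e j) + (\<Sum>j\<in>idx N. r0 j \<bullet> edge N e' j))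
   + (\<Sum>j\<in>idx N. K * hh j * (e j \<bullet> e' j))"
  unfolding W'_def K_def sum.distrib sum_subtractf ..
 have "W' = (\<Sum>j\<in>idx N. Q j + ((M j - m j) * (Y' j \<bullet> a j) - M' j * (norm (a j))^2 / 2)
   + ((c j - cy j) * (\<theta> j \<bullet> edge N X' j) - \<kappa> j \<bullet> edge N a j)
   - (m j *\<^sub>R x' j - M j *\<^sub>R X' j) \<bullet> e' j - r j \<bullet> e' j + r0' j \<bullet> edge N e j
   + K * hh j * (e j \<bullet> e' j))"
  using energy_variation tested_scheme[of e'] unfolding fv flux_split Wsplit sum.distrib sum_subtractf
  by linarith
 also have "... <= - (3 / (4 * A)) * Sd + 1 * Z + 3 * A * (45 * A ^ 8 + 3 * A * K^2) * (Sa + Se + S0 + h^2)"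
  by (rule sum_bound[OF _ growth_terms[OF _ K_def]]) (use A in auto)
 finally show ?thesis by (simp add: K_def)
qed

text \<open>By \<open>tan_edge_curv\<close> the tangential differences of both curvatures are means
  of mass times squared curvature. Their difference therefore involves values of the curvature error
  and length errors, and no slope of the curvature error.\<close>

lemma tangential_bound:
 assumes j: "j \<in> idx N"
 shows "\<bar>\<tau> j \<bullet> edge N a j\<bar> <= h * (3 * A^2 * (\<epsilon> j + \<epsilon> (nxt N j) + \<epsilon> (prv N j) + norm (a j) + norm (a (prv N j))))"
proof -
 have sq: "\<bar>m i * (norm (y i))^2 - M i * (norm (Y i))^2\<bar> <= h * (A^2 * ((\<epsilon> i + \<epsilon> (nxt N i)) / 2 + 2 * norm (a i)))"
  if i: "i \<in> idx N" for i
 proof -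
  have "\<bar>(norm (Y i) - norm (y i)) * (norm (Y i) + norm (y i))\<bar> <= norm (a i) * (2 * A)"
   using norm_triangle_ineq3[of "y i" "Y i"] Y[OF i] y[OF i] by (intro abs_mult_le) (auto simp: a_def)
  then have "\<bar>m i * ((norm (Y i) - norm (y i)) * (norm (Y i) + norm (y i)))\<bar> <= (A * h) * (norm (a i) * (2 * A))"
   using mass_bounds(1)[OF i] cur.mass_pos[OF i] by (intro abs_mult_le[of "m i"]) auto
  moreover have "\<bar>(m i - M i) * (norm (Y i))^2\<bar> <= (h * (\<epsilon> i + \<epsilon> (nxt N i)) / 2) * A^2"
   using Y[OF i] by (intro abs_mult_le mass_bounds i) (auto intro: power_mono)
  moreover have "m i * (norm (y i))^2 - M i * (norm (Y i))^2
   = (m i - M i) * (norm (Y i))^2 - m i * ((norm (Y i) - norm (y i)) * (norm (Y i) + norm (y i)))"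
   by (simp add: power2_eq_square algebra_simps)
  ultimately have "\<bar>m i * (norm (y i))^2 - M i * (norm (Y i))^2\<bar>
    <= (h * (\<epsilon> i + \<epsilon> (nxt N i)) / 2) * A^2 + (A * h) * (norm (a i) * (2 * A))"
   by linarith
  also have "... = h * (A^2 * ((\<epsilon> i + \<epsilon> (nxt N i)) / 2 + 2 * norm (a i)))"
   by (simp add: power2_eq_square field_simps)
  finally show ?thesis .
 qed
 have th: "\<bar>\<theta> j \<bullet> edge N Y j\<bar> <= h * (A^2 * (2 * \<epsilon> j))"
  using abs_inner_le[OF theta[OF j] dY[OF j]] by (simp add: power2_eq_square mult_ac)
 have "\<tau> j \<bullet> edge N a j = \<tau> j \<bullet> edge N y j - T j \<bullet> edge N Y j - \<theta> j \<bullet> edge N Y j"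
 proof -
  have ea: "edge N a j = edge N y j - edge N Y j" by (simp add: edge_def a_def)
  show ?thesis unfolding ea by (simp add: \<theta>_def inner_diff_left inner_diff_right)
 qed
 also have "... = - ((m j * (norm (y j))^2 - M j * (norm (Y j))^2)
   + (m (prv N j) * (norm (y (prv N j)))^2 - M (prv N j) * (norm (Y (prv N j)))^2)) / 2 - \<theta> j \<bullet> edge N Y j"
  unfolding cur.tan_edge_curv[OF j] ex.tan_edge_curv[OF j] by (simp add: field_simps)
 finally have "\<tau> j \<bullet> edge N a j = - ((m j * (norm (y j))^2 - M j * (norm (Y j))^2)
   + (m (prv N j) * (norm (y (prv N j)))^2 - M (prv N j) * (norm (Y (prv N j)))^2)) / 2 - \<theta> j \<bullet> edge N Y j" .
 moreover have "\<bar>t\<bar> <= (P + R) / 2 + U" if "t = - (p + q) / 2 - u" "\<bar>p\<bar> <= P" "\<bar>q\<bar> <= R" "\<bar>u\<bar> <= U"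
   for t p q u P R U :: real
   using that unfolding abs_le_iff by (simp add: field_simps)
 ultimately have "\<bar>\<tau> j \<bullet> edge N a j\<bar> <= (h * (A^2 * ((\<epsilon> j + \<epsilon> (nxt N j)) / 2 + 2 * norm (a j)))
   + h * (A^2 * ((\<epsilon> (prv N j) + \<epsilon> j) / 2 + 2 * norm (a (prv N j))))) / 2 + h * (A^2 * (2 * \<epsilon> j))"
  using sq[OF j] sq[OF prv_in[OF j], unfolded nxt_prv[OF j]] th by blast
 also have "... = h * (A^2 * (((\<epsilon> j + \<epsilon> (nxt N j)) / 2 + 2 * norm (a j) + ((\<epsilon> (prv N j) + \<epsilon> j) / 2
   + 2 * norm (a (prv N j)))) / 2 + 2 * \<epsilon> j))"
  by (simp add: field_simps)
 also have "... <= h * (A^2 * (3 * (\<epsilon> j + \<epsilon> (nxt N j) + \<epsilon> (prv N j) + norm (a j) + norm (a (prv N j)))))"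
 proof (intro mult_left_mono)
  show "((\<epsilon> j + \<epsilon> (nxt N j)) / 2 + 2 * norm (a j) + ((\<epsilon> (prv N j) + \<epsilon> j) / 2
   + 2 * norm (a (prv N j)))) / 2 + 2 * \<epsilon> j
   <= 3 * (\<epsilon> j + \<epsilon> (nxt N j) + \<epsilon> (prv N j) + norm (a j) + norm (a (prv N j)))"
  proof -
   have "((e1 + e2) / 2 + 2 * a1 + ((e3 + e1) / 2 + 2 * a2)) / 2 + 2 * e1 <= 3 * (e1 + e2 + e3 + a1 + a2)"
    if "0 <= e1" "0 <= e2" "0 <= e3" "0 <= a1" "0 <= a2" for e1 e2 e3 a1 a2 :: real
    using that by (simp add: field_simps)
   from this[OF eps(1) eps(1) eps(1) norm_ge_zero norm_ge_zero] show ?thesis .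
  qed
 qed (use h in auto)
 finally show ?thesis by (simp add: algebra_simps)
qed

lemma sq_sum5: "(p + q + u + v + w)^2 <= 5 * (p^2 + q^2 + u^2 + v^2 + w^2)" for p q u v w :: real
proof -
 have "0 <= (p - q)^2 + (p - u)^2 + (p - v)^2 + (p - w)^2 + (q - u)^2 + (q - v)^2 + (q - w)^2
  + (u - v)^2 + (u - w)^2 + (v - w)^2" by simp
 then show ?thesis by (simp add: power2_eq_square algebra_simps)
qed

lemma diss_terms:
 assumes j: "j \<in> idx N"
 shows "A * ((m j *\<^sub>R x' j - M j *\<^sub>R X' j) \<bullet> a j + lam / hh j * (edge N e j \<bullet> edge N a j)
   + r0 j \<bullet> edge N a j + r j \<bullet> a j
   - ((normal_proj (\<tau> j) (edge N Y j) /\<^sub>R l j - normal_proj (T j) (edge N Y j) /\<^sub>R L j)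
     + (cy j *\<^sub>R \<tau> j - c j *\<^sub>R T j)) \<bullet> edge N a j)
   + (\<tau> j \<bullet> edge N a j)^2 / h
  <= h * (3 / (16 * A) * (norm (e' j))^2 + 1 / 4 * (norm (edge N a j) / h)^2
    + (4 * A^2 * (6 * A ^ 4 + lam * A)^2 + 50 * A ^ 5) * (s j + h^2))"
proof -
 define \<alpha> \<alpha>p \<beta> D where "\<alpha> = norm (a j)" and "\<alpha>p = norm (a (prv N j))" and "\<beta> = norm (e' j)"
  and "D = norm (edge N a j) / h"
 define cR where "cR = 6 * A ^ 4 + lam * A"
 have cR0: "0 <= cR" using A_ge0 lam by (simp add: cR_def)
 have nn: "0 <= \<alpha>" "0 <= \<alpha>p" "0 <= D" using h by (auto simp: \<alpha>_def \<alpha>p_def D_def)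
 have nD: "norm (edge N a j) = h * D" using h by (simp add: D_def)
 have hp: "0 < hh j" using hh(1)[OF j] h A_pos by (meson less_le_trans zero_less_mult_pos)
 \<comment> \<open>Everything tested with the edges of \<open>a\<close> except the normal curvature
   slopes. It is bounded by errors of the energy and \<open>h\<close>, so \<open>young\<close> needs
   only a quarter of the squared slope.\<close>
 define R where "R = (lam / hh j) *\<^sub>R edge N e j + r0 j
   - ((normal_proj (\<tau> j) (edge N Y j) /\<^sub>R l j - normal_proj (T j) (edge N Y j) /\<^sub>R L j)
     + (cy j *\<^sub>R \<tau> j - c j *\<^sub>R T j))"
 have R: "norm R <= cR * (\<epsilon> j + \<alpha> + \<alpha>p + h)"
 proof -
  have 1: "norm ((lam / hh j) *\<^sub>R edge N e j) <= lam * A * \<epsilon> j"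
  proof -
   have "h / hh j <= A" using hh(1)[OF j] hp by (simp add: field_simps)
   then have "h / hh j * (lam * \<epsilon> j) <= A * (lam * \<epsilon> j)"
    using lam eps(1)[of j] by (intro mult_right_mono) auto
   then show ?thesis using hp lam by (simp add: eps(2) mult_ac)
  qed
  have 2: "norm (normal_proj (\<tau> j) (edge N Y j) /\<^sub>R l j - normal_proj (T j) (edge N Y j) /\<^sub>R L j) <= 5 * A ^ 4 * \<epsilon> j"
   by (rule proj_diff[OF j dY[OF j]])
  have "cy j *\<^sub>R \<tau> j - c j *\<^sub>R T j = c j *\<^sub>R \<theta> j - (c j - cy j) *\<^sub>R \<tau> j"
   by (simp add: \<theta>_def algebra_simps)
  then have "norm (cy j *\<^sub>R \<tau> j - c j *\<^sub>R T j) <= norm (c j *\<^sub>R \<theta> j) + norm ((c j - cy j) *\<^sub>R \<tau> j)"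
   by (metis norm_triangle_ineq4)
  also have "... <= (A^2 / 2) * (2 * A * \<epsilon> j) + A / 2 * (\<alpha> + \<alpha>p)"
  proof (rule add_mono)
   show "norm (c j *\<^sub>R \<theta> j) <= (A^2 / 2) * (2 * A * \<epsilon> j)"
    unfolding norm_scaleR by (intro mult_mono c_bounds theta j) auto
   show "norm ((c j - cy j) *\<^sub>R \<tau> j) <= A / 2 * (\<alpha> + \<alpha>p)"
    using cy_diff[OF j] cur.norm_tan[OF j] by (simp add: \<alpha>_def \<alpha>p_def)
  qed
  finally have 3: "norm (cy j *\<^sub>R \<tau> j - c j *\<^sub>R T j) <= A ^ 3 * \<epsilon> j + A / 2 * (\<alpha> + \<alpha>p)"
   by (simp add: power2_eq_square power3_eq_cube)
  have "norm R <= lam * A * \<epsilon> j + A * h + (5 * A ^ 4 * \<epsilon> j + (A ^ 3 * \<epsilon> j + A / 2 * (\<alpha> + \<alpha>p)))"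
   unfolding R_def
   by (intro order_trans[OF norm_triangle_ineq4] order_trans[OF norm_triangle_ineq] add_mono 1 2 3 r0 j)
  also have "... <= cR * \<epsilon> j + cR * \<alpha> + cR * \<alpha>p + cR * h"
  proof -
   have p: "1 <= A ^ 4" "A <= A ^ 4" "A ^ 3 <= A ^ 4" using A_pow[of 0 4] A_pow[of 1 4] A_pow[of 3 4] by auto
   have lA: "0 <= lam * A" using lam A_ge0 by simp
   have "(lam * A + 5 * A ^ 4 + A ^ 3) * \<epsilon> j <= cR * \<epsilon> j"
    using p eps(1)[of j] by (intro mult_right_mono) (auto simp: cR_def)
   moreover have "A * h <= cR * h" "A / 2 * \<alpha> <= cR * \<alpha>" "A / 2 * \<alpha>p <= cR * \<alpha>p"
    unfolding cR_def using p lA A_ge0 h nn by (intro mult_right_mono; simp)+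
   ultimately show ?thesis by (simp add: algebra_simps add_divide_distrib)
  qed
  finally show ?thesis by (simp add: algebra_simps)
 qed
 have Rsq: "(norm R)^2 <= 4 * cR^2 * (s j + h^2)"
 proof -
  have "(norm R)^2 <= (cR * (\<epsilon> j + \<alpha> + \<alpha>p + h))^2" using R by (intro power_mono) auto
  also have "... = cR^2 * (\<epsilon> j + \<alpha> + \<alpha>p + h)^2" by (rule power_mult_distrib)
  also have "... <= cR^2 * (4 * ((\<epsilon> j)^2 + \<alpha>^2 + \<alpha>p^2 + h^2))"
  proof (intro mult_left_mono)
   have "0 <= (\<epsilon> j - \<alpha>)^2 + (\<epsilon> j - \<alpha>p)^2 + (\<epsilon> j - h)^2 + (\<alpha> - \<alpha>p)^2 + (\<alpha> - h)^2 + (\<alpha>p - h)^2" by simp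
   then show "(\<epsilon> j + \<alpha> + \<alpha>p + h)^2 <= 4 * ((\<epsilon> j)^2 + \<alpha>^2 + \<alpha>p^2 + h^2)"
    by (simp add: power2_eq_square algebra_simps)
  qed simp
  also have "... <= cR^2 * (4 * (s j + h^2))"
   using s_ge(5)[of j] by (intro mult_left_mono) (auto simp: \<alpha>_def \<alpha>p_def)
  finally show ?thesis by (simp add: algebra_simps)
 qed
 have "\<bar>R \<bullet> edge N a j\<bar> <= norm R * (h * D)"
  by (rule abs_inner_le) (simp_all add: nD)
 then have "A * (R \<bullet> edge N a j) <= A * (norm R * (h * D))" using A_ge0 by (intro mult_left_mono) auto
 also have "... = h * (D * (A * norm R))" by (simp add: mult_ac)
 also have "... <= h * (1 / 4 * D^2 + (A * norm R)^2 / (4 * (1 / 4)))"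
  using h by (intro mult_left_mono young) auto
 also have "... <= h * (1 / 4 * D^2 + 4 * A^2 * cR^2 * (s j + h^2))"
 proof (intro mult_left_mono add_left_mono)
  have "(A * norm R)^2 / (4 * (1 / 4)) = A^2 * (norm R)^2" by (simp add: power_mult_distrib)
  also have "... <= A^2 * (4 * cR^2 * (s j + h^2))" using Rsq by (rule mult_left_mono) simp
  finally show "(A * norm R)^2 / (4 * (1 / 4)) <= 4 * A^2 * cR^2 * (s j + h^2)" by simp
 qed (use h in simp)
 finally have 1: "A * (R \<bullet> edge N a j) <= h * (1 / 4 * D^2 + 4 * A^2 * cR^2 * (s j + h^2))" .
 have mm: "(m j *\<^sub>R x' j - M j *\<^sub>R X' j) \<bullet> a j = m j * (e' j \<bullet> a j) + (m j - M j) * (X' j \<bullet> a j)"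
  unfolding e'_def by (simp add: inner_simps algebra_simps)
 have "\<bar>m j * (e' j \<bullet> a j)\<bar> <= (A * h) * (\<beta> * \<alpha>)"
  unfolding \<alpha>_def \<beta>_def using mass_bounds(1)[OF j] cur.mass_pos[OF j]
  by (intro abs_mult_le Cauchy_Schwarz_ineq2) auto
 then have "A * (m j * (e' j \<bullet> a j)) <= A * ((A * h) * (\<beta> * \<alpha>))"
  using A_ge0 by (intro mult_left_mono) auto
 also have "... = h * (\<beta> * (A^2 * \<alpha>))" by (simp add: power2_eq_square mult_ac)
 also have "... <= h * (3 / (16 * A) * \<beta>^2 + (A^2 * \<alpha>)^2 / (4 * (3 / (16 * A))))"
  using h A by (intro mult_left_mono young) auto
 also have "(A^2 * \<alpha>)^2 / (4 * (3 / (16 * A))) = 4 / 3 * (A ^ 5 * \<alpha>^2)"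
  using A by (simp add: power_def numeral_eq_Suc)
 finally have 2: "A * (m j * (e' j \<bullet> a j)) <= h * (3 / (16 * A) * \<beta>^2 + 4 / 3 * (A ^ 5 * \<alpha>^2))" .
 have "(m j - M j) * (X' j \<bullet> a j) <= h * (\<alpha> * (A * (\<epsilon> j + \<epsilon> (nxt N j)) / 2))"
  using mass_diff_inner[OF j X'[OF j], of "a j"] unfolding \<alpha>_def by linarith
 also have "... <= h * (A * ((\<epsilon> j)^2 + (\<epsilon> (nxt N j))^2 + \<alpha>^2))"
 proof (intro mult_left_mono)
  have "\<alpha> * (\<epsilon> j + \<epsilon> (nxt N j)) <= 1 / 2 * \<alpha>^2 + (\<epsilon> j + \<epsilon> (nxt N j))^2 / (4 * (1 / 2))" by (rule young) simp
  moreover have "p <= 2 * (v + u)"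
   if "p <= 1 / 2 * u + q / (4 * (1 / 2))" "q <= 2 * v" "0 <= u" "0 <= v" for p u q v :: real
   using that by simp
  ultimately have "\<alpha> * (\<epsilon> j + \<epsilon> (nxt N j)) <= 2 * (((\<epsilon> j)^2 + (\<epsilon> (nxt N j))^2) + \<alpha>^2)"
   using eps_sq[of j "nxt N j"] by (meson sum_power2_ge_zero zero_le_power2)
  from mult_left_mono[OF this A_ge0]
  show "\<alpha> * (A * (\<epsilon> j + \<epsilon> (nxt N j)) / 2) <= A * ((\<epsilon> j)^2 + (\<epsilon> (nxt N j))^2 + \<alpha>^2)"
   by (simp add: algebra_simps)
 qed (use h in simp)
 finally have "A * ((m j - M j) * (X' j \<bullet> a j)) <= A * (h * (A * ((\<epsilon> j)^2 + (\<epsilon> (nxt N j))^2 + \<alpha>^2)))"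
  using A_ge0 by (rule mult_left_mono)
 then have 3: "A * ((m j - M j) * (X' j \<bullet> a j)) <= h * (A^2 * ((\<epsilon> j)^2 + (\<epsilon> (nxt N j))^2 + \<alpha>^2))"
  by (simp add: power2_eq_square mult_ac)
 have "\<bar>r j \<bullet> a j\<bar> <= (A * h^2) * \<alpha>"
  unfolding \<alpha>_def by (intro abs_inner_le r j) simp
 then have "A * (r j \<bullet> a j) <= A * ((A * h^2) * \<alpha>)" using A_ge0 by (intro mult_left_mono) auto
 also have "... = h * (\<alpha> * (A^2 * h))" by (simp add: power2_eq_square mult_ac)
 also have "... <= h * (1 * \<alpha>^2 + (A^2 * h)^2 / (4 * 1))"
  using h by (intro mult_left_mono young) auto
 also have "(A^2 * h)^2 / (4 * 1) = 1 / 4 * (A ^ 4 * h^2)"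
  by (simp add: power_mult_distrib flip: power_mult)
 finally have 4: "A * (r j \<bullet> a j) <= h * (1 * \<alpha>^2 + 1 / 4 * (A ^ 4 * h^2))" .
 define E where "E = \<epsilon> j + \<epsilon> (nxt N j) + \<epsilon> (prv N j) + \<alpha> + \<alpha>p"
 have "(\<tau> j \<bullet> edge N a j)^2 <= (h * (3 * A^2 * E))^2"
  using power_mono[OF tangential_bound[OF j] abs_ge_zero, of 2] unfolding E_def \<alpha>_def \<alpha>p_def by simp
 also have "... = h * (h * (9 * (A ^ 4 * E^2)))"
  by (simp add: power_def numeral_eq_Suc mult_ac)
 finally have "(\<tau> j \<bullet> edge N a j)^2 / h <= h * (9 * (A ^ 4 * E^2))"
  using h by (simp add: field_simps)
 also have "... <= h * (9 * (A ^ 4 * (5 * s j)))"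
 proof (intro mult_left_mono)
  show "E^2 <= 5 * s j"
   using sq_sum5[of "\<epsilon> j" "\<epsilon> (nxt N j)" "\<epsilon> (prv N j)" \<alpha> \<alpha>p] s_ge(7)[of j]
   unfolding E_def \<alpha>_def \<alpha>p_def
   by (meson mult_left_mono order_trans zero_le_numeral)
 qed (use h A_ge0 in auto)
 finally have 5: "(\<tau> j \<bullet> edge N a j)^2 / h <= h * (45 * (A ^ 4 * s j))" by simp
 have lhs: "A * ((m j *\<^sub>R x' j - M j *\<^sub>R X' j) \<bullet> a j + lam / hh j * (edge N e j \<bullet> edge N a j)
   + r0 j \<bullet> edge N a j + r j \<bullet> a j
   - ((normal_proj (\<tau> j) (edge N Y j) /\<^sub>R l j - normal_proj (T j) (edge N Y j) /\<^sub>R L j)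
     + (cy j *\<^sub>R \<tau> j - c j *\<^sub>R T j)) \<bullet> edge N a j)
  = A * (R \<bullet> edge N a j) + A * (m j * (e' j \<bullet> a j)) + A * ((m j - M j) * (X' j \<bullet> a j)) + A * (r j \<bullet> a j)"
  unfolding mm R_def by (simp add: inner_diff_left inner_add_left distrib_left right_diff_distrib)
 have pw: "A ^ k * t <= A ^ 5 * (s j + h^2)" if "k <= 5" "t <= s j \<or> t <= h^2" "0 <= t" for k t
 proof (rule mult_mono[OF A_pow])
  show "t <= s j + h^2" using that(2) s_ge(8)[of j] zero_le_power2[of h] by linarith
 qed (use that A_ge0 in auto)
 have rest: "4 / 3 * (A ^ 5 * \<alpha>^2) + A^2 * ((\<epsilon> j)^2 + (\<epsilon> (nxt N j))^2 + \<alpha>^2) + (1 * \<alpha>^2 + 1 / 4 * (A ^ 4 * h^2))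
   + 45 * (A ^ 4 * s j) <= 50 * (A ^ 5 * (s j + h^2))"
 proof -
  have "A ^ 5 * \<alpha>^2 <= A ^ 5 * (s j + h^2)" "A^2 * ((\<epsilon> j)^2 + (\<epsilon> (nxt N j))^2 + \<alpha>^2) <= A ^ 5 * (s j + h^2)"
   "A ^ 0 * \<alpha>^2 <= A ^ 5 * (s j + h^2)" "A ^ 4 * h^2 <= A ^ 5 * (s j + h^2)" "A ^ 4 * s j <= A ^ 5 * (s j + h^2)"
   "A ^ 0 * 0 <= A ^ 5 * (s j + h^2)"
   using s_ge[of j] unfolding \<alpha>_def by (intro pw; simp)+
  then show ?thesis unfolding power_0 mult_1_left by linarith
 qed
 have "h * (1 / 4 * D^2 + 4 * A^2 * cR^2 * (s j + h^2)) + h * (3 / (16 * A) * \<beta>^2 + 4 / 3 * (A ^ 5 * \<alpha>^2))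
   + h * (A^2 * ((\<epsilon> j)^2 + (\<epsilon> (nxt N j))^2 + \<alpha>^2)) + h * (1 * \<alpha>^2 + 1 / 4 * (A ^ 4 * h^2)) + h * (45 * (A ^ 4 * s j))
  = h * (3 / (16 * A) * \<beta>^2 + 1 / 4 * D^2 + 4 * A^2 * cR^2 * (s j + h^2)
   + (4 / 3 * (A ^ 5 * \<alpha>^2) + A^2 * ((\<epsilon> j)^2 + (\<epsilon> (nxt N j))^2 + \<alpha>^2) + (1 * \<alpha>^2 + 1 / 4 * (A ^ 4 * h^2))
   + 45 * (A ^ 4 * s j)))"
  by (simp only: distrib_left ac_simps)
 also have "... <= h * (3 / (16 * A) * \<beta>^2 + 1 / 4 * D^2 + 4 * A^2 * cR^2 * (s j + h^2) + 50 * (A ^ 5 * (s j + h^2)))"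
  using h by (intro mult_left_mono add_left_mono rest) simp
 also have "... = h * (3 / (16 * A) * \<beta>^2 + 1 / 4 * D^2 + (4 * A^2 * cR^2 + 50 * A ^ 5) * (s j + h^2))"
  by (simp add: algebra_simps)
 finally show ?thesis unfolding lhs \<beta>_def[symmetric] D_def[symmetric] cR_def[symmetric]
  using 1 2 3 4 5 by linarith
qed

text \<open>Testing with the curvature error produces the normal part of its slopes, and
  \<open>tangential_bound\<close> adds the tangential part. A quarter of \<open>Z\<close> reappears
  on the right and is absorbed; the share 3 / (16 A) of \<open>Sd\<close> thereby grows to 1 / (4
  A), which still fits into the 3 / (4 A) of \<open>W'_bound\<close>.\<close>

lemma dissipation: "Z <= 1 / (4 * A) * Sd + diss_const A lam * (Sa + Se + S0 + h^2)"
proof -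
 let ?R = "%j. (normal_proj (\<tau> j) (edge N Y j) /\<^sub>R l j - normal_proj (T j) (edge N Y j) /\<^sub>R L j)
     + (cy j *\<^sub>R \<tau> j - c j *\<^sub>R T j)"
 let ?kz = "4 * A^2 * (6 * A ^ 4 + lam * A)^2 + 50 * A ^ 5"
 have split: "h * (norm (edge N a j) / h)^2 <= A * ((flux j - Flux j - ?R j) \<bullet> edge N a j)
   + (\<tau> j \<bullet> edge N a j)^2 / h" if j: "j \<in> idx N" for j
 proof -
  let ?P = "normal_proj (\<tau> j) (edge N a j)"
  have ea: "edge N y j - edge N Y j = edge N a j" by (simp add: edge_def a_def)
  have "flux j - Flux j - ?R j = ?P /\<^sub>R l j"
   unfolding flux_def Flux_def ea[symmetric] normal_proj_def
   by (simp add: algebra_simps inner_diff_right)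
  then have 1: "(flux j - Flux j - ?R j) \<bullet> edge N a j = (norm ?P)^2 / l j"
   using inner_normal_proj(1)[OF cur.norm_tan[OF j], of "edge N a j"] by (simp add: divide_inverse mult_ac)
  have "1 / h <= A * (1 / l j)" using l(2)[OF j] cur.len_pos[OF j] h by (simp add: field_simps)
  then have "1 / h * (norm ?P)^2 <= A * (1 / l j) * (norm ?P)^2" by (rule mult_right_mono) simp
  then have 2: "(norm ?P)^2 / h <= A * ((norm ?P)^2 / l j)" by simp
  have "h * (norm (edge N a j) / h)^2 = (norm (edge N a j))^2 / h"
   using h by (simp add: power_divide power2_eq_square)
  also have "... = (norm ?P)^2 / h + (\<tau> j \<bullet> edge N a j)^2 / h"
   using inner_normal_proj(2)[OF cur.norm_tan[OF j], of "edge N a j"] by (simp add: add_divide_distrib)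
  finally show ?thesis using 2 unfolding 1 by linarith
 qed
 have "Z <= (\<Sum>j\<in>idx N. A * ((flux j - Flux j - ?R j) \<bullet> edge N a j) + (\<tau> j \<bullet> edge N a j)^2 / h)"
  unfolding Z_def by (rule sum_mono[OF split])
 also have "... = A * (\<Sum>j\<in>idx N. (flux j - Flux j) \<bullet> edge N a j) - A * (\<Sum>j\<in>idx N. ?R j \<bullet> edge N a j)
   + (\<Sum>j\<in>idx N. (\<tau> j \<bullet> edge N a j)^2 / h)"
  by (simp only: inner_diff_left[of "flux _ - Flux _"] right_diff_distrib sum.distrib sum_subtractf sum_distrib_left)
 also have "... = (\<Sum>j\<in>idx N. A * ((m j *\<^sub>R x' j - M j *\<^sub>R X' j) \<bullet> a j + lam / hh j * (edge N e j \<bullet> edge N a j)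
   + r0 j \<bullet> edge N a j + r j \<bullet> a j - ?R j \<bullet> edge N a j) + (\<tau> j \<bullet> edge N a j)^2 / h)"
  unfolding tested_scheme
  by (simp only: distrib_left right_diff_distrib sum.distrib sum_subtractf sum_distrib_left)
 also have "... <= 3 / (16 * A) * Sd + 1 / 4 * Z + 3 * A * ?kz * (Sa + Se + S0 + h^2)"
  by (rule sum_bound[OF _ diss_terms]) (use A in auto)
 finally have "3 / 4 * Z <= 3 / (16 * A) * Sd + 3 * A * ?kz * (Sa + Se + S0 + h^2)" by simp
 then have "Z <= 4 / 3 * (3 / (16 * A) * Sd + 3 * A * ?kz * (Sa + Se + S0 + h^2))" by simp
 also have "... = 1 / (4 * A) * Sd + diss_const A lam * (Sa + Se + S0 + h^2)"
  unfolding diss_const_def using A by (simp add: field_simps)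
 finally show ?thesis .
qed

lemma energy_growth: "W' <= - 1 / (2 * A) * Sd + growth_const A lam * (Sa + Se + S0 + h^2)"
proof -
 have "- (3 / (4 * A)) * Sd + 1 / (4 * A) * Sd = - 1 / (2 * A) * Sd" using A by (simp add: field_simps)
 then show ?thesis
  using W'_bound dissipation unfolding growth_const_def distrib_right[of _ "diss_const A lam"] by linarith
qed

end

lemma coercivity_pos: "1 <= A ==> 0 < lam ==> 0 < coercivity A lam"
 by (simp add: coercivity_def)

lemma diss_const_nonneg: "1 <= A ==> 0 < lam ==> 0 <= diss_const A lam"
 by (simp add: diss_const_def)

lemma growth_const_nonneg: "1 <= A ==> 0 < lam ==> 0 <= growth_const A lam"
 unfolding growth_const_def by (intro add_nonneg_nonneg diss_const_nonneg) auto

section \<open>Gronwall's inequality and ordinary differential equations\<close>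

lemma gronwall:
 fixes W W' :: "real => real"
 assumes W: "!!t. t \<in> {0..t1} ==> (W has_real_derivative W' t) (at t within {0..t1})"
  and le: "!!t. t \<in> {0..t1} ==> W' t <= K * W t + b"
  and K: "0 <= K" and b: "0 <= b" and t: "t \<in> {0..t1}"
 shows "W t <= (W 0 + b * t) * exp (K * t)"
proof -
 define V where "V s = W s * exp (- K * s) - b * s" for s
 have cont: "continuous_on {0..t1} W"
  unfolding continuous_on_eq_continuous_within using W DERIV_continuous by blast
 have "V t <= V 0"
 proof (rule DERIV_nonpos_imp_decreasing_open[where f = V])
  show "0 <= t" using t by simp
  show "continuous_on {0..t} V"
   unfolding V_def using t by (intro continuous_intros continuous_on_subset[OF cont]) auto
  fix s assume s: "0 < s" "s < t"
  then have "(W has_real_derivative W' s) (at s)"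
   using W[of s] t at_within_interior[of s "{0..t1}"] by (simp add: interior_atLeastAtMost_real)
  then have "(V has_real_derivative (W' s - K * W s) * exp (- K * s) - b) (at s)"
   unfolding V_def by (auto intro!: derivative_eq_intros simp: algebra_simps)
  moreover have "(W' s - K * W s) * exp (- K * s) - b <= 0"
  proof -
   have "(W' s - K * W s) * exp (- K * s) <= b * exp (- K * s)"
    using le[of s] s t by (intro mult_right_mono) auto
   also have "... <= b * 1" using s K b by (intro mult_left_mono) (auto simp: mult_nonneg_nonneg)
   finally show ?thesis by simp
  qed
  ultimately show "\<exists>y. (V has_real_derivative y) (at s) & y <= 0" by blast
 qed
 then have "W t * exp (- K * t) <= W 0 + b * t" by (simp add: V_def)
 then have "W t * exp (- K * t) * exp (K * t) <= (W 0 + b * t) * exp (K * t)" by (rule mult_right_mono) simp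
 then show ?thesis by (simp add: mult.assoc exp_add[symmetric])
qed

text \<open>Lets bounded continuous functions serve as the state space in
  \<open>picard_lindeloef\<close>, as \<open>discrete_ode\<close> needs.\<close>

instance bcontfun :: (metric_space, banach) banach ..

lemma bounded_linear_apply_bcontfun: "bounded_linear (%f::'a::topological_space \<Rightarrow>\<^sub>C 'b::real_normed_vector. apply_bcontfun f t)"
 by (rule bounded_linear_intro[where K = 1]) (auto intro: norm_bounded)

text \<open>The contraction is with respect to the sup norm weighted by \<open>exp (- K * t)\<close>, so no subdivision
 of the time interval is needed.\<close>

lemma picard_lindeloef:
 fixes G :: "'e::banach => 'e"
 assumes lip: "!!a b. norm (G a - G b) <= L * norm (a - b)" and L: "0 <= L" and T: "0 <= T"
 shows "\<exists>x. x 0 = x0 & (\<forall>t\<in>{0..T}. (x has_vector_derivative G (x t)) (at t within {0..T}))"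
proof -
 \<comment> \<open>Twice the Lipschitz constant makes the contraction factor at most one half; the
   added 1 keeps \<open>K\<close> positive when \<open>L\<close> is zero.\<close>
 define K where "K = 2 * L + 1"
 have K: "0 < K" "L / K <= 1 / 2" using L by (auto simp: K_def field_simps)
 \<comment> \<open>Time clamped to the interval, so that the fixed point map acts on functions
   bounded and continuous on the whole line.\<close>
 define c where "c t = max 0 (min T t)" for t
 have c: "c t \<in> {0..T}" "continuous_on UNIV c" for t
  using T by (auto simp: c_def intro!: continuous_intros)
 have cid: "c t = t" if "t \<in> {0..T}" for t using that by (auto simp: c_def)
 have contG: "continuous_on UNIV G"
  by (rule lipschitz_on_continuous_on[of L], rule lipschitz_onI) (auto simp: dist_norm lip L)
 define g where "g f s = G (exp (K * s) *\<^sub>R f s)" for f :: "real => 'e" and s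
 have contg: "continuous_on S (g f)" if "continuous_on S f" for S f
  unfolding g_def by (rule continuous_on_compose2[OF contG]) (auto intro!: continuous_intros that)
 \<comment> \<open>The unknown is x multiplied by the exponential weight, so the plain sup norm of
   \<open>f\<close> is the weighted norm of x.\<close>
 define F where "F f t = exp (- K * c t) *\<^sub>R (x0 + integral {0..c t} (g f))" for f :: "real => 'e" and t
 have F_bcont: "F f \<in> bcontfun" if f: "continuous_on UNIV f" for f
 proof -
  have "continuous_on {0..T} (%t. integral {0..t} (g f))"
   by (rule indefinite_integral_continuous_1, rule integrable_continuous_real, rule contg,
     rule continuous_on_subset[OF f]) simp
  then have 1: "continuous_on {0..T} (%t. exp (- K * t) *\<^sub>R (x0 + integral {0..t} (g f)))"
   by (intro continuous_intros)
  have "range (F f) \<subseteq> (%t. exp (- K * t) *\<^sub>R (x0 + integral {0..t} (g f))) ` {0..T}"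
   using c(1) by (auto simp: F_def)
  then have "bounded (range (F f))"
   using compact_imp_bounded[OF compact_continuous_image[OF 1]] by (meson bounded_subset compact_Icc)
  moreover have "continuous_on UNIV (F f)"
   unfolding F_def by (rule continuous_on_compose2[OF 1 c(2)]) (use c in auto)
  ultimately show ?thesis by (simp add: bcontfun_def)
 qed
 define \<Phi> where "\<Phi> f = Bcontfun (F (apply_bcontfun f))" for f
 have \<Phi>: "apply_bcontfun (\<Phi> f) = F (apply_bcontfun f)" for f
  unfolding \<Phi>_def by (rule Bcontfun_inverse[OF F_bcont]) simp
 have contr: "dist (\<Phi> f) (\<Phi> f') <= 1 / 2 * dist f f'" for f f'
 proof (rule dist_bound)
  fix t
  define d where "d = dist f f'"
  have ig: "(g (apply_bcontfun f)) integrable_on {0..c t}" "(g (apply_bcontfun f')) integrable_on {0..c t}"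
   by (rule integrable_continuous_real, rule contg, simp)+
  have ei: "((%s. L * d * exp (K * s)) has_integral (L * d * exp (K * c t) / K - L * d * exp (K * 0) / K)) {0..c t}"
   using K c(1)[of t] by (intro fundamental_theorem_of_calculus)
    (auto intro!: derivative_eq_intros simp: has_real_derivative_iff_has_vector_derivative[symmetric])
  have "norm (integral {0..c t} (%s. g (apply_bcontfun f) s - g (apply_bcontfun f') s))
    <= integral {0..c t} (%s. L * d * exp (K * s))"
  proof (rule integral_norm_bound_integral)
   show "(%s. g (apply_bcontfun f) s - g (apply_bcontfun f') s) integrable_on {0..c t}"
    by (intro integrable_diff ig)
   show "(%s. L * d * exp (K * s)) integrable_on {0..c t}" using ei by blast
   fix s
   have "norm (g (apply_bcontfun f) s - g (apply_bcontfun f') s) <= L * norm (exp (K * s) *\<^sub>R f s - exp (K * s) *\<^sub>R f' s)"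
    unfolding g_def by (rule lip)
   also have "... = L * (exp (K * s) * dist (f s) (f' s))"
    by (simp add: dist_norm flip: scaleR_diff_right)
   also have "... <= L * (exp (K * s) * d)"
    unfolding d_def by (intro mult_left_mono dist_bounded L) simp
   finally show "norm (g (apply_bcontfun f) s - g (apply_bcontfun f') s) <= L * d * exp (K * s)"
    by (simp add: mult_ac)
  qed
  also have "... = L * d * exp (K * c t) / K - L * d * exp (K * 0) / K"
   using ei by (rule integral_unique)
  also have "... <= L * d * exp (K * c t) / K" using L K by (simp add: d_def)
  finally have "norm (integral {0..c t} (g (apply_bcontfun f)) - integral {0..c t} (g (apply_bcontfun f')))
    <= L / K * d * exp (K * c t)"
   using ig by (simp add: integral_diff mult_ac)
  then have "exp (- K * c t) * norm (integral {0..c t} (g (apply_bcontfun f)) - integral {0..c t} (g (apply_bcontfun f')))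
    <= exp (- K * c t) * (L / K * d * exp (K * c t))" by (rule mult_left_mono) simp
  also have "... = L / K * d" by (simp add: exp_minus field_simps)
  also have "... <= 1 / 2 * d" using K by (intro mult_right_mono) (auto simp: d_def)
  finally show "dist (apply_bcontfun (\<Phi> f) t) (apply_bcontfun (\<Phi> f') t) <= 1 / 2 * dist f f'"
   unfolding \<Phi> F_def dist_norm d_def scaleR_diff_right[symmetric] by simp
 qed
 obtain f where f: "\<Phi> f = f" using banach_fix_type[of "1 / 2" \<Phi>] contr by auto
 define x where "x t = exp (K * t) *\<^sub>R apply_bcontfun f t" for t
 have x: "x t = x0 + integral {0..t} (%s. G (x s))" if t: "t \<in> {0..T}" for t
 proof -
  have "apply_bcontfun f t = F (apply_bcontfun f) t" using f \<Phi> by metis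
  then have "x t = (exp (K * t) * exp (- K * t)) *\<^sub>R (x0 + integral {0..t} (g (apply_bcontfun f)))"
   unfolding x_def F_def cid[OF t] by simp
  moreover have "g (apply_bcontfun f) = (%s. G (x s))" by (simp add: fun_eq_iff g_def x_def)
  ultimately show ?thesis by (simp add: exp_add[symmetric])
 qed
 have cx: "continuous_on {0..T} (%s. G (x s))"
  unfolding x_def by (rule continuous_on_compose2[OF contG]) (auto intro!: continuous_intros)
 have "(x has_vector_derivative G (x t)) (at t within {0..T})" if t: "t \<in> {0..T}" for t
 proof (rule has_vector_derivative_transform[OF t])
  show "x s = x0 + integral {0..s} (%s. G (x s))" if "s \<in> {0..T}" for s
   by (rule x[OF that])
  show "((%s. x0 + integral {0..s} (%s. G (x s))) has_vector_derivative G (x t)) (at t within {0..T})"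
   using integral_has_vector_derivative[OF cx t] by (auto intro!: derivative_eq_intros)
 qed
 moreover have "x 0 = x0" using x[of 0] T by simp
 ultimately show ?thesis by blast
qed

text \<open>\<open>picard_lindeloef\<close> wants a Banach space. A nodal field is encoded as the
  bounded continuous function \<open>R\<close> that places a hat of half-width one at each integer;
  the field is transported by evaluation at the integers, and the solution is read off there. The
  Lipschitz constant picks up powers of \<open>N\<close>, which is harmless because only existence
  is concluded.\<close>

lemma discrete_ode:
 fixes G :: "(nat => 'a::banach) => nat => 'a"
 assumes lip: "!!a b j. j \<in> idx N ==> norm (G a j - G b j) <= L * (\<Sum>i\<in>idx N. norm (a i - b i))"
  and L: "0 <= L" and T: "0 <= T"
 shows "\<exists>x. (\<forall>j\<in>idx N. x 0 j = x0 j) &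
  (\<forall>t\<in>{0..T}. \<forall>j\<in>idx N. ((%s. x s j) has_vector_derivative G (x t) j) (at t within {0..T}))"
proof -
 define R where "R z r = (\<Sum>j\<in>idx N. max 0 (1 - \<bar>r - real j\<bar>) *\<^sub>R z j)" for z :: "nat => 'a" and r
 have hat: "0 <= max 0 (1 - \<bar>r\<bar>)" "max 0 (1 - \<bar>r\<bar>) <= 1" for r :: real by auto
 have R_le: "norm (R z r) <= (\<Sum>j\<in>idx N. norm (z j))" for z r
  unfolding R_def
 proof (rule sum_norm_le)
  fix j
  show "norm (max 0 (1 - \<bar>r - real j\<bar>) *\<^sub>R z j) <= norm (z j)"
   using mult_right_mono[OF hat(2)[of "r - real j"], of "norm (z j)"] by simp
 qed
 have R_apply: "apply_bcontfun (Bcontfun (R z)) = R z" for z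
 proof (rule Bcontfun_inverse, rule bcontfun_normI[OF _ R_le])
  show "continuous_on UNIV (R z)" unfolding R_def by (intro continuous_intros)
 qed
 have R_node: "R z (real j) = z j" if "j \<in> idx N" for z j
 proof -
  have "max 0 (1 - \<bar>real j - real i\<bar>) *\<^sub>R z i = (if i = j then z j else 0)" for i
  proof (cases i j rule: linorder_cases)
   case less
   then have "real i + 1 <= real j" by linarith
   then show ?thesis using less by simp
  next
   case greater
   then have "real j + 1 <= real i" by linarith
   then show ?thesis using greater by simp
  qed simp
  then show ?thesis using that by (simp add: R_def)
 qed
 define H where "H f = Bcontfun (R (G (%i. apply_bcontfun f (real i))))" for f :: "real \<Rightarrow>\<^sub>C 'a"
 have "norm (H f - H f') <= (N * (L * N)) * norm (f - f')" for f f'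
 proof (rule norm_bound)
  fix r
  let ?G = "%f. G (%i. apply_bcontfun f (real i))"
  have "apply_bcontfun (H f - H f') r = R (%j. ?G f j - ?G f' j) r"
   by (simp add: H_def R_apply) (simp add: R_def sum_subtractf scaleR_diff_right)
  then have "norm (apply_bcontfun (H f - H f') r) <= (\<Sum>j\<in>idx N. norm (?G f j - ?G f' j))"
   by (simp only: R_le)
  also have "... <= (\<Sum>j\<in>idx N. (L * N) * norm (f - f'))"
  proof (rule sum_mono)
   fix j assume j: "j \<in> idx N"
   have "norm (?G f j - ?G f' j) <= L * (\<Sum>i\<in>idx N. norm (f (real i) - f' (real i)))" by (rule lip[OF j])
   also have "... <= L * (\<Sum>i\<in>idx N. norm (f - f'))"
    by (intro mult_left_mono sum_mono L norm_bounded[of "f - f'", unfolded minus_bcontfun.rep_eq])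
   finally show "norm (?G f j - ?G f' j) <= (L * N) * norm (f - f')" by (simp add: idx_def)
  qed
  finally show "norm (apply_bcontfun (H f - H f') r) <= (N * (L * N)) * norm (f - f')"
   by (simp add: idx_def)
 qed
 from picard_lindeloef[of H, OF this _ T, of "Bcontfun (R x0)"]
 obtain x where x: "x 0 = Bcontfun (R x0)"
  "!!t. t \<in> {0..T} ==> (x has_vector_derivative H (x t)) (at t within {0..T})"
  using L by auto
 have "((%s. apply_bcontfun (x s) (real j)) has_vector_derivative G (%i. apply_bcontfun (x t) (real i)) j) (at t within {0..T})"
  if "t \<in> {0..T}" "j \<in> idx N" for t j
  using bounded_linear.has_vector_derivative[OF bounded_linear_apply_bcontfun x(2)[OF that(1)], of "real j"]
   R_node[OF that(2)]
  by (simp add: H_def R_apply)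
 moreover have "apply_bcontfun (x 0) (real j) = x0 j" if "j \<in> idx N" for j
  using R_node[OF that] by (simp add: x(1) R_apply)
 ultimately show ?thesis by (intro exI[of _ "%t i. apply_bcontfun (x t) (real i)"]) auto
qed

text \<open>Gronwall without inhomogeneity for the sum of the squared differences.\<close>

lemma discrete_ode_unique:
 fixes G :: "(nat => 'a::real_inner) => nat => 'a"
 assumes lip: "!!a b j. j \<in> idx N ==> norm (G a j - G b j) <= L * (\<Sum>i\<in>idx N. norm (a i - b i))"
  and L: "0 <= L"
  and x: "!!t j. t \<in> {0..T} ==> j \<in> idx N ==> ((%s. x s j) has_vector_derivative G (x t) j) (at t within {0..T})"
  and z: "!!t j. t \<in> {0..T} ==> j \<in> idx N ==> ((%s. z s j) has_vector_derivative G (z t) j) (at t within {0..T})"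
  and init: "!!j. j \<in> idx N ==> x 0 j = z 0 j"
  and t: "t \<in> {0..T}" and j: "j \<in> idx N"
 shows "x t j = z t j"
proof -
 define D where "D s = (\<Sum>i\<in>idx N. (x s i - z s i) \<bullet> (x s i - z s i))" for s
 define D' where "D' s = (\<Sum>i\<in>idx N. 2 * ((x s i - z s i) \<bullet> (G (x s) i - G (z s) i)))" for s
 have der: "(D has_real_derivative D' s) (at s within {0..T})" if s: "s \<in> {0..T}" for s
  unfolding D_def D'_def has_real_derivative_iff_has_vector_derivative
 proof (rule has_vector_derivative_sum)
  fix i assume i: "i \<in> idx N"
  have "((%s. x s i - z s i) has_vector_derivative G (x s) i - G (z s) i) (at s within {0..T})"
   by (rule has_vector_derivative_diff[OF x[OF s i] z[OF s i]])
  from bounded_bilinear.has_vector_derivative[OF bounded_bilinear_inner this this]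
  show "((%s. (x s i - z s i) \<bullet> (x s i - z s i)) has_vector_derivative
    2 * ((x s i - z s i) \<bullet> (G (x s) i - G (z s) i))) (at s within {0..T})"
   by (simp add: inner_commute)
 qed
 have le: "D' s <= 2 * L * N * D s + 0" if s: "s \<in> {0..T}" for s
 proof -
  define S where "S = (\<Sum>i\<in>idx N. norm (x s i - z s i))"
  have "D' s <= (\<Sum>i\<in>idx N. 2 * (norm (x s i - z s i) * (L * S)))"
   unfolding D'_def S_def
  proof (intro sum_mono mult_left_mono)
   fix i assume i: "i \<in> idx N"
   have "(x s i - z s i) \<bullet> (G (x s) i - G (z s) i) <= norm (x s i - z s i) * norm (G (x s) i - G (z s) i)"
    by (rule norm_cauchy_schwarz)
   also have "... <= norm (x s i - z s i) * (L * (\<Sum>i\<in>idx N. norm (x s i - z s i)))"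
    by (intro mult_left_mono lip i) simp
   finally show "(x s i - z s i) \<bullet> (G (x s) i - G (z s) i) <= norm (x s i - z s i) * (L * (\<Sum>i\<in>idx N. norm (x s i - z s i)))" .
  qed simp
  also have "... = 2 * L * S^2"
   unfolding sum_distrib_left[symmetric] sum_distrib_right[symmetric] S_def[symmetric]
   by (simp add: power2_eq_square)
  also have "... <= 2 * L * (N * D s)"
  proof (intro mult_left_mono)
   have "S^2 = (\<Sum>i\<in>idx N. 1 * norm (x s i - z s i))^2" by (simp add: S_def)
   also have "... <= (\<Sum>i\<in>idx N. 1^2) * (\<Sum>i\<in>idx N. (norm (x s i - z s i))^2)"
    by (rule Cauchy_Schwarz_ineq_sum)
   finally show "S^2 <= N * D s" by (simp add: D_def power2_norm_eq_inner idx_def)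
  qed (use L in simp)
  finally show ?thesis by simp
 qed
 have "D t <= (D 0 + 0 * t) * exp (2 * L * N * t)"
  by (rule gronwall[OF der le]) (use L t in auto)
 moreover have "D 0 = 0" by (simp add: D_def init)
 ultimately have "D t <= 0" by simp
 moreover have "(x t j - z t j) \<bullet> (x t j - z t j) <= D t"
  unfolding D_def by (rule member_le_sum[OF j]) auto
 ultimately have "(x t j - z t j) \<bullet> (x t j - z t j) <= 0" by linarith
 then show ?thesis using inner_gt_zero_iff[of "x t j - z t j"] by (auto simp: not_less[symmetric])
qed

section \<open>Geometry of a polygon as a function of its nodes\<close>

definition ptang :: "nat => (nat => 'a::real_inner) => nat => 'a" where
 "ptang N z j = edge N z j /\<^sub>R norm (edge N z j)"
definition pmass :: "nat => (nat => 'a::real_inner) => nat => real" where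
 "pmass N z j = (norm (edge N z j) + norm (edge N z (nxt N j))) / 2"
definition pcurv :: "nat => (nat => 'a::real_inner) => nat => 'a" where
 "pcurv N z j = (ptang N z (nxt N j) - ptang N z j) /\<^sub>R pmass N z j"
definition pflux :: "nat => real => (nat => real) => (nat => 'a::real_inner) => nat => 'a" where
 "pflux N lam hh z j = normal_proj (ptang N z j) (edge N (pcurv N z) j) /\<^sub>R norm (edge N z j)
   + (((norm (pcurv N z j))^2 + (norm (pcurv N z (prv N j)))^2) / 4) *\<^sub>R ptang N z j
   - (lam / hh j) *\<^sub>R edge N z j"

definition len_d :: "nat => (nat => 'a::real_inner) => (nat => 'a) => nat => real" where
 "len_d N z z' j = ptang N z j \<bullet> edge N z' j"
definition tang_d :: "nat => (nat => 'a::real_inner) => (nat => 'a) => nat => 'a" where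
 "tang_d N z z' j = (edge N z' j - len_d N z z' j *\<^sub>R ptang N z j) /\<^sub>R norm (edge N z j)"
definition mass_d :: "nat => (nat => 'a::real_inner) => (nat => 'a) => nat => real" where
 "mass_d N z z' j = (len_d N z z' j + len_d N z z' (nxt N j)) / 2"
definition curv_d :: "nat => (nat => 'a::real_inner) => (nat => 'a) => nat => 'a" where
 "curv_d N z z' j = (tang_d N z z' (nxt N j) - tang_d N z z' j - mass_d N z z' j *\<^sub>R pcurv N z j)
   /\<^sub>R pmass N z j"

text \<open>\<open>z'\<close> is arbitrary here: the dashed quantities are the directional
  derivatives of the geometry along it.\<close>

lemma polygonI:
 assumes "!!j. j \<in> idx N ==> edge N z j ~= 0"
 shows "polygon N z z' (%j. norm (edge N z j)) (pmass N z) (ptang N z) (pcurv N z)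
  (len_d N z z') (mass_d N z z') (tang_d N z z') (curv_d N z z')"
proof
 fix j assume j: "j \<in> idx N"
 have e: "edge N z j ~= 0" using assms[OF j] .
 have m: "pmass N z j ~= 0"
  using e unfolding pmass_def by (metis add_nonneg_eq_0_iff divide_eq_0_iff norm_eq_zero norm_ge_zero zero_neq_numeral)
 show "edge N z j = norm (edge N z j) *\<^sub>R ptang N z j" "0 < norm (edge N z j)" "norm (ptang N z j) = 1"
  using e by (auto simp: ptang_def)
 show "pmass N z j = (norm (edge N z j) + norm (edge N z (nxt N j))) / 2" by (simp add: pmass_def)
 show "pmass N z j *\<^sub>R pcurv N z j = ptang N z (nxt N j) - ptang N z j" using m by (simp add: pcurv_def)
 show "len_d N z z' j = ptang N z j \<bullet> edge N z' j" by (simp add: len_d_def)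
 show "norm (edge N z j) *\<^sub>R tang_d N z z' j = edge N z' j - len_d N z z' j *\<^sub>R ptang N z j"
  using e by (simp add: tang_d_def)
 show "mass_d N z z' j = (len_d N z z' j + len_d N z z' (nxt N j)) / 2" by (simp add: mass_d_def)
 show "mass_d N z z' j *\<^sub>R pcurv N z j + pmass N z j *\<^sub>R curv_d N z z' j = tang_d N z z' (nxt N j) - tang_d N z z' j"
  using m by (simp add: curv_d_def)
qed

lemma has_vector_derivative_norm:
 fixes f :: "real => 'a::real_inner"
 assumes f: "(f has_vector_derivative f') (at t within S)" and nz: "f t ~= 0"
 shows "((%s. norm (f s)) has_vector_derivative (f t /\<^sub>R norm (f t)) \<bullet> f') (at t within S)"
proof -
 have "(f has_derivative (%h. h *\<^sub>R f')) (at t within S)" using f by (simp add: has_vector_derivative_def)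
 from has_derivative_compose[OF this has_derivative_norm[OF nz]]
 show ?thesis
  unfolding has_vector_derivative_def o_def
  by (rule has_derivative_eq_rhs) (auto simp: sgn_div_norm inner_commute)
qed

lemma has_vector_derivative_inverse_scaleR:
 fixes f :: "real => 'a::real_normed_vector" and g :: "real => real"
 assumes f: "(f has_vector_derivative f') (at t within S)" and g: "(g has_vector_derivative g') (at t within S)"
  and nz: "g t ~= 0"
 shows "((%s. f s /\<^sub>R g s) has_vector_derivative (f' - g' *\<^sub>R (f t /\<^sub>R g t)) /\<^sub>R g t) (at t within S)"
proof -
 have "((%s. inverse (g s)) has_real_derivative - (inverse (g t) * g' * inverse (g t))) (at t within S)"
  by (rule DERIV_inverse'[OF g[folded has_real_derivative_iff_has_vector_derivative] nz])
 from has_vector_derivative_scaleR[OF this f] show ?thesis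
  by (rule has_vector_derivative_eq_rhs) (simp add: algebra_simps)
qed

lemma edge_has_vector_derivative:
 assumes "!!j. j \<in> idx N ==> ((%s. z s j) has_vector_derivative z' j) (at t within S)" and "j \<in> idx N"
 shows "((%s. edge N (z s) j) has_vector_derivative edge N z' j) (at t within S)"
 unfolding edge_def using assms by (intro has_vector_derivative_diff) auto

context
 fixes N :: nat and z :: "real => nat => 'a::real_inner" and z' t S
 assumes z': "!!j. j \<in> idx N ==> ((%s. z s j) has_vector_derivative z' j) (at t within S)"
  and nz: "!!j. j \<in> idx N ==> edge N (z t) j ~= 0"
begin

lemma len_has_vector_derivative:
 "j \<in> idx N ==> ((%s. norm (edge N (z s) j)) has_vector_derivative len_d N (z t) z' j) (at t within S)"
 unfolding len_d_def ptang_def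
 by (rule has_vector_derivative_norm[OF edge_has_vector_derivative[OF z'] nz])

lemma ptang_has_vector_derivative:
 "j \<in> idx N ==> ((%s. ptang N (z s) j) has_vector_derivative tang_d N (z t) z' j) (at t within S)"
 unfolding ptang_def tang_d_def
 by (rule has_vector_derivative_inverse_scaleR[OF edge_has_vector_derivative[OF z'] len_has_vector_derivative])
  (auto simp: nz)

lemma pmass_has_vector_derivative:
 "j \<in> idx N ==> ((%s. pmass N (z s) j) has_vector_derivative mass_d N (z t) z' j) (at t within S)"
proof -
 assume j: "j \<in> idx N"
 have "((%s. norm (edge N (z s) j) + norm (edge N (z s) (nxt N j))) has_vector_derivative
   len_d N (z t) z' j + len_d N (z t) z' (nxt N j)) (at t within S)"
  using j by (intro has_vector_derivative_add len_has_vector_derivative) auto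
 from has_vector_derivative_divide[OF this, of 2] show ?thesis
  unfolding pmass_def mass_d_def .
qed

lemma pcurv_has_vector_derivative:
 "j \<in> idx N ==> ((%s. pcurv N (z s) j) has_vector_derivative curv_d N (z t) z' j) (at t within S)"
 unfolding pcurv_def curv_d_def
 using polygon.mass_pos[OF polygonI[of N "z t" z']] nz
 by (intro has_vector_derivative_inverse_scaleR has_vector_derivative_diff ptang_has_vector_derivative
   pmass_has_vector_derivative) force+

end

section \<open>The truncated scheme\<close>

text \<open>Lengths are truncated from below in denominators and from above in the unbounded term, which makes
 the right hand side globally Lipschitz. Nothing changes as long as all edge lengths lie
 in \<open>[p, q]\<close>.\<close>

definition clen :: "real => nat => (nat => 'a::real_inner) => nat => real" where
 "clen p N z j = max p (norm (edge N z j))"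
definition ctang :: "real => nat => (nat => 'a::real_inner) => nat => 'a" where
 "ctang p N z j = edge N z j /\<^sub>R clen p N z j"
definition cmass :: "real => nat => (nat => 'a::real_inner) => nat => real" where
 "cmass p N z j = (clen p N z j + clen p N z (nxt N j)) / 2"
definition ccurv :: "real => nat => (nat => 'a::real_inner) => nat => 'a" where
 "ccurv p N z j = (ctang p N z (nxt N j) - ctang p N z j) /\<^sub>R cmass p N z j"
text \<open>The last term is written as a truncated length times a truncated tangent, so that both
  factors are bounded. Squared norms appear as inner products, to which the rule for bounded
  bilinear maps applies.\<close>

definition cflux :: "real => real => nat => real => (nat => real) => (nat => 'a::real_inner) => nat => 'a" where
 "cflux p q N lam hh z j = normal_proj (ctang p N z j) (edge N (ccurv p N z) j) /\<^sub>R clen p N z j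
   + ((ccurv p N z j \<bullet> ccurv p N z j + ccurv p N z (prv N j) \<bullet> ccurv p N z (prv N j)) / 4) *\<^sub>R ctang p N z j
   - (lam / hh j * min q (norm (edge N z j))) *\<^sub>R ctang p N z j"
definition cfield :: "real => real => nat => real => (nat => real) => (nat => 'a::real_inner) => nat => 'a" where
 "cfield p q N lam hh z j = (cflux p q N lam hh z j - cflux p q N lam hh z (nxt N j)) /\<^sub>R cmass p N z j"

lemma cutoff_inactive:
 assumes "!!j. j \<in> idx N ==> p <= norm (edge N z j) & norm (edge N z j) <= q" and p: "0 < p" and j: "j \<in> idx N"
 shows "ccurv p N z j = pcurv N z j" "cmass p N z j = pmass N z j"
  "cfield p q N lam hh z j = (pflux N lam hh z j - pflux N lam hh z (nxt N j)) /\<^sub>R pmass N z j"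
proof -
 have 1: "clen p N z i = norm (edge N z i)" "ctang p N z i = ptang N z i" if "i \<in> idx N" for i
  using assms(1)[OF that] by (auto simp: clen_def ctang_def ptang_def max_def)
 show m: "cmass p N z j = pmass N z j" using j by (simp add: cmass_def pmass_def 1)
 have m': "cmass p N z i = pmass N z i" if "i \<in> idx N" for i using that by (simp add: cmass_def pmass_def 1)
 have c: "ccurv p N z i = pcurv N z i" if "i \<in> idx N" for i
  using that by (simp add: ccurv_def pcurv_def 1 m')
 then show "ccurv p N z j = pcurv N z j" using j by blast
 have f: "cflux p q N lam hh z i = pflux N lam hh z i" if i: "i \<in> idx N" for i
 proof -
  have e: "edge N (ccurv p N z) i = edge N (pcurv N z) i" using i by (simp add: edge_def c)
  have m: "min q (norm (edge N z i)) = norm (edge N z i)" using assms(1)[OF i] by auto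
  have "norm (edge N z i) ~= 0" using assms(1)[OF i] p by linarith
  then have "norm (edge N z i) *\<^sub>R ptang N z i = edge N z i" by (simp add: ptang_def)
  then have l: "(lam / hh i * norm (edge N z i)) *\<^sub>R ptang N z i = (lam / hh i) *\<^sub>R edge N z i"
   by (metis scaleR_scaleR)
  show ?thesis unfolding cflux_def pflux_def e m 1[OF i] l using i by (simp add: c power2_norm_eq_inner)
 qed
 show "cfield p q N lam hh z j = (pflux N lam hh z j - pflux N lam hh z (nxt N j)) /\<^sub>R pmass N z j"
  using j by (simp add: cfield_def m f)
qed

definition lip_nodal :: "nat => ((nat => 'a::real_normed_vector) => 'b::real_normed_vector) => bool" where
 "lip_nodal N f \<longleftrightarrow> (\<exists>L\<ge>0. \<forall>a b. norm (f a - f b) <= L * (\<Sum>i\<in>idx N. norm (a i - b i)))"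

text \<open>Lipschitz functions are not closed under products. Together with boundedness they are,
  and the truncated scheme is built from such functions by sums, products and reciprocals.\<close>

definition blip_nodal :: "nat => ((nat => 'a::real_normed_vector) => 'b::real_normed_vector) => bool" where
 "blip_nodal N f \<longleftrightarrow> lip_nodal N f & (\<exists>B\<ge>0. \<forall>a. norm (f a) <= B)"

lemma blip_imp_lip: "blip_nodal N f ==> lip_nodal N f"
 by (simp add: blip_nodal_def)

lemma lip_nodal_add:
 assumes "lip_nodal N f" "lip_nodal N g" shows "lip_nodal N (%a. f a + g a)"
proof -
 obtain L M where L: "L \<ge> 0" "!!a b. norm (f a - f b) <= L * (\<Sum>i\<in>idx N. norm (a i - b i))"
  and M: "M \<ge> 0" "!!a b. norm (g a - g b) <= M * (\<Sum>i\<in>idx N. norm (a i - b i))"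
  using assms unfolding lip_nodal_def by auto
 show ?thesis unfolding lip_nodal_def
 proof (intro exI[of _ "L + M"] conjI allI)
  show "0 <= L + M" using L M by simp
  fix a b
  have "norm (f a + g a - (f b + g b)) <= norm (f a - f b) + norm (g a - g b)"
   by (metis add_diff_add norm_triangle_ineq)
  then show "norm (f a + g a - (f b + g b)) <= (L + M) * (\<Sum>i\<in>idx N. norm (a i - b i))"
   using L(2)[of a b] M(2)[of a b] by (simp add: distrib_right)
 qed
qed

lemma lip_nodal_uminus: "lip_nodal N f ==> lip_nodal N (%a. - f a)"
 unfolding lip_nodal_def by (simp add: norm_minus_commute)

lemma blip_nodalI: "lip_nodal N f ==> (!!a. norm (f a) <= B) ==> 0 <= B ==> blip_nodal N f"
 unfolding blip_nodal_def by blast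

lemma blip_nodal_add: assumes "blip_nodal N f" "blip_nodal N g" shows "blip_nodal N (%a. f a + g a)"
proof -
 obtain B C where B: "B \<ge> 0" "!!a. norm (f a) <= B" and C: "C \<ge> 0" "!!a. norm (g a) <= C"
  using assms unfolding blip_nodal_def by auto
 show ?thesis
  by (rule blip_nodalI[of _ _ "B + C"]) (use assms B C in \<open>auto intro: lip_nodal_add blip_imp_lip norm_triangle_le add_mono\<close>)
qed

lemma blip_nodal_uminus: assumes "blip_nodal N f" shows "blip_nodal N (%a. - f a)"
proof -
 obtain B where B: "B \<ge> 0" "!!a. norm (f a) <= B"
  using assms unfolding blip_nodal_def by auto
 show ?thesis
  by (rule blip_nodalI[of _ _ B]) (use assms B in \<open>auto intro: lip_nodal_uminus blip_imp_lip\<close>)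
qed

lemma blip_nodal_diff: "blip_nodal N f ==> blip_nodal N g ==> blip_nodal N (%a. f a - g a)"
 using blip_nodal_add[of N f "%a. - g a"] blip_nodal_uminus[of N g] by simp

lemma blip_nodal_prod:
 fixes f :: "(nat => 'a::real_normed_vector) => 'b::real_normed_vector"
  and g :: "(nat => 'a) => 'c::real_normed_vector" and prd :: "'b => 'c => 'd::real_normed_vector"
 assumes bl: "bounded_bilinear prd" and "blip_nodal N f" "blip_nodal N g"
 shows "blip_nodal N (%a. prd (f a) (g a))"
proof -
 obtain K where K: "K > 0" "!!u v. norm (prd u v) <= norm u * norm v * K"
  using bounded_bilinear.pos_bounded[OF bl] by blast
 obtain L B M C where L: "L \<ge> 0" "!!a b. norm (f a - f b) <= L * (\<Sum>i\<in>idx N. norm (a i - b i))"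
  and M: "M \<ge> 0" "!!a b. norm (g a - g b) <= M * (\<Sum>i\<in>idx N. norm (a i - b i))"
  and B: "B \<ge> 0" "!!a. norm (f a) <= B" and C: "C \<ge> 0" "!!a. norm (g a) <= C"
  using assms(2,3) unfolding lip_nodal_def blip_nodal_def by auto
 have "lip_nodal N (%a. prd (f a) (g a))" unfolding lip_nodal_def
 proof (intro exI[of _ "(B * M + L * C) * K"] conjI allI)
  show "0 <= (B * M + L * C) * K" using L M B C K by simp
  fix a b :: "nat => 'a"
  let ?s = "\<Sum>i\<in>idx N. norm (a i - b i)"
  have s: "0 <= ?s" by (simp add: sum_nonneg)
  have "prd (f a) (g a) - prd (f b) (g b) = prd (f a) (g a - g b) + prd (f a - f b) (g b)"
   by (simp add: bounded_bilinear.diff_left[OF bl] bounded_bilinear.diff_right[OF bl])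
  also have "norm ... <= norm (f a) * norm (g a - g b) * K + norm (f a - f b) * norm (g b) * K"
   by (intro order_trans[OF norm_triangle_ineq] add_mono K)
  also have "... <= B * (M * ?s) * K + L * ?s * C * K"
   using L M B C K s by (intro add_mono mult_right_mono mult_mono) auto
  finally show "norm (prd (f a) (g a) - prd (f b) (g b)) <= (B * M + L * C) * K * ?s"
   by (simp add: algebra_simps)
 qed
 moreover have "norm (prd (f a) (g a)) <= B * C * K" for a
  by (rule order_trans[OF K(2)]) (use B C K in \<open>intro mult_right_mono mult_mono; auto\<close>)
 ultimately show ?thesis
  by (rule blip_nodalI) (use B C K in simp)
qed

lemma blip_nodal_const: "blip_nodal N (%a. c)"
 by (rule blip_nodalI[of _ _ "norm c"]) (auto simp: lip_nodal_def intro!: exI[of _ 0])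

lemma blip_nodal_inverse:
 fixes f :: "(nat => 'a::real_normed_vector) => real"
 assumes "lip_nodal N f" and p: "0 < p" and f: "!!a. p <= f a"
 shows "blip_nodal N (%a. inverse (f a))"
proof -
 obtain L where L: "L \<ge> 0" "!!a b. norm (f a - f b) <= L * (\<Sum>i\<in>idx N. norm (a i - b i))"
  using assms(1) unfolding lip_nodal_def by auto
 have inv: "\<bar>inverse (f a)\<bar> <= inverse p" for a
  using f[of a] p by (simp add: le_imp_inverse_le)
 have "lip_nodal N (%a. inverse (f a))" unfolding lip_nodal_def
 proof (intro exI[of _ "inverse p * (L * inverse p)"] conjI allI)
  show "0 <= inverse p * (L * inverse p)" using L p by simp
  fix a b
  have nz: "f a ~= 0" "f b ~= 0" using f[of a] f[of b] p by auto
  have "\<bar>inverse (f a) - inverse (f b)\<bar> = \<bar>inverse (f a)\<bar> * (\<bar>f a - f b\<bar> * \<bar>inverse (f b)\<bar>)"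
   unfolding inverse_diff_inverse[OF nz] by (simp add: abs_mult)
  also have "... <= inverse p * ((L * (\<Sum>i\<in>idx N. norm (a i - b i))) * inverse p)"
   using inv L(2)[of a b] p by (intro mult_mono) auto
  finally show "norm (inverse (f a) - inverse (f b)) <= inverse p * (L * inverse p) * (\<Sum>i\<in>idx N. norm (a i - b i))"
   by (simp add: mult_ac)
 qed
 then show ?thesis by (rule blip_nodalI[of _ _ "inverse p"]) (use inv p in auto)
qed

lemma lip_nodal_edge:
 assumes j: "j \<in> idx N" shows "lip_nodal N (%a. edge N a j)"
 unfolding lip_nodal_def
proof (intro exI[of _ 2] conjI allI)
 fix a b :: "nat => 'a"
 have m: "norm (a i - b i) <= (\<Sum>i\<in>idx N. norm (a i - b i))" if "i \<in> idx N" for i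
  by (rule member_le_sum[OF that]) auto
 have "edge N a j - edge N b j = (a j - b j) - (a (prv N j) - b (prv N j))" by (simp add: edge_def)
 then have "norm (edge N a j - edge N b j) <= norm (a j - b j) + norm (a (prv N j) - b (prv N j))"
  by (metis norm_triangle_ineq4)
 then show "norm (edge N a j - edge N b j) <= 2 * (\<Sum>i\<in>idx N. norm (a i - b i))"
  using m[OF j] m[OF prv_in[OF j]] by linarith
qed simp

lemma lip_nodal_compose:
 assumes "lip_nodal N f" and "!!u v. norm (g u - g v) <= C * norm (u - v)" "0 <= C"
 shows "lip_nodal N (%a. g (f a))"
proof -
 obtain L where L: "L \<ge> 0" "!!a b. norm (f a - f b) <= L * (\<Sum>i\<in>idx N. norm (a i - b i))"
  using assms(1) unfolding lip_nodal_def by auto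
 show ?thesis unfolding lip_nodal_def
 proof (intro exI[of _ "C * L"] conjI allI)
  fix a b
  have "norm (g (f a) - g (f b)) <= C * (L * (\<Sum>i\<in>idx N. norm (a i - b i)))"
   using assms(2)[of "f a" "f b"] mult_left_mono[OF L(2)[of a b] assms(3)] by linarith
  then show "norm (g (f a) - g (f b)) <= C * L * (\<Sum>i\<in>idx N. norm (a i - b i))" by (simp add: mult_ac)
 qed (use L assms in simp)
qed

text \<open>\<open>norm v\<close> is at most its own truncated length, so the change of the
  denominator costs only one factor 1 / p, even for long vectors.\<close>

lemma truncated_normalisation_lipschitz:
 fixes u v :: "'a::real_normed_vector"
 assumes p: "0 < p"
 shows "norm (u /\<^sub>R max p (norm u) - v /\<^sub>R max p (norm v)) <= 2 / p * norm (u - v)"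
proof -
 define \<alpha> \<beta> where "\<alpha> = max p (norm u)" and "\<beta> = max p (norm v)"
 have ab: "p <= \<alpha>" "p <= \<beta>" "norm v <= \<beta>" "\<bar>\<beta> - \<alpha>\<bar> <= norm (u - v)"
  using norm_triangle_ineq3[of u v] by (auto simp: \<alpha>_def \<beta>_def max_def)
 have pos: "0 < \<alpha>" "0 < \<beta>" using ab p by auto
 have ia: "inverse \<alpha> <= inverse p" using ab p by (simp add: le_imp_inverse_le)
 have "u /\<^sub>R \<alpha> - v /\<^sub>R \<beta> = inverse \<alpha> *\<^sub>R (u - v) + (inverse \<alpha> * (\<beta> - \<alpha>) * inverse \<beta>) *\<^sub>R v"
  using pos by (simp add: algebra_simps field_simps flip: scaleR_add_left)
 also have "norm ... <= inverse \<alpha> * norm (u - v) + inverse \<alpha> * \<bar>\<beta> - \<alpha>\<bar> * (inverse \<beta> * norm v)"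
  by (rule order_trans[OF norm_triangle_ineq]) (use pos in \<open>simp add: abs_mult mult_ac\<close>)
 also have "... <= inverse p * norm (u - v) + inverse p * norm (u - v) * 1"
  using ab pos p ia by (intro add_mono mult_mono) (auto simp: field_simps)
 finally show ?thesis using p by (simp add: \<alpha>_def \<beta>_def field_simps)
qed

context
 fixes N :: nat and p q lam :: real and hh :: "nat => real"
 assumes p: "0 < p" and q: "0 <= q"
begin

lemma blip_ctang: "j \<in> idx N ==> blip_nodal N (%z::nat => 'a::real_inner. ctang p N z j)"
proof -
 assume j: "j \<in> idx N"
 have "lip_nodal N (%z::nat => 'a. ctang p N z j)"
  unfolding ctang_def clen_def
  by (rule lip_nodal_compose[OF lip_nodal_edge[OF j], where g = "%u. u /\<^sub>R max p (norm u)"],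
    rule truncated_normalisation_lipschitz[OF p]) (use p in simp)
 moreover have "norm (ctang p N z j) <= 1" for z :: "nat => 'a"
  using p unfolding ctang_def clen_def by (auto simp: field_simps max_def split: if_splits)
 ultimately show ?thesis by (rule blip_nodalI) simp
qed

lemma lip_clen: "j \<in> idx N ==> lip_nodal N (%z::nat => 'a::real_inner. clen p N z j)"
proof -
 assume j: "j \<in> idx N"
 have "\<bar>max p (norm u) - max p (norm v)\<bar> <= 1 * norm (u - v)" for u v :: 'a
  using norm_triangle_ineq3[of u v] by (auto simp: max_def)
 then show ?thesis unfolding clen_def
  by (intro lip_nodal_compose[OF lip_nodal_edge[OF j], where g = "%u. max p (norm u)" and C = 1]) auto
qed

lemma blip_inverse_clen: "j \<in> idx N ==> blip_nodal N (%z::nat => 'a::real_inner. inverse (clen p N z j))"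
 by (rule blip_nodal_inverse[OF lip_clen p]) (auto simp: clen_def)

lemma blip_inverse_cmass: "j \<in> idx N ==> blip_nodal N (%z::nat => 'a::real_inner. inverse (cmass p N z j))"
proof (rule blip_nodal_inverse[OF _ p])
 assume j: "j \<in> idx N"
 show "lip_nodal N (%z::nat => 'a. cmass p N z j)" unfolding cmass_def
  by (rule lip_nodal_compose[OF lip_nodal_add[OF lip_clen[OF j] lip_clen[OF nxt_in[OF j]]], of _ 1]) auto
 show "p <= cmass p N z j" for z :: "nat => 'a" unfolding cmass_def clen_def by (simp add: max_def)
qed

lemma blip_ccurv: "j \<in> idx N ==> blip_nodal N (%z::nat => 'a::real_inner. ccurv p N z j)"
 unfolding ccurv_def
 by (intro blip_nodal_prod[OF bounded_bilinear_scaleR] blip_inverse_cmass blip_nodal_diff blip_ctang) auto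

lemma blip_cflux: "j \<in> idx N ==> blip_nodal N (%z::nat => 'a::real_inner. cflux p q N lam hh z j)"
proof -
 assume j: "j \<in> idx N"
 have "\<bar>min q (norm u) - min q (norm v)\<bar> <= 1 * norm (u - v)" for u v :: 'a
  using norm_triangle_ineq3[of u v] by (auto simp: min_def)
 then have "lip_nodal N (%z::nat => 'a. min q (norm (edge N z j)))"
  by (intro lip_nodal_compose[OF lip_nodal_edge[OF j], where g = "%u. min q (norm u)" and C = 1]) auto
 then have m: "blip_nodal N (%z::nat => 'a. min q (norm (edge N z j)))"
  unfolding blip_nodal_def using q by (auto intro!: exI[of _ q])
 show ?thesis
  unfolding cflux_def normal_proj_def edge_def[of N "ccurv p N _"] divide_inverse[of "_ + _" 4]
  using j by (intro blip_nodal_prod[OF bounded_bilinear_scaleR] blip_nodal_prod[OF bounded_bilinear_inner]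
    blip_nodal_prod[OF bounded_bilinear_mult] blip_inverse_clen blip_nodal_diff blip_nodal_add
    blip_ccurv blip_ctang blip_nodal_const m) auto
qed

lemma cfield_lipschitz:
 "\<exists>L\<ge>0. \<forall>a b :: nat => 'a::real_inner. \<forall>j\<in>idx N.
   norm (cfield p q N lam hh a j - cfield p q N lam hh b j) <= L * (\<Sum>i\<in>idx N. norm (a i - b i))"
proof -
 have "\<forall>j\<in>idx N. \<exists>L\<ge>0. \<forall>a b :: nat => 'a. norm (cfield p q N lam hh a j - cfield p q N lam hh b j)
   <= L * (\<Sum>i\<in>idx N. norm (a i - b i))"
 proof
  fix j assume j: "j \<in> idx N"
  have "blip_nodal N (%z::nat => 'a. cfield p q N lam hh z j)" unfolding cfield_def
   using j by (intro blip_nodal_prod[OF bounded_bilinear_scaleR] blip_inverse_cmass blip_nodal_diff blip_cflux) auto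
  then show "\<exists>L\<ge>0. \<forall>a b :: nat => 'a. norm (cfield p q N lam hh a j - cfield p q N lam hh b j)
   <= L * (\<Sum>i\<in>idx N. norm (a i - b i))" unfolding blip_nodal_def lip_nodal_def by blast
 qed
 then obtain L where L: "!!j. j \<in> idx N ==> 0 <= L j"
  "!!j a b. j \<in> idx N ==> norm (cfield p q N lam hh a j - cfield p q N lam hh (b::nat => 'a) j)
   <= L j * (\<Sum>i\<in>idx N. norm (a i - b i))" by metis
 show ?thesis
 proof (intro exI[of _ "\<Sum>j\<in>idx N. L j"] conjI allI ballI)
  show "0 <= (\<Sum>j\<in>idx N. L j)" by (intro sum_nonneg L)
  fix a b :: "nat => 'a" and j assume j: "j \<in> idx N"
  have "L j <= (\<Sum>j\<in>idx N. L j)" by (rule member_le_sum[OF j]) (auto simp: L)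
  then have "L j * (\<Sum>i\<in>idx N. norm (a i - b i)) <= (\<Sum>j\<in>idx N. L j) * (\<Sum>i\<in>idx N. norm (a i - b i))"
   by (rule mult_right_mono) (simp add: sum_nonneg)
  then show "norm (cfield p q N lam hh a j - cfield p q N lam hh b j) <= (\<Sum>j\<in>idx N. L j) * (\<Sum>i\<in>idx N. norm (a i - b i))"
   using L(2)[OF j, of a b] by linarith
 qed
qed

end

lemma continuous_on_lip_nodal:
 assumes "lip_nodal N f" and x: "!!i. i \<in> idx N ==> continuous_on S (%t. x t i)"
 shows "continuous_on S (%t. f (x t))"
 unfolding continuous_on_def
proof
 fix t assume t: "t \<in> S"
 obtain L where L: "L \<ge> 0" "!!a b. norm (f a - f b) <= L * (\<Sum>i\<in>idx N. norm (a i - b i))"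
  using assms(1) unfolding lip_nodal_def by auto
 have "((%s. L * (\<Sum>i\<in>idx N. norm (x s i - x t i))) \<longlongrightarrow> L * (\<Sum>i\<in>idx N. norm (x t i - x t i))) (at t within S)"
  using x t by (intro tendsto_intros) (auto simp: continuous_on_def)
 then have "((%s. L * (\<Sum>i\<in>idx N. norm (x s i - x t i))) \<longlongrightarrow> 0) (at t within S)" by simp
 then have "((%s. f (x s) - f (x t)) \<longlongrightarrow> 0) (at t within S)"
  by (rule Lim_null_comparison[rotated]) (simp add: L(2))
 then show "((%s. f (x s)) \<longlongrightarrow> f (x t)) (at t within S)" by (simp add: LIM_zero_iff)
qed

text \<open>Bootstrapping. The times at which \<open>g\<close> is at least \<open>b\<close> form a
  compact set. If it had a least element, \<open>g\<close> would be below \<open>b\<close> before it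
  and, by continuity, at most \<open>b\<close> there, and \<open>improve\<close> would make this
  strict.\<close>

lemma continuity_argument:
 fixes g :: "real => real"
 assumes cont: "continuous_on {0..T} g" and T: "0 <= T"
  and improve: "!!t. t \<in> {0..T} ==> (!!s. s \<in> {0..t} ==> g s <= b) ==> g t < b"
  and init: "g 0 <= b" and t: "t \<in> {0..T}"
 shows "g t < b"
proof (rule ccontr)
 assume bad: "\<not> g t < b"
 let ?S = "{0..T} \<inter> g -` {b..}"
 have "closed ?S" by (rule continuous_closed_preimage[OF cont]) auto
 then have "compact ?S" using bounded_subset[of "{0..T}" ?S] by (auto simp: compact_eq_bounded_closed)
 moreover have "?S ~= {}" using bad t by auto
 ultimately obtain s where s: "s \<in> ?S" "!!r. r \<in> ?S ==> s <= r"
  using compact_attains_inf[of ?S] by blast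
 have below: "g r < b" if "r \<in> {0..<s}" for r
  using s(2)[of r] s(1) that by (force simp: not_less)
 have "g 0 < b" using improve[of 0] T init by auto
 have "g s <= b"
 proof (rule ccontr)
  assume "\<not> g s <= b"
  then obtain r where "0 <= r" "r <= s" "g r = b"
   using IVT'[of g 0 b s] \<open>g 0 < b\<close> s(1) continuous_on_subset[OF cont, of "{0..s}"] by auto
  then show False using below[of r] \<open>\<not> g s <= b\<close> by (cases "r = s") auto
 qed
 then have "g s < b" using improve[of s] s(1) below by (force simp: less_le)
 then show False using s(1) by simp
qed

section \<open>The energy method in time\<close>

lemma inner_has_real_derivative:
 fixes f g :: "real => 'a::real_inner"
 assumes "(f has_vector_derivative f') (at t within S)" "(g has_vector_derivative g') (at t within S)"
 shows "((%s. f s \<bullet> g s) has_real_derivative (f t \<bullet> g' + f' \<bullet> g t)) (at t within S)"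
 using bounded_bilinear.has_vector_derivative[OF bounded_bilinear_inner assms]
 by (simp add: has_real_derivative_iff_has_vector_derivative)

lemma norm_sq_has_real_derivative:
 fixes f :: "real => 'a::real_inner"
 assumes "(f has_vector_derivative f') (at t within S)"
 shows "((%s. (norm (f s))^2) has_real_derivative (2 * (f t \<bullet> f'))) (at t within S)"
 using inner_has_real_derivative[OF assms assms] by (simp add: power2_norm_eq_inner inner_commute)

text \<open>The only point beyond the product rule: for unit vectors half of |\<tau> - T|^2 has the
  derivative -(\<tau>' . T + \<tau> . T').\<close>

lemma Psi_has_real_derivative:
 fixes \<tau> T w :: "real => 'a::real_inner" and l L c :: "real => real"
 assumes \<tau>: "(\<tau> has_vector_derivative \<tau>') (at t within S)" "\<tau> t \<bullet> \<tau>' = 0"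
  and T: "(T has_vector_derivative T') (at t within S)" "T t \<bullet> T' = 0"
  and w: "(w has_vector_derivative w') (at t within S)"
  and l: "(l has_real_derivative l') (at t within S)"
  and L: "(L has_real_derivative L') (at t within S)" "L t ~= 0"
  and c: "(c has_real_derivative c') (at t within S)"
 shows "((%s. c s * l s * ((norm (\<tau> s - T s))^2 / 2) + (1 - l s / L s) * (w s \<bullet> (\<tau> s - T s))
    - l s / L s * (w s \<bullet> T s) * ((norm (\<tau> s - T s))^2 / 2)) has_real_derivative
  (c' * l t * ((norm (\<tau> t - T t))^2 / 2) + c t * l' * ((norm (\<tau> t - T t))^2 / 2)
    + c t * l t * (- (\<tau>' \<bullet> T t + \<tau> t \<bullet> T'))
   - (l' * L t - l t * L') / (L t)^2 * (w t \<bullet> (\<tau> t - T t))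
   + (1 - l t / L t) * (w' \<bullet> (\<tau> t - T t) + w t \<bullet> (\<tau>' - T'))
   - (l' * L t - l t * L') / (L t)^2 * (w t \<bullet> T t) * ((norm (\<tau> t - T t))^2 / 2)
   - l t / L t * (w' \<bullet> T t + w t \<bullet> T') * ((norm (\<tau> t - T t))^2 / 2)
   - l t / L t * (w t \<bullet> T t) * (- (\<tau>' \<bullet> T t + \<tau> t \<bullet> T')))) (at t within S)"
proof -
 note th = has_vector_derivative_diff[OF \<tau>(1) T(1)]
 have "2 * ((\<tau> t - T t) \<bullet> (\<tau>' - T')) / 2 = - (\<tau>' \<bullet> T t + \<tau> t \<bullet> T')"
  using \<tau>(2) T(2) by (simp add: inner_diff_left inner_diff_right inner_commute)
 from DERIV_cong[OF DERIV_cdivide[OF norm_sq_has_real_derivative[OF th]] this]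
 have s: "((%s. (norm (\<tau> s - T s))^2 / 2) has_real_derivative - (\<tau>' \<bullet> T t + \<tau> t \<bullet> T')) (at t within S)" .
 have r: "((%s. l s / L s) has_real_derivative (l' * L t - l t * L') / (L t)^2) (at t within S)"
  using DERIV_divide[OF l L] by (simp add: power2_eq_square)
 note a = inner_has_real_derivative[OF w th]
 note b = inner_has_real_derivative[OF w T(1)]
 show ?thesis
  by (rule DERIV_cong, (rule DERIV_diff DERIV_add DERIV_mult DERIV_const c l s r a b)+)
   (simp add: algebra_simps)
qed

text \<open>Gronwall's bound for the energy plus 2 A^3 / lam h^2. By coercivity this sum is
  nonnegative, and at time zero it equals the added term, since the initial errors vanish.\<close>

definition energy_const :: "real => real => real => real" where
 "energy_const A lam T = (2 * A ^ 3 / lam + growth_const A lam * T)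
   * exp (growth_const A lam / coercivity A lam * T) / coercivity A lam"

text \<open>From integrating the growth inequality over the whole interval. The first summand is the
  lower bound of the energy at the final time, and the factor 2 A undoes the coefficient of the
  dissipation.\<close>

definition rate_const :: "real => real => real => real" where
 "rate_const A lam T = 2 * A * (2 * A ^ 3 / lam + growth_const A lam * (energy_const A lam T + 1) * T)"

definition curv_rate_const :: "real => real => real => real" where
 "curv_rate_const A lam T = 1 / (4 * A) * rate_const A lam T + diss_const A lam * (energy_const A lam T + 1) * T"

text \<open>The exact polygon satisfies the bounds on lengths and curvature with room: 2 h instead
  of h, an extra h, an extra 1. A polygon that is close to it then still satisfies
  \<open>good\<close>, which the energy estimate requires.\<close>

locale consistent =
 fixes N :: nat and A h lam T :: real and hh :: "nat => real"
  and X X' r0 r0' r :: "real => nat => 'a::{real_inner, banach}"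
 assumes A: "1 <= A" and lam: "0 < lam" and T: "0 < T" and h: "0 < h" "h <= 1" and card: "real N * h <= A"
  and hh: "j \<in> idx N ==> h <= A * hh j" "j \<in> idx N ==> hh j <= h"
  and X_deriv: "t \<in> {0..T} ==> j \<in> idx N ==> ((%s. X s j) has_vector_derivative X' t j) (at t within {0..T})"
  and X'_cont: "j \<in> idx N ==> continuous_on {0..T} (%t. X' t j)"
  and r0_deriv: "t \<in> {0..T} ==> j \<in> idx N ==> ((%s. r0 s j) has_vector_derivative r0' t j) (at t within {0..T})"
  and L: "t \<in> {0..T} ==> j \<in> idx N ==> 2 * h <= A * norm (edge N (X t) j)"
   "t \<in> {0..T} ==> j \<in> idx N ==> norm (edge N (X t) j) + h <= A * h"
  and Y: "t \<in> {0..T} ==> j \<in> idx N ==> norm (pcurv N (X t) j) + 1 <= A"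
  and Y': "t \<in> {0..T} ==> j \<in> idx N ==> norm (curv_d N (X t) (X' t) j) <= A"
  and dY: "t \<in> {0..T} ==> j \<in> idx N ==> norm (edge N (pcurv N (X t)) j) <= A * h"
  and dY': "t \<in> {0..T} ==> j \<in> idx N ==> norm (edge N (curv_d N (X t) (X' t)) j) <= A * h"
  and T': "t \<in> {0..T} ==> j \<in> idx N ==> norm (tang_d N (X t) (X' t) j) <= A"
  and L': "t \<in> {0..T} ==> j \<in> idx N ==> \<bar>len_d N (X t) (X' t) j\<bar> <= A * h"
  and X': "t \<in> {0..T} ==> j \<in> idx N ==> norm (X' t j) <= A"
  and dX': "t \<in> {0..T} ==> j \<in> idx N ==> norm (edge N (X' t) j) <= A * h"
  and r0: "t \<in> {0..T} ==> j \<in> idx N ==> norm (r0 t j) <= A * h"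
  and r0': "t \<in> {0..T} ==> j \<in> idx N ==> norm (r0' t j) <= A * h"
  and r: "t \<in> {0..T} ==> j \<in> idx N ==> norm (r t j) <= A * h^2"
  and exact: "t \<in> {0..T} ==> j \<in> idx N ==> pmass N (X t) j *\<^sub>R X' t j
    = (pflux N lam hh (X t) j + r0 t j) - (pflux N lam hh (X t) (nxt N j) + r0 t (nxt N j)) + r t j"
begin

lemma A_pos: "0 < A" and h_ge0: "0 <= h" using A h by auto

lemma L_nz: "t \<in> {0..T} ==> j \<in> idx N ==> edge N (X t) j ~= 0"
 using L(1)[of t j] h by auto

definition good :: "(nat => 'a) => bool" where
 "good z \<longleftrightarrow> (\<forall>j\<in>idx N. h <= A * norm (edge N z j) & norm (edge N z j) <= A * h & norm (pcurv N z j) <= A)"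

lemma good_nz: "good z ==> j \<in> idx N ==> edge N z j ~= 0"
 using h unfolding good_def by force

lemma scheme_error:
 assumes t: "t \<in> {0..T}" and good: "good x"
  and scheme: "!!j. j \<in> idx N ==> pmass N x j *\<^sub>R x' j = pflux N lam hh x j - pflux N lam hh x (nxt N j)"
 shows "scheme_error N x x' (%j. norm (edge N x j)) (pmass N x) (ptang N x) (pcurv N x)
  (len_d N x x') (mass_d N x x') (tang_d N x x') (curv_d N x x')
  (X t) (X' t) (%j. norm (edge N (X t) j)) (pmass N (X t)) (ptang N (X t)) (pcurv N (X t))
  (len_d N (X t) (X' t)) (mass_d N (X t) (X' t)) (tang_d N (X t) (X' t)) (curv_d N (X t) (X' t))
  A h lam hh (r0 t) (r0' t) (r t)"
proof -
 have pp: "polygon_pair N x x' (%j. norm (edge N x j)) (pmass N x) (ptang N x) (pcurv N x)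
  (len_d N x x') (mass_d N x x') (tang_d N x x') (curv_d N x x')
  (X t) (X' t) (%j. norm (edge N (X t) j)) (pmass N (X t)) (ptang N (X t)) (pcurv N (X t))
  (len_d N (X t) (X' t)) (mass_d N (X t) (X' t)) (tang_d N (X t) (X' t)) (curv_d N (X t) (X' t))"
  unfolding polygon_pair_def using polygonI[OF good_nz[OF good]] polygonI[OF L_nz[OF t]] by blast
 interpret pp: polygon_pair N x x' "%j. norm (edge N x j)" "pmass N x" "ptang N x" "pcurv N x"
  "len_d N x x'" "mass_d N x x'" "tang_d N x x'" "curv_d N x x'"
  "X t" "X' t" "%j. norm (edge N (X t) j)" "pmass N (X t)" "ptang N (X t)" "pcurv N (X t)"
  "len_d N (X t) (X' t)" "mass_d N (X t) (X' t)" "tang_d N (X t) (X' t)" "curv_d N (X t) (X' t)"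
  by (rule pp)
 have g: "h <= A * norm (edge N x j)" "norm (edge N x j) <= A * h" "norm (pcurv N x j) <= A" if "j \<in> idx N" for j
  using good that by (auto simp: good_def)
 show ?thesis
 proof (unfold_locales, goal_cases)
  case 10 then show ?case using L(1)[OF t 10] h by linarith
 next
  case 11 then show ?case using L(2)[OF t 11] h by linarith
 next
  case 13 then show ?case using Y[OF t 13] by linarith
 next
  case (24 j)
  have e: "pflux N lam hh x = (%j. pp.flux j - (lam / hh j) *\<^sub>R edge N x j)"
   by (simp add: fun_eq_iff pflux_def pp.flux_def pp.cy_def)
  show ?case using scheme[OF 24] unfolding e by simp
 next
  case (25 j)
  have e: "pflux N lam hh (X t) = (%j. pp.Flux j - (lam / hh j) *\<^sub>R edge N (X t) j)"
   by (simp add: fun_eq_iff pflux_def pp.Flux_def pp.c_def)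
  show ?case using exact[OF t 25] unfolding e by simp
 qed (use A lam h card hh g Y'[OF t] dY[OF t] dY'[OF t] T'[OF t] L'[OF t] X'[OF t] dX'[OF t] r0[OF t] r0'[OF t] r[OF t] in auto)
qed

definition E where
 "E z t = (\<Sum>j\<in>idx N. h * (norm (pcurv N z j - pcurv N (X t) j))^2)
   + (\<Sum>j\<in>idx N. h * (norm (edge N (%i. z i - X t i) j) / h)^2)
   + (\<Sum>j\<in>idx N. h * (norm (z j - X t j))^2)"

definition D where "D z' t = (\<Sum>j\<in>idx N. h * (norm (z' j - X' t j))^2)"

definition Z where
 "Z z t = (\<Sum>j\<in>idx N. h * (norm (edge N (%i. pcurv N z i - pcurv N (X t) i) j) / h)^2)"

definition cf where
 "cf t j = ((norm (pcurv N (X t) j))^2 + (norm (pcurv N (X t) (prv N j)))^2) / 4"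

definition psi where
 "psi z t j = cf t j * norm (edge N z j) * ((norm (ptang N z j - ptang N (X t) j))^2 / 2)
   + (1 - norm (edge N z j) / norm (edge N (X t) j)) * (edge N (pcurv N (X t)) j \<bullet> (ptang N z j - ptang N (X t) j))
   - norm (edge N z j) / norm (edge N (X t) j) * (edge N (pcurv N (X t)) j \<bullet> ptang N (X t) j)
    * ((norm (ptang N z j - ptang N (X t) j))^2 / 2)"

definition W where
 "W z t = (\<Sum>j\<in>idx N. pmass N z j * ((norm (pcurv N z j - pcurv N (X t) j))^2 / 2)
   + lam / (2 * hh j) * (norm (edge N (%i. z i - X t i) j))^2 - psi z t j
   + r0 t j \<bullet> edge N (%i. z i - X t i) j + weight A lam * hh j / 2 * (norm (z j - X t j))^2)"

text \<open>Carries the estimates of a single instant over to moving polygons. The time interval may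
  be shorter than \<open>{0..T}\<close>, because the bootstrap applies the energy bound up to an
  arbitrary time.\<close>

lemma energy_facts:
 assumes t: "t \<in> {0..t1}" and t1: "t1 <= T" and good: "good (x t)"
  and scheme: "!!j. j \<in> idx N ==> pmass N (x t) j *\<^sub>R x' j = pflux N lam hh (x t) j - pflux N lam hh (x t) (nxt N j)"
  and x': "!!j. j \<in> idx N ==> ((%s. x s j) has_vector_derivative x' j) (at t within {0..t1})"
 shows "coercivity A lam * E (x t) t - 2 * A ^ 3 / lam * h^2 <= W (x t) t"
  and "\<exists>w. ((%s. W (x s) s) has_real_derivative w) (at t within {0..t1}) &
    w <= - 1 / (2 * A) * D x' t + growth_const A lam * (E (x t) t + h^2)"
  and "Z (x t) t <= 1 / (4 * A) * D x' t + diss_const A lam * (E (x t) t + h^2)"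
proof -
 have tT: "t \<in> {0..T}" using t t1 by auto
 interpret se: scheme_error N "x t" x' "%j. norm (edge N (x t) j)" "pmass N (x t)" "ptang N (x t)" "pcurv N (x t)"
  "len_d N (x t) x'" "mass_d N (x t) x'" "tang_d N (x t) x'" "curv_d N (x t) x'"
  "X t" "X' t" "%j. norm (edge N (X t) j)" "pmass N (X t)" "ptang N (X t)" "pcurv N (X t)"
  "len_d N (X t) (X' t)" "mass_d N (X t) (X' t)" "tang_d N (X t) (X' t)" "curv_d N (X t) (X' t)"
  A h lam hh "r0 t" "r0' t" "r t"
  by (rule scheme_error[OF tT good scheme])
 have e: "se.e = (%i. x t i - X t i)" by (simp add: fun_eq_iff se.e_def)
 have e': "se.e' = (%i. x' i - X' t i)" by (simp add: fun_eq_iff se.e'_def)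
 have a: "se.a = (%i. pcurv N (x t) i - pcurv N (X t) i)" by (simp add: fun_eq_iff se.a_def)
 have E: "E (x t) t = se.Sa + se.Se + se.S0"
  by (simp add: E_def se.Sa_def se.Se_def se.S0_def se.\<epsilon>_def e a)
 have D: "D x' t = se.Sd" by (simp add: D_def se.Sd_def e')
 have Z: "Z (x t) t = se.Z" by (simp add: Z_def se.Z_def a)
 have psi: "psi (x t) t j = se.\<Psi> j" for j
  by (simp add: psi_def cf_def se.\<Psi>_def se.c_def se.\<sigma>_def se.\<theta>_def se.\<rho>_def)
 have W: "W (x t) t = se.W"
  unfolding W_def se.W_def by (rule sum.cong[OF refl]) (simp add: e a psi)
 show "coercivity A lam * E (x t) t - 2 * A ^ 3 / lam * h^2 <= W (x t) t"
  unfolding E W by (rule se.W_coercive)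
 show "Z (x t) t <= 1 / (4 * A) * D x' t + diss_const A lam * (E (x t) t + h^2)"
  unfolding E D Z by (rule se.dissipation)
 have XD: "((%s. X s j) has_vector_derivative X' t j) (at t within {0..t1})" if "j \<in> idx N" for j
  using has_vector_derivative_within_subset[OF X_deriv[OF tT that], of "{0..t1}"] t1 by auto
 have rD: "((%s. r0 s j) has_vector_derivative r0' t j) (at t within {0..t1})" if "j \<in> idx N" for j
  using has_vector_derivative_within_subset[OF r0_deriv[OF tT that], of "{0..t1}"] t1 by auto
 note nz = good_nz[OF good] L_nz[OF tT]
 have dx: "((%s. norm (edge N (x s) j)) has_real_derivative len_d N (x t) x' j) (at t within {0..t1})"
  "((%s. ptang N (x s) j) has_vector_derivative tang_d N (x t) x' j) (at t within {0..t1})"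
  "((%s. pmass N (x s) j) has_real_derivative mass_d N (x t) x' j) (at t within {0..t1})"
  "((%s. pcurv N (x s) j) has_vector_derivative curv_d N (x t) x' j) (at t within {0..t1})"
  if j: "j \<in> idx N" for j
  unfolding has_real_derivative_iff_has_vector_derivative
  by (rule len_has_vector_derivative ptang_has_vector_derivative pmass_has_vector_derivative
    pcurv_has_vector_derivative, rule x', assumption, rule nz(1), assumption, rule j)+
 have dX: "((%s. norm (edge N (X s) j)) has_real_derivative len_d N (X t) (X' t) j) (at t within {0..t1})"
  "((%s. ptang N (X s) j) has_vector_derivative tang_d N (X t) (X' t) j) (at t within {0..t1})"
  "((%s. pcurv N (X s) j) has_vector_derivative curv_d N (X t) (X' t) j) (at t within {0..t1})"
  if j: "j \<in> idx N" for j
  unfolding has_real_derivative_iff_has_vector_derivative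
  by (rule len_has_vector_derivative ptang_has_vector_derivative
    pcurv_has_vector_derivative, rule XD, assumption, rule nz(2), assumption, rule j)+
 have cfD: "((%s. cf s j) has_real_derivative se.c' j) (at t within {0..t1})" if j: "j \<in> idx N" for j
  unfolding cf_def se.c'_def
  by (rule DERIV_cong[OF DERIV_cdivide[OF DERIV_add[OF norm_sq_has_real_derivative[OF dX(3)[OF j]]
    norm_sq_has_real_derivative[OF dX(3)[OF prv_in[OF j]]]]]]) simp
 have psiD: "((%s. psi (x s) s j) has_real_derivative se.\<Psi>' j) (at t within {0..t1})" if j: "j \<in> idx N" for j
  unfolding psi_def
  by (rule DERIV_cong[OF Psi_has_real_derivative[OF dx(2)[OF j] se.cur.tan_tan'[OF j] dX(2)[OF j] se.ex.tan_tan'[OF j]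
    edge_has_vector_derivative[OF dX(3) j] dx(1)[OF j] dX(1)[OF j] _ cfD[OF j]]])
   (use nz j in \<open>auto simp: se.\<Psi>'_def se.\<sigma>_def se.\<theta>_def se.\<rho>_def se.\<rho>'_def se.\<sigma>'_def se.c_def cf_def\<close>)
 have eD: "((%s. x s j - X s j) has_vector_derivative se.e' j) (at t within {0..t1})" if "j \<in> idx N" for j
  unfolding se.e'_def by (rule has_vector_derivative_diff[OF x'[OF that] XD[OF that]])
 have edD: "((%s. edge N (%i. x s i - X s i) j) has_vector_derivative edge N se.e' j) (at t within {0..t1})"
  if "j \<in> idx N" for j
  by (rule edge_has_vector_derivative[OF eD that])
 have aD: "((%s. pcurv N (x s) j - pcurv N (X s) j) has_vector_derivative se.a' j) (at t within {0..t1})"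
  if "j \<in> idx N" for j
  unfolding se.a'_def by (rule has_vector_derivative_diff[OF dx(4)[OF that] dX(3)[OF that]])
 have "((%s. W (x s) s) has_real_derivative se.W') (at t within {0..t1})"
  unfolding W_def se.W'_def
 proof (rule DERIV_sum)
  fix j assume j: "j \<in> idx N"
  note d1 = DERIV_mult[OF dx(3)[OF j] DERIV_cdivide[OF norm_sq_has_real_derivative[OF aD[OF j]], of 2]]
  note d2 = DERIV_cmult[OF norm_sq_has_real_derivative[OF edD[OF j]], of "lam / (2 * hh j)"]
  note d3 = inner_has_real_derivative[OF rD[OF j] edD[OF j]]
  note d4 = DERIV_cmult[OF norm_sq_has_real_derivative[OF eD[OF j]], of "weight A lam * hh j / 2"]
  show "((%s. pmass N (x s) j * ((norm (pcurv N (x s) j - pcurv N (X s) j))^2 / 2)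
   + lam / (2 * hh j) * (norm (edge N (%i. x s i - X s i) j))^2 - psi (x s) s j
   + r0 s j \<bullet> edge N (%i. x s i - X s i) j + weight A lam * hh j / 2 * (norm (x s j - X s j))^2)
   has_real_derivative
   mass_d N (x t) x' j * (norm (se.a j))^2 / 2 + pmass N (x t) j * (se.a j \<bullet> se.a' j)
   + lam / hh j * (edge N se.e j \<bullet> edge N se.e' j) - se.\<Psi>' j
   + (r0' t j \<bullet> edge N se.e j + r0 t j \<bullet> edge N se.e' j) + weight A lam * hh j * (se.e j \<bullet> se.e' j))
   (at t within {0..t1})"
   by (rule DERIV_cong[OF DERIV_add[OF DERIV_add[OF DERIV_diff[OF DERIV_add[OF d1 d2] psiD[OF j]] d3] d4]])
    (simp add: e a)
 qed
 then show "\<exists>w. ((%s. W (x s) s) has_real_derivative w) (at t within {0..t1}) &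
    w <= - 1 / (2 * A) * D x' t + growth_const A lam * (E (x t) t + h^2)"
  unfolding E D using se.energy_growth by blast
qed

lemma W_init: "(!!j. j \<in> idx N ==> z j = X 0 j) ==> W z 0 = 0"
proof -
 assume z: "!!j. j \<in> idx N ==> z j = X 0 j"
 have e: "edge N z j = edge N (X 0) j" if "j \<in> idx N" for j using z that by (simp add: edge_def)
 have t: "ptang N z j = ptang N (X 0) j" "pmass N z j = pmass N (X 0) j" if "j \<in> idx N" for j
  using that by (simp_all add: ptang_def pmass_def e)
 have c: "pcurv N z j = pcurv N (X 0) j" if "j \<in> idx N" for j
  using that by (simp add: pcurv_def t)
 have d: "edge N (%i. z i - X 0 i) j = 0" if "j \<in> idx N" for j
  using that z by (simp add: edge_def)
 have "norm (edge N z j) / norm (edge N (X 0) j) = 1" if "j \<in> idx N" for j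
  using that L_nz[of 0 j] T by (simp add: e)
 then show ?thesis unfolding W_def psi_def by (intro sum.neutral ballI) (simp add: z c d t)
qed

lemma consts_pos: "0 < coercivity A lam" "0 <= growth_const A lam" "0 <= diss_const A lam" "0 <= energy_const A lam T"
proof -
 show 1: "0 < coercivity A lam" "0 <= growth_const A lam" "0 <= diss_const A lam"
  using A lam by (simp_all add: coercivity_pos growth_const_nonneg diss_const_nonneg)
 show "0 <= energy_const A lam T"
  unfolding energy_const_def using 1 A lam T by (intro divide_nonneg_pos mult_nonneg_nonneg add_nonneg_nonneg) auto
qed

lemma energy_bound:
 assumes t1: "t1 \<in> {0..T}" and good: "!!t. t \<in> {0..t1} ==> good (x t)"
  and scheme: "!!t j. t \<in> {0..t1} ==> j \<in> idx N ==>
    pmass N (x t) j *\<^sub>R x' t j = pflux N lam hh (x t) j - pflux N lam hh (x t) (nxt N j)"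
  and x': "!!t j. t \<in> {0..t1} ==> j \<in> idx N ==> ((%s. x s j) has_vector_derivative x' t j) (at t within {0..t1})"
  and init: "!!j. j \<in> idx N ==> x 0 j = X 0 j" and t: "t \<in> {0..t1}"
 shows "E (x t) t <= energy_const A lam T * h^2"
proof -
 define G k b where "G = growth_const A lam" and "k = coercivity A lam" and "b = 2 * A ^ 3 / lam"
 have pos: "0 <= G" "0 < k" "0 <= b" using consts_pos A lam by (auto simp: G_def k_def b_def)
 have t1T: "t1 <= T" using t1 by simp
 have ef1: "coercivity A lam * E (x t) t - 2 * A ^ 3 / lam * h^2 <= W (x t) t"
  and ef2: "\<exists>w. ((%s. W (x s) s) has_real_derivative w) (at t within {0..t1}) &
    w <= - 1 / (2 * A) * D (x' t) t + growth_const A lam * (E (x t) t + h^2)"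
  if t: "t \<in> {0..t1}" for t
  using energy_facts[OF t t1T good[OF t] scheme[OF t] x'[OF t]] by blast+
 have "\<forall>t\<in>{0..t1}. \<exists>w. ((%s. W (x s) s) has_real_derivative w) (at t within {0..t1}) &
    w <= - 1 / (2 * A) * D (x' t) t + G * (E (x t) t + h^2)"
  unfolding G_def by (intro ballI ef2)
 from bchoice[OF this] obtain w where w: "!!t. t \<in> {0..t1} ==> ((%s. W (x s) s) has_real_derivative w t) (at t within {0..t1})"
  "!!t. t \<in> {0..t1} ==> w t <= - 1 / (2 * A) * D (x' t) t + G * (E (x t) t + h^2)" by blast
 define V where "V s = W (x s) s + b * h^2" for s
 have EV: "E (x s) s <= V s / k" if s: "s \<in> {0..t1}" for s
  using ef1[OF s] pos by (simp add: V_def b_def k_def field_simps)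
 have "V t <= (V 0 + G * h^2 * t) * exp (G / k * t)"
 proof (rule gronwall[where W = V and W' = w and ?t1.0 = t1])
  fix s assume s: "s \<in> {0..t1}"
  show "(V has_real_derivative w s) (at s within {0..t1})"
   unfolding V_def using w(1)[OF s] by (auto intro!: derivative_eq_intros)
  have "0 <= D (x' s) s" unfolding D_def using h by (auto intro!: sum_nonneg)
  then have "- 1 / (2 * A) * D (x' s) s <= 0" using A_pos by (simp add: field_simps)
  moreover have "G * E (x s) s <= G * (V s / k)" using EV[OF s] pos by (intro mult_left_mono) auto
  ultimately show "w s <= G / k * V s + G * h^2"
   using w(2)[OF s] by (simp add: distrib_left)
 qed (use pos t in auto)
 also have "V 0 = b * h^2" unfolding V_def using W_init[OF init] by simp
 also have "(b * h^2 + G * h^2 * t) * exp (G / k * t) <= (b * h^2 + G * h^2 * T) * exp (G / k * T)"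
 proof (rule mult_mono)
  show "b * h^2 + G * h^2 * t <= b * h^2 + G * h^2 * T"
   using pos t t1T by (intro add_left_mono mult_left_mono) auto
  show "exp (G / k * t) <= exp (G / k * T)" using pos t t1T by (auto intro!: divide_right_mono mult_left_mono)
 qed (use pos T in auto)
 finally have "V t / k <= (b * h^2 + G * h^2 * T) * exp (G / k * T) / k"
  using pos by (intro divide_right_mono) auto
 also have "... = energy_const A lam T * h^2"
  unfolding energy_const_def b_def G_def k_def by (simp add: algebra_simps)
 finally show ?thesis using EV[OF t] by linarith
qed

lemma rate_bounds:
 assumes good: "!!t. t \<in> {0..T} ==> good (x t)"
  and scheme: "!!t j. t \<in> {0..T} ==> j \<in> idx N ==>
    pmass N (x t) j *\<^sub>R x' t j = pflux N lam hh (x t) j - pflux N lam hh (x t) (nxt N j)"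
  and x': "!!t j. t \<in> {0..T} ==> j \<in> idx N ==> ((%s. x s j) has_vector_derivative x' t j) (at t within {0..T})"
  and cont: "!!j. j \<in> idx N ==> continuous_on {0..T} (%t. x' t j)"
  and init: "!!j. j \<in> idx N ==> x 0 j = X 0 j"
 shows "(%t. D (x' t) t) integrable_on {0..T}"
  and "integral {0..T} (%t. D (x' t) t) <= rate_const A lam T * h^2"
  and "continuous_on {0..T} (%t. D (x' t) t)"
  and "!!t. t \<in> {0..T} ==> Z (x t) t <= 1 / (4 * A) * D (x' t) t + diss_const A lam * (energy_const A lam T + 1) * h^2"
proof -
 define G b where "G = growth_const A lam" and "b = 2 * A ^ 3 / lam"
 define eb where "eb = energy_const A lam T"
 have pos: "0 <= G" "0 <= b" "0 <= eb" using consts_pos A lam by (auto simp: G_def b_def eb_def)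
 have ef1: "coercivity A lam * E (x t) t - 2 * A ^ 3 / lam * h^2 <= W (x t) t"
  and ef2: "\<exists>w. ((%s. W (x s) s) has_real_derivative w) (at t within {0..T}) &
    w <= - 1 / (2 * A) * D (x' t) t + growth_const A lam * (E (x t) t + h^2)"
  and ef3: "Z (x t) t <= 1 / (4 * A) * D (x' t) t + diss_const A lam * (E (x t) t + h^2)"
  if t: "t \<in> {0..T}" for t
  using energy_facts[OF t order_refl good[OF t] scheme[OF t] x'[OF t]] by blast+
 have E: "E (x t) t <= eb * h^2" if "t \<in> {0..T}" for t
  unfolding eb_def by (rule energy_bound[OF _ good scheme x' init that]) (use T in auto)
 show cD: "continuous_on {0..T} (%t. D (x' t) t)"
  unfolding D_def
  by (intro continuous_on_sum continuous_on_mult continuous_on_const continuous_on_power continuous_on_norm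
    continuous_on_diff) (auto intro: cont X'_cont)
 then show iD: "(%t. D (x' t) t) integrable_on {0..T}" by (rule integrable_continuous_real)
 have "\<forall>t\<in>{0..T}. \<exists>w. ((%s. W (x s) s) has_real_derivative w) (at t within {0..T}) &
    w <= - 1 / (2 * A) * D (x' t) t + G * (E (x t) t + h^2)"
  unfolding G_def by (intro ballI ef2)
 from bchoice[OF this] obtain w where w: "!!t. t \<in> {0..T} ==> ((%s. W (x s) s) has_real_derivative w t) (at t within {0..T})"
  "!!t. t \<in> {0..T} ==> w t <= - 1 / (2 * A) * D (x' t) t + G * (E (x t) t + h^2)" by blast
 have wi: "(w has_integral (W (x T) T - W (x 0) 0)) {0..T}"
  by (rule fundamental_theorem_of_calculus)
   (use T w(1)[unfolded has_real_derivative_iff_has_vector_derivative] in \<open>simp_all only: less_imp_le\<close>)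
 have "((%t. w t + 1 / (2 * A) * D (x' t) t) has_integral
   (W (x T) T - W (x 0) 0 + 1 / (2 * A) * integral {0..T} (%t. D (x' t) t))) {0..T}"
  by (intro has_integral_add wi has_integral_mult_right integrable_integral iD)
 moreover have "((%t. G * (eb + 1) * h^2) has_integral (G * (eb + 1) * h^2 * T)) {0..T}"
  using has_integral_const_real[of "G * (eb + 1) * h^2" 0 T] T by (simp add: mult_ac)
 ultimately have "W (x T) T - W (x 0) 0 + 1 / (2 * A) * integral {0..T} (%t. D (x' t) t) <= G * (eb + 1) * h^2 * T"
 proof (rule has_integral_le)
  fix t assume t: "t \<in> {0..T}"
  have "G * (E (x t) t + h^2) <= G * ((eb + 1) * h^2)"
   using E[OF t] pos by (intro mult_left_mono) (auto simp: algebra_simps)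
  then show "w t + 1 / (2 * A) * D (x' t) t <= G * (eb + 1) * h^2"
   using w(2)[OF t] by (simp add: mult_ac)
 qed
 moreover have "W (x 0) 0 = 0" by (rule W_init[OF init])
 moreover have "- (b * h^2) <= W (x T) T"
 proof -
  have T0: "T \<in> {0..T}" using T by simp
  have "0 <= E (x T) T" unfolding E_def using h by (intro add_nonneg_nonneg sum_nonneg) auto
  then have "0 <= coercivity A lam * E (x T) T" using consts_pos by simp
  then show ?thesis using ef1[OF T0] unfolding b_def by linarith
 qed
 ultimately have "1 / (2 * A) * integral {0..T} (%t. D (x' t) t) <= b * h^2 + G * (eb + 1) * h^2 * T"
  by linarith
 then show "integral {0..T} (%t. D (x' t) t) <= rate_const A lam T * h^2"
 proof -
  let ?I = "integral {0..T} (%t. D (x' t) t)"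
  assume "1 / (2 * A) * ?I <= b * h^2 + G * (eb + 1) * h^2 * T"
  then have "2 * A * (1 / (2 * A) * ?I) <= 2 * A * (b * h^2 + G * (eb + 1) * h^2 * T)"
   using A_pos by (intro mult_left_mono) auto
  then show ?thesis
   unfolding rate_const_def b_def[symmetric] G_def[symmetric] eb_def[symmetric] using A_pos
   by (simp add: algebra_simps)
 qed
 fix t assume t: "t \<in> {0..T}"
 have "diss_const A lam * (E (x t) t + h^2) <= diss_const A lam * ((eb + 1) * h^2)"
  using E[OF t] consts_pos by (intro mult_left_mono) (auto simp: algebra_simps)
 then show "Z (x t) t <= 1 / (4 * A) * D (x' t) t + diss_const A lam * (energy_const A lam T + 1) * h^2"
  using ef3[OF t] by (simp add: eb_def mult_ac)
qed

text \<open>The truncated scheme has a global solution, and the truncation never acts as long as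
  \<open>g\<close> is small. While it does not act, the energy is of order h^2. Since
  \<open>g\<close> lacks the weight h of the energy, it is then of order h: this loss of one power
  is the inverse estimate, and \<open>small\<close> makes it sufficient to close the
  bootstrap.\<close>

lemma existence:
 assumes small: "energy_const A lam T * A^2 * h < 1"
 shows "\<exists>x x'. (\<forall>t\<in>{0..T}. \<forall>j\<in>idx N. ((%s. x s j) has_vector_derivative x' t j) (at t within {0..T}))
  & (\<forall>t\<in>{0..T}. good (x t))
  & (\<forall>t\<in>{0..T}. \<forall>j\<in>idx N. pmass N (x t) j *\<^sub>R x' t j = pflux N lam hh (x t) j - pflux N lam hh (x t) (nxt N j))
  & (\<forall>j\<in>idx N. continuous_on {0..T} (%t. x' t j))
  & (\<forall>j\<in>idx N. x 0 j = X 0 j)"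
proof -
 define p q where "p = h / A" and "q = A * h"
 have pq: "0 < p" "0 <= q" using A h by (auto simp: p_def q_def)
 obtain Lc where Lc: "0 <= Lc" "!!a b :: nat => 'a. !!j. j \<in> idx N ==>
   norm (cfield p q N lam hh a j - cfield p q N lam hh b j) <= Lc * (\<Sum>i\<in>idx N. norm (a i - b i))"
  using cfield_lipschitz[OF pq, of N lam hh] by blast
 obtain x where x0: "!!j. j \<in> idx N ==> x 0 j = X 0 j" and
  xD: "!!t j. t \<in> {0..T} ==> j \<in> idx N ==>
   ((%s. x s j) has_vector_derivative cfield p q N lam hh (x t) j) (at t within {0..T})"
  using discrete_ode[of N "cfield p q N lam hh" Lc T "X 0"] Lc T by force
 define x' where "x' t = cfield p q N lam hh (x t)" for t
 have xc: "continuous_on {0..T} (%t. x t j)" if "j \<in> idx N" for j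
  using xD[OF _ that] by (meson continuous_on_eq_continuous_within has_vector_derivative_continuous)
 have Xc: "continuous_on {0..T} (%t. X t j)" if "j \<in> idx N" for j
  using X_deriv[OF _ that] by (meson continuous_on_eq_continuous_within has_vector_derivative_continuous)
 have Yc: "continuous_on {0..T} (%t. pcurv N (X t) j)" if j: "j \<in> idx N" for j
  unfolding continuous_on_eq_continuous_within
 proof
  fix t assume t: "t \<in> {0..T}"
  have "((%s. pcurv N (X s) j) has_vector_derivative curv_d N (X t) (X' t) j) (at t within {0..T})"
   by (rule pcurv_has_vector_derivative[OF X_deriv[OF t] L_nz[OF t] j])
  then show "continuous (at t within {0..T}) (%t. pcurv N (X t) j)" by (rule has_vector_derivative_continuous)
 qed
 \<comment> \<open>The truncated curvature is used because continuity of \<open>g\<close> has to be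
   known before the edges are known not to vanish.\<close>
 define g where "g t = (\<Sum>j\<in>idx N. (norm (edge N (%i. x t i - X t i) j) / h)^2
   + (norm (ccurv p N (x t) j - pcurv N (X t) j))^2)" for t
 have cg: "continuous_on {0..T} g"
  unfolding g_def
 proof (rule continuous_on_sum)
  fix j assume j: "j \<in> idx N"
  have 1: "continuous_on {0..T} (%t. ccurv p N (x t) j)"
   by (rule continuous_on_lip_nodal[OF blip_imp_lip[OF blip_ccurv[OF pq j]] xc])
  have 2: "continuous_on {0..T} (%t. edge N (%i. x t i - X t i) j)"
   unfolding edge_def using j by (intro continuous_on_diff xc Xc) auto
  show "continuous_on {0..T} (%t. (norm (edge N (%i. x t i - X t i) j) / h)^2
   + (norm (ccurv p N (x t) j - pcurv N (X t) j))^2)"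
   using h by (intro continuous_on_add continuous_on_power continuous_on_norm continuous_on_diff
     continuous_on_divide continuous_on_const 1 2 Yc j) auto
 qed
 \<comment> \<open>The threshold lets an edge vary by h / A, half of its lower bound 2 h / A, so
   that h / A remains; the curvature varies by at most 1. This uses up the room in
   \<open>consistent\<close>.\<close>
 have inactive: "p <= norm (edge N (x t) j) & norm (edge N (x t) j) <= q"
  "norm (ccurv p N (x t) j - pcurv N (X t) j) <= 1"
  if t: "t \<in> {0..T}" and gt: "g t <= 1 / A^2" and j: "j \<in> idx N" for t j
 proof -
  have le: "(norm (edge N (%i. x t i - X t i) j) / h)^2 + (norm (ccurv p N (x t) j - pcurv N (X t) j))^2 <= (1 / A)^2"
   using gt member_le_sum[OF j, of "%j. (norm (edge N (%i. x t i - X t i) j) / h)^2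
    + (norm (ccurv p N (x t) j - pcurv N (X t) j))^2"] by (simp add: g_def power_divide)
  have "(norm (edge N (%i. x t i - X t i) j) / h)^2 <= (1 / A)^2" "(norm (ccurv p N (x t) j - pcurv N (X t) j))^2 <= (1 / A)^2"
   by (rule order_trans[OF _ le]; simp)+
  then have b: "norm (edge N (%i. x t i - X t i) j) / h <= 1 / A" "norm (ccurv p N (x t) j - pcurv N (X t) j) <= 1 / A"
   using A_pos by (auto intro: power2_le_imp_le)
  have e: "norm (edge N (%i. x t i - X t i) j) <= h / A" using b(1) h by (simp add: field_simps)
  have "1 / A <= 1" using A by simp
  then show "norm (ccurv p N (x t) j - pcurv N (X t) j) <= 1" using b(2) by linarith
  have "\<bar>norm (edge N (x t) j) - norm (edge N (X t) j)\<bar> <= h / A"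
   using norm_triangle_ineq3[of "edge N (x t) j" "edge N (X t) j"] e unfolding edge_diff by linarith
  moreover have "2 * (h / A) <= norm (edge N (X t) j)" using L(1)[OF t j] A_pos by (simp add: field_simps)
  moreover have "h / A <= h" using A h by (simp add: field_simps)
  ultimately show "p <= norm (edge N (x t) j) & norm (edge N (x t) j) <= q"
   using L(2)[OF t j] unfolding p_def q_def by linarith
 qed
 have cut: "good (x t)" "!!j. j \<in> idx N ==> ccurv p N (x t) j = pcurv N (x t) j"
  "!!j. j \<in> idx N ==> pmass N (x t) j *\<^sub>R x' t j = pflux N lam hh (x t) j - pflux N lam hh (x t) (nxt N j)"
  if t: "t \<in> {0..T}" and gt: "g t <= 1 / A^2" for t
 proof -
  have ci: "ccurv p N (x t) j = pcurv N (x t) j"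
   "cfield p q N lam hh (x t) j = (pflux N lam hh (x t) j - pflux N lam hh (x t) (nxt N j)) /\<^sub>R pmass N (x t) j"
   if "j \<in> idx N" for j
   using cutoff_inactive[of N p "x t" q j] inactive(1)[OF t gt] pq(1) that by auto
  show cc: "ccurv p N (x t) j = pcurv N (x t) j" if "j \<in> idx N" for j by (rule ci(1)[OF that])
  show "good (x t)" unfolding good_def
  proof (intro ballI conjI)
   fix j assume j: "j \<in> idx N"
   show "h <= A * norm (edge N (x t) j)" "norm (edge N (x t) j) <= A * h"
    using inactive(1)[OF t gt j] A_pos by (auto simp: p_def q_def field_simps)
   have "norm (pcurv N (x t) j) <= norm (pcurv N (x t) j - pcurv N (X t) j) + norm (pcurv N (X t) j)"
    by (metis diff_add_cancel norm_triangle_ineq)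
   then show "norm (pcurv N (x t) j) <= A"
    using inactive(2)[OF t gt j] Y[OF t j] unfolding cc[OF j] by linarith
  qed
  fix j assume j: "j \<in> idx N"
  have nz: "edge N (x t) i ~= 0" if "i \<in> idx N" for i
   using inactive(1)[OF t gt that] pq by auto
  have "pmass N (x t) j ~= 0"
   using polygon.mass_pos[OF polygonI[of N "x t", OF nz] j] by simp
  then show "pmass N (x t) j *\<^sub>R x' t j = pflux N lam hh (x t) j - pflux N lam hh (x t) (nxt N j)"
   unfolding x'_def ci(2)[OF j] by simp
 qed
 have gle: "g t < 1 / A^2" if t: "t \<in> {0..T}" for t
 proof (rule continuity_argument[OF cg _ _ _ t])
  show "0 <= T" using T by simp
  have "ccurv p N (x 0) j = pcurv N (X 0) j" if j: "j \<in> idx N" for j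
  proof -
   have e: "edge N (x 0) i = edge N (X 0) i" if "i \<in> idx N" for i using x0 that by (simp add: edge_def)
   have tt: "ptang N (x 0) i = ptang N (X 0) i" "pmass N (x 0) i = pmass N (X 0) i" if "i \<in> idx N" for i
    using that by (simp_all add: ptang_def pmass_def e)
   have "p <= norm (edge N (x 0) i) & norm (edge N (x 0) i) <= q" if i: "i \<in> idx N" for i
   proof -
    have "2 * (h / A) <= norm (edge N (X 0) i)" using L(1)[of 0 i] i A_pos T by (simp add: field_simps)
    moreover have "0 < h / A" using h A_pos by simp
    ultimately show ?thesis using L(2)[of 0 i] i T h unfolding e[OF i] p_def q_def by auto
   qed
   from cutoff_inactive(1)[of N p "x 0" q, OF this pq(1) j]
   show ?thesis using j by (simp add: pcurv_def tt)
  qed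
  then have "g 0 = 0" unfolding g_def by (intro sum.neutral) (auto simp: edge_def x0)
  then show "g 0 <= 1 / A^2" by simp
  fix t assume t: "t \<in> {0..T}" and le: "!!s. s \<in> {0..t} ==> g s <= 1 / A^2"
  have sT: "s \<in> {0..T}" if "s \<in> {0..t}" for s using t that by auto
  have "E (x t) t <= energy_const A lam T * h^2"
  proof (rule energy_bound[where x = x and x' = x' and ?t1.0 = t, OF t])
   fix s j assume s: "s \<in> {0..t}" and j: "j \<in> idx N"
   show "((%s. x s j) has_vector_derivative x' s j) (at s within {0..t})"
    unfolding x'_def by (rule has_vector_derivative_within_subset[OF xD[OF sT[OF s] j]]) (use t in auto)
  next
   fix s assume s: "s \<in> {0..t}"
   show "good (x s)" by (rule cut(1)[OF sT[OF s] le[OF s]])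
   fix j assume "j \<in> idx N"
   then show "pmass N (x s) j *\<^sub>R x' s j = pflux N lam hh (x s) j - pflux N lam hh (x s) (nxt N j)"
    by (rule cut(3)[OF sT[OF s] le[OF s]])
  qed (use x0 t in auto)
  moreover have "h * g t <= E (x t) t"
  proof -
   have "h * g t = (\<Sum>j\<in>idx N. h * (norm (pcurv N (x t) j - pcurv N (X t) j))^2)
     + (\<Sum>j\<in>idx N. h * (norm (edge N (%i. x t i - X t i) j) / h)^2)"
    unfolding g_def sum.distrib[symmetric] sum_distrib_left
    using cut(2)[OF t le] t by (intro sum.cong) (auto simp: algebra_simps)
   also have "... <= E (x t) t" unfolding E_def using h by (simp add: sum_nonneg)
   finally show ?thesis .
  qed
  ultimately have "h * g t <= h * (energy_const A lam T * h)" by (simp add: power2_eq_square mult_ac)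
  then have "g t <= energy_const A lam T * h" using h by simp
  also have "... < 1 / A^2"
   using small A_pos by (simp only: pos_less_divide_eq zero_less_power mult_ac)
  finally show "g t < 1 / A^2" .
 qed
 have cx': "continuous_on {0..T} (%t. x' t j)" if j: "j \<in> idx N" for j
 proof -
  have "lip_nodal N (%z::nat => 'a. cfield p q N lam hh z j)"
   unfolding lip_nodal_def using Lc j by blast
  then show ?thesis unfolding x'_def by (rule continuous_on_lip_nodal[where f = "%z. cfield p q N lam hh z j"]) (rule xc)
 qed
 show ?thesis
 proof (rule exI[of _ x], rule exI[of _ x'], intro conjI ballI)
  fix t j assume t: "t \<in> {0..T}" and j: "j \<in> idx N"
  show "((%s. x s j) has_vector_derivative x' t j) (at t within {0..T})"
   unfolding x'_def by (rule xD[OF t j])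
  show "pmass N (x t) j *\<^sub>R x' t j = pflux N lam hh (x t) j - pflux N lam hh (x t) (nxt N j)"
   by (rule cut(3)[OF t less_imp_le[OF gle[OF t]] j])
 next
  fix t assume t: "t \<in> {0..T}"
  show "good (x t)" by (rule cut(1)[OF t less_imp_le[OF gle[OF t]]])
 qed (simp_all only: cx' x0)
qed

end

section \<open>Uniform smallness together with the time derivative\<close>

lemma rsqrt_has_vector_derivative:
 assumes f: "(f has_vector_derivative f') (at x within S)" and p: "0 < f x"
 shows "((%s. inverse (sqrt (f s))) has_vector_derivative
   - (f' * (inverse (sqrt (f x)) * inverse (sqrt (f x)) * inverse (sqrt (f x)))) / 2) (at x within S)"
proof -
 have "((%s. sqrt (f s)) has_real_derivative inverse (sqrt (f x)) / 2 * f') (at x within S)"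
  by (rule DERIV_chain2[OF DERIV_real_sqrt f[folded has_real_derivative_iff_has_vector_derivative]]) (use p in auto)
 from DERIV_inverse'[OF this] p show ?thesis
  unfolding has_real_derivative_iff_has_vector_derivative by (simp add: mult_ac)
qed

text \<open>One integration raises the order by one and keeps the constant. Factorials are given up,
  since only orders in h matter.\<close>

lemma integrated_bound:
 fixes S R :: "real => 'a::real_normed_vector"
 assumes d: "!!v. (S has_vector_derivative R v) (at v)" and R: "!!v. norm (R v) <= C * \<bar>v\<bar> ^ n" and S: "S 0 = 0" and C: "0 <= C"
 shows "norm (S v) <= C * \<bar>v\<bar> ^ Suc n"
proof -
 have "norm (S v - S 0) <= (C * \<bar>v\<bar> ^ n) * norm (v - 0)"
 proof (rule differentiable_bound)
  show "convex (closed_segment 0 v)" by simp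
  fix w assume w: "w \<in> closed_segment 0 v"
  show "(S has_derivative (%k. k *\<^sub>R R w)) (at w within closed_segment 0 v)"
   using d[of w] unfolding has_vector_derivative_def by (rule has_derivative_at_withinI)
  have "\<bar>w\<bar> <= \<bar>v\<bar>" using w by (auto simp: closed_segment_eq_real_ivl split: if_splits)
  then have "C * \<bar>w\<bar> ^ n <= C * \<bar>v\<bar> ^ n" using C by (intro mult_left_mono power_mono) auto
  then have "norm (R w) <= C * \<bar>v\<bar> ^ n" using R[of w] by linarith
  then show "onorm (%k. k *\<^sub>R R w) <= C * \<bar>v\<bar> ^ n"
   using C by (intro onorm_bound) (auto simp: mult.commute intro: mult_left_mono)
 qed auto
 then show ?thesis using S by (simp add: mult_ac)
qed

lemma has_vector_derivative_shift_arg: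
 assumes "(f has_vector_derivative f') (at (u + v))" shows "((%v. f (u + v)) has_vector_derivative f') (at v)"
proof -
 have "((%v. u + v) has_vector_derivative 1) (at v)" by (auto intro!: derivative_eq_intros)
 from vector_diff_chain_at[OF this] assms show ?thesis by (simp add: o_def)
qed

lemma taylor2_bound:
 fixes f0 f1 f2 :: "real => 'a::real_normed_vector"
 assumes d: "!!v. (f0 has_vector_derivative f1 v) (at v)" "!!v. (f1 has_vector_derivative f2 v) (at v)"
  and C: "!!v. norm (f2 v) <= C"
 shows "norm (f0 (u + b) - f0 u - b *\<^sub>R f1 u) <= C * \<bar>b\<bar> ^ 2"
proof -
 have C0: "0 <= C" using C[of 0] norm_ge_zero order_trans by blast
 note sh = d[THEN has_vector_derivative_shift_arg]
 have 1: "norm (f1 (u + v) - f1 u) <= C * \<bar>v\<bar> ^ Suc 0" for v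
 proof (rule integrated_bound[where R = "%v. f2 (u + v)"])
  show "((%v. f1 (u + v) - f1 u) has_vector_derivative f2 (u + v)) (at v)" for v
   using sh(2) by (auto intro!: derivative_eq_intros)
 qed (use C C0 in auto)
 have "norm (f0 (u + v) - f0 u - v *\<^sub>R f1 u) <= C * \<bar>v\<bar> ^ Suc (Suc 0)" for v
 proof (rule integrated_bound[where R = "%v. f1 (u + v) - f1 u"])
  show "((%v. f0 (u + v) - f0 u - v *\<^sub>R f1 u) has_vector_derivative f1 (u + v) - f1 u) (at v)" for v
   using sh(1) by (auto intro!: derivative_eq_intros)
 qed (use 1 C0 in auto)
 then show ?thesis by (simp add: numeral_2_eq_2)
qed

lemma taylor4_bound:
 fixes f0 f1 f2 f3 f4 :: "real => 'a::real_normed_vector"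
 assumes d: "!!v. (f0 has_vector_derivative f1 v) (at v)" "!!v. (f1 has_vector_derivative f2 v) (at v)"
  "!!v. (f2 has_vector_derivative f3 v) (at v)" "!!v. (f3 has_vector_derivative f4 v) (at v)"
  and C: "!!v. norm (f4 v) <= C"
 shows "norm (f0 (u + b) - f0 u - b *\<^sub>R f1 u - (b^2 / 2) *\<^sub>R f2 u - (b ^ 3 / 6) *\<^sub>R f3 u) <= C * \<bar>b\<bar> ^ 4"
proof -
 have C0: "0 <= C" using C[of 0] norm_ge_zero order_trans by blast
 note sh = d[THEN has_vector_derivative_shift_arg]
 have 2: "norm (f2 (u + v) - f2 u - v *\<^sub>R f3 u) <= C * \<bar>v\<bar> ^ 2" for v
  by (rule taylor2_bound[OF d(3,4) C])
 have 3: "norm (f1 (u + v) - f1 u - v *\<^sub>R f2 u - (v^2 / 2) *\<^sub>R f3 u) <= C * \<bar>v\<bar> ^ Suc 2" for v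
 proof (rule integrated_bound[where R = "%v. f2 (u + v) - f2 u - v *\<^sub>R f3 u"])
  show "((%v. f1 (u + v) - f1 u - v *\<^sub>R f2 u - (v^2 / 2) *\<^sub>R f3 u) has_vector_derivative f2 (u + v) - f2 u - v *\<^sub>R f3 u) (at v)" for v
   using sh(2) by (auto intro!: derivative_eq_intros simp: power2_eq_square)
 qed (use 2 C0 in auto)
 have "norm (f0 (u + v) - f0 u - v *\<^sub>R f1 u - (v^2 / 2) *\<^sub>R f2 u - (v ^ 3 / 6) *\<^sub>R f3 u) <= C * \<bar>v\<bar> ^ Suc (Suc 2)" for v
 proof (rule integrated_bound[where R = "%v. f1 (u + v) - f1 u - v *\<^sub>R f2 u - (v^2 / 2) *\<^sub>R f3 u"])
  show "((%v. f0 (u + v) - f0 u - v *\<^sub>R f1 u - (v^2 / 2) *\<^sub>R f2 u - (v ^ 3 / 6) *\<^sub>R f3 u) has_vector_derivative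
   f1 (u + v) - f1 u - v *\<^sub>R f2 u - (v^2 / 2) *\<^sub>R f3 u) (at v)" for v
   using sh(1) by (auto intro!: derivative_eq_intros simp: power2_eq_square power3_eq_cube)
 qed (use 3 C0 in auto)
 then show ?thesis by (simp add: eval_nat_numeral)
qed

text \<open>The consistency errors have to be small together with their time derivatives, uniformly over all
 solutions and meshes under consideration. These are collected in an index set \<open>I\<close>, and \<open>h\<close> is the
 mesh size belonging to an index.\<close>

locale jets =
 fixes T :: real and I :: "'w set" and h :: "'w => real"
 assumes h: "q \<in> I ==> 0 < h q & h q <= 1"
begin

definition small :: "nat => ('w => real => 'a::real_normed_vector) => bool" where
 "small k A \<longleftrightarrow> (\<exists>C\<ge>0. \<forall>q\<in>I. \<forall>t\<in>{0..T}. \<exists>A'. (A q has_vector_derivative A') (at t within {0..T})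
   & norm (A q t) <= C * h q ^ k & norm A' <= C * h q ^ k)"

text \<open>\<open>small\<close> with the constant and the time derivative named, the latter as a
  function of index and time.\<close>

definition bnd where
 "bnd k A A' C \<longleftrightarrow> 0 <= C & (\<forall>q\<in>I. \<forall>t\<in>{0..T}. (A q has_vector_derivative A' q t) (at t within {0..T})
   & norm (A q t :: 'a::real_normed_vector) <= C * h q ^ k & norm (A' q t) <= C * h q ^ k)"

lemma bndD:
 assumes "bnd k A A' C"
 shows "0 <= C"
  "!!q t. q \<in> I ==> t \<in> {0..T} ==> (A q has_vector_derivative A' q t) (at t within {0..T})"
  "!!q t. q \<in> I ==> t \<in> {0..T} ==> norm (A q t) <= C * h q ^ k"
  "!!q t. q \<in> I ==> t \<in> {0..T} ==> norm (A' q t) <= C * h q ^ k"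
 using assms unfolding bnd_def by auto

lemma small_I:
 assumes "!!q t. q \<in> I ==> t \<in> {0..T} ==> (A q has_vector_derivative A' q t) (at t within {0..T})"
  and "!!q t. q \<in> I ==> t \<in> {0..T} ==> norm (A q t) <= C * h q ^ k"
  and "!!q t. q \<in> I ==> t \<in> {0..T} ==> norm (A' q t) <= C' * h q ^ k"
 shows "small k A"
 unfolding small_def
proof (intro exI[of _ "max 0 (max C C')"] conjI ballI)
 fix q t assume w: "q \<in> I" and t: "t \<in> {0..T}"
 have "0 <= h q ^ k" using h[OF w] by simp
 then have "C * h q ^ k <= max 0 (max C C') * h q ^ k" "C' * h q ^ k <= max 0 (max C C') * h q ^ k"
  by (intro mult_right_mono; simp)+
 then have "norm (A q t) <= max 0 (max C C') * h q ^ k" "norm (A' q t) <= max 0 (max C C') * h q ^ k"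
  using assms(2,3)[OF w t] by linarith+
 with assms(1)[OF w t] show "\<exists>A'. (A q has_vector_derivative A') (at t within {0..T})
   & norm (A q t) <= max 0 (max C C') * h q ^ k & norm A' <= max 0 (max C C') * h q ^ k"
  by (intro exI conjI)
qed simp

lemma small_E:
 assumes "small k A"
 obtains C A' where "bnd k A A' C"
proof -
 obtain C where C: "0 <= C" "\<forall>q\<in>I. \<forall>t\<in>{0..T}. \<exists>A'. (A q has_vector_derivative A') (at t within {0..T})
   & norm (A q t) <= C * h q ^ k & norm A' <= C * h q ^ k"
  using assms unfolding small_def by (elim exE conjE)
 define A' where "A' q t = (SOME A'. (A q has_vector_derivative A') (at t within {0..T})
   & norm (A q t) <= C * h q ^ k & norm A' <= C * h q ^ k)" for q t
 have *: "(A q has_vector_derivative A' q t) (at t within {0..T})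
   & norm (A q t) <= C * h q ^ k & norm (A' q t) <= C * h q ^ k" if "q \<in> I" "t \<in> {0..T}" for q t
  unfolding A'_def by (rule someI_ex) (rule bspec[OF bspec[OF C(2) that(1)] that(2)])
 show thesis by (rule that[of A' C]) (use C(1) * in \<open>simp add: bnd_def\<close>)
qed

lemma small_cong:
 assumes "small k B" and eq: "!!q t. q \<in> I ==> t \<in> {0..T} ==> A q t = B q t"
 shows "small k A"
proof -
 obtain C B' where "bnd k B B' C" by (rule small_E[OF assms(1)])
 note B = bndD[OF this]
 show ?thesis
 proof (rule small_I[where A' = B'])
  fix q t assume w: "q \<in> I" and t: "t \<in> {0..T}"
  show "(A q has_vector_derivative B' q t) (at t within {0..T})"
   by (rule has_vector_derivative_transform[OF t _ B(2)[OF w t]]) (rule eq[OF w])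
  show "norm (A q t) <= C * h q ^ k" using B(3)[OF w t] eq[OF w t] by simp
  show "norm (B' q t) <= C * h q ^ k" by (rule B(4)[OF w t])
 qed
qed

lemma small_mono:
 assumes "small l A" "k <= l" shows "small k A"
proof -
 obtain C A' where "bnd l A A' C" by (rule small_E[OF assms(1)])
 note A = bndD[OF this]
 have "C * h q ^ l <= C * h q ^ k" if "q \<in> I" for q
  using h[OF that] assms(2) A(1) by (intro mult_left_mono power_decreasing) auto
 then show ?thesis
  by (intro small_I[where A' = A' and C = C and C' = C] A(2) order_trans[OF A(3)] order_trans[OF A(4)])
qed

lemma small_add:
 assumes "small k A" "small k B" shows "small k (%q t. A q t + B q t)"
proof -
 obtain C A' where "bnd k A A' C" by (rule small_E[OF assms(1)])
 note A = bndD[OF this]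
 obtain D B' where "bnd k B B' D" by (rule small_E[OF assms(2)])
 note B = bndD[OF this]
 show ?thesis
 proof (rule small_I[where A' = "%q t. A' q t + B' q t" and C = "C + D" and C' = "C + D"])
  fix q t assume w: "q \<in> I" and t: "t \<in> {0..T}"
  show "((%t. A q t + B q t) has_vector_derivative A' q t + B' q t) (at t within {0..T})"
   by (rule has_vector_derivative_add[OF A(2)[OF w t] B(2)[OF w t]])
  show "norm (A q t + B q t) <= (C + D) * h q ^ k" "norm (A' q t + B' q t) <= (C + D) * h q ^ k"
   unfolding distrib_right by (intro norm_triangle_mono A B w t)+
 qed
qed

lemma small_prod:
 fixes A :: "'w => real => 'a::real_normed_vector" and B :: "'w => real => 'b::real_normed_vector"
  and pr :: "'a => 'b => 'c::real_normed_vector"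
 assumes bl: "bounded_bilinear pr" and "small k A" "small l B" shows "small (k + l) (%q t. pr (A q t) (B q t))"
proof -
 obtain C A' where "bnd k A A' C" by (rule small_E[OF assms(2)])
 note A = bndD[OF this]
 obtain D B' where "bnd l B B' D" by (rule small_E[OF assms(3)])
 note B = bndD[OF this]
 obtain K where K: "K > 0" "!!u v. norm (pr u v) <= norm u * norm v * K"
  using bounded_bilinear.pos_bounded[OF bl] by blast
 have pr: "norm (pr u v) <= (C * D * K) * h q ^ (k + l)"
  if "q \<in> I" "norm u <= C * h q ^ k" "norm v <= D * h q ^ l" for u v q
 proof -
  have "norm (pr u v) <= (C * h q ^ k) * (D * h q ^ l) * K"
   by (rule order_trans[OF K(2)]) (use that K A(1) h[OF that(1)] in \<open>intro mult_right_mono mult_mono; auto\<close>)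
  then show ?thesis by (simp add: power_add mult_ac)
 qed
 show ?thesis
 proof (rule small_I[where A' = "%q t. pr (A q t) (B' q t) + pr (A' q t) (B q t)" and C = "C * D * K" and C' = "C * D * K + C * D * K"])
  fix q t assume w: "q \<in> I" and t: "t \<in> {0..T}"
  show "((%t. pr (A q t) (B q t)) has_vector_derivative pr (A q t) (B' q t) + pr (A' q t) (B q t)) (at t within {0..T})"
   by (rule bounded_bilinear.has_vector_derivative[OF bl A(2)[OF w t] B(2)[OF w t]])
  show "norm (pr (A q t) (B q t)) <= C * D * K * h q ^ (k + l)" by (intro pr A B w t)
  show "norm (pr (A q t) (B' q t) + pr (A' q t) (B q t)) <= (C * D * K + C * D * K) * h q ^ (k + l)"
   unfolding distrib_right by (intro norm_triangle_mono pr A B w t)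
 qed
qed

lemmas small_scaleR = small_prod[OF bounded_bilinear_scaleR]
lemmas small_inner = small_prod[OF bounded_bilinear_inner]
lemmas small_mult = small_prod[OF bounded_bilinear_mult]

lemma small_step:
 assumes "!!q. q \<in> I ==> norm (b q) <= C * h q ^ k"
 shows "small k (%q t. b q)"
 by (rule small_I[where A' = "%_ _. 0" and C = C and C' = 0]) (use assms in auto)

lemma small_const: "small 0 (%q t. c)"
 by (rule small_step[where C = "norm c"]) auto

lemma small_uminus: "small k A ==> small k (%q t. - A q t)"
 using small_scaleR[of 0 "%_ _. - 1" k A] small_const[of "- 1 :: real"] by simp

lemma small_diff: "small k A ==> small k B ==> small k (%q t. A q t - B q t)"
 using small_add[of k A "%q t. - B q t"] small_uminus[of k B] by simp

lemma small_inverse: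
 fixes A :: "'w => real => real"
 assumes "small 0 A" and c: "0 < c" "!!q t. q \<in> I ==> t \<in> {0..T} ==> c <= A q t"
 shows "small 0 (%q t. inverse (A q t))"
proof -
 obtain C A' where "bnd 0 A A' C" by (rule small_E[OF assms(1)])
 note A = bndD[OF this]
 show ?thesis
 proof (rule small_I[where A' = "%q t. - (inverse (A q t) * A' q t * inverse (A q t))" and C = "inverse c" and C' = "inverse c * C * inverse c"])
  fix q t assume w: "q \<in> I" and t: "t \<in> {0..T}"
  have p: "c <= A q t" by (rule c(2)[OF w t])
  have i: "\<bar>inverse (A q t)\<bar> <= inverse c" using p c(1) by (simp add: le_imp_inverse_le)
  show "((%t. inverse (A q t)) has_vector_derivative - (inverse (A q t) * A' q t * inverse (A q t))) (at t within {0..T})"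
   unfolding has_real_derivative_iff_has_vector_derivative[symmetric]
   by (rule DERIV_inverse'[OF A(2)[OF w t, folded has_real_derivative_iff_has_vector_derivative]]) (use p c in auto)
  show "norm (inverse (A q t)) <= inverse c * h q ^ 0" using i by simp
  have "\<bar>inverse (A q t) * A' q t * inverse (A q t)\<bar> <= inverse c * C * inverse c"
   using A(4)[OF w t] by (intro abs_mult_le i) simp
  then show "norm (- (inverse (A q t) * A' q t * inverse (A q t))) <= inverse c * C * inverse c * h q ^ 0" by simp
 qed
qed

lemma small_sqrt:
 assumes "small 0 A" and c: "0 < c" "!!q t. q \<in> I ==> t \<in> {0..T} ==> c <= A q t"
 shows "small 0 (%q t. sqrt (A q t))"
proof -
 obtain C A' where "bnd 0 A A' C" by (rule small_E[OF assms(1)])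
 note A = bndD[OF this]
 show ?thesis
 proof (rule small_I[where A' = "%q t. A' q t * (inverse (sqrt (A q t)) / 2)" and C = "sqrt C" and C' = "C * inverse (sqrt c)"])
  fix q t assume w: "q \<in> I" and t: "t \<in> {0..T}"
  have p: "c <= A q t" by (rule c(2)[OF w t])
  have i: "\<bar>inverse (sqrt (A q t)) / 2\<bar> <= inverse (sqrt c)"
  proof -
   have "inverse (sqrt (A q t)) <= inverse (sqrt c)" "0 <= inverse (sqrt (A q t))"
    using p c(1) by (auto intro: le_imp_inverse_le)
   then show ?thesis unfolding abs_le_iff by linarith
  qed
  have "((%t. sqrt (A q t)) has_real_derivative inverse (sqrt (A q t)) / 2 * A' q t) (at t within {0..T})"
   by (rule DERIV_chain2[OF DERIV_real_sqrt A(2)[OF w t, folded has_real_derivative_iff_has_vector_derivative]])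
    (use p c in auto)
  then show "((%t. sqrt (A q t)) has_vector_derivative A' q t * (inverse (sqrt (A q t)) / 2)) (at t within {0..T})"
   by (simp add: has_real_derivative_iff_has_vector_derivative mult.commute)
  show "norm (sqrt (A q t)) <= sqrt C * h q ^ 0" using A(3)[OF w t] p c by simp
  have "\<bar>A' q t * (inverse (sqrt (A q t)) / 2)\<bar> <= C * inverse (sqrt c)"
   using A(4)[OF w t] by (intro abs_mult_le i) simp
  then show "norm (A' q t * (inverse (sqrt (A q t)) / 2)) <= C * inverse (sqrt c) * h q ^ 0" by simp
 qed
qed

text \<open>All mesh widths are comparable to h, so each division by one costs exactly one
  order.\<close>

lemma small_divide_step:
 assumes A: "small (Suc k) A" and b: "!!q. q \<in> I ==> h q <= c * \<bar>b q\<bar> & b q ~= 0"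
 shows "small k (%q t. A q t /\<^sub>R b q)"
proof -
 obtain C A' where "bnd (Suc k) A A' C" by (rule small_E[OF A])
 note A = bndD[OF this]
 have *: "norm (v /\<^sub>R b q) <= (c * C) * h q ^ k" if w: "q \<in> I" and v: "norm v <= C * h q ^ Suc k" for v q
 proof -
  have "C * h q ^ k * h q <= C * h q ^ k * (c * \<bar>b q\<bar>)"
   using b[OF w] h[OF w] A(1) by (intro mult_left_mono) auto
  then have "norm v <= (c * C) * h q ^ k * \<bar>b q\<bar>" using v by (simp add: mult_ac)
  then show ?thesis using b[OF w] by (simp add: field_simps)
 qed
 show ?thesis
 proof (rule small_I[where A' = "%q t. A' q t /\<^sub>R b q" and C = "c * C" and C' = "c * C"])
  fix q t assume w: "q \<in> I" and t: "t \<in> {0..T}"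
  show "((%t. A q t /\<^sub>R b q) has_vector_derivative A' q t /\<^sub>R b q) (at t within {0..T})"
   by (rule bounded_linear.has_vector_derivative[OF bounded_linear_scaleR_right A(2)[OF w t]])
 qed (intro * A; assumption)+
qed

text \<open>For passing to a neighbouring node, which belongs to the same mesh.\<close>

lemma small_shift:
 assumes A: "small k A" and p: "!!q. q \<in> I ==> p q \<in> I & h (p q) = h q"
 shows "small k (%q. A (p q))"
proof -
 obtain C A' where "bnd k A A' C" by (rule small_E[OF A])
 note A = bndD[OF this]
 show ?thesis
 proof (rule small_I[where A' = "%q. A' (p q)" and C = C and C' = C])
  fix q t assume w: "q \<in> I" and t: "t \<in> {0..T}"
  note p = conjunct1[OF p[OF w]] conjunct2[OF p[OF w]]
  show "(A (p q) has_vector_derivative A' (p q) t) (at t within {0..T})" by (rule A(2)[OF p(1) t])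
  show "norm (A (p q) t) <= C * h q ^ k" "norm (A' (p q) t) <= C * h q ^ k"
   using A(3,4)[OF p(1) t] by (simp_all add: p(2))
 qed
qed

text \<open>\<open>SS k A A'\<close>: the time derivative of \<open>A\<close> is \<open>A'\<close>, and both have \<open>k\<close> derivatives in \<open>u\<close>, which commute with the
 time derivative; all these are bounded.\<close>

definition SS0 :: "('w => real => real => 'a::real_normed_vector) => ('w => real => real => 'a) => bool" where
 "SS0 A A' \<longleftrightarrow> (\<exists>C. \<forall>q\<in>I. \<forall>t\<in>{0..T}. \<forall>u. norm (A q t u) <= C & norm (A' q t u) <= C
   & ((%s. A q s u) has_vector_derivative A' q t u) (at t within {0..T}))"

definition u_deriv :: "('w => real => real => 'a::real_normed_vector) => ('w => real => real => 'a) => bool" where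
 "u_deriv A B \<longleftrightarrow> (\<forall>q\<in>I. \<forall>t\<in>{0..T}. \<forall>u. (A q t has_vector_derivative B q t u) (at u))"

primrec SS :: "nat => ('w => real => real => 'a::real_normed_vector) => ('w => real => real => 'a) => bool" where
 "SS 0 A A' \<longleftrightarrow> SS0 A A'"
| "SS (Suc k) A A' \<longleftrightarrow> SS0 A A' & (\<exists>B B'. u_deriv A B & u_deriv A' B' & SS k B B')"

lemma SS_SS0: "SS k A A' ==> SS0 A A'"
 by (cases k) auto

lemma SS_Suc: "SS (Suc k) A A' ==> SS k A A'"
proof (induction k arbitrary: A A')
 case (Suc k)
 from Suc.prems obtain B B' where "u_deriv A B" "u_deriv A' B'" "SS (Suc k) B B'" "SS0 A A'"
  by (auto simp del: SS.simps simp: SS.simps(2)[of "Suc k"])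
 with Suc.IH[of B B'] show ?case unfolding SS.simps(2)[of k] by blast
qed simp

lemma SS_mono: "SS l A A' ==> k <= l ==> SS k A A'"
proof (induction l)
 case (Suc l)
 then show ?case by (cases "k = Suc l") (use SS_Suc le_SucE in blast)+
qed simp

lemma SS0_add:
 assumes "SS0 A A'" "SS0 B B'" shows "SS0 (%q t u. A q t u + B q t u) (%q t u. A' q t u + B' q t u)"
proof -
 obtain C where C: "\<forall>q\<in>I. \<forall>t\<in>{0..T}. \<forall>u. norm (A q t u) <= C & norm (A' q t u) <= C
   & ((%s. A q s u) has_vector_derivative A' q t u) (at t within {0..T})" using assms(1) unfolding SS0_def by blast
 obtain D where D: "\<forall>q\<in>I. \<forall>t\<in>{0..T}. \<forall>u. norm (B q t u) <= D & norm (B' q t u) <= D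
   & ((%s. B q s u) has_vector_derivative B' q t u) (at t within {0..T})" using assms(2) unfolding SS0_def by blast
 show ?thesis unfolding SS0_def
  by (rule exI[of _ "C + D"]) (use C D in \<open>auto intro!: norm_triangle_mono has_vector_derivative_add\<close>)
qed

lemma u_deriv_add: "u_deriv A B ==> u_deriv A2 B2 ==> u_deriv (%q t u. A q t u + A2 q t u) (%q t u. B q t u + B2 q t u)"
 unfolding u_deriv_def by (auto intro!: has_vector_derivative_add)

lemma SS_add: "SS k A A' ==> SS k B B' ==> SS k (%q t u. A q t u + B q t u) (%q t u. A' q t u + B' q t u)"
proof (induction k arbitrary: A A' B B')
 case (Suc k)
 obtain a a' b b' where "u_deriv A a" "u_deriv A' a'" "SS k a a'" "u_deriv B b" "u_deriv B' b'" "SS k b b'"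
  using Suc.prems by auto
 then show ?case using Suc SS0_add[of A A' B B'] by (auto intro!: u_deriv_add exI)
qed (simp add: SS0_add)

lemma SS0_prod:
 fixes A A' :: "'w => real => real => 'a::real_normed_vector" and B B' :: "'w => real => real => 'b::real_normed_vector"
  and pr :: "'a => 'b => 'c::real_normed_vector"
 assumes bl: "bounded_bilinear pr" and "SS0 A A'" "SS0 B B'"
 shows "SS0 (%q t u. pr (A q t u) (B q t u)) (%q t u. pr (A q t u) (B' q t u) + pr (A' q t u) (B q t u))"
proof -
 obtain C where C: "\<forall>q\<in>I. \<forall>t\<in>{0..T}. \<forall>u. norm (A q t u) <= C & norm (A' q t u) <= C
   & ((%s. A q s u) has_vector_derivative A' q t u) (at t within {0..T})" using assms(2) unfolding SS0_def by blast
 obtain D where D: "\<forall>q\<in>I. \<forall>t\<in>{0..T}. \<forall>u. norm (B q t u) <= D & norm (B' q t u) <= D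
   & ((%s. B q s u) has_vector_derivative B' q t u) (at t within {0..T})" using assms(3) unfolding SS0_def by blast
 obtain K where K: "K > 0" "!!u v. norm (pr u v) <= norm u * norm v * K"
  using bounded_bilinear.pos_bounded[OF bl] by blast
 have pr: "norm (pr u v) <= C * D * K" if "norm u <= C" "norm v <= D" for u v
  by (rule order_trans[OF K(2)])
   (use that K order_trans[OF norm_ge_zero that(1)] in \<open>intro mult_right_mono mult_mono; auto\<close>)
 show ?thesis unfolding SS0_def
 proof (intro exI[of _ "\<bar>C * D * K\<bar> + \<bar>C * D * K\<bar>"] ballI allI conjI)
  fix q t u assume w: "q \<in> I" and t: "t \<in> {0..T}"
  have "norm (pr (A q t u) (B q t u)) <= C * D * K" "norm (pr (A q t u) (B' q t u)) <= C * D * K"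
   "norm (pr (A' q t u) (B q t u)) <= C * D * K"
   using C D w t by (auto intro!: pr)
  then show "norm (pr (A q t u) (B q t u)) <= \<bar>C * D * K\<bar> + \<bar>C * D * K\<bar>"
   "norm (pr (A q t u) (B' q t u) + pr (A' q t u) (B q t u)) <= \<bar>C * D * K\<bar> + \<bar>C * D * K\<bar>"
   using norm_triangle_ineq[of "pr (A q t u) (B' q t u)" "pr (A' q t u) (B q t u)"] by linarith+
  show "((%s. pr (A q s u) (B q s u)) has_vector_derivative pr (A q t u) (B' q t u) + pr (A' q t u) (B q t u)) (at t within {0..T})"
   using C D w t by (intro bounded_bilinear.has_vector_derivative[OF bl]) auto
 qed
qed

lemma u_deriv_prod:
 assumes "bounded_bilinear pr" "u_deriv A a" "u_deriv B b"
 shows "u_deriv (%q t u. pr (A q t u) (B q t u)) (%q t u. pr (A q t u) (b q t u) + pr (a q t u) (B q t u))"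
 using assms unfolding u_deriv_def by (auto intro!: bounded_bilinear.has_vector_derivative)

lemma SS_prod:
 fixes A A' :: "'w => real => real => 'a::real_normed_vector" and B B' :: "'w => real => real => 'b::real_normed_vector"
  and pr :: "'a => 'b => 'c::real_normed_vector"
 assumes bl: "bounded_bilinear pr"
 shows "SS k A A' ==> SS k B B' ==>
  SS k (%q t u. pr (A q t u) (B q t u)) (%q t u. pr (A q t u) (B' q t u) + pr (A' q t u) (B q t u))"
proof (induction k arbitrary: A A' B B')
 case (Suc k)
 obtain a a' b b' where ab: "u_deriv A a" "u_deriv A' a'" "SS k a a'" "u_deriv B b" "u_deriv B' b'" "SS k b b'"
  using Suc.prems by auto
 have k: "SS k A A'" "SS k B B'" using Suc.prems SS_Suc by blast+
 let ?D = "%q t u. pr (A q t u) (b q t u) + pr (a q t u) (B q t u)"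
 let ?D' = "%q t u. (pr (A q t u) (b' q t u) + pr (a q t u) (B' q t u)) + (pr (A' q t u) (b q t u) + pr (a' q t u) (B q t u))"
 have "SS k ?D (%q t u. (pr (A q t u) (b' q t u) + pr (A' q t u) (b q t u)) + (pr (a q t u) (B' q t u) + pr (a' q t u) (B q t u)))"
  by (rule SS_add[OF Suc.IH[OF k(1) ab(6)] Suc.IH[OF ab(3) k(2)]])
 \<comment> \<open>The time derivative of the u-derivative and the u-derivative of the time
   derivative consist of the same four products in different order; here they are made to
   agree.\<close>
 then have "SS k ?D ?D'" by (simp add: add_ac)
 moreover have "u_deriv (%q t u. pr (A q t u) (B q t u)) ?D"
  by (rule u_deriv_prod[OF bl ab(1) ab(4)])
 moreover have "u_deriv (%q t u. pr (A q t u) (B' q t u) + pr (A' q t u) (B q t u)) ?D'"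
  by (rule u_deriv_add[OF u_deriv_prod[OF bl ab(1) ab(5)] u_deriv_prod[OF bl ab(2) ab(4)]])
 moreover have "SS0 (%q t u. pr (A q t u) (B q t u)) (%q t u. pr (A q t u) (B' q t u) + pr (A' q t u) (B q t u))"
  using Suc.prems by (intro SS0_prod[OF bl]) (auto intro: SS_SS0)
 ultimately show ?case unfolding SS.simps by blast
qed (simp add: SS0_prod[OF bl])

lemma u_deriv_const: "u_deriv (%_ _ _. c) (%_ _ _. 0)"
 by (simp add: u_deriv_def)

lemma SS_const: "SS k (%_ _ _. c) (%_ _ _. 0)"
proof (induction k arbitrary: c)
 case 0
 show ?case by (auto simp: SS0_def intro!: exI[of _ "norm c"])
next
 case (Suc k)
 have "SS0 (%_ _ _. c) (%_ _ _. 0)" by (auto simp: SS0_def intro!: exI[of _ "norm c"])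
 then show ?case using Suc.IH[of 0] u_deriv_const unfolding SS.simps by blast
qed

lemma SS0_cong:
 assumes "SS0 A A'" and eq: "!!q t u. q \<in> I ==> t \<in> {0..T} ==> B q t u = A q t u & B' q t u = A' q t u"
 shows "SS0 B B'"
proof -
 obtain C where C: "\<forall>q\<in>I. \<forall>t\<in>{0..T}. \<forall>u. norm (A q t u) <= C & norm (A' q t u) <= C
   & ((%s. A q s u) has_vector_derivative A' q t u) (at t within {0..T})" using assms(1) unfolding SS0_def by blast
 show ?thesis unfolding SS0_def
 proof (intro exI[of _ C] ballI allI conjI)
  fix q t u assume w: "q \<in> I" and t: "t \<in> {0..T}"
  show "norm (B q t u) <= C" "norm (B' q t u) <= C" using C w t eq[OF w t] by auto
  have "((%s. A q s u) has_vector_derivative B' q t u) (at t within {0..T})" using C w t eq[OF w t] by auto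
  then show "((%s. B q s u) has_vector_derivative B' q t u) (at t within {0..T})"
   by (rule has_vector_derivative_transform[OF t, rotated]) (simp add: eq[OF w])
 qed
qed

lemma u_deriv_cong:
 assumes "u_deriv A B" and eq: "!!q t u. q \<in> I ==> t \<in> {0..T} ==> A2 q t u = A q t u & B2 q t u = B q t u"
 shows "u_deriv A2 B2"
proof -
 have "A2 q t = A q t" if "q \<in> I" "t \<in> {0..T}" for q t using eq[OF that] by auto
 then show ?thesis using assms unfolding u_deriv_def by simp
qed

lemma SS_cong:
 "SS k A A' ==> (!!q t u. q \<in> I ==> t \<in> {0..T} ==> B q t u = A q t u & B' q t u = A' q t u) ==> SS k B B'"
proof (cases k)
 case 0
 then show "SS k A A' ==> (!!q t u. q \<in> I ==> t \<in> {0..T} ==> B q t u = A q t u & B' q t u = A' q t u) ==> SS k B B'"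
  using SS0_cong[of A A' B B'] by simp
next
 case (Suc l)
 assume *: "SS k A A'" and eq: "!!q t u. q \<in> I ==> t \<in> {0..T} ==> B q t u = A q t u & B' q t u = A' q t u"
 obtain D D' where D: "u_deriv A D" "u_deriv A' D'" "SS l D D'" "SS0 A A'" using * Suc by auto
 have "u_deriv B D" by (rule u_deriv_cong[OF D(1)]) (simp add: eq)
 moreover have "u_deriv B' D'" by (rule u_deriv_cong[OF D(2)]) (simp add: eq)
 ultimately show "SS k B B'" using SS0_cong[OF D(4) eq] D(3) Suc by auto
qed

lemma u_deriv_unique:
 assumes "u_deriv A B" "u_deriv A C" "q \<in> I" "t \<in> {0..T}" shows "B q t u = C q t u"
 using assms unfolding u_deriv_def by (blast intro: vector_derivative_unique_at)

text \<open>The derivative of the inverse square root is a product of its own powers with the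
  derivative of \<open>A\<close>, so the induction needs only the product rule. Apart from sums and
  products this is the only operation from which tangent, curvature and flux are built.\<close>

lemma SS_rsqrt:
 assumes c: "0 < c" "!!q t u. q \<in> I ==> t \<in> {0..T} ==> c <= A q t u"
 shows "SS k A A' ==> SS k (%q t u. inverse (sqrt (A q t u)))
   (%q t u. - (A' q t u * (inverse (sqrt (A q t u)) * inverse (sqrt (A q t u)) * inverse (sqrt (A q t u)))) / 2)"
proof (induction k)
 let ?g = "%q t u. inverse (sqrt (A q t u))"
 let ?g3 = "%q t u. ?g q t u * ?g q t u * ?g q t u"
 have S0: "SS0 ?g (%q t u. - (A' q t u * ?g3 q t u) / 2)" if A: "SS0 A A'"
 proof -
  obtain C where C: "\<forall>q\<in>I. \<forall>t\<in>{0..T}. \<forall>u. norm (A q t u) <= C & norm (A' q t u) <= C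
   & ((%s. A q s u) has_vector_derivative A' q t u) (at t within {0..T})" using A unfolding SS0_def by blast
  define B where "B = inverse (sqrt c)"
  have B: "0 <= B" using c(1) by (simp add: B_def)
  show ?thesis unfolding SS0_def
  proof (intro exI[of _ "B + \<bar>C\<bar> * (B * B * B) / 2"] ballI allI conjI)
   fix q t u assume w: "q \<in> I" and t: "t \<in> {0..T}"
   have p: "c <= A q t u" by (rule c(2)[OF w t])
   have g: "\<bar>?g q t u\<bar> <= B" using p c(1) unfolding B_def by (auto intro!: le_imp_inverse_le)
   have n: "0 <= \<bar>C\<bar> * (B * B * B) / 2" using B by simp
   then show "norm (?g q t u) <= B + \<bar>C\<bar> * (B * B * B) / 2" using g unfolding real_norm_def by linarith
   have "\<bar>A' q t u * ?g3 q t u\<bar> <= \<bar>C\<bar> * (B * B * B)"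
    using C w t by (intro abs_mult_le g) (auto intro: order_trans[OF _ abs_ge_self])
   then show "norm (- (A' q t u * ?g3 q t u) / 2) <= B + \<bar>C\<bar> * (B * B * B) / 2" using B by simp
   show "((%s. ?g q s u) has_vector_derivative - (A' q t u * ?g3 q t u) / 2) (at t within {0..T})"
    by (rule rsqrt_has_vector_derivative) (use C w t p c(1) in auto)
  qed
 qed
 case 0
 then show ?case unfolding SS.simps by (rule S0)
next
 let ?g = "%q t u. inverse (sqrt (A q t u))"
 let ?g3 = "%q t u. ?g q t u * ?g q t u * ?g q t u"
 case (Suc k)
 note M = bounded_bilinear_mult
 let ?g' = "%q t u. - (A' q t u * ?g3 q t u) / 2"
 obtain a a' where a: "u_deriv A a" "u_deriv A' a'" "SS k a a'" and A: "SS0 A A'" using Suc.prems by auto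
 have g: "SS k ?g ?g'" by (rule Suc.IH[OF SS_Suc[OF Suc.prems]])
 let ?B = "%q t u. - (a q t u * ?g3 q t u) / 2"
 let ?B' = "%q t u. - (a q t u * (3 * ?g q t u * ?g q t u * ?g' q t u) + a' q t u * ?g3 q t u) / 2"
 have U1: "u_deriv ?g ?B"
  unfolding u_deriv_def
 proof (intro ballI allI)
  fix q t u assume w: "q \<in> I" and t: "t \<in> {0..T}"
  show "(?g q t has_vector_derivative ?B q t u) (at u)"
   by (rule rsqrt_has_vector_derivative) (use a(1) w t c(1) c(2)[OF w t, of u] in \<open>auto simp: u_deriv_def\<close>)
 qed
 have "SS k ?B ?B'"
  by (rule SS_cong[OF SS_prod[OF M SS_const[of k "- 1 / 2"] SS_prod[OF M a(3) SS_prod[OF M SS_prod[OF M g g] g]]]])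
   (simp add: algebra_simps add_divide_distrib diff_divide_distrib)
 moreover have "u_deriv ?g' ?B'"
  by (rule u_deriv_cong[OF u_deriv_prod[OF M u_deriv_const[of "- 1 / 2"]
    u_deriv_prod[OF M a(2) u_deriv_prod[OF M u_deriv_prod[OF M U1 U1] U1]]]])
   (simp add: algebra_simps add_divide_distrib diff_divide_distrib)
 moreover have "SS0 ?g ?g'" using SS_SS0[OF g] .
 ultimately show ?case using U1 unfolding SS.simps by blast
qed

text \<open>Hides the time derivative, so that the approximation arguments need to name only the
  field itself.\<close>

definition SX :: "nat => ('w => real => real => 'a::real_normed_vector) => bool" where
 "SX k A \<longleftrightarrow> (\<exists>A'. SS k A A')"

lemma SX_mono: "SX l A ==> k <= l ==> SX k A"
 unfolding SX_def using SS_mono by blast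

lemma SX_add: "SX k A ==> SX k B ==> SX k (%q t u. A q t u + B q t u)"
 unfolding SX_def using SS_add by blast

lemma SX_prod: "bounded_bilinear pr ==> SX k A ==> SX k B ==> SX k (%q t u. pr (A q t u) (B q t u))"
 unfolding SX_def using SS_prod by blast

lemma SX_const: "SX k (%_ _ _. c)"
 unfolding SX_def using SS_const by blast

lemma SX_uminus: "SX k A ==> SX k (%q t u. - A q t u)"
 using SX_prod[OF bounded_bilinear_scaleR SX_const[of k "- 1 :: real"], of A] by simp

lemma SX_diff: "SX k A ==> SX k B ==> SX k (%q t u. A q t u - B q t u)"
 using SX_add[of k A "%q t u. - B q t u"] SX_uminus[of k B] by simp

lemmas SX_inner = SX_prod[OF bounded_bilinear_inner]
lemmas SX_scaleR = SX_prod[OF bounded_bilinear_scaleR]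

lemma SX_deriv: "SX (Suc k) A ==> \<exists>B. u_deriv A B & SX k B"
 unfolding SX_def SS.simps by blast

lemma SX_deriv': "SX (Suc k) A ==> u_deriv A B ==> SX k B"
proof -
 assume A: "SX (Suc k) A" and B: "u_deriv A B"
 obtain D D' where D: "u_deriv A D" "SS k D D'" using A unfolding SX_def by auto
 show "SX k B" unfolding SX_def
  by (rule exI[of _ D'], rule SS_cong[OF D(2)]) (simp add: u_deriv_unique[OF B D(1)])
qed

lemma small_eval: assumes "SX 0 A" shows "small 0 (%q t. A q t (v q))"
proof -
 obtain A' C where "\<forall>q\<in>I. \<forall>t\<in>{0..T}. \<forall>u. norm (A q t u) <= C & norm (A' q t u) <= C
   & ((%s. A q s u) has_vector_derivative A' q t u) (at t within {0..T})"
  using assms unfolding SX_def SS.simps SS0_def by (elim exE)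
 then show ?thesis by (intro small_I[where A' = "%q t. A' q t (v q)" and C = C and C' = C]) auto
qed

context
 fixes v b :: "'w => real" and Cb :: real
 assumes b: "!!q. q \<in> I ==> \<bar>b q\<bar> <= Cb * h q"
begin

lemma power_step: "q \<in> I ==> 0 <= C ==> C * \<bar>b q\<bar> ^ n <= (C * Cb ^ n) * h q ^ n"
 using power_mono[OF b[of q], of n] mult_left_mono[of "\<bar>b q\<bar> ^ n" "Cb ^ n * h q ^ n" C]
 by (simp add: power_mult_distrib mult_ac)

lemma small_taylor2:
 assumes A: "SX 2 A" and B: "u_deriv A B"
 shows "small 2 (%q t. A q t (v q + b q) - A q t (v q) - b q *\<^sub>R B q t (v q))"
proof -
 obtain A' where "SS 2 A A'" using A unfolding SX_def by blast
 then obtain B1 B' D D' where S: "SS0 A A'" "u_deriv A B1" "u_deriv A' B'" "SS0 B1 B'" "u_deriv B1 D" "u_deriv B' D'" "SS0 D D'"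
  by (auto simp: numeral_2_eq_2)
 obtain C0 where C0: "\<forall>q\<in>I. \<forall>t\<in>{0..T}. \<forall>u. norm (A q t u) <= C0 & norm (A' q t u) <= C0
   & ((%s. A q s u) has_vector_derivative A' q t u) (at t within {0..T})" using S(1) unfolding SS0_def by blast
 obtain C1 where C1: "\<forall>q\<in>I. \<forall>t\<in>{0..T}. \<forall>u. norm (B1 q t u) <= C1 & norm (B' q t u) <= C1
   & ((%s. B1 q s u) has_vector_derivative B' q t u) (at t within {0..T})" using S(4) unfolding SS0_def by blast
 obtain C2 where C2: "\<forall>q\<in>I. \<forall>t\<in>{0..T}. \<forall>u. norm (D q t u) <= C2 & norm (D' q t u) <= C2
   & ((%s. D q s u) has_vector_derivative D' q t u) (at t within {0..T})" using S(7) unfolding SS0_def by blast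
 have "small 2 (%q t. A q t (v q + b q) - A q t (v q) - b q *\<^sub>R B1 q t (v q))"
 proof (rule small_I[where A' = "%q t. A' q t (v q + b q) - A' q t (v q) - b q *\<^sub>R B' q t (v q)" and C = "\<bar>C2\<bar> * Cb ^ 2" and C' = "\<bar>C2\<bar> * Cb ^ 2"])
  fix q t assume w: "q \<in> I" and t: "t \<in> {0..T}"
  show "((%t. A q t (v q + b q) - A q t (v q) - b q *\<^sub>R B1 q t (v q)) has_vector_derivative
   A' q t (v q + b q) - A' q t (v q) - b q *\<^sub>R B' q t (v q)) (at t within {0..T})"
   using C0 C1 w t
   by (intro has_vector_derivative_diff bounded_linear.has_vector_derivative[OF bounded_linear_scaleR_right]) auto
  have "norm (A q t (v q + b q) - A q t (v q) - b q *\<^sub>R B1 q t (v q)) <= \<bar>C2\<bar> * \<bar>b q\<bar> ^ 2"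
   by (rule taylor2_bound[of _ _ "D q t"]) (use S C2 w t in \<open>auto simp: u_deriv_def intro: order_trans[OF _ abs_ge_self]\<close>)
  then show "norm (A q t (v q + b q) - A q t (v q) - b q *\<^sub>R B1 q t (v q)) <= \<bar>C2\<bar> * Cb ^ 2 * h q ^ 2"
   by (rule order_trans[OF _ power_step[OF w abs_ge_zero]])
  have "norm (A' q t (v q + b q) - A' q t (v q) - b q *\<^sub>R B' q t (v q)) <= \<bar>C2\<bar> * \<bar>b q\<bar> ^ 2"
   by (rule taylor2_bound[of _ _ "D' q t"]) (use S C2 w t in \<open>auto simp: u_deriv_def intro: order_trans[OF _ abs_ge_self]\<close>)
  then show "norm (A' q t (v q + b q) - A' q t (v q) - b q *\<^sub>R B' q t (v q)) <= \<bar>C2\<bar> * Cb ^ 2 * h q ^ 2"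
   by (rule order_trans[OF _ power_step[OF w abs_ge_zero]])
 qed
 then show ?thesis
  by (rule small_cong) (simp add: u_deriv_unique[OF B S(2)])
qed

lemma small_taylor4:
 assumes A: "SS 4 A0 A0'" and d: "u_deriv A0 A1" "u_deriv A1 A2" "u_deriv A2 A3"
 shows "small 4 (%q t. A0 q t (v q + b q) - A0 q t (v q) - b q *\<^sub>R A1 q t (v q)
   - ((b q)^2 / 2) *\<^sub>R A2 q t (v q) - ((b q) ^ 3 / 6) *\<^sub>R A3 q t (v q))"
proof -
 obtain B1 B1' B2 B2' B3 B3' B4 B4' where S: "SS0 A0 A0'" "u_deriv A0 B1" "u_deriv A0' B1'" "SS0 B1 B1'"
   "u_deriv B1 B2" "u_deriv B1' B2'" "SS0 B2 B2'" "u_deriv B2 B3" "u_deriv B2' B3'" "SS0 B3 B3'"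
   "u_deriv B3 B4" "u_deriv B3' B4'" "SS0 B4 B4'"
  using A by (auto simp: eval_nat_numeral)
 have e1: "B1 q t u = A1 q t u" if "q \<in> I" "t \<in> {0..T}" for q t u
  by (rule u_deriv_unique[OF S(2) d(1) that])
 have "u_deriv B1 A2" by (rule u_deriv_cong[OF d(2)]) (simp add: e1)
 then have e2: "B2 q t u = A2 q t u" if "q \<in> I" "t \<in> {0..T}" for q t u
  using u_deriv_unique[OF S(5)] that by blast
 have "u_deriv B2 A3" by (rule u_deriv_cong[OF d(3)]) (simp add: e2)
 then have e3: "B3 q t u = A3 q t u" if "q \<in> I" "t \<in> {0..T}" for q t u
  using u_deriv_unique[OF S(8)] that by blast
 have tD: "((%s. F q s u) has_vector_derivative F' q t u) (at t within {0..T})"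
  if "SS0 F F'" "q \<in> I" "t \<in> {0..T}" for F F' :: "'w => real => real => 'a" and q t u
  using that unfolding SS0_def by blast
 obtain C where C: "\<forall>q\<in>I. \<forall>t\<in>{0..T}. \<forall>u. norm (B4 q t u) <= C & norm (B4' q t u) <= C
   & ((%s. B4 q s u) has_vector_derivative B4' q t u) (at t within {0..T})" using S(13) unfolding SS0_def by blast
 have "small 4 (%q t. A0 q t (v q + b q) - A0 q t (v q) - b q *\<^sub>R B1 q t (v q)
   - ((b q)^2 / 2) *\<^sub>R B2 q t (v q) - ((b q) ^ 3 / 6) *\<^sub>R B3 q t (v q))"
 proof (rule small_I[where A' = "%q t. A0' q t (v q + b q) - A0' q t (v q) - b q *\<^sub>R B1' q t (v q)
   - ((b q)^2 / 2) *\<^sub>R B2' q t (v q) - ((b q) ^ 3 / 6) *\<^sub>R B3' q t (v q)" and C = "\<bar>C\<bar> * Cb ^ 4" and C' = "\<bar>C\<bar> * Cb ^ 4"])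
  fix q t assume w: "q \<in> I" and t: "t \<in> {0..T}"
  show "((%t. A0 q t (v q + b q) - A0 q t (v q) - b q *\<^sub>R B1 q t (v q)
   - ((b q)^2 / 2) *\<^sub>R B2 q t (v q) - ((b q) ^ 3 / 6) *\<^sub>R B3 q t (v q)) has_vector_derivative
   A0' q t (v q + b q) - A0' q t (v q) - b q *\<^sub>R B1' q t (v q)
   - ((b q)^2 / 2) *\<^sub>R B2' q t (v q) - ((b q) ^ 3 / 6) *\<^sub>R B3' q t (v q)) (at t within {0..T})"
   by (intro has_vector_derivative_diff bounded_linear.has_vector_derivative[OF bounded_linear_scaleR_right] tD[OF _ w t] S)
  have "norm (A0 q t (v q + b q) - A0 q t (v q) - b q *\<^sub>R B1 q t (v q)
   - ((b q)^2 / 2) *\<^sub>R B2 q t (v q) - ((b q) ^ 3 / 6) *\<^sub>R B3 q t (v q)) <= \<bar>C\<bar> * \<bar>b q\<bar> ^ 4"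
   by (rule taylor4_bound[of _ _ _ _ "B4 q t"]) (use S C w t in \<open>auto simp: u_deriv_def intro: order_trans[OF _ abs_ge_self]\<close>)
  then show "norm (A0 q t (v q + b q) - A0 q t (v q) - b q *\<^sub>R B1 q t (v q)
   - ((b q)^2 / 2) *\<^sub>R B2 q t (v q) - ((b q) ^ 3 / 6) *\<^sub>R B3 q t (v q)) <= \<bar>C\<bar> * Cb ^ 4 * h q ^ 4"
   by (rule order_trans[OF _ power_step[OF w abs_ge_zero]])
  have "norm (A0' q t (v q + b q) - A0' q t (v q) - b q *\<^sub>R B1' q t (v q)
   - ((b q)^2 / 2) *\<^sub>R B2' q t (v q) - ((b q) ^ 3 / 6) *\<^sub>R B3' q t (v q)) <= \<bar>C\<bar> * \<bar>b q\<bar> ^ 4"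
   by (rule taylor4_bound[of _ _ _ _ "B4' q t"]) (use S C w t in \<open>auto simp: u_deriv_def intro: order_trans[OF _ abs_ge_self]\<close>)
  then show "norm (A0' q t (v q + b q) - A0' q t (v q) - b q *\<^sub>R B1' q t (v q)
   - ((b q)^2 / 2) *\<^sub>R B2' q t (v q) - ((b q) ^ 3 / 6) *\<^sub>R B3' q t (v q)) <= \<bar>C\<bar> * Cb ^ 4 * h q ^ 4"
   by (rule order_trans[OF _ power_step[OF w abs_ge_zero]])
 qed
 then show ?thesis by (rule small_cong) (simp add: e1 e2 e3)
qed

end

end

section \<open>Bounds for the continuous solution\<close>

lemma smooth_pdu: "smooth_on_strip T f ==> smooth_on_strip T (pdu f)"
 and smooth_pdt: "smooth_on_strip T f ==> smooth_on_strip T (pdt T f)"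
 unfolding smooth_on_strip_def by (metis Ck_on_strip.simps(2))+

lemma smooth_cont: "smooth_on_strip T f ==> continuous_on ({0..T} \<times> UNIV) (%(t, u). f t u)"
 unfolding smooth_on_strip_def by (metis Ck_on_strip.simps(1))

lemma smooth_du: "smooth_on_strip T f ==> t \<in> {0..T} ==> (f t has_vector_derivative pdu f t u) (at u)"
proof -
 assume "smooth_on_strip T f" "t \<in> {0..T}"
 then have "f t differentiable (at u)" unfolding smooth_on_strip_def by (metis Ck_on_strip.simps(2))
 then show ?thesis unfolding pdu_def du_def by (simp add: vector_derivative_works)
qed

lemma smooth_dt:
 "smooth_on_strip T f ==> t \<in> {0..T} ==> ((%s. f s u) has_vector_derivative pdt T f t u) (at t within {0..T})"
proof -
 assume "smooth_on_strip T f" "t \<in> {0..T}"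
 then have "(%s. f s u) differentiable (at t within {0..T})" unfolding smooth_on_strip_def by (metis Ck_on_strip.simps(2))
 then show ?thesis unfolding pdt_def by (simp add: vector_derivative_works)
qed

lemma pdt_eqI:
 assumes "((%s. f s u) has_vector_derivative D) (at t within {0..T})" "0 < T" "t \<in> {0..T}"
 shows "pdt T f t u = D"
 unfolding pdt_def using assms by (auto intro!: vector_derivative_within_cbox[where a = 0 and b = T, unfolded cbox_interval])

text \<open>Locally f(s, v) is f(s, a) plus the integral of f_u from a to v. Differentiating in s
  under the integral and then in v gives the claim. This also covers the end points of the time
  interval, where the time derivative is one-sided.\<close>

lemma mixed_derivatives_commute:
 fixes f :: "real => real => 'a::banach"
 assumes f: "smooth_on_strip T f" and T: "0 < T" and t: "t \<in> {0..T}"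
 shows "(pdt T f t has_vector_derivative pdt T (pdu f) t u) (at u)"
proof -
 define a b where "a = u - 1" and "b = u + 1"
 note fu = smooth_pdu[OF f]
 have slice: "continuous_on S (g t)" if "smooth_on_strip T g" "t \<in> {0..T}" for g :: "real => real => 'a" and S t
 proof -
  have "continuous_on S (%v. case (t, v) of (t, u) => g t u)"
   by (rule continuous_on_compose2[OF smooth_cont[OF that(1)], of S "%v. (t, v)"])
    (use that(2) in \<open>auto intro: continuous_on_Pair continuous_on_const continuous_on_id\<close>)
  then show ?thesis by simp
 qed
 have ftc: "((pdu f s) has_integral (f s v - f s a)) {a..v}" if "s \<in> {0..T}" "a <= v" for s v
  by (rule fundamental_theorem_of_calculus[OF that(2)])
   (rule has_vector_derivative_at_within[OF smooth_du[OF f that(1)]])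
 have eq: "pdt T f t v = pdt T f t a + integral {a..v} (pdt T (pdu f) t)" if v: "v \<in> {a..b}" for v
 proof (rule pdt_eqI[OF _ T t])
  have "((%s. integral (cbox a v) (pdu f s)) has_vector_derivative integral (cbox a v) (pdt T (pdu f) t)) (at t within {0..T})"
  proof (rule leibniz_rule_vector_derivative)
   show "((%s. pdu f s w) has_vector_derivative pdt T (pdu f) s w) (at s within {0..T})" if "s \<in> {0..T}" for s w
    by (rule smooth_dt[OF fu that])
   show "pdu f s integrable_on cbox a v" if "s \<in> {0..T}" for s
    using integrable_continuous_real[OF slice[OF fu that]] by simp
   show "continuous_on ({0..T} \<times> cbox a v) (%(s, w). pdt T (pdu f) s w)"
    by (rule continuous_on_subset[OF smooth_cont[OF smooth_pdt[OF fu]]]) auto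
  qed (use t in auto)
  from has_vector_derivative_add[OF smooth_dt[OF f t, of a] this]
  show "((%s. f s v) has_vector_derivative pdt T f t a + integral {a..v} (pdt T (pdu f) t)) (at t within {0..T})"
   unfolding cbox_interval
   by (rule has_vector_derivative_transform[OF t, rotated]) (use integral_unique[OF ftc] v in simp)
 qed
 have u: "u \<in> {a..b}" by (simp add: a_def b_def)
 have "((%v. pdt T f t a + integral {a..v} (pdt T (pdu f) t)) has_vector_derivative 0 + pdt T (pdu f) t u) (at u within {a..b})"
  by (intro has_vector_derivative_add has_vector_derivative_const
    integral_has_vector_derivative[OF slice[OF smooth_pdt[OF fu] t] u])
 then have "(pdt T f t has_vector_derivative 0 + pdt T (pdu f) t u) (at u within {a..b})"
  by (rule has_vector_derivative_transform[OF u, rotated]) (rule eq)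
 moreover have "at u within {a..b} = at u"
  by (rule at_within_interior) (simp add: a_def b_def interior_atLeastAtMost_real)
 ultimately show ?thesis by simp
qed

lemma smooth_funpow_pdu: "smooth_on_strip T f ==> smooth_on_strip T ((pdu ^^ j) f)"
 by (induction j) (auto intro: smooth_pdu)

lemma smooth_funpow_pdt: "smooth_on_strip T f ==> smooth_on_strip T ((pdt T ^^ j) f)"
 by (induction j) (auto intro: smooth_pdt)

lemma periodic_2piD: "periodic_2pi g ==> g (u + 2 * pi) = g u"
 by (simp add: periodic_2pi_def)

lemma periodic_reduce:
 assumes "periodic_2pi g" shows "\<exists>v\<in>{0..2 * pi}. g u = g v"
proof -
 have n: "g (v + 2 * pi * real n) = g v" for v n
 proof (induction n)
  case (Suc n)
  then show ?case using periodic_2piD[OF assms, of "v + 2 * pi * real n"] by (simp add: algebra_simps)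
 qed simp
 define k where "k = \<lfloor>u / (2 * pi)\<rfloor>"
 define v where "v = u - 2 * pi * of_int k"
 have "g u = g v"
 proof (cases "0 <= k")
  case True
  then show ?thesis using n[of v "nat k"] by (simp add: v_def)
 next
  case False
  then show ?thesis using n[of u "nat (- k)"] by (simp add: v_def)
 qed
 moreover have "v \<in> {0..2 * pi}"
 proof -
  have "of_int k <= u / (2 * pi)" "u / (2 * pi) < of_int k + 1" unfolding k_def by linarith+
  then show ?thesis by (simp add: v_def field_simps)
 qed
 ultimately show ?thesis by blast
qed

lemma periodic_pdu:
 assumes "smooth_on_strip T f" "\<forall>t\<in>{0..T}. periodic_2pi (f t)" shows "\<forall>t\<in>{0..T}. periodic_2pi (pdu f t)"
proof
 fix t assume t: "t \<in> {0..T}"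
 have e: "(%v. f t (2 * pi + v)) = f t" using assms(2) t by (auto simp: periodic_2pi_def fun_eq_iff add.commute)
 show "periodic_2pi (pdu f t)" unfolding periodic_2pi_def
 proof
  fix u
  have "(f t has_vector_derivative pdu f t (2 * pi + u)) (at u)"
   using has_vector_derivative_shift_arg[OF smooth_du[OF assms(1) t], of "2 * pi" u] unfolding e .
  then show "pdu f t (u + 2 * pi) = pdu f t u"
   using vector_derivative_unique_at[OF _ smooth_du[OF assms(1) t]] by (simp add: add.commute)
 qed
qed

lemma periodic_pdt:
 assumes "smooth_on_strip T f" "\<forall>t\<in>{0..T}. periodic_2pi (f t)" "0 < T" shows "\<forall>t\<in>{0..T}. periodic_2pi (pdt T f t)"
proof
 fix t assume t: "t \<in> {0..T}"
 show "periodic_2pi (pdt T f t)" unfolding periodic_2pi_def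
 proof
  fix u
  show "pdt T f t (u + 2 * pi) = pdt T f t u"
  proof (rule pdt_eqI[OF _ assms(3) t])
   show "((%s. f s (u + 2 * pi)) has_vector_derivative pdt T f t u) (at t within {0..T})"
    by (rule has_vector_derivative_transform[OF t _ smooth_dt[OF assms(1) t]])
     (use assms(2) in \<open>auto simp: periodic_2pi_def\<close>)
  qed
 qed
qed

text \<open>The supremum is taken over a bounded set by compactness of the rectangle, so it is an
  upper bound; periodicity of all derivatives extends the bound to every u.\<close>

lemma Ck_norm_bound:
 fixes x :: "real => real => 'a::real_normed_vector"
 assumes x: "smooth_on_strip T x" "\<forall>t\<in>{0..T}. periodic_2pi (x t)" and T: "0 < T" and ij: "i + j <= k" and t: "t \<in> {0..T}"
 shows "norm ((pdt T ^^ i) ((pdu ^^ j) x) t u) <= Ck_norm T k x"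
proof -
 define F where "F i j = (pdt T ^^ i) ((pdu ^^ j) x)" for i j
 have sF: "smooth_on_strip T (F i j)" for i j
  unfolding F_def by (intro smooth_funpow_pdt smooth_funpow_pdu x)
 have pu: "\<forall>t\<in>{0..T}. periodic_2pi ((pdu ^^ j) x t)" for j
 proof (induction j)
  case (Suc j)
  from periodic_pdu[OF smooth_funpow_pdu[OF x(1)] this] show ?case by simp
 qed (simp add: x(2)[simplified])
 have pF: "\<forall>t\<in>{0..T}. periodic_2pi (F i j t)" for i j
  unfolding F_def
 proof (induction i)
  case 0
  show ?case using pu[of j] by simp
 next
  case (Suc i)
  from periodic_pdt[OF smooth_funpow_pdt[OF smooth_funpow_pdu[OF x(1)]] this T] show ?case by simp
 qed
 let ?S = "{norm (F i j t u) | i j t u. i + j <= k & t \<in> {0..T} & u \<in> {0..2 * pi}}"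
 have "bdd_above (\<Union>(i, j)\<in>{..k} \<times> {..k}. (%(t, u). norm (F i j t u)) ` ({0..T} \<times> {0..2 * pi}))"
 proof (subst bdd_above_UN)
  show "\<forall>p\<in>{..k} \<times> {..k}. bdd_above (case p of (i, j) => (%(t, u). norm (F i j t u)) ` ({0..T} \<times> {0..2 * pi}))"
  proof (clarify)
   fix i j
   have "continuous_on ({0..T} \<times> {0..2 * pi}) (%(t, u). F i j t u)"
    by (rule continuous_on_subset[OF smooth_cont[OF sF]]) auto
   then have "compact ((%p. norm (case p of (t, u) => F i j t u)) ` ({0..T} \<times> {0..2 * pi}))"
    by (intro compact_continuous_image continuous_on_norm compact_Times) auto
   then have "bdd_above ((%p. norm (case p of (t, u) => F i j t u)) ` ({0..T} \<times> {0..2 * pi}))"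
    by (intro bounded_imp_bdd_above compact_imp_bounded)
   then show "bdd_above ((%(t, u). norm (F i j t u)) ` ({0..T} \<times> {0..2 * pi}))"
    by (simp add: case_prod_unfold)
  qed
 qed auto
 then have bdd: "bdd_above ?S" by (rule bdd_above_mono) force
 obtain v where v: "v \<in> {0..2 * pi}" "F i j t u = F i j t v" using periodic_reduce[of "F i j t" u] pF t by auto
 have "norm (F i j t v) <= Sup ?S" by (rule cSup_upper[OF _ bdd]) (use ij t v in blast)
 then show ?thesis unfolding Ck_norm_def F_def[symmetric] v(2) .
qed

context jets
begin

text \<open>Besides the j + k derivatives in u, one derivative is spent on time; this is the 1 in
  the condition on \<open>K\<close>.\<close>

lemma SS_smooth:
 fixes X :: "'w => real => real => 'a::banach"
 assumes X: "!!q. q \<in> I ==> smooth_on_strip T (X q)"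
  "!!q. q \<in> I ==> \<forall>t\<in>{0..T}. periodic_2pi (X q t)" "!!q. q \<in> I ==> Ck_norm T K (X q) <= B" and T: "0 < T"
 shows "j + k + 1 <= K ==> SS k (%q. (pdu ^^ j) (X q)) (%q. pdt T ((pdu ^^ j) (X q)))"
proof (induction k arbitrary: j)
 have S0: "SS0 (%q. (pdu ^^ j) (X q)) (%q. pdt T ((pdu ^^ j) (X q)))" if j: "j + 1 <= K" for j
  unfolding SS0_def
 proof (intro exI[of _ B] ballI allI conjI)
  fix q t u assume w: "q \<in> I" and t: "t \<in> {0..T}"
  show "norm ((pdu ^^ j) (X q) t u) <= B"
   using Ck_norm_bound[OF X(1,2)[OF w] T _ t, of 0 j K u] X(3)[OF w] j by simp
  show "norm (pdt T ((pdu ^^ j) (X q)) t u) <= B"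
   using Ck_norm_bound[OF X(1,2)[OF w] T _ t, of 1 j K u] X(3)[OF w] j by simp
  show "((%s. (pdu ^^ j) (X q) s u) has_vector_derivative pdt T ((pdu ^^ j) (X q)) t u) (at t within {0..T})"
   by (rule smooth_dt[OF smooth_funpow_pdu[OF X(1)[OF w]] t])
 qed
 case 0
 then show ?case using S0[of j] by simp
next
 case (Suc k)
 have "SS0 (%q. (pdu ^^ j) (X q)) (%q. pdt T ((pdu ^^ j) (X q)))"
  by (rule SS_SS0[OF Suc.IH]) (use Suc.prems in simp)
 moreover have "u_deriv (%q. (pdu ^^ j) (X q)) (%q. (pdu ^^ Suc j) (X q))"
  unfolding u_deriv_def by (auto intro!: smooth_du smooth_funpow_pdu X(1))
 moreover have "u_deriv (%q. pdt T ((pdu ^^ j) (X q))) (%q. pdt T ((pdu ^^ Suc j) (X q)))"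
  unfolding u_deriv_def by (auto intro!: mixed_derivatives_commute smooth_funpow_pdu X(1) T)
 moreover have "SS k (%q. (pdu ^^ Suc j) (X q)) (%q. pdt T ((pdu ^^ Suc j) (X q)))"
  by (rule Suc.IH) (use Suc.prems in simp)
 ultimately show ?case unfolding SS.simps by blast
qed

text \<open>Both fields are required to be bounded, since the error of a product is an error of one
  factor times the other factor.\<close>

definition approx :: "nat => ('w => real => 'a::real_normed_vector) => ('w => real => 'a) => bool" where
 "approx k A B \<longleftrightarrow> small 0 A & small 0 B & small k (%q t. A q t - B q t)"

lemma small_zero: "small k (%q t. 0)"
 by (rule small_step[where C = 0]) simp

lemma approx_refl: "small 0 A ==> approx k A A"
 by (simp add: approx_def small_zero)

lemma approxI: "small 0 B ==> small k (%q t. A q t - B q t) ==> approx k A B"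
 using small_add[of 0 B "%q t. A q t - B q t"] small_mono[of k "%q t. A q t - B q t" 0]
 by (simp add: approx_def)

lemma approxD: assumes "approx k A B" shows "small 0 A" "small 0 B" "small k (%q t. A q t - B q t)"
 using assms by (auto simp: approx_def)

lemma approx_mono: "approx l A B ==> k <= l ==> approx k A B"
 unfolding approx_def using small_mono by blast

lemma approx_cong:
 assumes "approx k A B" "!!q t. q \<in> I ==> t \<in> {0..T} ==> A2 q t = A q t" "!!q t. q \<in> I ==> t \<in> {0..T} ==> B2 q t = B q t"
 shows "approx k A2 B2"
proof -
 have "small 0 A2" by (rule small_cong[OF approxD(1)[OF assms(1)]]) (rule assms(2))
 moreover have "small 0 B2" by (rule small_cong[OF approxD(2)[OF assms(1)]]) (rule assms(3))
 moreover have "small k (%q t. A2 q t - B2 q t)"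
  by (rule small_cong[OF approxD(3)[OF assms(1)]]) (simp add: assms(2,3))
 ultimately show ?thesis by (simp add: approx_def)
qed

lemma approx_add: "approx k A B ==> approx k A2 B2 ==> approx k (%q t. A q t + A2 q t) (%q t. B q t + B2 q t)"
 unfolding approx_def using small_add[of k "%q t. A q t - B q t" "%q t. A2 q t - B2 q t"]
 by (auto intro: small_add simp: add_diff_add)

lemma approx_prod:
 assumes bl: "bounded_bilinear pr" and A: "approx k A B" and A2: "approx k A2 B2"
 shows "approx k (%q t. pr (A q t) (A2 q t)) (%q t. pr (B q t) (B2 q t))"
proof -
 note a = approxD[OF A] and b = approxD[OF A2]
 have "small k (%q t. pr (A q t) (A2 q t - B2 q t) + pr (A q t - B q t) (B2 q t))"
  using small_add[OF small_prod[OF bl a(1) b(3), unfolded add_0] small_prod[OF bl a(3) b(2), unfolded add_0_right]] .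
 then have "small k (%q t. pr (A q t) (A2 q t) - pr (B q t) (B2 q t))"
  by (simp add: bounded_bilinear.diff_left[OF bl] bounded_bilinear.diff_right[OF bl])
 then show ?thesis
  unfolding approx_def using small_prod[OF bl a(1) b(1)] small_prod[OF bl a(2) b(2)] by simp
qed

lemmas approx_inner = approx_prod[OF bounded_bilinear_inner]
lemmas approx_mult = approx_prod[OF bounded_bilinear_mult]
lemmas approx_scaleR = approx_prod[OF bounded_bilinear_scaleR]

lemma approx_const: "approx k (%q t. c) (%q t. c)"
 by (intro approx_refl small_const)

lemma approx_diff: "approx k A B ==> approx k A2 B2 ==> approx k (%q t. A q t - A2 q t) (%q t. B q t - B2 q t)"
 using approx_add[of k A B "%q t. - 1 *\<^sub>R A2 q t" "%q t. - 1 *\<^sub>R B2 q t"] approx_scaleR[OF approx_const, of k A2 B2 "- 1"]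
 by simp

lemma approx_perturb:
 assumes A: "approx k A B" and C: "small k C" shows "approx k (%q t. A q t + C q t) B"
proof -
 have "approx k C (%q t. 0)" by (rule approxI[OF small_zero]) (simp add: C)
 from approx_add[OF A this] show ?thesis by simp
qed

lemma approx_inverse:
 fixes A B :: "'w => real => real"
 assumes A: "approx k A B" and c: "0 < c" "!!q t. q \<in> I ==> t \<in> {0..T} ==> c <= A q t" "!!q t. q \<in> I ==> t \<in> {0..T} ==> c <= B q t"
 shows "approx k (%q t. inverse (A q t)) (%q t. inverse (B q t))"
proof -
 note a = approxD[OF A]
 note i = small_inverse[OF a(1) c(1,2)] small_inverse[OF a(2) c(1,3)]
 have "small k (%q t. - (inverse (A q t) * (A q t - B q t) * inverse (B q t)))"
  using small_uminus[OF small_mult[OF small_mult[OF i(1) a(3)] i(2)]] by simp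
 then have "small k (%q t. inverse (A q t) - inverse (B q t))"
 proof (rule small_cong)
  fix q t assume "q \<in> I" "t \<in> {0..T}"
  then have "A q t ~= 0" "B q t ~= 0" using c(1) c(2,3)[of q t] by auto
  then show "inverse (A q t) - inverse (B q t) = - (inverse (A q t) * (A q t - B q t) * inverse (B q t))"
   by (rule inverse_diff_inverse)
 qed
 then show ?thesis using i by (simp add: approx_def)
qed

text \<open>The difference of the roots is the difference of the radicands over the sum of the
  roots, which stays away from zero.\<close>

lemma approx_sqrt:
 assumes A: "approx k A B" and c: "0 < c" "!!q t. q \<in> I ==> t \<in> {0..T} ==> c <= A q t" "!!q t. q \<in> I ==> t \<in> {0..T} ==> c <= B q t"
 shows "approx k (%q t. sqrt (A q t)) (%q t. sqrt (B q t))"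
proof -
 note a = approxD[OF A]
 note i = small_sqrt[OF a(1) c(1,2)] small_sqrt[OF a(2) c(1,3)]
 have ge: "sqrt c <= sqrt (A q t) + sqrt (B q t)" if "q \<in> I" "t \<in> {0..T}" for q t
 proof -
  have "sqrt c <= sqrt (A q t)" "0 <= sqrt (B q t)" using c(2,3)[OF that] c(1) by auto
  then show ?thesis by linarith
 qed
 have "small k (%q t. (A q t - B q t) * inverse (sqrt (A q t) + sqrt (B q t)))"
  using small_mult[OF a(3) small_inverse[OF small_add[OF i], of "sqrt c"]] c(1) ge by simp
 then have "small k (%q t. sqrt (A q t) - sqrt (B q t))"
 proof (rule small_cong)
  fix q t assume w: "q \<in> I" "t \<in> {0..T}"
  have "0 < sqrt c" using c(1) by simp
  then have nz: "sqrt (A q t) + sqrt (B q t) ~= 0" using ge[OF w] by linarith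
  have "(sqrt (A q t) - sqrt (B q t)) * (sqrt (A q t) + sqrt (B q t)) = A q t - B q t"
   using c(1) c(2,3)[OF w] by (simp add: algebra_simps)
  then show "sqrt (A q t) - sqrt (B q t) = (A q t - B q t) * inverse (sqrt (A q t) + sqrt (B q t))"
   using nz by (simp add: field_simps)
 qed
 then show ?thesis using i by (simp add: approx_def)
qed

end

text \<open>An index stands for a node of a mesh together with a solution: \<open>v\<close> is its
  parameter, \<open>bp\<close> and \<open>bm\<close> are the widths to the right and to the left,
  \<open>nx\<close> and \<open>pv\<close> its cyclic neighbours. The parameters of neighbours agree
  only up to the period, hence the alternatives with 2 pi. \<open>h_small\<close> keeps difference
  quotients of the curve away from zero.\<close>

locale node_jets = jets T I h
 for T :: real and I :: "'w set" and h :: "'w => real" +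
 fixes X :: "'w => real => real => 'a::{real_inner, banach}" and v bp bm :: "'w => real" and nx pv :: "'w => 'w"
  and lam c0 chat cbar B :: real
 assumes T: "0 < T" and c0: "0 < c0" and chat: "0 < chat" and B: "0 <= B"
  and X_smooth: "q \<in> I ==> smooth_on_strip T (X q)"
  and X_periodic: "q \<in> I ==> \<forall>t\<in>{0..T}. periodic_2pi (X q t)"
  and X_norm: "q \<in> I ==> Ck_norm T 8 (X q) <= B"
  and X_lower: "q \<in> I ==> t \<in> {0..T} ==> c0 <= norm (pdu (X q) t u)"
  and bp: "q \<in> I ==> h q <= chat * bp q & bp q <= h q"
  and bm: "q \<in> I ==> h q <= chat * bm q & bm q <= h q"
  and b_diff: "q \<in> I ==> \<bar>bp q - bm q\<bar> <= cbar * (h q)^2"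
  and h_small: "q \<in> I ==> 2 * B * h q <= c0"
  and nx: "q \<in> I ==> nx q \<in> I & h (nx q) = h q & X (nx q) = X q & bm (nx q) = bp q"
  and pv: "q \<in> I ==> pv q \<in> I & h (pv q) = h q & X (pv q) = X q & bp (pv q) = bm q"
  and v_nx: "q \<in> I ==> v (nx q) = v q + bp q \<or> v (nx q) + 2 * pi = v q + bp q"
  and v_pv: "q \<in> I ==> v (pv q) = v q - bm q \<or> v (pv q) = v q - bm q + 2 * pi"
  and flow: "q \<in> I ==> t \<in> {0..T} ==> pdt T (X q) t u =
     - nabla_s (X q t) (nabla_s (X q t) (curvature_vec (X q t))) u
     - (1 / 2 * (norm (curvature_vec (X q t) u))^2) *\<^sub>R curvature_vec (X q t) u
     + lam *\<^sub>R (du (du (X q t)) u /\<^sub>R norm (du (X q t) u))"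
begin

section \<open>The fields of the continuous solution and the conservative form of the flow\<close>

lemma step_pos: "q \<in> I ==> 0 < bp q" "q \<in> I ==> 0 < bm q"
 using bp[of q] bm[of q] h[of q] chat by (meson less_le_trans zero_less_mult_pos)+

definition x1 where "x1 q = pdu (X q)"
definition x2 where "x2 q = pdu (x1 q)"
definition x3 where "x3 q = pdu (x2 q)"
text \<open>The factor 1 / |x_u|, then tangent, derivative of this factor, derivative of the
  tangent, and curvature. They are spelled out with inner products and an inverse root, so that the
  closure rules apply directly.\<close>

definition gg where "gg q t u = inverse (sqrt (x1 q t u \<bullet> x1 q t u))"
definition tt where "tt q t u = gg q t u *\<^sub>R x1 q t u"
definition gu where
 "gu q t u = - ((x1 q t u \<bullet> x2 q t u + x2 q t u \<bullet> x1 q t u) * (gg q t u * gg q t u * gg q t u)) / 2"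
definition tu where "tu q t u = gg q t u *\<^sub>R x2 q t u + gu q t u *\<^sub>R x1 q t u"
definition yy where "yy q t u = gg q t u *\<^sub>R tu q t u"

text \<open>Of the eight controlled derivatives one is kept for time. The flux \<open>ff\<close>
  uses three of the remaining seven and retains four, enough for its Taylor expansions.\<close>

lemma SX_x: "SX 7 X" "SX 6 x1" "SX 5 x2" "SX 4 x3"
proof -
 have *: "SX k (%q. (pdu ^^ j) (X q))" if "j + k + 1 <= 8" for j k
  unfolding SX_def by (rule exI, rule SS_smooth[where X = X and K = 8 and B = B]) (use X_smooth X_periodic X_norm T that in auto)
 show "SX 7 X" "SX 6 x1" "SX 5 x2" "SX 4 x3"
  using *[of 0 7] *[of 1 6] *[of 2 5] *[of 3 4]
  by (simp_all add: x1_def[abs_def] x2_def[abs_def] x3_def[abs_def] eval_nat_numeral)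
qed

lemma u_deriv_x: "u_deriv X x1" "u_deriv x1 x2" "u_deriv x2 x3"
 unfolding u_deriv_def x1_def x2_def x3_def by (auto intro!: smooth_du smooth_pdu X_smooth)

lemma x1_sq: "q \<in> I ==> t \<in> {0..T} ==> c0^2 <= x1 q t u \<bullet> x1 q t u"
 using power_mono[OF X_lower[of q t u], of 2] c0 by (simp add: x1_def power2_norm_eq_inner)

lemma gg_eq: "gg q t u = inverse (norm (x1 q t u))"
 by (simp add: gg_def norm_eq_sqrt_inner)

lemma x1_nz: "q \<in> I ==> t \<in> {0..T} ==> norm (x1 q t u) > 0"
 using less_le_trans[OF c0 X_lower[of q t u]] by (simp only: x1_def)

lemma SX_gg: "SX 6 gg"
proof -
 obtain N' where "SS 6 (%q t u. x1 q t u \<bullet> x1 q t u) N'" using SX_inner[OF SX_x(2) SX_x(2)] unfolding SX_def by blast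
 from SS_rsqrt[OF _ x1_sq this] c0 show ?thesis unfolding SX_def gg_def[abs_def] by auto
qed

lemma u_deriv_gg: "u_deriv gg gu"
 unfolding u_deriv_def
proof (intro ballI allI)
 fix q t u assume w: "q \<in> I" and t: "t \<in> {0..T}"
 have d: "(x1 q t has_vector_derivative x2 q t u) (at u)" using u_deriv_x(2) w t by (simp add: u_deriv_def)
 have "0 < x1 q t u \<bullet> x1 q t u" using x1_nz[OF w t, of u] by (simp add: power2_norm_eq_inner[symmetric])
 from rsqrt_has_vector_derivative[OF bounded_bilinear.has_vector_derivative[OF bounded_bilinear_inner d d] this]
 show "(gg q t has_vector_derivative gu q t u) (at u)" unfolding gg_def gu_def .
qed

lemma SX_t: "SX 6 tt" "SX 5 gu" "SX 5 tu" "SX 5 yy"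
proof -
 show "SX 6 tt" unfolding tt_def[abs_def] by (rule SX_scaleR[OF SX_gg SX_x(2)])
 show g: "SX 5 gu" by (rule SX_deriv'[OF _ u_deriv_gg]) (use SX_gg in \<open>simp add: eval_nat_numeral\<close>)
 have m: "SX 5 gg" "SX 5 x1" by (rule SX_mono[OF SX_gg] SX_mono[OF SX_x(2)], simp)+
 show t: "SX 5 tu" unfolding tu_def[abs_def]
  by (rule SX_add[OF SX_scaleR[OF m(1) SX_x(3)] SX_scaleR[OF g m(2)]])
 show "SX 5 yy" unfolding yy_def[abs_def] by (rule SX_scaleR[OF m(1) t])
qed

lemma u_deriv_tt: "u_deriv tt tu"
 unfolding tt_def[abs_def] tu_def[abs_def] by (rule u_deriv_prod[OF bounded_bilinear_scaleR u_deriv_gg u_deriv_x(2)])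

text \<open>Only existence and regularity of y_u are needed, not its formula; its values are
  determined by uniqueness of derivatives.\<close>

definition yu where "yu = (SOME D. u_deriv yy D & SX 4 D)"

lemma yu: "u_deriv yy yu" "SX 4 yu"
proof -
 have "\<exists>D. u_deriv yy D & SX 4 D" by (rule SX_deriv) (use SX_t(4) in \<open>simp add: eval_nat_numeral\<close>)
 from someI_ex[OF this] show "u_deriv yy yu" "SX 4 yu" by (auto simp: yu_def)
qed

definition zz where "zz q t u = gg q t u *\<^sub>R yu q t u - ((gg q t u *\<^sub>R yu q t u) \<bullet> tt q t u) *\<^sub>R tt q t u"

text \<open>The continuous counterpart of \<open>pflux\<close>: the normal arc-length derivative of
  the curvature, plus half of |y|^2 times the tangent, minus lam x_u.\<close>

definition ff where "ff q t u = zz q t u + ((yy q t u \<bullet> yy q t u) *\<^sub>R tt q t u) /\<^sub>R 2 - lam *\<^sub>R x1 q t u"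

lemma SX_zf: "SX 4 zz" "SX 4 ff"
proof -
 have m: "SX 4 gg" "SX 4 x1" "SX 4 tt" "SX 4 yy"
  by (rule SX_mono[OF SX_gg] SX_mono[OF SX_x(2)] SX_mono[OF SX_t(1)] SX_mono[OF SX_t(4)], simp)+
 show z: "SX 4 zz" unfolding zz_def[abs_def]
  by (intro SX_diff SX_scaleR SX_inner m yu)
 show "SX 4 ff" unfolding ff_def[abs_def]
  by (intro SX_add SX_diff SX_scaleR SX_inner m z SX_const)
qed

definition fu where "fu = (SOME D. u_deriv ff D & SX 3 D)"

lemma fu: "u_deriv ff fu" "SX 3 fu"
proof -
 have "\<exists>D. u_deriv ff D & SX 3 D" by (rule SX_deriv) (use SX_zf(2) in \<open>simp add: eval_nat_numeral\<close>)
 from someI_ex[OF this] show "u_deriv ff fu" "SX 3 fu" by (auto simp: fu_def)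
qed

text \<open>The flow is x_t = -|x_u|^{-1} times the u-derivative of \<open>ff\<close>. The normal
  derivative \<open>zz\<close> is orthogonal to the tangent, so the tangential part of its
  derivative is -zz . tau_u = -(y_u . y). The derivative of |y|^2 / 2 in front of the tangent
  cancels exactly this part, which the outer normal derivative in the flow removes.\<close>

lemma flow_conservative:
 assumes w: "q \<in> I" and t: "t \<in> {0..T}"
 shows "pdt T (X q) t u = - (gg q t u *\<^sub>R fu q t u)" and "curvature_vec (X q t) u = yy q t u"
  and "du (curvature_vec (X q t)) u = yu q t u" and "tangent (X q t) u = tt q t u"
proof -
 have dx: "du (X q t) = x1 q t" by (simp add: x1_def pdu_def fun_eq_iff)
 have ddx: "du (x1 q t) = x2 q t" by (simp add: x2_def pdu_def fun_eq_iff)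
 have tan: "tangent (X q t) = tt q t" by (simp add: tangent_def dx tt_def gg_eq fun_eq_iff)
 have ud: "du (F q t) = F' q t" if "u_deriv F F'" for F F' :: "'w => real => real => 'a"
  using that w t unfolding u_deriv_def du_def by (auto simp: fun_eq_iff intro!: vector_derivative_at)
 have vd: "(F q t has_vector_derivative F' q t u) (at u)" if "u_deriv F F'" for F F' :: "'w => real => real => 'b::real_normed_vector" and u
  using that w t unfolding u_deriv_def by auto
 have cur: "curvature_vec (X q t) = yy q t"
  by (simp add: curvature_vec_def tan ud[OF u_deriv_tt] dx yy_def gg_eq fun_eq_iff)
 show "curvature_vec (X q t) u = yy q t u" by (simp add: cur)
 show "du (curvature_vec (X q t)) u = yu q t u" by (simp add: cur ud[OF yu(1)])
 show "tangent (X q t) u = tt q t u" by (simp add: tan)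
 have n1: "nabla_s (X q t) (yy q t) = zz q t"
  by (simp add: nabla_s_def arc_deriv_def tan ud[OF yu(1)] dx zz_def gg_eq fun_eq_iff)
 obtain zu where zu: "u_deriv zz zu" "SX 3 zu" using SX_deriv[of 3 zz] SX_zf(1) by (auto simp: eval_nat_numeral)
 have n2: "nabla_s (X q t) (zz q t) u = gg q t u *\<^sub>R zu q t u - ((gg q t u *\<^sub>R zu q t u) \<bullet> tt q t u) *\<^sub>R tt q t u"
  by (simp add: nabla_s_def arc_deriv_def tan ud[OF zu(1)] dx gg_eq)
 have tan1: "tt q t u \<bullet> tt q t u = 1" for u
  using x1_nz[OF w t, of u] by (simp add: tt_def gg_eq dot_square_norm power2_eq_square)
 have inner_const: "a \<bullet> G' + F' \<bullet> b = 0"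
  if "(F has_vector_derivative F') (at u)" "(G has_vector_derivative G') (at u)" "!!u. F u \<bullet> G u = c" "F u = a" "G u = b"
  for F G :: "real => 'a" and F' G' a b c u
 proof -
  have "((%u. F u \<bullet> G u) has_vector_derivative F u \<bullet> G' + F' \<bullet> G u) (at u)"
   by (rule bounded_bilinear.has_vector_derivative[OF bounded_bilinear_inner that(1,2)])
  moreover have "((%u. F u \<bullet> G u) has_vector_derivative 0) (at u)" unfolding that(3) by simp
  ultimately show ?thesis using vector_derivative_unique_at that(4,5) by blast
 qed
 have tut: "tu q t u \<bullet> tt q t u = 0" for u
  using inner_const[OF vd[OF u_deriv_tt] vd[OF u_deriv_tt] tan1 refl refl] by (simp add: inner_commute)
 have yt: "yy q t u \<bullet> tt q t u = 0" for u by (simp add: yy_def tut)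
 have zt: "zz q t u \<bullet> tt q t u = 0" for u by (simp add: zz_def inner_diff_left tan1)
 have zut: "zu q t u \<bullet> tt q t u = - (zz q t u \<bullet> tu q t u)"
  using inner_const[OF vd[OF zu(1)] vd[OF u_deriv_tt] zt refl refl, of u] by linarith
 have zy: "zz q t u \<bullet> yy q t u = gg q t u * (yu q t u \<bullet> yy q t u)"
  using yt[of u] by (simp add: zz_def inner_diff_left inner_diff_right inner_commute)
 have fu_eq: "fu q t u = zu q t u + (((yy q t u \<bullet> yy q t u) *\<^sub>R tu q t u
   + (yy q t u \<bullet> yu q t u + yu q t u \<bullet> yy q t u) *\<^sub>R tt q t u) /\<^sub>R 2) - lam *\<^sub>R x2 q t u"
 proof (rule vector_derivative_unique_at[OF vd[OF fu(1)]])
  show "(ff q t has_vector_derivative zu q t u + (((yy q t u \<bullet> yy q t u) *\<^sub>R tu q t u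
   + (yy q t u \<bullet> yu q t u + yu q t u \<bullet> yy q t u) *\<^sub>R tt q t u) /\<^sub>R 2) - lam *\<^sub>R x2 q t u) (at u)"
   unfolding ff_def[abs_def]
   by (intro has_vector_derivative_diff has_vector_derivative_add vd[OF zu(1)]
     bounded_linear.has_vector_derivative[OF bounded_linear_scaleR_right]
     bounded_bilinear.has_vector_derivative[OF bounded_bilinear_scaleR]
     bounded_bilinear.has_vector_derivative[OF bounded_bilinear_inner] vd[OF yu(1)] vd[OF u_deriv_tt] vd[OF u_deriv_x(2)])
 qed
 have gt: "gg q t u *\<^sub>R tu q t u = yy q t u" by (simp add: yy_def)
 have "pdt T (X q) t u = - (gg q t u *\<^sub>R zu q t u - (gg q t u * (zu q t u \<bullet> tt q t u)) *\<^sub>R tt q t u)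
   - (1 / 2 * (yy q t u \<bullet> yy q t u)) *\<^sub>R yy q t u + lam *\<^sub>R (gg q t u *\<^sub>R x2 q t u)"
  unfolding flow[OF w t] cur n1 n2 dx ddx by (simp add: gg_eq power2_norm_eq_inner)
 also have "gg q t u * (zu q t u \<bullet> tt q t u) = - (gg q t u * (yu q t u \<bullet> yy q t u))"
  unfolding zut using zy unfolding yy_def[of q t u] by (simp add: inner_commute mult_ac)
 also have "- (gg q t u *\<^sub>R zu q t u - - (gg q t u * (yu q t u \<bullet> yy q t u)) *\<^sub>R tt q t u)
   - (1 / 2 * (yy q t u \<bullet> yy q t u)) *\<^sub>R yy q t u + lam *\<^sub>R (gg q t u *\<^sub>R x2 q t u)
  = - (gg q t u *\<^sub>R fu q t u)"
  unfolding fu_eq scaleR_add_right scaleR_diff_right gt[symmetric]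
  by (simp add: algebra_simps inner_commute)
 finally show "pdt T (X q) t u = - (gg q t u *\<^sub>R fu q t u)" .
qed

section \<open>Consistency of the discrete quantities at a node\<close>

definition Qp where "Qp q t = (X q t (v q + bp q) - X q t (v q)) /\<^sub>R bp q"
definition Qm where "Qm q t = (X q t (v q) - X q t (v q - bm q)) /\<^sub>R bm q"
definition eta where "eta q = (bp q + bm q) / 2"
definition sp where "sp q t = norm (Qp q t)"
definition sm where "sm q t = norm (Qm q t)"
definition TM where "TM q t = Qm q t /\<^sub>R sm q t"
definition MM where "MM q t = (bm q * sm q t + bp q * sp q t) / 2"
definition YY where "YY q t = (Qp q t /\<^sub>R sp q t - Qm q t /\<^sub>R sm q t) /\<^sub>R MM q t"

lemma step_le: "q \<in> I ==> \<bar>bp q\<bar> <= 1 * h q" "q \<in> I ==> \<bar>- bm q\<bar> <= 1 * h q"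
 "q \<in> I ==> h q <= chat * \<bar>bp q\<bar> & bp q ~= 0" "q \<in> I ==> h q <= chat * \<bar>bm q\<bar> & bm q ~= 0"
 "q \<in> I ==> h q <= chat * \<bar>eta q\<bar> & eta q ~= 0" "q \<in> I ==> 0 < eta q & eta q <= h q"
 using step_pos[of q] bp[of q] bm[of q] by (auto simp: eta_def field_simps)

lemma small_steps: "small 1 (%q t. bp q)" "small 1 (%q t. bm q)" "small 1 (%q t. eta q)"
 "small 2 (%q t. bp q - bm q)" "small 3 (%q t. (bp q)^2 - (bm q)^2)" "small 2 (%q t. (bp q)^2 + (bm q)^2)"
proof -
 show 1: "small 1 (%q t. bp q)" "small 1 (%q t. bm q)" "small 1 (%q t. eta q)"
  by (rule small_step[where C = 1]; use step_le in force)+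
 show 2: "small 2 (%q t. bp q - bm q)" by (rule small_step[where C = cbar]) (use b_diff in auto)
 have "small 3 (%q t. (bp q - bm q) * (bp q + bm q))"
  using small_mult[OF 2 small_add[OF 1(1,2)]] by (simp add: numeral_3_eq_3 numeral_2_eq_2)
 then show "small 3 (%q t. (bp q)^2 - (bm q)^2)" by (simp add: power2_eq_square algebra_simps)
 show "small 2 (%q t. (bp q)^2 + (bm q)^2)"
  using small_add[OF small_mult[OF 1(1) 1(1)] small_mult[OF 1(2) 1(2)]]
  by (simp only: power2_eq_square one_add_one)
qed

lemma small_x: "small 0 (%q t. x1 q t (v q))" "small 0 (%q t. x2 q t (v q))" "small 0 (%q t. x3 q t (v q))"
 "small 0 (%q t. gg q t (v q))" "small 0 (%q t. tt q t (v q))" "small 0 (%q t. yy q t (v q))"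
 "small 0 (%q t. yu q t (v q))" "small 0 (%q t. fu q t (v q))" "small 0 (%q t. X q t (v q))"
 by (rule small_eval, rule SX_mono, rule SX_x SX_gg SX_t yu fu, simp)+

lemma normal_proj_divide:
 "normal_proj \<tau> d /\<^sub>R (b * s) = inverse s *\<^sub>R (d /\<^sub>R b - (\<tau> \<bullet> (d /\<^sub>R b)) *\<^sub>R (\<tau>::'b::real_inner))"
 by (simp add: normal_proj_def scaleR_diff_right mult_ac)

lemma half_sum_scaleR: "((p + p) * (1 / 4)) *\<^sub>R a = (p *\<^sub>R (a::'b::real_vector)) /\<^sub>R 2"
 by simp

lemma scaleR_normal_part:
 "g *\<^sub>R (y - (\<tau> \<bullet> y) *\<^sub>R (\<tau>::'b::real_inner)) = g *\<^sub>R y - ((g *\<^sub>R y) \<bullet> \<tau>) *\<^sub>R \<tau>"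
 by (simp add: scaleR_diff_right inner_commute[of y])

lemma half_sum_minus_half_diff: "(1 / 2) *\<^sub>R (p + q) + (- 1 / 2) *\<^sub>R (p - q) = (q::'b::real_vector)"
proof -
 have "(1 / 2) *\<^sub>R (p + q) + (- 1 / 2) *\<^sub>R (p - q) = (1 / 2) *\<^sub>R ((p + q) - (p - q))"
  by (simp only: scaleR_diff_right[of "1 / 2" "p + q"] minus_divide_left[symmetric] scaleR_minus_left add_uminus_conv_diff)
 also have "(p + q) - (p - q) = q + q" by simp
 finally show ?thesis by (simp only: scaleR_half_double)
qed

lemma doubled_curvature:
 assumes n: "n ~= (0::real)"
 shows "inverse ((1 / 4) * ((2 * n) * (2 * n))) *\<^sub>R ((1 / 2) *\<^sub>R
    ((2 * n) *\<^sub>R b - ((b \<bullet> (2 *\<^sub>R a)) * inverse (2 * n)) *\<^sub>R (2 *\<^sub>R a)))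
  = inverse n *\<^sub>R b - (((a::'b::real_inner) \<bullet> b) * inverse n ^ 3) *\<^sub>R a"
proof -
 have c1: "inverse ((1 / 4) * ((2 * n) * (2 * n))) * (1 / 2 * (2 * n)) = inverse n"
  using n by (simp add: field_simps)
 have c2: "inverse ((1 / 4) * ((2 * n) * (2 * n))) * (1 / 2 * (2 * s * inverse (2 * n) * 2)) = s * inverse n ^ 3" for s
  using n by (simp add: field_simps power3_eq_cube)
 have i: "b \<bullet> (2 *\<^sub>R a) = 2 * (a \<bullet> b)" by (simp add: inner_commute[of b a])
 show ?thesis unfolding i by (simp only: scaleR_diff_right scaleR_scaleR c1 c2)
qed

lemma scaleR_inverse_divide: "inverse (m / e) *\<^sub>R (i *\<^sub>R (z::'b::real_vector)) = inverse m *\<^sub>R (i *\<^sub>R (e *\<^sub>R z))"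
 by (simp add: divide_inverse mult_ac)

lemma scaleR_half_combination:
 "e *\<^sub>R ((1 / 2) *\<^sub>R (s *\<^sub>R d - w *\<^sub>R p)) = (1 / 2) *\<^sub>R (s *\<^sub>R (e *\<^sub>R d) - (e * w) *\<^sub>R (p::'b::real_vector))"
 by (simp add: scaleR_diff_right mult_ac)

lemma residual_algebra:
 "m *\<^sub>R (- g) - (f0 - f1) = f1 - f0 - p *\<^sub>R f - (m *\<^sub>R g - ((p + q) / 2) *\<^sub>R f) + ((p - q) * (1 / 2)) *\<^sub>R (f::'b::real_vector)"
proof -
 have "((p + q) / 2) *\<^sub>R f + ((p - q) * (1 / 2)) *\<^sub>R f = ((p + q) / 2 + (p - q) * (1 / 2)) *\<^sub>R f"
  by (simp only: scaleR_add_left)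
 also have "(p + q) / 2 + (p - q) * (1 / 2) = p" by (simp add: field_simps)
 finally show ?thesis by (simp add: algebra_simps)
qed

lemma diff_quotients_scaleR:
 assumes "s ~= 0" "r ~= 0"
 shows "a /\<^sub>R s - (b::'b::real_vector) /\<^sub>R r = inverse (s * r) *\<^sub>R (r *\<^sub>R a - s *\<^sub>R b)"
proof -
 have "inverse (s * r) * r = inverse s" "inverse (s * r) * s = inverse r" using assms by simp_all
 then show ?thesis by (simp only: scaleR_diff_right scaleR_scaleR)
qed

lemma diff_divide_scaleR: "b ~= 0 ==> (a::'b::real_vector) /\<^sub>R b - c = (a - b *\<^sub>R c) /\<^sub>R b"
 by (simp add: scaleR_diff_right)

text \<open>In the sum the term with x_uu has the factor bp - bm, which is of order two by
  \<open>b_diff\<close>. In the difference the leading error has the factor bp^2 - bm^2, which is of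
  order three for the same reason, and one order is lost in dividing by \<open>eta\<close>.\<close>

lemma difference_quotients:
 "small 2 (%q t. Qp q t + Qm q t - 2 *\<^sub>R x1 q t (v q))"
 "small 2 (%q t. (Qp q t - Qm q t) /\<^sub>R eta q - x2 q t (v q))"
proof -
 obtain X' where X': "SS 4 X X'" using SX_mono[OF SX_x(1), of 4] unfolding SX_def by auto
 define Rp where "Rp q t = X q t (v q + bp q) - X q t (v q) - bp q *\<^sub>R x1 q t (v q)
   - ((bp q)^2 / 2) *\<^sub>R x2 q t (v q) - ((bp q) ^ 3 / 6) *\<^sub>R x3 q t (v q)" for q t
 define Rm where "Rm q t = X q t (v q + - bm q) - X q t (v q) - (- bm q) *\<^sub>R x1 q t (v q)
   - ((- bm q)^2 / 2) *\<^sub>R x2 q t (v q) - ((- bm q) ^ 3 / 6) *\<^sub>R x3 q t (v q)" for q t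
 have R: "small 4 Rp" "small 4 Rm"
  unfolding Rp_def[abs_def] Rm_def[abs_def]
  by (rule small_taylor4[where Cb = 1, OF _ X' u_deriv_x], rule step_le, assumption)+
 have Rb: "small 3 (%q t. Rp q t /\<^sub>R bp q)" "small 3 (%q t. Rm q t /\<^sub>R bm q)"
  by (rule small_divide_step[where c = chat], use R in \<open>simp add: eval_nat_numeral\<close>, rule step_le, assumption)+
 have Qp: "Qp q t = x1 q t (v q) + (bp q / 2) *\<^sub>R x2 q t (v q) + ((bp q)^2 / 6) *\<^sub>R x3 q t (v q) + Rp q t /\<^sub>R bp q"
  and Qm: "Qm q t = x1 q t (v q) - (bm q / 2) *\<^sub>R x2 q t (v q) + ((bm q)^2 / 6) *\<^sub>R x3 q t (v q) - Rm q t /\<^sub>R bm q"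
  if w: "q \<in> I" for q t
 proof -
  have nz: "bp q ~= 0" "bm q ~= 0" using step_pos[OF w] by auto
  have c: "inverse b * b = 1" "inverse b * (b^2 / 2) = b / 2" "inverse b * (b ^ 3 / 6) = b^2 / 6"
   if "b ~= 0" for b :: real using that by (simp_all add: power2_eq_square power3_eq_cube)
  have "X q t (v q + bp q) - X q t (v q) = Rp q t + bp q *\<^sub>R x1 q t (v q)
   + ((bp q)^2 / 2) *\<^sub>R x2 q t (v q) + ((bp q) ^ 3 / 6) *\<^sub>R x3 q t (v q)" by (simp add: Rp_def)
  then show "Qp q t = x1 q t (v q) + (bp q / 2) *\<^sub>R x2 q t (v q) + ((bp q)^2 / 6) *\<^sub>R x3 q t (v q) + Rp q t /\<^sub>R bp q"
   unfolding Qp_def by (simp only: scaleR_add_right scaleR_scaleR c[OF nz(1)] scaleR_one add_ac)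
  have "X q t (v q) - X q t (v q - bm q) = - Rm q t + bm q *\<^sub>R x1 q t (v q)
   - ((bm q)^2 / 2) *\<^sub>R x2 q t (v q) + ((bm q) ^ 3 / 6) *\<^sub>R x3 q t (v q)"
   by (simp add: Rm_def power3_eq_cube)
  then show "Qm q t = x1 q t (v q) - (bm q / 2) *\<^sub>R x2 q t (v q) + ((bm q)^2 / 6) *\<^sub>R x3 q t (v q) - Rm q t /\<^sub>R bm q"
   unfolding Qm_def by (simp only: scaleR_add_right scaleR_diff_right scaleR_minus_right scaleR_scaleR c[OF nz(2)] scaleR_one)
    simp
 qed
 have half: "small 2 (%q t. (bp q - bm q) * (1 / 2))" "small 2 (%q t. ((bp q)^2 + (bm q)^2) * (1 / 6))"
   "small 3 (%q t. ((bp q)^2 - (bm q)^2) * (1 / 6))"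
  using small_mult[OF small_steps(4) small_const[of "1 / 2"]] small_mult[OF small_steps(6) small_const[of "1 / 6"]]
   small_mult[OF small_steps(5) small_const[of "1 / 6"]] by simp_all
 have "small 2 (%q t. ((bp q - bm q) * (1 / 2)) *\<^sub>R x2 q t (v q) + (((bp q)^2 + (bm q)^2) * (1 / 6)) *\<^sub>R x3 q t (v q)
   + (Rp q t /\<^sub>R bp q - Rm q t /\<^sub>R bm q))"
  using small_add[OF small_add[OF small_scaleR[OF half(1) small_x(2), unfolded add_0_right]
     small_scaleR[OF half(2) small_x(3), unfolded add_0_right]]
    small_mono[OF small_diff[OF Rb], of 2]] by simp
 then show "small 2 (%q t. Qp q t + Qm q t - 2 *\<^sub>R x1 q t (v q))"
  by (rule small_cong) (simp add: Qp Qm algebra_simps scaleR_2 add_divide_distrib diff_divide_distrib)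
 have "small 3 (%q t. (((bp q)^2 - (bm q)^2) * (1 / 6)) *\<^sub>R x3 q t (v q) + (Rp q t /\<^sub>R bp q + Rm q t /\<^sub>R bm q))"
  using small_add[OF small_scaleR[OF half(3) small_x(3), unfolded add_0_right] small_add[OF Rb]] .
 then have "small (Suc 2) (%q t. Qp q t - Qm q t - eta q *\<^sub>R x2 q t (v q))"
  unfolding numeral_2_eq_2 numeral_3_eq_3[symmetric]
  by (rule small_cong) (simp add: Qp Qm eta_def power2_eq_square algebra_simps add_divide_distrib diff_divide_distrib)
 from small_divide_step[OF this step_le(5)]
 show "small 2 (%q t. (Qp q t - Qm q t) /\<^sub>R eta q - x2 q t (v q))"
  by (rule small_cong) (assumption | rule diff_divide_scaleR | (use step_le(5) in blast))+
qed

text \<open>A difference quotient differs from x_u by at most B h, which \<open>h_small\<close>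
  makes no larger than c0 / 2.\<close>

lemma speed_lower:
 assumes w: "q \<in> I" and t: "t \<in> {0..T}"
 shows "c0 / 2 <= sp q t" "c0 / 2 <= sm q t"
proof -
 have x2B: "norm (x2 q t u) <= B" for u
  using Ck_norm_bound[OF X_smooth[OF w] X_periodic[OF w] T _ t, of 0 2 8 u] X_norm[OF w]
  by (simp add: x2_def x1_def numeral_2_eq_2)
 have *: "c0 / 2 <= norm ((X q t (u + b) - X q t u) /\<^sub>R b)" if b: "\<bar>b\<bar> <= h q" "b ~= 0" for b u
 proof -
  let ?z = "X q t (u + b) - X q t u - b *\<^sub>R x1 q t u"
  have z: "norm ?z <= B * \<bar>b\<bar> ^ 2"
   by (rule taylor2_bound[where ?f2.0 = "x2 q t"]) (use u_deriv_x w t x2B in \<open>auto simp: u_deriv_def\<close>)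
  have e: "(X q t (u + b) - X q t u) /\<^sub>R b - x1 q t u = ?z /\<^sub>R b"
   using b by (simp add: scaleR_diff_right)
  have "norm (?z /\<^sub>R b) = norm ?z / \<bar>b\<bar>" by (simp add: divide_inverse mult.commute)
  also have "... <= B * \<bar>b\<bar> ^ 2 / \<bar>b\<bar>" by (rule divide_right_mono[OF z]) simp
  also have "... = B * \<bar>b\<bar>" using b by (cases "b < 0") (auto simp: power2_eq_square)
  finally have "norm ((X q t (u + b) - X q t u) /\<^sub>R b - x1 q t u) <= B * \<bar>b\<bar>" unfolding e .
  moreover have "B * \<bar>b\<bar> <= B * h q" using b B by (intro mult_left_mono) auto
  moreover have "c0 <= norm (x1 q t u)" using X_lower[OF w t] by (simp add: x1_def)
  moreover have "norm (x1 q t u) <= norm ((X q t (u + b) - X q t u) /\<^sub>R b) + norm ((X q t (u + b) - X q t u) /\<^sub>R b - x1 q t u)"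
   by (metis norm_minus_commute norm_triangle_sub)
  ultimately show ?thesis using h_small[OF w] by linarith
 qed
 show "c0 / 2 <= sp q t" unfolding sp_def Qp_def by (rule *) (use step_pos[OF w] bp[OF w] in auto)
 have e: "(X q t (v q + - bm q) - X q t (v q)) /\<^sub>R (- bm q) = Qm q t"
  unfolding Qm_def by (simp add: scaleR_diff_right)
 show "c0 / 2 <= sm q t" unfolding sm_def e[symmetric] by (rule *) (use step_pos[OF w] bm[OF w] in auto)
qed

text \<open>Symmetric and antisymmetric combinations of the two difference quotients at a node are
 approximated to second order; this uses \<open>b_diff\<close>.\<close>

lemma second_order:
 "approx 2 (%q t. YY q t) (%q t. yy q t (v q))"
 "approx 2 (%q t. MM q t / eta q) (%q t. norm (x1 q t (v q)))"
 "approx 1 (%q t. Qm q t) (%q t. x1 q t (v q))"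
 "approx 1 (%q t. sm q t) (%q t. norm (x1 q t (v q)))"
proof -
 define P where "P q t = Qp q t + Qm q t" for q t
 define D where "D q t = (Qp q t - Qm q t) /\<^sub>R eta q" for q t
 define S where "S q t = sp q t + sm q t" for q t
 \<comment> \<open>This is (sp - sm) / eta without division by a width, since sp^2 - sm^2 is the
   inner product of Qp - Qm with Qp + Qm.\<close>
 define W where "W q t = (D q t \<bullet> P q t) * inverse (S q t)" for q t
 define a where "a q t = x1 q t (v q)" for q t
 define b where "b q t = x2 q t (v q)" for q t
 have sab: "small 0 a" "small 0 b" unfolding a_def[abs_def] b_def[abs_def] by (rule small_x)+
 have P: "approx 2 P (%q t. 2 *\<^sub>R a q t)" unfolding P_def[abs_def] a_def
  by (rule approxI[OF _ difference_quotients(1)]) (use small_scaleR[OF small_const sab(1), of 2] in \<open>simp add: a_def\<close>)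
 have D: "approx 2 D b" unfolding D_def[abs_def] b_def
  by (rule approxI[OF _ difference_quotients(2)]) (use sab(2) in \<open>simp add: b_def[abs_def]\<close>)
 have eD: "eta q *\<^sub>R D q t = Qp q t - Qm q t" if "q \<in> I" for q t
  using step_le(5)[OF that] by (simp add: D_def)
 have Spos: "c0 <= S q t" if "q \<in> I" "t \<in> {0..T}" for q t
  using speed_lower[OF that] by (simp add: S_def)
 have Wd: "eta q * W q t = sp q t - sm q t" if w: "q \<in> I" and t: "t \<in> {0..T}" for q t
 proof -
  have "(sp q t - sm q t) * S q t = (Qp q t - Qm q t) \<bullet> P q t"
   unfolding S_def P_def sp_def sm_def
   by (simp add: inner_add_right inner_diff_left inner_commute power2_norm_eq_inner[symmetric] power2_eq_square algebra_simps)
  also have "... = eta q * (D q t \<bullet> P q t)" unfolding eD[OF w, symmetric] by simp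
  finally show ?thesis using Spos[OF w t] c0 by (simp add: W_def field_simps)
 qed
 have small_S: "small 0 S"
 proof -
  have sq: "small 0 (%q t. Qp q t \<bullet> Qp q t)" "small 0 (%q t. Qm q t \<bullet> Qm q t)"
  proof -
   have e: "small 0 (%q t. eta q *\<^sub>R D q t)"
    using small_mono[OF small_scaleR[OF small_steps(3) approxD(1)[OF D]]] by simp
   have "small 0 (%q t. (1 / 2) *\<^sub>R (P q t + eta q *\<^sub>R D q t))"
    using small_scaleR[OF small_const small_add[OF approxD(1)[OF P] e], of "1/2"] by simp
   then have q: "small 0 Qp"
    by (rule small_cong) (use eD in \<open>simp add: P_def scaleR_2[symmetric]\<close>)
   have "small 0 (%q t. (1 / 2) *\<^sub>R (P q t - eta q *\<^sub>R D q t))"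
    using small_scaleR[OF small_const small_diff[OF approxD(1)[OF P] e], of "1/2"] by simp
   then have q': "small 0 Qm"
    by (rule small_cong) (use eD in \<open>simp add: P_def scaleR_2[symmetric]\<close>)
   show "small 0 (%q t. Qp q t \<bullet> Qp q t)" "small 0 (%q t. Qm q t \<bullet> Qm q t)"
    using small_inner[OF q q] small_inner[OF q' q'] by simp_all
  qed
  have ge: "(c0 / 2)^2 <= Qp q t \<bullet> Qp q t" "(c0 / 2)^2 <= Qm q t \<bullet> Qm q t" if "q \<in> I" "t \<in> {0..T}" for q t
   using speed_lower[OF that] c0 unfolding sp_def sm_def power2_norm_eq_inner[symmetric] by (auto intro!: power_mono)
  have "small 0 (%q t. sqrt (Qp q t \<bullet> Qp q t) + sqrt (Qm q t \<bullet> Qm q t))"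
   using c0 by (intro small_add small_sqrt[OF sq(1) _ ge(1)] small_sqrt[OF sq(2) _ ge(2)]) auto
  then show ?thesis by (simp add: S_def[abs_def] sp_def sm_def norm_eq_sqrt_inner)
 qed
 have sW: "small 0 W" unfolding W_def[abs_def]
  using small_mult[OF small_inner[OF approxD(1)[OF D] approxD(1)[OF P]] small_inverse[OF small_S c0 Spos]] by simp
 have e2: "small 2 (%q t. eta q * eta q * F q t)" if "small 0 F" for F
  using small_mult[OF small_mult[OF small_steps(3) small_steps(3)] that] by (simp only: one_add_one add_0_right)
 \<comment> \<open>The sum of the squares of sp + sm and sp - sm equals that of |Qp + Qm| and |Qp -
   Qm|. Hence \<open>S\<close> is |P| up to a term with eta squared, with no first order
   term.\<close>
 have S2: "S q t * S q t = P q t \<bullet> P q t + eta q * eta q * (D q t \<bullet> D q t - W q t * W q t)"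
  if w: "q \<in> I" and t: "t \<in> {0..T}" for q t
 proof -
  have "eta q * eta q * (D q t \<bullet> D q t - W q t * W q t)
    = (eta q *\<^sub>R D q t) \<bullet> (eta q *\<^sub>R D q t) - (eta q * W q t) * (eta q * W q t)" by (simp add: algebra_simps)
  moreover have "S q t * S q t = P q t \<bullet> P q t + ((Qp q t - Qm q t) \<bullet> (Qp q t - Qm q t) - (sp q t - sm q t) * (sp q t - sm q t))"
  proof -
   have "sp q t * sp q t = Qp q t \<bullet> Qp q t" "sm q t * sm q t = Qm q t \<bullet> Qm q t"
    by (simp_all add: sp_def sm_def dot_square_norm power2_eq_square)
   then show ?thesis unfolding S_def P_def by (simp add: inner_simps inner_commute algebra_simps)
  qed
  ultimately show ?thesis unfolding eD[OF w] Wd[OF w t] by simp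
 qed
 have S2a: "approx 2 (%q t. S q t * S q t) (%q t. (2 *\<^sub>R a q t) \<bullet> (2 *\<^sub>R a q t))"
  by (rule approx_cong[OF approx_perturb[OF approx_inner[OF P P] e2]])
   (use small_diff[OF small_inner[OF approxD(1)[OF D] approxD(1)[OF D], unfolded add_0] small_mult[OF sW sW, unfolded add_0]] S2
    in \<open>auto\<close>)
 have an: "c0 <= norm (a q t)" if "q \<in> I" "t \<in> {0..T}" for q t
  using X_lower[OF that] by (simp add: a_def x1_def)
 have Sa: "approx 2 S (%q t. 2 * norm (a q t))"
 proof (rule approx_cong[OF approx_sqrt[OF S2a, of "c0 * c0"]])
  fix q t assume w: "q \<in> I" "t \<in> {0..T}"
  show "c0 * c0 <= S q t * S q t" using Spos[OF w] c0 by (intro mult_mono) auto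
  have "c0 * c0 <= (2 * norm (a q t)) * (2 * norm (a q t))" using an[OF w] c0 by (intro mult_mono) auto
  then show "c0 * c0 <= (2 *\<^sub>R a q t) \<bullet> (2 *\<^sub>R a q t)" by (simp add: power2_norm_eq_inner[symmetric] power2_eq_square)
  show "S q t = sqrt (S q t * S q t)" using Spos[OF w] c0 by simp
  show "2 * norm (a q t) = sqrt ((2 *\<^sub>R a q t) \<bullet> (2 *\<^sub>R a q t))" by (simp add: real_sqrt_mult norm_eq_sqrt_inner)
 qed (use c0 in auto)
 have na: "c0 <= 2 * norm (a q t)" if "q \<in> I" "t \<in> {0..T}" for q t using an[OF that] c0 by linarith
 have Wa: "approx 2 W (%q t. (b q t \<bullet> (2 *\<^sub>R a q t)) * inverse (2 * norm (a q t)))"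
  unfolding W_def[abs_def]
  by (intro approx_mult approx_inner D P approx_inverse[OF Sa c0]) (auto intro: Spos na)
 define p where "p q t = sp q t * sm q t" for q t
 have pge: "(c0 / 2) * (c0 / 2) <= p q t" if "q \<in> I" "t \<in> {0..T}" for q t
  unfolding p_def using speed_lower[OF that] c0 by (intro mult_mono) auto
 have pa: "approx 2 p (%q t. (1 / 4) * ((2 * norm (a q t)) * (2 * norm (a q t))))"
 proof (rule approx_cong[OF approx_perturb[OF approx_mult[OF approx_const approx_mult[OF Sa Sa]] e2]])
  show "small 0 (%q t. - (1 / 4) * (W q t * W q t))"
   using small_mult[OF small_const small_mult[OF sW sW], of "- (1 / 4)"] by simp
  fix q t assume w: "q \<in> I" "t \<in> {0..T}"
  have "eta q * eta q * (- (1 / 4) * (W q t * W q t)) = - (1 / 4) * ((eta q * W q t) * (eta q * W q t))" by simp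
  then show "p q t = 1 / 4 * (S q t * S q t) + eta q * eta q * (- (1 / 4) * (W q t * W q t))"
   unfolding Wd[OF w] p_def S_def by (simp add: algebra_simps)
 qed simp
 show M: "approx 2 (%q t. MM q t / eta q) (%q t. norm (x1 q t (v q)))"
 proof (rule approx_cong[OF approx_perturb[OF approx_mult[OF approx_const[of _ "1 / 2"] Sa]]])
  show "small 2 (%q t. 1 / 4 * ((bp q - bm q) * W q t))"
   using small_mult[OF small_const small_mult[OF small_steps(4) sW], of "1 / 4"] by (simp only: add_0_left add_0_right)
  fix q t assume w: "q \<in> I" "t \<in> {0..T}"
  have ep: "eta q ~= 0" using step_le(5)[OF w(1)] by simp
  have W': "W q t = (sp q t - sm q t) / eta q" using Wd[OF w] ep by (simp add: field_simps)
  have "MM q t = eta q * (1 / 2 * S q t) + 1 / 4 * ((bp q - bm q) * (sp q t - sm q t))"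
   unfolding MM_def S_def eta_def by (simp add: field_simps)
  then show "MM q t / eta q = 1 / 2 * S q t + 1 / 4 * ((bp q - bm q) * W q t)"
   unfolding W' using ep by (simp add: add_divide_distrib)
 qed (simp add: a_def)
 have Mge: "c0 / 2 <= MM q t / eta q" if w: "q \<in> I" "t \<in> {0..T}" for q t
 proof -
  have "bm q * (c0 / 2) <= bm q * sm q t" "bp q * (c0 / 2) <= bp q * sp q t"
   using speed_lower[OF w] step_pos[OF w(1)] by (auto intro!: mult_left_mono)
  then show ?thesis using step_le(6)[OF w(1)] unfolding MM_def eta_def by (simp add: field_simps)
 qed
 \<comment> \<open>In the numerator of \<open>YY\<close>, sm Qp - sp Qm equals eta / 2 times S D - W
   P. The eta cancels against the mass, so only quantities of order zero are left, each approximated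
   to second order.\<close>
 have "approx 2 (%q t. inverse (MM q t / eta q) *\<^sub>R (inverse (p q t) *\<^sub>R ((1 / 2) *\<^sub>R (S q t *\<^sub>R D q t - W q t *\<^sub>R P q t))))
   (%q t. inverse (norm (x1 q t (v q))) *\<^sub>R (inverse ((1 / 4) * ((2 * norm (a q t)) * (2 * norm (a q t)))) *\<^sub>R ((1 / 2) *\<^sub>R
    ((2 * norm (a q t)) *\<^sub>R b q t - ((b q t \<bullet> (2 *\<^sub>R a q t)) * inverse (2 * norm (a q t))) *\<^sub>R (2 *\<^sub>R a q t)))))"
 proof (intro approx_scaleR approx_diff approx_const Sa D Wa P approx_inverse[OF M, of "c0 / 2"] approx_inverse[OF pa, of "(c0 / 2) * (c0 / 2)"])
  fix q t assume w: "q \<in> I" "t \<in> {0..T}"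
  show "c0 / 2 <= MM q t / eta q" by (rule Mge[OF w])
  show "c0 / 2 <= norm (x1 q t (v q))" using an[OF w] c0 by (simp add: a_def)
  show "(c0 / 2) * (c0 / 2) <= p q t" by (rule pge[OF w])
  have "(c0 / 2) * (c0 / 2) <= norm (a q t) * norm (a q t)" using an[OF w] c0 by (intro mult_mono) auto
  then show "(c0 / 2) * (c0 / 2) <= (1 / 4) * ((2 * norm (a q t)) * (2 * norm (a q t)))" by simp
 qed (use c0 in auto)
 then show "approx 2 (%q t. YY q t) (%q t. yy q t (v q))"
 proof (rule approx_cong)
  fix q t assume w: "q \<in> I" "t \<in> {0..T}"
  have ep: "eta q ~= 0" using step_le(5)[OF w(1)] by simp
  have s: "sp q t ~= 0" "sm q t ~= 0" using speed_lower[OF w] c0 by auto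
  have "eta q *\<^sub>R ((1 / 2) *\<^sub>R (S q t *\<^sub>R D q t - W q t *\<^sub>R P q t))
    = (1 / 2) *\<^sub>R (S q t *\<^sub>R (eta q *\<^sub>R D q t) - (eta q * W q t) *\<^sub>R P q t)"
   by (rule scaleR_half_combination)
  also have "... = sm q t *\<^sub>R Qp q t - sp q t *\<^sub>R Qm q t"
  proof -
   have "S q t *\<^sub>R (Qp q t - Qm q t) - (sp q t - sm q t) *\<^sub>R P q t = 2 *\<^sub>R (sm q t *\<^sub>R Qp q t - sp q t *\<^sub>R Qm q t)"
    unfolding S_def P_def scaleR_2 by (simp add: algebra_simps)
   then show ?thesis unfolding eD[OF w(1)] Wd[OF w] by simp
  qed
  finally have 1: "eta q *\<^sub>R ((1 / 2) *\<^sub>R (S q t *\<^sub>R D q t - W q t *\<^sub>R P q t)) = sm q t *\<^sub>R Qp q t - sp q t *\<^sub>R Qm q t" .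
  have 2: "Qp q t /\<^sub>R sp q t - Qm q t /\<^sub>R sm q t = inverse (p q t) *\<^sub>R (sm q t *\<^sub>R Qp q t - sp q t *\<^sub>R Qm q t)"
   unfolding p_def by (rule diff_quotients_scaleR) (use s in auto)
  have "inverse (MM q t / eta q) *\<^sub>R (inverse (p q t) *\<^sub>R ((1 / 2) *\<^sub>R (S q t *\<^sub>R D q t - W q t *\<^sub>R P q t)))
    = inverse (MM q t) *\<^sub>R (inverse (p q t) *\<^sub>R (eta q *\<^sub>R ((1 / 2) *\<^sub>R (S q t *\<^sub>R D q t - W q t *\<^sub>R P q t))))"
   by (rule scaleR_inverse_divide)
  then show "YY q t = inverse (MM q t / eta q) *\<^sub>R (inverse (p q t) *\<^sub>R ((1 / 2) *\<^sub>R (S q t *\<^sub>R D q t - W q t *\<^sub>R P q t)))"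
   unfolding 1 YY_def 2 by simp
  define n where "n = norm (a q t)"
  have n: "n ~= 0" using an[OF w] c0 by (auto simp: n_def)
  have "yy q t (v q) = inverse n *\<^sub>R (inverse n *\<^sub>R b q t - ((a q t \<bullet> b q t) * inverse n ^ 3) *\<^sub>R a q t)"
   unfolding yy_def tu_def gu_def gg_eq n_def a_def b_def inner_commute[of "x2 q t (v q)"]
   by (simp add: power3_eq_cube)
  also have "... = inverse n *\<^sub>R (inverse ((1 / 4) * ((2 * n) * (2 * n))) *\<^sub>R ((1 / 2) *\<^sub>R
    ((2 * n) *\<^sub>R b q t - ((b q t \<bullet> (2 *\<^sub>R a q t)) * inverse (2 * n)) *\<^sub>R (2 *\<^sub>R a q t))))"
   unfolding doubled_curvature[OF n] ..
  finally show "yy q t (v q) = inverse (norm (x1 q t (v q))) *\<^sub>R (inverse ((1 / 4) * ((2 * norm (a q t)) * (2 * norm (a q t)))) *\<^sub>R ((1 / 2) *\<^sub>R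
    ((2 * norm (a q t)) *\<^sub>R b q t - ((b q t \<bullet> (2 *\<^sub>R a q t)) * inverse (2 * norm (a q t))) *\<^sub>R (2 *\<^sub>R a q t))))"
   by (simp add: n_def a_def)
 qed
 have eD1: "small 1 (%q t. (- 1 / 2 * eta q) *\<^sub>R D q t)"
  using small_scaleR[OF small_mult[OF small_const small_steps(3)] approxD(1)[OF D], of "- 1 / 2"] by simp
 show Q: "approx 1 (%q t. Qm q t) (%q t. x1 q t (v q))"
 proof (rule approx_cong[OF approx_perturb[OF approx_scaleR[OF approx_const[of _ "1 / 2 :: real"] approx_mono[OF P]] eD1]])
  fix q t assume w: "q \<in> I"
  have "(- 1 / 2 * eta q) *\<^sub>R D q t = (- 1 / 2) *\<^sub>R (eta q *\<^sub>R D q t)" by simp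
  then show "Qm q t = (1 / 2) *\<^sub>R P q t + (- 1 / 2 * eta q) *\<^sub>R D q t"
   by (simp only: eD[OF w] P_def half_sum_minus_half_diff)
 qed (simp_all add: a_def)
 have eW1: "small 1 (%q t. (- 1 / 2 * eta q) * W q t)"
  using small_mult[OF small_mult[OF small_const small_steps(3)] sW, of "- 1 / 2"] by simp
 show "approx 1 (%q t. sm q t) (%q t. norm (x1 q t (v q)))"
 proof (rule approx_cong[OF approx_perturb[OF approx_mult[OF approx_const[of _ "1 / 2 :: real"] approx_mono[OF Sa]] eW1]])
  fix q t assume w: "q \<in> I" "t \<in> {0..T}"
  have "(- 1 / 2 * eta q) * W q t = (- 1 / 2) * (eta q * W q t)" by simp
  then show "sm q t = 1 / 2 * S q t + (- 1 / 2 * eta q) * W q t"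
   unfolding Wd[OF w] S_def by (simp add: field_simps)
 qed (simp_all add: a_def)
qed

lemma periodic_fields:
 assumes w: "q \<in> I" and t: "t \<in> {0..T}"
 shows "yy q t (u + 2 * pi) = yy q t u" "ff q t (u + 2 * pi) = ff q t u"
proof -
 have p1: "\<forall>t\<in>{0..T}. periodic_2pi (x1 q t)"
  unfolding x1_def by (rule periodic_pdu[OF X_smooth[OF w] X_periodic[OF w]])
 have p2: "\<forall>t\<in>{0..T}. periodic_2pi (x2 q t)"
  unfolding x2_def by (rule periodic_pdu[OF _ p1]) (simp add: x1_def smooth_pdu X_smooth[OF w])
 have x: "x1 q t (u + 2 * pi) = x1 q t u" "x2 q t (u + 2 * pi) = x2 q t u" for u
  using periodic_2piD p1 p2 t by blast+
 have g: "gg q t (u + 2 * pi) = gg q t u" "tt q t (u + 2 * pi) = tt q t u" "yy q t (u + 2 * pi) = yy q t u" for u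
  by (simp_all add: gg_def tt_def yy_def tu_def gu_def x)
 show "yy q t (u + 2 * pi) = yy q t u" by (rule g)
 have e: "(%u. yy q t (2 * pi + u)) = yy q t" using g(3) by (simp add: fun_eq_iff add.commute)
 have "(yy q t has_vector_derivative yu q t (2 * pi + u)) (at u)"
  using has_vector_derivative_shift_arg[of "yy q t" "yu q t (2 * pi + u)" "2 * pi" u] yu(1) w t
  unfolding e by (auto simp: u_deriv_def)
 moreover have "(yy q t has_vector_derivative yu q t u) (at u)" using yu(1) w t by (auto simp: u_deriv_def)
 ultimately have "yu q t (2 * pi + u) = yu q t u" by (rule vector_derivative_unique_at)
 then have "yu q t (u + 2 * pi) = yu q t u" by (simp only: add.commute)
 then show "ff q t (u + 2 * pi) = ff q t u" by (simp add: ff_def zz_def g x)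
qed

text \<open>All fields but \<open>yu\<close> are given by formulas in the curve. \<open>yu\<close>
  was chosen by \<open>SOME\<close>, so its values at two indices are compared through the
  derivative of the curvature.\<close>

lemma fields_shift:
 assumes w: "q \<in> I" and w': "q' \<in> I" and t: "t \<in> {0..T}" and X: "X q' = X q"
 shows "yy q' t u = yy q t u" "ff q' t u = ff q t u"
proof -
 have x: "x1 q' = x1 q" "x2 q' = x2 q" by (simp_all add: x1_def x2_def X)
 have g: "gg q' = gg q" "tt q' = tt q" "yy q' = yy q"
  by (simp_all add: fun_eq_iff gg_def tt_def yy_def tu_def gu_def x)
 then show "yy q' t u = yy q t u" by simp
 have "yu q' t u = yu q t u"
  using flow_conservative(3)[OF w t, of u] flow_conservative(3)[OF w' t, of u] X by simp
 then show "ff q' t u = ff q t u" by (simp add: ff_def zz_def g x)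
qed

lemma yy_pv: "q \<in> I ==> t \<in> {0..T} ==> yy (pv q) t (v (pv q)) = yy q t (v q + - bm q)"
 and ff_nx: "q \<in> I ==> t \<in> {0..T} ==> ff (nx q) t (v (nx q)) = ff q t (v q + bp q)"
proof -
 assume w: "q \<in> I" and t: "t \<in> {0..T}"
 show "yy (pv q) t (v (pv q)) = yy q t (v q + - bm q)"
  using fields_shift(1)[OF w _ t] pv[OF w] v_pv[OF w] periodic_fields(1)[OF w t] by auto
 have "ff q t (v (nx q)) = ff q t (v q + bp q)"
  using v_nx[OF w] periodic_fields(2)[OF w t, of "v (nx q)"] by auto
 then show "ff (nx q) t (v (nx q)) = ff q t (v q + bp q)"
  using fields_shift(2)[OF w _ t] nx[OF w] by simp
qed

text \<open>The second order accuracy of the curvature is needed at both nodes: dividing by the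
  width then leaves first order accuracy of the slope, which enters the flux.\<close>

lemma curvature_step:
 "small 2 (%q t. YY q t - YY (pv q) t - bm q *\<^sub>R yu q t (v q))"
proof -
 have 1: "small 2 (%q t. YY q t - yy q t (v q))" by (rule approxD[OF second_order(1)])
 have 2: "small 2 (%q t. YY (pv q) t - yy (pv q) t (v (pv q)))"
  by (rule small_shift[OF 1]) (use pv in blast)
 have 3: "small 2 (%q t. yy q t (v q + - bm q) - yy q t (v q) - (- bm q) *\<^sub>R yu q t (v q))"
  by (rule small_taylor2[where Cb = 1, OF _ _ yu(1)]) (use step_le SX_mono[OF SX_t(4), of 2] in auto)
 show ?thesis
  by (rule small_cong[OF small_diff[OF small_diff[OF 1 2] 3]]) (simp add: yy_pv)
qed

definition FL where
 "FL q t = normal_proj (TM q t) (YY q t - YY (pv q) t) /\<^sub>R (bm q * sm q t)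
   + (((norm (YY q t))^2 + (norm (YY (pv q) t))^2) / 4) *\<^sub>R TM q t - lam *\<^sub>R Qm q t"

text \<open>The discrete flux belongs to the edge on the left of the node but is compared with
  \<open>ff\<close> at the node, the right end of that edge. First order is what this comparison
  gives, and it suffices because the error stays inside the flux difference.\<close>

lemma first_order:
 "approx 1 (%q t. TM q t) (%q t. tt q t (v q))"
 "approx 1 (%q t. (YY q t - YY (pv q) t) /\<^sub>R bm q) (%q t. yu q t (v q))"
 "small 1 (%q t. YY q t - YY (pv q) t)"
 "approx 1 (%q t. FL q t) (%q t. ff q t (v q))"
proof -
 have i: "approx 1 (%q t. inverse (sm q t)) (%q t. inverse (norm (x1 q t (v q))))"
 proof (rule approx_inverse[OF second_order(4), of "c0 / 2"])
  fix q t assume w: "q \<in> I" "t \<in> {0..T}"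
  show "c0 / 2 <= sm q t" using speed_lower(2)[OF w] by linarith
  show "c0 / 2 <= norm (x1 q t (v q))" using X_lower[OF w, of "v q"] c0 by (simp add: x1_def)
 qed (use c0 in simp)
 show T1: "approx 1 (%q t. TM q t) (%q t. tt q t (v q))"
  by (rule approx_cong[OF approx_scaleR[OF i second_order(3)]]) (simp_all add: TM_def tt_def gg_eq)
 have "small (Suc 1) (%q t. YY q t - YY (pv q) t - bm q *\<^sub>R yu q t (v q))"
  using curvature_step by (simp add: numeral_2_eq_2)
 from small_divide_step[OF this step_le(4)]
 have d: "small 1 (%q t. (YY q t - YY (pv q) t) /\<^sub>R bm q - yu q t (v q))"
  by (rule small_cong) (assumption | rule diff_divide_scaleR | (use step_le(4) in blast))+
 show Y1: "approx 1 (%q t. (YY q t - YY (pv q) t) /\<^sub>R bm q) (%q t. yu q t (v q))"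
  by (rule approxI[OF small_x(7) d])
 have "small (1 + 0) (%q t. bm q *\<^sub>R ((YY q t - YY (pv q) t) /\<^sub>R bm q))"
  by (rule small_scaleR[OF small_steps(2) approxD(1)[OF Y1]])
 then have s1: "small 1 (%q t. bm q *\<^sub>R ((YY q t - YY (pv q) t) /\<^sub>R bm q))" by simp
 show dY: "small 1 (%q t. YY q t - YY (pv q) t)"
  by (rule small_cong[OF s1]) (simp add: step_le(4))
 have Y: "approx 1 (%q t. YY q t) (%q t. yy q t (v q))" by (rule approx_mono[OF second_order(1)]) simp
 have "approx 1 (%q t. YY q t + - 1 *\<^sub>R (YY q t - YY (pv q) t)) (%q t. yy q t (v q))"
  by (rule approx_perturb[OF Y]) (use small_scaleR[OF small_const dY, of "- 1"] in simp)
 then have Yp: "approx 1 (%q t. YY (pv q) t) (%q t. yy q t (v q))" by simp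
 define D where "D q t = (YY q t - YY (pv q) t) /\<^sub>R bm q" for q t
 have D: "approx 1 D (%q t. yu q t (v q))" unfolding D_def[abs_def] by (rule Y1)
 have "approx 1 (%q t. inverse (sm q t) *\<^sub>R (D q t - (TM q t \<bullet> D q t) *\<^sub>R TM q t)
    + ((YY q t \<bullet> YY q t + YY (pv q) t \<bullet> YY (pv q) t) * (1 / 4)) *\<^sub>R TM q t - lam *\<^sub>R Qm q t)
   (%q t. inverse (norm (x1 q t (v q))) *\<^sub>R (yu q t (v q) - (tt q t (v q) \<bullet> yu q t (v q)) *\<^sub>R tt q t (v q))
    + ((yy q t (v q) \<bullet> yy q t (v q) + yy q t (v q) \<bullet> yy q t (v q)) * (1 / 4)) *\<^sub>R tt q t (v q) - lam *\<^sub>R x1 q t (v q))"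
  by (rule approx_diff[OF approx_add[OF approx_scaleR[OF i approx_diff[OF D approx_scaleR[OF approx_inner[OF T1 D] T1]]]
     approx_scaleR[OF approx_mult[OF approx_add[OF approx_inner[OF Y Y] approx_inner[OF Yp Yp]] approx_const] T1]]
    approx_scaleR[OF approx_const second_order(3)]])
 then show "approx 1 (%q t. FL q t) (%q t. ff q t (v q))"
 proof (rule approx_cong)
  fix q t assume w: "q \<in> I"
  show "FL q t = inverse (sm q t) *\<^sub>R (D q t - (TM q t \<bullet> D q t) *\<^sub>R TM q t)
    + ((YY q t \<bullet> YY q t + YY (pv q) t \<bullet> YY (pv q) t) * (1 / 4)) *\<^sub>R TM q t - lam *\<^sub>R Qm q t"
   by (simp only: FL_def D_def normal_proj_divide power2_norm_eq_inner divide_inverse mult_1_left)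
  show "ff q t (v q) = inverse (norm (x1 q t (v q))) *\<^sub>R (yu q t (v q) - (tt q t (v q) \<bullet> yu q t (v q)) *\<^sub>R tt q t (v q))
    + ((yy q t (v q) \<bullet> yy q t (v q) + yy q t (v q) \<bullet> yy q t (v q)) * (1 / 4)) *\<^sub>R tt q t (v q) - lam *\<^sub>R x1 q t (v q)"
   unfolding ff_def zz_def gg_eq half_sum_scaleR scaleR_normal_part ..
 qed
qed

text \<open>The increment of \<open>ff\<close> is \<open>bp\<close> times its derivative up to
  second order, and the mass times the velocity is minus \<open>eta\<close> times that derivative.
  The difference of \<open>bp\<close> and \<open>eta\<close> is (bp - bm) / 2, again of second order
  by \<open>b_diff\<close>.\<close>

lemma residual_small:
 "small 2 (%q t. MM q t *\<^sub>R pdt T (X q) t (v q) - (ff q t (v q) - ff q t (v q + bp q)))"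
proof -
 define G where "G q t = gg q t (v q) *\<^sub>R fu q t (v q)" for q t
 have G: "small 0 G" unfolding G_def[abs_def] using small_scaleR[OF small_x(4) small_x(8)] by simp
 have 1: "small 2 (%q t. ff q t (v q + bp q) - ff q t (v q) - bp q *\<^sub>R fu q t (v q))"
  by (rule small_taylor2[where Cb = 1, OF _ _ fu(1)]) (use step_le SX_mono[OF SX_zf(2), of 2] in auto)
 have 2: "small 2 (%q t. ((MM q t / eta q - norm (x1 q t (v q))) * eta q) *\<^sub>R G q t)"
  using small_mono[OF small_scaleR[OF small_mult[OF approxD(3)[OF second_order(2)] small_steps(3)] G], of 2] by simp
 have 3: "small 2 (%q t. ((bp q - bm q) * (1 / 2)) *\<^sub>R fu q t (v q))"
  using small_scaleR[OF small_mult[OF small_steps(4) small_const[of "1 / 2"]] small_x(8)] by simp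
 show ?thesis
 proof (rule small_cong[OF small_add[OF small_diff[OF 1 2] 3]])
  fix q t assume w: "q \<in> I" "t \<in> {0..T}"
  have ep: "eta q ~= 0" using step_le(5)[OF w(1)] by simp
  have n: "norm (x1 q t (v q)) *\<^sub>R G q t = fu q t (v q)"
   using x1_nz[OF w, of "v q"] by (simp add: G_def gg_eq)
  have "((MM q t / eta q - norm (x1 q t (v q))) * eta q) *\<^sub>R G q t = MM q t *\<^sub>R G q t - eta q *\<^sub>R (norm (x1 q t (v q)) *\<^sub>R G q t)"
   using ep by (simp add: algebra_simps)
  then have "((MM q t / eta q - norm (x1 q t (v q))) * eta q) *\<^sub>R G q t = MM q t *\<^sub>R G q t - eta q *\<^sub>R fu q t (v q)"
   unfolding n .
  then show "MM q t *\<^sub>R pdt T (X q) t (v q) - (ff q t (v q) - ff q t (v q + bp q))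
   = ff q t (v q + bp q) - ff q t (v q) - bp q *\<^sub>R fu q t (v q)
    - ((MM q t / eta q - norm (x1 q t (v q))) * eta q) *\<^sub>R G q t + ((bp q - bm q) * (1 / 2)) *\<^sub>R fu q t (v q)"
   by (simp only: flow_conservative(1)[OF w] G_def[symmetric] eta_def residual_algebra)
 qed
qed

end

section \<open>Explicit bounds, uniform over all nodes\<close>

context node_jets
begin

lemma uniform_lipschitz:
 fixes F :: "'w => real => real => 'b::real_normed_vector"
 assumes "SX (Suc k) F"
 shows "\<exists>C\<ge>0. \<forall>q\<in>I. \<forall>t\<in>{0..T}. \<forall>u w. norm (F q t w - F q t u) <= C * \<bar>w - u\<bar>"
proof -
 obtain G where G: "u_deriv F G" "SX 0 G" using SX_deriv[of 0 F] SX_mono[OF assms, of 1] by auto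
 obtain C where C: "\<forall>q\<in>I. \<forall>t\<in>{0..T}. \<forall>u. norm (G q t u) <= C"
  using G(2) unfolding SX_def SS.simps SS0_def by blast
 show ?thesis
 proof (intro exI[of _ "\<bar>C\<bar>"] conjI ballI allI)
  fix q t u w assume w: "q \<in> I" "t \<in> {0..T}"
  have "norm (F q t w - F q t u) <= \<bar>C\<bar> * norm (w - u)"
  proof (rule differentiable_bound[of UNIV "F q t" "%u d. d *\<^sub>R G q t u"])
   show "(F q t has_derivative (%d. d *\<^sub>R G q t u)) (at u)" for u
    using G(1) w unfolding u_deriv_def has_vector_derivative_def by blast
   show "onorm (%d. d *\<^sub>R G q t u) <= \<bar>C\<bar>" for u
   proof (rule onorm_le)
    fix d :: real
    have "norm (G q t u) <= \<bar>C\<bar>" using C w by (auto intro: order_trans[OF _ abs_ge_self])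
    then show "norm (d *\<^sub>R G q t u) <= \<bar>C\<bar> * norm d" by (simp add: mult.commute[of "\<bar>C\<bar>"] mult_left_mono)
   qed
  qed auto
  then show "norm (F q t w - F q t u) <= \<bar>C\<bar> * \<bar>w - u\<bar>" by simp
 qed simp
qed

text \<open>The bound is required for every derivative \<open>A'\<close>, so it can be applied to
  whichever expression for the derivative is at hand. As it holds for all large \<open>C\<close>,
  finitely many such conditions are combined by \<open>eventually\<close> at infinity.\<close>

definition bounded_order :: "nat => ('w => real => 'b::real_normed_vector) => real => bool" where
 "bounded_order k A C \<longleftrightarrow> (\<forall>q\<in>I. \<forall>t\<in>{0..T}. A q differentiable (at t within {0..T}) & norm (A q t) <= C * h q ^ k
  & (\<forall>A'. (A q has_vector_derivative A') (at t within {0..T}) --> norm A' <= C * h q ^ k))"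

lemma bounded_orderD:
 assumes "bounded_order k A C" "q \<in> I" "t \<in> {0..T}"
 shows "A q differentiable (at t within {0..T})" "norm (A q t) <= C * h q ^ k"
  "(A q has_vector_derivative A') (at t within {0..T}) ==> norm A' <= C * h q ^ k"
 using assms unfolding bounded_order_def by auto

lemma eventually_bounded_order:
 fixes A :: "'w => real => 'b::real_normed_vector"
 assumes "small k A"
 shows "eventually (bounded_order k A) at_top"
proof -
 obtain A2 C where A: "bnd k A A2 C" by (rule small_E[OF assms])
 have e: "A' = A2 q t" if "q \<in> I" "t \<in> {0..T}" "(A q has_vector_derivative A') (at t within {0..T})" for q t A'
  by (rule vector_derivative_unique_within[OF _ that(3) bndD(2)[OF A that(1,2)]])
   (use T that in \<open>auto simp: trivial_limit_within islimpt_Icc\<close>)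
 show ?thesis
 proof (rule eventually_at_top_linorderI[of C])
  fix D assume D: "C <= D"
  show "bounded_order k A D" unfolding bounded_order_def
  proof (intro conjI ballI allI impI)
   fix q t assume w: "q \<in> I" "t \<in> {0..T}"
   have CD: "C * h q ^ k <= D * h q ^ k" using D h[OF w(1)] by (intro mult_right_mono) auto
   show "A q differentiable (at t within {0..T})" by (rule differentiableI_vector[OF bndD(2)[OF A w]])
   show "norm (A q t) <= D * h q ^ k" using bndD[OF A] w CD by force
   show "norm A' <= D * h q ^ k" if "(A q has_vector_derivative A') (at t within {0..T})" for A'
    using bndD[OF A] w e[OF w that] CD by force
  qed
 qed
qed

definition lipschitz_bound :: "('w => real => real => 'b::real_normed_vector) => real => bool" where
 "lipschitz_bound F C \<longleftrightarrow> (\<forall>q\<in>I. \<forall>t\<in>{0..T}. \<forall>u w. norm (F q t w - F q t u) <= C * \<bar>w - u\<bar>)"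

lemma eventually_lipschitz_bound:
 fixes F :: "'w => real => real => 'b::real_normed_vector"
 assumes "SX (Suc k) F"
 shows "eventually (lipschitz_bound F) at_top"
proof -
 obtain C where C: "\<forall>q\<in>I. \<forall>t\<in>{0..T}. \<forall>u w. norm (F q t w - F q t u) <= C * \<bar>w - u\<bar>"
  using uniform_lipschitz[OF assms] by blast
 show ?thesis
 proof (rule eventually_at_top_linorderI[of C])
  fix D assume D: "C <= D"
  have "C * \<bar>w - u\<bar> <= D * \<bar>w - u\<bar>" for w u using D by (intro mult_right_mono) auto
  then show "lipschitz_bound F D" unfolding lipschitz_bound_def using C by (meson order_trans)
 qed
qed

lemma small_quantities:
 "small 0 (%q t. X q t (v q))" "small 1 (%q t. bm q *\<^sub>R Qm q t)" "small 1 (%q t. bm q * sm q t)"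
 "small 0 YY" "small 1 (%q t. YY q t - YY (pv q) t)" "small 0 TM" "small 1 (%q t. ff q t (v q) - FL q t)"
 "small 2 (%q t. MM q t *\<^sub>R pdt T (X q) t (v q) - (ff q t (v q) - ff q t (v q + bp q)))"
 "small 1 (%q t. Qm q t - x1 q t (v q))" "small 1 (%q t. YY q t - yy q t (v q))"
 "small 1 (%q t. (YY q t - YY (pv q) t) /\<^sub>R bm q - yu q t (v q))"
proof -
 show "small 0 (%q t. X q t (v q))" by (rule small_x)
 show "small 1 (%q t. bm q *\<^sub>R Qm q t)"
  using small_scaleR[OF small_steps(2) approxD(1)[OF second_order(3)]] by simp
 show "small 1 (%q t. bm q * sm q t)"
  using small_mult[OF small_steps(2) approxD(1)[OF second_order(4)]] by simp
 show "small 0 YY" using approxD(1)[OF second_order(1)] by simp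
 show "small 1 (%q t. YY q t - YY (pv q) t)" by (rule first_order)
 show "small 0 TM" using approxD(1)[OF first_order(1)] by simp
 have "small 1 (%q t. - (FL q t - ff q t (v q)))"
  by (rule small_uminus[OF approxD(3)[OF first_order(4)]])
 then show "small 1 (%q t. ff q t (v q) - FL q t)" by simp
 show "small 2 (%q t. MM q t *\<^sub>R pdt T (X q) t (v q) - (ff q t (v q) - ff q t (v q + bp q)))"
  by (rule residual_small)
 show "small 1 (%q t. Qm q t - x1 q t (v q))" by (rule approxD[OF second_order(3)])
 show "small 1 (%q t. YY q t - yy q t (v q))" by (rule small_mono[OF approxD(3)[OF second_order(1)]]) simp
 show "small 1 (%q t. (YY q t - YY (pv q) t) /\<^sub>R bm q - yu q t (v q))" by (rule approxD[OF first_order(2)])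
qed

lemma SX_time: "SX 3 (%q. pdt T (X q))"
proof -
 have 1: "SX 3 (%q t u. - (gg q t u *\<^sub>R fu q t u))"
  by (intro SX_uminus SX_scaleR SX_mono[OF SX_gg] fu) simp
 then obtain A' where "SS 3 (%q t u. - (gg q t u *\<^sub>R fu q t u)) A'" unfolding SX_def by blast
 then have "SS 3 (%q. pdt T (X q)) A'"
  by (rule SS_cong) (simp add: flow_conservative(1))
 then show ?thesis unfolding SX_def by blast
qed

context
 fixes N :: nat and W :: "nat => 'w" and x :: "real => real => 'a" and z :: "nat => 'a" and t :: real and hh :: "nat => real"
 assumes W: "\<forall>i\<in>idx N. W i \<in> I & nx (W i) = W (nxt N i) & pv (W i) = W (prv N i) & X (W i) = x
   & z i = x t (v (W i)) & hh i = bm (W i)"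
  and t: "t \<in> {0..T}"
begin

lemma nodal_curve:
 assumes i: "i \<in> idx N"
 shows "edge N z i = bm (W i) *\<^sub>R Qm (W i) t" "norm (edge N z i) = bm (W i) * sm (W i) t"
  "ptang N z i = TM (W i) t" "pmass N z i = MM (W i) t" "pcurv N z i = YY (W i) t"
proof -
 have w: "W i \<in> I" and X: "X (W i) = x" using W i by auto
 note pos = step_pos[OF w]
 have per: "x t (u + 2 * pi) = x t u" for u
  using X_periodic[OF w] t X by (auto intro: periodic_2piD)
 have zp: "z (prv N i) = x t (v (pv (W i)))" "z (nxt N i) = x t (v (nx (W i)))" using W i by auto
 have "x t (v (pv (W i))) = x t (v (W i) - bm (W i))" using v_pv[OF w] per by auto
 moreover have "x t (v (nx (W i))) = x t (v (W i) + bp (W i))" using v_nx[OF w] per[of "v (nx (W i))"] by auto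
 moreover have "z i = x t (v (W i))" using W i by auto
 ultimately have e: "edge N z i = bm (W i) *\<^sub>R Qm (W i) t"
  and en: "edge N z (nxt N i) = bp (W i) *\<^sub>R Qp (W i) t"
  using pos i by (simp_all add: edge_def zp Qm_def Qp_def X)
 show "edge N z i = bm (W i) *\<^sub>R Qm (W i) t" by (rule e)
 show n: "norm (edge N z i) = bm (W i) * sm (W i) t" using pos by (simp add: e sm_def)
 have nn: "norm (edge N z (nxt N i)) = bp (W i) * sp (W i) t" using pos by (simp add: en sp_def)
 have tn: "ptang N z (nxt N i) = Qp (W i) t /\<^sub>R sp (W i) t"
  using pos by (simp add: ptang_def nn) (simp add: en)
 show tm: "ptang N z i = TM (W i) t"
  using pos by (simp add: ptang_def n TM_def) (simp add: e)
 show m: "pmass N z i = MM (W i) t" by (simp add: pmass_def MM_def n nn)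
 show "pcurv N z i = YY (W i) t" by (simp add: pcurv_def m tn tm YY_def TM_def)
qed

lemma nodal_flux:
 assumes i: "i \<in> idx N"
 shows "edge N (pcurv N z) i = YY (W i) t - YY (pv (W i)) t" "pflux N lam hh z i = FL (W i) t"
proof -
 have p: "pcurv N z (prv N i) = YY (pv (W i)) t" using nodal_curve(5)[of "prv N i"] W i by simp
 show e: "edge N (pcurv N z) i = YY (W i) t - YY (pv (W i)) t" by (simp add: edge_def p nodal_curve(5)[OF i])
 have b: "(lam / hh i) *\<^sub>R edge N z i = lam *\<^sub>R Qm (W i) t"
  using W i step_pos(2)[of "W i"] by (simp add: nodal_curve(1)[OF i])
 show "pflux N lam hh z i = FL (W i) t"
  unfolding pflux_def e p b FL_def nodal_curve(2,3,5)[OF i] ..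
qed

end

end

section \<open>Consistency of the nodes of the exact solution\<close>

context node_jets
begin

text \<open>The two scalar conditions on \<open>C\<close> serve the lower bound for the edge lengths
  and the bound for the number of nodes times h.\<close>

definition common_bound :: "real => bool" where
 "common_bound C \<longleftrightarrow> 0 <= C & 4 * chat / c0 <= C & 2 * pi * chat <= C
  & bounded_order 0 (%q t. X q t (v q)) C & bounded_order 1 (%q t. bm q *\<^sub>R Qm q t) C
  & bounded_order 1 (%q t. bm q * sm q t) C & bounded_order 0 YY C
  & bounded_order 1 (%q t. YY q t - YY (pv q) t) C & bounded_order 0 TM C
  & bounded_order 1 (%q t. ff q t (v q) - FL q t) C
  & bounded_order 2 (%q t. MM q t *\<^sub>R pdt T (X q) t (v q) - (ff q t (v q) - ff q t (v q + bp q))) C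
  & bounded_order 1 (%q t. Qm q t - x1 q t (v q)) C & bounded_order 1 (%q t. YY q t - yy q t (v q)) C
  & bounded_order 1 (%q t. (YY q t - YY (pv q) t) /\<^sub>R bm q - yu q t (v q)) C
  & lipschitz_bound X C & lipschitz_bound x1 C & lipschitz_bound (%q. pdt T (X q)) C
  & lipschitz_bound yy C & lipschitz_bound yu C"

lemma common_bound_exists: "\<exists>C. common_bound C"
proof -
 have "eventually common_bound at_top"
  unfolding common_bound_def[abs_def]
  by (intro eventually_conj eventually_ge_at_top eventually_bounded_order small_quantities
    eventually_lipschitz_bound[of 0] SX_mono[OF SX_x(1)] SX_mono[OF SX_x(2)] SX_mono[OF SX_time]
    SX_mono[OF SX_t(4)] SX_mono[OF yu(2)]) simp_all
 from eventually_happens'[OF _ this] show ?thesis by simp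
qed

context
 fixes N :: nat and W :: "nat => 'w" and x :: "real => real => 'a" and U hh :: "nat => real" and hN C :: real
 assumes W: "\<forall>i\<in>idx N. W i \<in> I & nx (W i) = W (nxt N i) & pv (W i) = W (prv N i) & X (W i) = x
   & v (W i) = U i & hh i = bm (W i) & h (W i) = hN"
  and N: "0 < N" "real N * hN <= 2 * pi * chat" and C: "common_bound C" and lam: "0 < lam"
begin

lemma family_nodal: "\<forall>i\<in>idx N. W i \<in> I & nx (W i) = W (nxt N i) & pv (W i) = W (prv N i) & X (W i) = x
   & x t (U i) = x t (v (W i)) & hh i = bm (W i)"
 using W by auto

lemmas family_curve = nodal_curve[OF family_nodal] and family_flux = nodal_flux[OF family_nodal]

lemma family_in: "i \<in> idx N ==> W i \<in> I" and family_h: "i \<in> idx N ==> h (W i) = hN"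
 and family_X: "i \<in> idx N ==> X (W i) = x" "i \<in> idx N ==> v (W i) = U i"
 and family_hh: "i \<in> idx N ==> bm (W i) = hh i"
 using W by auto

lemma hN: "0 < hN" "hN <= 1"
proof -
 have "1 \<in> idx N" using N by (simp add: idx_def)
 then show "0 < hN" "hN <= 1" using h[OF family_in] family_h by force+
qed

lemma X_nodal_deriv:
 "t \<in> {0..T} ==> j \<in> idx N ==> ((%s. x s (U j)) has_vector_derivative pdt T x t (U j)) (at t within {0..T})"
 using smooth_dt[OF X_smooth[OF family_in]] family_X by auto

lemma transfer_deriv:
 assumes "((%s. f s) has_vector_derivative D) (at t within {0..T})" "!!s. s \<in> {0..T} ==> g s = f s" "t \<in> {0..T}"
 shows "(g has_vector_derivative D) (at t within {0..T})"
 by (rule has_vector_derivative_transform[OF assms(3) _ assms(1)]) (simp add: assms(2))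

text \<open>With \<open>r0\<close> the nodal value of \<open>ff\<close> minus the discrete flux,
  flux plus \<open>r0\<close> is exactly \<open>ff\<close> at the node, and the difference of
  neighbours is the one in \<open>residual_small\<close>; what that leaves is \<open>r\<close>. The
  constant 2 C + 1 provides the room that \<open>consistent\<close> demands: an extra h for lengths
  and an extra 1 for the curvature.\<close>

lemma consistent_family:
 "consistent N (2 * C + 1) hN lam T hh (%t j. x t (U j)) (%t j. pdt T x t (U j))
   (%t j. ff (W j) t (U j) - FL (W j) t)
   (%t j. vector_derivative (%s. ff (W j) s (U j) - FL (W j) s) (at t within {0..T}))
   (%t j. MM (W j) t *\<^sub>R pdt T x t (U j) - (ff (W j) t (U j) - ff (W j) t (U j + bp (W j))))"
proof -
 note c = C[unfolded common_bound_def]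
 have C0: "0 <= C" "4 * chat / c0 <= C" "2 * pi * chat <= C" using c by auto
 have up: "a <= (2 * C + 1) * b" if "a <= C * b" "0 <= b" for a b :: real
 proof -
  have "C * b <= (2 * C + 1) * b" using C0 that by (intro mult_right_mono) auto
  then show ?thesis using that by linarith
 qed
 have up': "a <= 2 * C + 1" if "a <= C" for a using C0 that by linarith
 have B0: "norm (x t (U j)) <= C & norm (pdt T x t (U j)) <= C" if t: "t \<in> {0..T}" and j: "j \<in> idx N" for t j
 proof -
  have c1: "bounded_order 0 (%q t. X q t (v q)) C" using c by auto
  show ?thesis
   using bounded_orderD(2,3)[OF c1 family_in[OF j] t] X_nodal_deriv[OF t j] by (simp add: family_X[OF j])
 qed
 have B1: "norm (edge N (%j. pdt T x t (U j)) j) <= C * hN" if t: "t \<in> {0..T}" and j: "j \<in> idx N" for t j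
 proof -
  have c1: "bounded_order 1 (%q t. bm q *\<^sub>R Qm q t) C" using c by auto
  have "((%s. edge N (%j. x s (U j)) j) has_vector_derivative edge N (%j. pdt T x t (U j)) j) (at t within {0..T})"
   by (rule edge_has_vector_derivative[OF X_nodal_deriv[OF t] j])
  then have "((%s. bm (W j) *\<^sub>R Qm (W j) s) has_vector_derivative edge N (%j. pdt T x t (U j)) j) (at t within {0..T})"
   by (rule transfer_deriv) (use family_curve(1)[OF _ j] t in auto)
  from bounded_orderD(3)[OF c1 family_in[OF j] t this] show ?thesis by (simp add: family_h[OF j])
 qed
 have len: "norm (edge N (%j. x t (U j)) j) = hh j * sm (W j) t" if t: "t \<in> {0..T}" and j: "j \<in> idx N" for t j
  using family_curve(2)[OF t j] family_hh[OF j] by simp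
 have hh: "hN <= chat * hh j" "hh j <= hN" "0 < hh j" if j: "j \<in> idx N" for j
  using bm[OF family_in[OF j]] step_pos(2)[OF family_in[OF j]] family_h[OF j] family_hh[OF j] by auto
 have low: "2 * hN <= (2 * C + 1) * norm (edge N (%j. x t (U j)) j)" if t: "t \<in> {0..T}" and j: "j \<in> idx N" for t j
 proof -
  have "hh j * (c0 / 2) <= norm (edge N (%j. x t (U j)) j)"
   unfolding len[OF t j] using speed_lower(2)[OF family_in[OF j] t] hh(3)[OF j] by (intro mult_left_mono) auto
  then have "(4 * chat / c0) * (hh j * (c0 / 2)) <= C * norm (edge N (%j. x t (U j)) j)"
   using C0 c0 chat hh(3)[OF j] by (intro mult_mono) auto
  moreover have "(4 * chat / c0) * (hh j * (c0 / 2)) = 2 * (chat * hh j)" using c0 by (simp add: field_simps)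
  ultimately show ?thesis using up[of "2 * hN" "norm (edge N (%j. x t (U j)) j)"] hh(1)[OF j] by simp
 qed
 have nz: "edge N (%j. x t (U j)) j ~= 0" if t: "t \<in> {0..T}" and j: "j \<in> idx N" for t j
  using low[OF t j] hN by auto
 have B2: "norm (edge N (%j. x t (U j)) j) <= C * hN & \<bar>len_d N (%j. x t (U j)) (%j. pdt T x t (U j)) j\<bar> <= C * hN"
  if t: "t \<in> {0..T}" and j: "j \<in> idx N" for t j
 proof -
  have c1: "bounded_order 1 (%q t. bm q * sm q t) C" using c by auto
  have "((%s. bm (W j) * sm (W j) s) has_vector_derivative len_d N (%j. x t (U j)) (%j. pdt T x t (U j)) j) (at t within {0..T})"
   by (rule transfer_deriv[OF len_has_vector_derivative[OF X_nodal_deriv[OF t] nz[OF t] j]])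
    (use len[OF _ j] family_hh[OF j] t in auto)
  from bounded_orderD(3)[OF c1 family_in[OF j] t this] bounded_orderD(2)[OF c1 family_in[OF j] t]
  show ?thesis using family_curve(2)[OF t j] by (simp add: family_h[OF j])
 qed
 have dY: "((%s. YY (W j) s) has_vector_derivative curv_d N (%j. x t (U j)) (%j. pdt T x t (U j)) j) (at t within {0..T})"
  if t: "t \<in> {0..T}" and j: "j \<in> idx N" for t j
  by (rule transfer_deriv[OF pcurv_has_vector_derivative[OF X_nodal_deriv[OF t] nz[OF t] j]])
   (use family_curve(5)[OF _ j] t in auto)
 have B3: "norm (pcurv N (%j. x t (U j)) j) <= C & norm (curv_d N (%j. x t (U j)) (%j. pdt T x t (U j)) j) <= C"
  if t: "t \<in> {0..T}" and j: "j \<in> idx N" for t j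
 proof -
  have c1: "bounded_order 0 YY C" using c by auto
  from bounded_orderD(3)[OF c1 family_in[OF j] t dY[OF t j]] bounded_orderD(2)[OF c1 family_in[OF j] t]
  show ?thesis using family_curve(5)[OF t j] by simp
 qed
 have B4: "norm (edge N (pcurv N (%j. x t (U j))) j) <= C * hN & norm (edge N (curv_d N (%j. x t (U j)) (%j. pdt T x t (U j))) j) <= C * hN"
  if t: "t \<in> {0..T}" and j: "j \<in> idx N" for t j
 proof -
  have c1: "bounded_order 1 (%q t. YY q t - YY (pv q) t) C" using c by auto
  have p: "pv (W j) = W (prv N j)" using W j by auto
  have "((%s. YY (W j) s - YY (pv (W j)) s) has_vector_derivative edge N (curv_d N (%j. x t (U j)) (%j. pdt T x t (U j))) j) (at t within {0..T})"
   unfolding edge_def p by (intro has_vector_derivative_diff dY t j prv_in)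
  from bounded_orderD(3)[OF c1 family_in[OF j] t this] bounded_orderD(2)[OF c1 family_in[OF j] t]
  show ?thesis using family_flux(1)[OF t j] by (simp add: family_h[OF j])
 qed
 have B5: "norm (tang_d N (%j. x t (U j)) (%j. pdt T x t (U j)) j) <= C" if t: "t \<in> {0..T}" and j: "j \<in> idx N" for t j
 proof -
  have c1: "bounded_order 0 TM C" using c by auto
  have "((%s. TM (W j) s) has_vector_derivative tang_d N (%j. x t (U j)) (%j. pdt T x t (U j)) j) (at t within {0..T})"
   by (rule transfer_deriv[OF ptang_has_vector_derivative[OF X_nodal_deriv[OF t] nz[OF t] j]])
    (use family_curve(3)[OF _ j] t in auto)
  from bounded_orderD(3)[OF c1 family_in[OF j] t this] show ?thesis by simp
 qed
 have r0d: "((%s. ff (W j) s (U j) - FL (W j) s) has_vector_derivative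
   vector_derivative (%s. ff (W j) s (U j) - FL (W j) s) (at t within {0..T})) (at t within {0..T})"
  and B6: "norm (ff (W j) t (U j) - FL (W j) t) <= C * hN"
   "norm (vector_derivative (%s. ff (W j) s (U j) - FL (W j) s) (at t within {0..T})) <= C * hN"
  if t: "t \<in> {0..T}" and j: "j \<in> idx N" for t j
 proof -
  have c1: "bounded_order 1 (%q t. ff q t (v q) - FL q t) C" using c by auto
  note b = bounded_orderD[OF c1 family_in[OF j] t, unfolded family_X(2)[OF j] family_h[OF j]]
  show d: "((%s. ff (W j) s (U j) - FL (W j) s) has_vector_derivative
   vector_derivative (%s. ff (W j) s (U j) - FL (W j) s) (at t within {0..T})) (at t within {0..T})"
   using b(1) by (simp add: vector_derivative_works)
  show "norm (ff (W j) t (U j) - FL (W j) t) <= C * hN" using b(2) by simp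
  show "norm (vector_derivative (%s. ff (W j) s (U j) - FL (W j) s) (at t within {0..T})) <= C * hN"
   using b(3)[OF d] by simp
 qed
 have B7: "norm (MM (W j) t *\<^sub>R pdt T x t (U j) - (ff (W j) t (U j) - ff (W j) t (U j + bp (W j)))) <= C * hN^2"
  if t: "t \<in> {0..T}" and j: "j \<in> idx N" for t j
 proof -
  have c1: "bounded_order 2 (%q t. MM q t *\<^sub>R pdt T (X q) t (v q) - (ff q t (v q) - ff q t (v q + bp q))) C" using c by auto
  show ?thesis using bounded_orderD(2)[OF c1 family_in[OF j] t] by (simp add: family_X[OF j] family_h[OF j])
 qed
  have Xc: "continuous_on {0..T} (%t. pdt T x t (U j))" if j: "j \<in> idx N" for j
  proof -
   have "continuous_on ({0..T} \<times> UNIV) (%(t, u). pdt T x t u)"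
    using smooth_cont[OF smooth_pdt[OF X_smooth[OF family_in[OF j]]]] by (simp add: family_X[OF j])
   then have "continuous_on {0..T} (%t. case (t, U j) of (t, u) => pdt T x t u)"
    by (rule continuous_on_compose2) (auto intro: continuous_on_Pair continuous_on_id continuous_on_const)
   then show ?thesis by simp
  qed
  have hhl: "hN <= (2 * C + 1) * hh j" if j: "j \<in> idx N" for j
  proof -
   have "chat <= 2 * pi * chat" using chat pi_gt3 by simp
   then have "chat * hh j <= C * hh j" using C0 hh(3)[OF j] by (intro mult_right_mono) auto
   then have "hN <= C * hh j" using hh(1)[OF j] by linarith
   then show ?thesis by (rule up) (use hh(3)[OF j] in simp)
  qed
 have h0: "0 <= hN" "0 <= hN^2" using hN by auto
 show ?thesis
 proof
  fix t j assume t: "t \<in> {0..T}" and j: "j \<in> idx N"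
  show "norm (edge N (%j. x t (U j)) j) + hN <= (2 * C + 1) * hN"
  proof -
   have "0 <= C * hN" using C0 h0 by simp
   moreover have "(2 * C + 1) * hN = C * hN + C * hN + hN" by (simp add: algebra_simps)
   ultimately show ?thesis using B2[OF t j] by linarith
  qed
  show "norm (pcurv N (%j. x t (U j)) j) + 1 <= 2 * C + 1" using B3[OF t j] C0 by linarith
  show "pmass N (%j. x t (U j)) j *\<^sub>R pdt T x t (U j)
    = (pflux N lam hh (%j. x t (U j)) j + (ff (W j) t (U j) - FL (W j) t))
    - (pflux N lam hh (%j. x t (U j)) (nxt N j) + (ff (W (nxt N j)) t (U (nxt N j)) - FL (W (nxt N j)) t))
    + (MM (W j) t *\<^sub>R pdt T x t (U j) - (ff (W j) t (U j) - ff (W j) t (U j + bp (W j))))"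
  proof -
   have "ff (W (nxt N j)) t (U (nxt N j)) = ff (W j) t (U j + bp (W j))"
    using ff_nx[OF family_in[OF j] t] W j by auto
   then show ?thesis
    unfolding family_curve(4)[OF t j] family_flux(2)[OF t j] family_flux(2)[OF t nxt_in[OF j]] by simp
  qed
  show "norm (curv_d N (%j. x t (U j)) (%j. pdt T x t (U j)) j) <= 2 * C + 1"
   "norm (tang_d N (%j. x t (U j)) (%j. pdt T x t (U j)) j) <= 2 * C + 1"
   "norm (pdt T x t (U j)) <= 2 * C + 1"
   using B3[OF t j] B5[OF t j] B0[OF t j] by (auto intro: up')
  show "norm (edge N (pcurv N (%j. x t (U j))) j) <= (2 * C + 1) * hN"
   "norm (edge N (curv_d N (%j. x t (U j)) (%j. pdt T x t (U j))) j) <= (2 * C + 1) * hN"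
   "\<bar>len_d N (%j. x t (U j)) (%j. pdt T x t (U j)) j\<bar> <= (2 * C + 1) * hN"
   "norm (edge N (%j. pdt T x t (U j)) j) <= (2 * C + 1) * hN"
   using B4[OF t j] B2[OF t j] B1[OF t j] h0 by (auto intro: up)
  show "norm (ff (W j) t (U j) - FL (W j) t) <= (2 * C + 1) * hN"
   "norm (vector_derivative (%s. ff (W j) s (U j) - FL (W j) s) (at t within {0..T})) <= (2 * C + 1) * hN"
   using B6[OF t j] h0 by (auto intro: up)
  show "norm (MM (W j) t *\<^sub>R pdt T x t (U j) - (ff (W j) t (U j) - ff (W j) t (U j + bp (W j)))) <= (2 * C + 1) * hN^2"
   by (rule up[OF B7[OF t j] h0(2)])
 qed (use C0 lam T hN hh X_nodal_deriv r0d low Xc hhl N in auto)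
qed

text \<open>Compares fields at a point between nodes with nodal quantities: moving to the node costs
  C h by the Lipschitz bounds, and replacing the field at the node by its discrete version, where
  needed, another C h.\<close>

lemma interpolation_family:
 assumes t: "t \<in> {0..T}" and j: "j \<in> idx N" and w: "\<bar>w - U j\<bar> <= hN"
 shows "norm (x t w - x t (U j)) <= (2 * C + 1) * hN"
  "norm (du (x t) w - edge N (%j. x t (U j)) j /\<^sub>R hh j) <= (2 * C + 1) * hN"
  "norm (pdt T x t w - pdt T x t (U j)) <= (2 * C + 1) * hN"
  "norm (curvature_vec (x t) w - pcurv N (%j. x t (U j)) j) <= (2 * C + 1) * hN"
  "norm (du (curvature_vec (x t)) w - edge N (pcurv N (%j. x t (U j))) j /\<^sub>R hh j) <= (2 * C + 1) * hN"
proof -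
 note c = C[unfolded common_bound_def]
 have C0: "0 <= C" using c by auto
 have "C * \<bar>w - U j\<bar> <= C * hN" using C0 w by (rule mult_left_mono[rotated])
 then have lip: "norm (F (W j) t w - F (W j) t (U j)) <= C * hN" if "lipschitz_bound F C" for F :: "'w => real => real => 'a"
  using that family_in[OF j] t unfolding lipschitz_bound_def by (meson order_trans)
 have ord: "norm (F (W j) t) <= C * hN" if "bounded_order 1 F C" for F :: "'w => real => 'a"
  using bounded_orderD(2)[OF that family_in[OF j] t] by (simp add: family_h[OF j])
 have tri: "norm (a - b) <= (2 * C + 1) * hN" if "norm (a - d) <= C * hN" "norm (b - d) <= C * hN" for a b d :: 'a
 proof -
  have "norm (a - b) <= norm (a - d) + norm (b - d)" by (metis norm_triangle_ineq4 diff_diff_eq2 add.commute diff_add_cancel)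
  moreover have "(2 * C + 1) * hN = C * hN + C * hN + hN" by (simp add: algebra_simps)
  ultimately show ?thesis using that hN by linarith
 qed
 have one: "norm a <= (2 * C + 1) * hN" if "norm a <= C * hN" for a :: 'a
  using tri[of a 0 0] that C0 hN by simp
 have lX: "lipschitz_bound X C" "lipschitz_bound x1 C" "lipschitz_bound (%q. pdt T (X q)) C" "lipschitz_bound yy C" "lipschitz_bound yu C"
  and oX: "bounded_order 1 (%q t. Qm q t - x1 q t (v q)) C" "bounded_order 1 (%q t. YY q t - yy q t (v q)) C"
  "bounded_order 1 (%q t. (YY q t - YY (pv q) t) /\<^sub>R bm q - yu q t (v q)) C" using c by auto
 note l = lip[OF lX(1)] lip[OF lX(2)] lip[OF lX(3)] lip[OF lX(4)] lip[OF lX(5)]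
 note o = ord[OF oX(1)] ord[OF oX(2)] ord[OF oX(3)]
 note fc = flow_conservative[OF family_in[OF j] t, unfolded family_X(1)[OF j]]
 have hj: "hh j ~= 0" using step_pos(2)[OF family_in[OF j]] family_hh[OF j] by simp
 show "norm (x t w - x t (U j)) <= (2 * C + 1) * hN" using one l(1) family_X[OF j] by simp
 show "norm (pdt T x t w - pdt T x t (U j)) <= (2 * C + 1) * hN" using one l(3) family_X[OF j] by simp
 have "edge N (%j. x t (U j)) j /\<^sub>R hh j = Qm (W j) t"
  unfolding family_curve(1)[OF t j] family_hh[OF j] using hj by simp
 moreover have "du (x t) w = x1 (W j) t w" by (simp add: x1_def pdu_def family_X[OF j])
 ultimately show "norm (du (x t) w - edge N (%j. x t (U j)) j /\<^sub>R hh j) <= (2 * C + 1) * hN"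
  using tri[OF l(2) o(1)[unfolded family_X(2)[OF j]]] by simp
 show "norm (curvature_vec (x t) w - pcurv N (%j. x t (U j)) j) <= (2 * C + 1) * hN"
  unfolding fc(2) family_curve(5)[OF t j] by (rule tri[OF l(4) o(2)[unfolded family_X(2)[OF j]]])
 show "norm (du (curvature_vec (x t)) w - edge N (pcurv N (%j. x t (U j))) j /\<^sub>R hh j) <= (2 * C + 1) * hN"
  unfolding fc(3) family_flux(1)[OF t j] by (rule tri[OF l(5) o(3)[unfolded family_X(2)[OF j] family_hh[OF j]]])
qed

end

end

section \<open>Consistency on the given mesh\<close>

lemma partition_pos: "partition_2pi N U ==> 0 < N"
 unfolding partition_2pi_def by (cases N) auto

lemma mesh_width_pos: "partition_2pi N U ==> j \<in> idx N ==> 0 < mesh_width N U j"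
 by (auto simp: partition_2pi_def mesh_width_def idx_def)

lemma mesh_width_le: "j \<in> idx N ==> mesh_width N U j <= mesh_size N U"
 unfolding mesh_size_def idx_def by (rule Max_ge) auto

lemma mesh_width_eq: "j \<in> idx N ==> mesh_width N U j = U j - U (j - 1)"
 by (auto simp: mesh_width_def idx_def)

lemma mesh_width_nxt: "j \<in> idx N ==> mesh_width N U (j + 1) = mesh_width N U (nxt N j)"
 by (auto simp: mesh_width_def nxt_def idx_def)

lemma node_nxt:
 assumes "partition_2pi N U" "j \<in> idx N"
 shows "U (nxt N j) = U j + mesh_width N U (nxt N j) \<or> U (nxt N j) + 2 * pi = U j + mesh_width N U (nxt N j)"
 using assms partition_pos[OF assms(1)] by (auto simp: nxt_def mesh_width_def partition_2pi_def idx_def)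

lemma node_prv:
 assumes "partition_2pi N U" "j \<in> idx N"
 shows "U (prv N j) = U j - mesh_width N U j \<or> U (prv N j) = U j - mesh_width N U j + 2 * pi"
 using assms partition_pos[OF assms(1)] by (auto simp: prv_def mesh_width_def partition_2pi_def idx_def)

lemma partition_mono:
 assumes "partition_2pi N U" "i <= j" "j <= N" shows "U i <= U j"
 using assms(2,3)
proof (induction j)
 case (Suc j)
 have "U j <= U (Suc j)" using assms(1) Suc.prems by (force simp: partition_2pi_def)
 then show ?case using Suc by (cases "i = Suc j") auto
qed simp

lemma sum_mesh_width: "partition_2pi N U ==> (\<Sum>j\<in>idx N. mesh_width N U j) = 2 * pi"
proof -
 assume p: "partition_2pi N U"
 have "(\<Sum>j\<in>{1..m}. mesh_width N U j) = U m - U 0" if "m <= N" for m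
  using that by (induction m) (auto simp: mesh_width_def)
 from this[of N] show ?thesis using p by (simp add: idx_def partition_2pi_def)
qed

definition regular_instance ::
 "real => real => real => real => real => real => (real => real => 'a::real_inner) => nat => (nat => real) => bool" where
 "regular_instance T lam c0 chat cbar B x N U \<longleftrightarrow>
   elastic_flow_solution T lam (x 0) x & (\<forall>t\<in>{0..T}. \<forall>u. c0 <= norm (pdu x t u)) & Ck_norm T 8 x <= B
   & admissible_mesh chat cbar N U & 0 < mesh_size N U & mesh_size N U <= 1 & 2 * B * mesh_size N U <= c0"

text \<open>The index set runs over all curves, meshes and nodes that obey the same scalar bounds,
  so one constant serves them all. This is what makes the final constant depend on the solution only
  through its norm.\<close>

lemma node_jets_regular:
 fixes T lam c0 chat cbar B :: real
 assumes "0 < T" "0 < c0" "0 < chat" "0 <= B"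
 shows "node_jets T {(x :: real => real => 'a::{real_inner,banach}, N, U, j). regular_instance T lam c0 chat cbar B x N U & j \<in> idx N}
  (%(x, N, U, j). mesh_size N U) fst (%(x, N, U, j). U j)
  (%(x, N, U, j). mesh_width N U (nxt N j)) (%(x, N, U, j). mesh_width N U j)
  (%(x, N, U, j). (x, N, U, nxt N j)) (%(x, N, U, j). (x, N, U, prv N j)) lam c0 chat cbar B"
  (is "node_jets T ?I ?h fst ?v ?bp ?bm ?nx ?pv _ _ _ _ _")
proof
 fix q assume "q \<in> ?I"
 then obtain x :: "real => real => 'a" and N U j where w: "q = (x, N, U, j)" and r: "regular_instance T lam c0 chat cbar B x N U" and j: "j \<in> idx N"
  by auto
 have adm: "admissible_mesh chat cbar N U" using r by (simp add: regular_instance_def)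
 then have p: "partition_2pi N U" by (simp add: admissible_mesh_def)
 have m: "mesh_size N U <= chat * mesh_width N U i" "mesh_width N U i <= mesh_size N U"
  "\<bar>mesh_width N U (nxt N i) - mesh_width N U i\<bar> <= cbar * (mesh_size N U)^2" if i: "i \<in> idx N" for i
 proof -
  have a: "mesh_size N U <= chat * mesh_width N U i & \<bar>mesh_width N U (i + 1) - mesh_width N U i\<bar> <= cbar * (mesh_size N U)^2"
   using adm i unfolding admissible_mesh_def idx_def by blast
  show "mesh_size N U <= chat * mesh_width N U i" "mesh_width N U i <= mesh_size N U"
   "\<bar>mesh_width N U (nxt N i) - mesh_width N U i\<bar> <= cbar * (mesh_size N U)^2"
   using a mesh_width_le[OF i] unfolding mesh_width_nxt[OF i] by auto
 qed
 show "0 < ?h q & ?h q <= 1" using r by (simp add: w regular_instance_def)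
 show "smooth_on_strip T (fst q)" "\<forall>t\<in>{0..T}. periodic_2pi (fst q t)" "Ck_norm T 8 (fst q) <= B"
  using r by (simp_all add: w regular_instance_def elastic_flow_solution_def)
 show "?h q <= chat * ?bp q & ?bp q <= ?h q" "?h q <= chat * ?bm q & ?bm q <= ?h q" "\<bar>?bp q - ?bm q\<bar> <= cbar * (?h q)^2"
  using m j by (simp_all add: w)
 show "2 * B * ?h q <= c0" using r by (simp add: w regular_instance_def)
 show "?nx q \<in> ?I & ?h (?nx q) = ?h q & fst (?nx q) = fst q & ?bm (?nx q) = ?bp q"
  "?pv q \<in> ?I & ?h (?pv q) = ?h q & fst (?pv q) = fst q & ?bp (?pv q) = ?bm q"
  using r j by (simp_all add: w)
 show "?v (?nx q) = ?v q + ?bp q \<or> ?v (?nx q) + 2 * pi = ?v q + ?bp q"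
  using node_nxt[OF p j] by (simp add: w)
 show "?v (?pv q) = ?v q - ?bm q \<or> ?v (?pv q) = ?v q - ?bm q + 2 * pi"
  using node_prv[OF p j] by (simp add: w)
 fix t u assume t: "t \<in> {0..T}"
 show "c0 <= norm (pdu (fst q) t u)" using r t by (simp add: w regular_instance_def)
 show "pdt T (fst q) t u =
     - nabla_s (fst q t) (nabla_s (fst q t) (curvature_vec (fst q t))) u
     - (1 / 2 * (norm (curvature_vec (fst q t) u))^2) *\<^sub>R curvature_vec (fst q t) u
     + lam *\<^sub>R (du (du (fst q t)) u /\<^sub>R norm (du (fst q t) u))"
  using r t by (simp add: w regular_instance_def elastic_flow_solution_def)
qed (use assms in auto)

lemma number_of_nodes:
 assumes "admissible_mesh chat cbar N U"
 shows "real N * mesh_size N U <= 2 * pi * chat"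
proof -
 have p: "partition_2pi N U" using assms by (simp add: admissible_mesh_def)
 have "(\<Sum>j\<in>idx N. mesh_size N U) <= (\<Sum>j\<in>idx N. chat * mesh_width N U j)"
  using assms by (intro sum_mono) (auto simp: admissible_mesh_def idx_def)
 then show ?thesis by (simp add: idx_def flip: sum_distrib_left) (use sum_mesh_width[OF p] in \<open>simp add: idx_def mult.commute\<close>)
qed

theorem uniform_consistency:
 fixes T lam c0 chat cbar B :: real
 assumes pos: "0 < T" "0 < lam" "0 < c0" "0 < chat" "0 <= B"
 shows "\<exists>A\<ge>1. \<forall>(x :: real => real => 'a::{real_inner,banach}) N U. regular_instance T lam c0 chat cbar B x N U -->
  (\<exists>r0 r0' r. consistent N A (mesh_size N U) lam T (mesh_width N U) (%t j. x t (U j)) (%t j. pdt T x t (U j)) r0 r0' r)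
  & (\<forall>t\<in>{0..T}. \<forall>j\<in>idx N. \<forall>w\<in>{U (j - 1)..U j}.
    norm (x t w - x t (U j)) <= A * mesh_size N U
   & norm (du (x t) w - edge N (%j. x t (U j)) j /\<^sub>R mesh_width N U j) <= A * mesh_size N U
   & norm (pdt T x t w - pdt T x t (U j)) <= A * mesh_size N U
   & norm (curvature_vec (x t) w - pcurv N (%j. x t (U j)) j) <= A * mesh_size N U
   & norm (du (curvature_vec (x t)) w - edge N (pcurv N (%j. x t (U j))) j /\<^sub>R mesh_width N U j) <= A * mesh_size N U)"
proof -
 define I where "I = {(x :: real => real => 'a, N, U, j). regular_instance T lam c0 chat cbar B x N U & j \<in> idx N}"
 interpret J: node_jets T I "%(x, N, U, j). mesh_size N U" fst "%(x, N, U, j). U j"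
  "%(x, N, U, j). mesh_width N U (nxt N j)" "%(x, N, U, j). mesh_width N U j"
  "%(x, N, U, j). (x, N, U, nxt N j)" "%(x, N, U, j). (x, N, U, prv N j)" lam c0 chat cbar B
  unfolding I_def by (rule node_jets_regular) (use pos in auto)
 obtain C where C: "J.common_bound C" using J.common_bound_exists by blast
 have C0: "0 <= C" using C unfolding J.common_bound_def by simp
 show ?thesis
 proof (intro exI[of _ "2 * C + 1"] conjI allI impI)
  show "1 <= 2 * C + 1" using C0 by simp
  fix x :: "real => real => 'a" and N U assume r: "regular_instance T lam c0 chat cbar B x N U"
  then have adm: "admissible_mesh chat cbar N U" by (simp add: regular_instance_def)
  then have p: "partition_2pi N U" by (simp add: admissible_mesh_def)
  define W where "W j = (x, N, U, j)" for j :: nat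
  have W: "\<forall>i\<in>idx N. W i \<in> I & (case W i of (x, N, U, j) => (x, N, U, nxt N j)) = W (nxt N i)
   & (case W i of (x, N, U, j) => (x, N, U, prv N j)) = W (prv N i) & fst (W i) = x
   & (case W i of (x, N, U, j) => U j) = U i & mesh_width N U i = (case W i of (x, N, U, j) => mesh_width N U j)
   & (case W i of (x, N, U, j) => mesh_size N U) = mesh_size N U"
   using r by (auto simp: W_def I_def)
  note fam = W partition_pos[OF p] number_of_nodes[OF adm] C pos(2)
  show "\<exists>r0 r0' r. consistent N (2 * C + 1) (mesh_size N U) lam T (mesh_width N U) (%t j. x t (U j)) (%t j. pdt T x t (U j)) r0 r0' r"
   by (rule exI, rule exI, rule exI, rule J.consistent_family[OF fam])
  have "\<bar>w - U j\<bar> <= mesh_size N U" if "j \<in> idx N" "w \<in> {U (j - 1)..U j}" for j w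
   using mesh_width_le[OF that(1), of U] that(2) by (simp add: mesh_width_eq[OF that(1)])
  then show "\<forall>t\<in>{0..T}. \<forall>j\<in>idx N. \<forall>w\<in>{U (j - 1)..U j}.
    norm (x t w - x t (U j)) <= (2 * C + 1) * mesh_size N U
   & norm (du (x t) w - edge N (%j. x t (U j)) j /\<^sub>R mesh_width N U j) <= (2 * C + 1) * mesh_size N U
   & norm (pdt T x t w - pdt T x t (U j)) <= (2 * C + 1) * mesh_size N U
   & norm (curvature_vec (x t) w - pcurv N (%j. x t (U j)) j) <= (2 * C + 1) * mesh_size N U
   & norm (du (curvature_vec (x t)) w - edge N (pcurv N (%j. x t (U j))) j /\<^sub>R mesh_width N U j) <= (2 * C + 1) * mesh_size N U"
   by (intro ballI conjI J.interpolation_family[OF fam]) auto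
 qed
qed

section \<open>Piecewise linear functions\<close>

lemma mesh_cover:
 assumes p: "partition_2pi N U" and v: "v \<in> {0..2 * pi}"
 shows "\<exists>j\<in>idx N. v \<in> {U (j - 1)..U j}"
proof -
 have U: "U 0 = 0" "U N = 2 * pi" using p by (auto simp: partition_2pi_def)
 define j where "j = (LEAST j. v <= U j)"
 have ex: "v <= U N" using v U by simp
 have j: "v <= U j" "j <= N" unfolding j_def by (rule LeastI, rule ex) (rule Least_le, rule ex)
 show ?thesis
 proof (cases "j = 0")
  case True
  then have "v = 0" using j U v by auto
  then have "v \<in> {U (1 - 1)..U 1}" using U partition_mono[OF p, of 0 1] partition_pos[OF p] by auto
  moreover have "1 \<in> idx N" using partition_pos[OF p] by (simp add: idx_def)
  ultimately show ?thesis by blast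
 next
  case False
  have "\<not> v <= U (j - 1)" using not_less_Least[of "j - 1" "%j. v <= U j"] False unfolding j_def by simp
  then show ?thesis using j False by (intro bexI[of _ j]) (auto simp: idx_def)
 qed
qed

lemma mesh_union: "partition_2pi N U ==> {0..2 * pi} = (\<Union>j\<in>idx N. {U (j - 1)..U j})"
proof (intro equalityI subsetI)
 assume p: "partition_2pi N U"
 fix v assume "v \<in> (\<Union>j\<in>idx N. {U (j - 1)..U j})"
 then obtain j where j: "j \<in> idx N" "U (j - 1) <= v" "v <= U j" by auto
 have "U 0 <= U (j - 1)" "U j <= U N" using j(1) by (auto intro!: partition_mono[OF p] simp: idx_def)
 then show "v \<in> {0..2 * pi}" using j p by (auto simp: partition_2pi_def)
qed (use mesh_cover in blast)

lemma least_index: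
 assumes p: "partition_2pi N U" and j: "j \<in> idx N" and v: "U (j - 1) < v" "v <= U j"
 shows "(LEAST j. 1 <= j & v <= U j) = j"
proof (rule Least_equality)
 show "1 <= j & v <= U j" using j v by (auto simp: idx_def)
 fix i assume i: "1 <= i & v <= U i"
 show "j <= i"
 proof (rule ccontr)
  assume "\<not> j <= i"
  then have "U i <= U (j - 1)" using j by (intro partition_mono[OF p]) (auto simp: idx_def)
  then show False using i v by simp
 qed
qed

lemma least_index_first:
 assumes p: "partition_2pi N U"
 shows "(LEAST j. 1 <= j & U 0 <= U j) = 1"
 by (rule Least_equality) (use partition_mono[OF p, of 0 1] partition_pos[OF p] in auto)

text \<open>The formula holds on the closed interval: at an interior left end point \<open>interp\<close> selects the
 preceding interval, which gives the same value.\<close>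

lemma interp_on:
 assumes p: "partition_2pi N U" and j: "j \<in> idx N" and v: "v \<in> {U (j - 1)..U j}"
 shows "interp N U f v = f (U (j - 1)) + ((v - U (j - 1)) / mesh_width N U j) *\<^sub>R (f (U j) - f (U (j - 1)))"
proof (cases "v = U (j - 1)")
 case False
 then have "(LEAST j. 1 <= j & v <= U j) = j" using v by (intro least_index[OF p j]) auto
 then show ?thesis by (simp add: interp_def Let_def)
next
 case v: True
 show ?thesis
 proof (cases "j = 1")
  case True
  then show ?thesis using least_index_first[OF p] by (simp add: interp_def Let_def v)
 next
  case False
  then have j': "j - 1 \<in> idx N" using j by (auto simp: idx_def)
  have lt: "U (j - 1 - 1) < U (j - 1)" using mesh_width_pos[OF p j'] mesh_width_eq[OF j', of U] by simp
  have "(LEAST j. 1 <= j & v <= U j) = j - 1" unfolding v by (rule least_index[OF p j' lt]) simp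
  then show ?thesis using lt mesh_width_eq[OF j', of U] by (simp add: interp_def Let_def v)
 qed
qed

text \<open>The left value on an interval is taken at the cyclic predecessor, so the node at 0
  carries the value of the node at 2 pi and periodicity is built in.\<close>

definition pl :: "nat => (nat => real) => (nat => 'a::real_vector) => real => 'a" where
 "pl N U z v = (let j = (LEAST j. 1 <= j & v <= U j)
   in z (prv N j) + ((v - U (j - 1)) / mesh_width N U j) *\<^sub>R edge N z j)"

lemma pl_interp:
 assumes f: "f (U 0) = f (U N)" and p: "partition_2pi N U" and v: "v \<in> {0..2 * pi}"
 shows "pl N U (%j. f (U j)) v = interp N U f v"
proof -
 have j: "1 <= (LEAST j. 1 <= j & v <= U j)"
  using LeastI[of "%j. 1 <= j & v <= U j" N] v p partition_pos[OF p] by (auto simp: partition_2pi_def)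
 have "f (U (prv N j)) = f (U (j - 1))" for j using f by (auto simp: prv_def)
 then show ?thesis by (simp add: pl_def interp_def Let_def edge_def)
qed

lemma pl_on:
 assumes p: "partition_2pi N U" and j: "j \<in> idx N" and v: "v \<in> {U (j - 1)..U j}"
 shows "pl N U z v = z (prv N j) + ((v - U (j - 1)) / mesh_width N U j) *\<^sub>R edge N z j"
proof (cases "v = U (j - 1)")
 case False
 then have "(LEAST j. 1 <= j & v <= U j) = j" using v by (intro least_index[OF p j]) auto
 then show ?thesis by (simp add: pl_def Let_def)
next
 case v: True
 show ?thesis
 proof (cases "j = 1")
  case True
  then show ?thesis using least_index_first[OF p] by (simp add: pl_def Let_def v)
 next
  case False
  then have j': "j - 1 \<in> idx N" "prv N j = j - 1" using j by (auto simp: idx_def prv_def)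
  have lt: "U (j - 1 - 1) < U (j - 1)" using mesh_width_pos[OF p j'(1)] mesh_width_eq[OF j'(1), of U] by simp
  have "(LEAST j. 1 <= j & v <= U j) = j - 1" unfolding v by (rule least_index[OF p j'(1) lt]) simp
  then show ?thesis using lt mesh_width_eq[OF j'(1), of U] by (simp add: pl_def Let_def v j'(2) edge_def)
 qed
qed

lemma pl_node: "partition_2pi N U ==> j \<in> idx N ==> pl N U z (U j) = z j"
 and pl_left_node: "partition_2pi N U ==> j \<in> idx N ==> pl N U z (U (j - 1)) = z (prv N j)"
 using pl_on[of N U j "U j" z] pl_on[of N U j "U (j - 1)" z] mesh_width_pos[of N U j] mesh_width_eq[of j N U]
 by (auto simp: edge_def)

lemma pl_deriv:
 fixes z :: "nat => 'a::real_normed_vector"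
 assumes p: "partition_2pi N U" and j: "j \<in> idx N" and v: "v \<in> {U (j - 1)<..<U j}"
 shows "(pl N U z has_vector_derivative edge N z j /\<^sub>R mesh_width N U j) (at v)"
proof -
 have "((%v. z (prv N j) + ((v - U (j - 1)) / mesh_width N U j) *\<^sub>R edge N z j) has_vector_derivative
   edge N z j /\<^sub>R mesh_width N U j) (at v)"
  by (auto intro!: derivative_eq_intros simp: divide_inverse)
 then show ?thesis
  by (rule has_vector_derivative_transform_within_open[of _ _ _ "{U (j - 1)<..<U j}"]) (use v in \<open>auto simp: pl_on[OF p j]\<close>)
qed

lemma pl_nodal:
 fixes \<phi> :: "real => real ^ 'n"
 assumes p: "partition_2pi N U" and \<phi>: "\<phi> \<in> fe_space_vec N U" and v: "v \<in> {0..2 * pi}"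
 shows "\<phi> v = pl N U (%j. \<phi> (U j)) v"
proof -
 obtain j where j: "j \<in> idx N" "v \<in> {U (j - 1)..U j}" using mesh_cover[OF p v] by blast
 have h: "0 < mesh_width N U j" by (rule mesh_width_pos[OF p j(1)])
 note hj = mesh_width_eq[OF j(1), of U]
 have "\<phi> v $ i = \<phi> (U (j - 1)) $ i + (v - U (j - 1)) / mesh_width N U j * (\<phi> (U j) $ i - \<phi> (U (j - 1)) $ i)" for i
 proof -
  obtain a b where ab: "\<forall>v\<in>{U (j - 1)..U j}. \<phi> v $ i = a + b * v"
   using \<phi> j(1) unfolding fe_space_vec_def fe_space_def idx_def by blast
  then have e: "\<phi> v $ i = a + b * v" "\<phi> (U j) $ i = a + b * U j" "\<phi> (U (j - 1)) $ i = a + b * U (j - 1)"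
   using j(2) by auto
  have "\<phi> (U j) $ i - \<phi> (U (j - 1)) $ i = b * mesh_width N U j" unfolding e hj by (simp add: right_diff_distrib)
  then have "(v - U (j - 1)) / mesh_width N U j * (\<phi> (U j) $ i - \<phi> (U (j - 1)) $ i) = b * (v - U (j - 1))"
   using h by simp
  then show ?thesis unfolding e(1,3) by (simp only:) (simp add: right_diff_distrib e)
 qed
 then have "\<phi> v = \<phi> (U (j - 1)) + ((v - U (j - 1)) / mesh_width N U j) *\<^sub>R (\<phi> (U j) - \<phi> (U (j - 1)))"
  by (simp add: vec_eq_iff)
 moreover have "\<phi> (U (j - 1)) = \<phi> (U (prv N j))"
 proof (cases "j = 1")
  case True
  have "\<phi> 0 = \<phi> (2 * pi)" using \<phi> by (simp add: fe_space_vec_def fe_space_def vec_eq_iff)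
  then show ?thesis using p True by (simp add: prv_def partition_2pi_def)
 qed (simp add: prv_def)
 ultimately show ?thesis using pl_on[OF p j, of "%j. \<phi> (U j)"] by (simp add: edge_def)
qed

lemma fe_deriv:
 fixes \<phi> :: "real => real ^ 'n"
 assumes p: "partition_2pi N U" and \<phi>: "\<forall>v\<in>{0..2 * pi}. \<phi> v = pl N U z v" and j: "j \<in> idx N" and v: "v \<in> {U (j - 1)<..<U j}"
 shows "du \<phi> v = edge N z j /\<^sub>R mesh_width N U j"
proof -
 have "(\<phi> has_vector_derivative edge N z j /\<^sub>R mesh_width N U j) (at v)"
 proof (rule has_vector_derivative_transform_within_open[OF pl_deriv[OF p j v], of "{U (j - 1)<..<U j}"])
  fix u assume u: "u \<in> {U (j - 1)<..<U j}"
  then have "u \<in> {0..2 * pi}" unfolding mesh_union[OF p] using j by (auto intro!: bexI[of _ j])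
  then show "pl N U z u = \<phi> u" using \<phi> by simp
 qed (use v in auto)
 then show ?thesis by (simp add: du_def vector_derivative_at)
qed

lemma pl_in_fe_space:
 fixes z :: "nat => real ^ 'n"
 assumes p: "partition_2pi N U"
 shows "pl N U z \<in> fe_space_vec N U"
 unfolding fe_space_vec_def fe_space_def
proof (intro CollectI allI conjI ballI)
 fix i
 have "continuous_on (\<Union>j\<in>idx N. {U (j - 1)..U j}) (pl N U z)"
 proof (rule continuous_on_closed_Union)
  fix j assume j: "j \<in> idx N"
  have "continuous_on {U (j - 1)..U j} (%v. z (prv N j) + ((v - U (j - 1)) / mesh_width N U j) *\<^sub>R edge N z j)"
   using mesh_width_pos[OF p j] by (auto intro!: continuous_intros)
  then show "continuous_on {U (j - 1)..U j} (pl N U z)"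
   by (rule continuous_on_eq) (simp add: pl_on[OF p j])
 qed auto
 then show "continuous_on {0..2 * pi} (%v. pl N U z v $ i)"
  unfolding mesh_union[OF p] by (rule bounded_linear.continuous_on[OF bounded_linear_vec_nth])
 show "\<exists>a b. \<forall>v\<in>{U (j - 1)..U j}. pl N U z v $ i = a + b * v" if "j \<in> {1..N}" for j
 proof (intro exI ballI)
  fix v assume v: "v \<in> {U (j - 1)..U j}"
  have j: "j \<in> idx N" using that by (simp add: idx_def)
  show "pl N U z v $ i = (z (prv N j) $ i - U (j - 1) / mesh_width N U j * edge N z j $ i)
    + (edge N z j $ i / mesh_width N U j) * v"
   unfolding pl_on[OF p j v] by (simp add: diff_divide_distrib left_diff_distrib)
 qed
 have "1 \<in> idx N" "N \<in> idx N" using partition_pos[OF p] by (auto simp: idx_def)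
 then show "pl N U z 0 $ i = pl N U z (2 * pi) $ i"
  using pl_left_node[OF p, of 1 z] pl_node[OF p, of N z] p by (simp add: partition_2pi_def prv_def)
qed

text \<open>\<open>eq\<close> leaves out the nodes, where the slope of a piecewise linear function
  has no definite value.\<close>

lemma has_integral_mesh:
 fixes f :: "real => real"
 assumes p: "partition_2pi N U"
  and f: "!!j. j \<in> idx N ==> (g j has_integral I j) {U (j - 1)..U j}"
  and eq: "!!j v. j \<in> idx N ==> v \<in> {U (j - 1)<..<U j} ==> f v = g j v"
 shows "(f has_integral (\<Sum>j\<in>idx N. I j)) {0..2 * pi}"
proof -
 have fI: "(f has_integral I j) {U (j - 1)..U j}" if "j \<in> idx N" for j
  by (rule has_integral_spike_interior[of "g j", folded interval_cbox, unfolded box_real])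
   (use f[OF that] eq[OF that] in auto)
 have "(f has_integral (\<Sum>j\<in>{1..m}. I j)) {U 0..U m}" if "m <= N" for m
  using that
 proof (induction m)
  case (Suc m)
  have "(f has_integral (\<Sum>j\<in>{1..m}. I j) + I (Suc m)) {U 0..U (Suc m)}"
  proof (rule has_integral_combine)
   show "U 0 <= U m" "U m <= U (Suc m)" using Suc.prems by (auto intro!: partition_mono[OF p])
   show "(f has_integral (\<Sum>j\<in>{1..m}. I j)) {U 0..U m}" using Suc by simp
   show "(f has_integral I (Suc m)) {U m..U (Suc m)}" using fI[of "Suc m"] Suc.prems by (simp add: idx_def)
  qed
  then show ?case by simp
 qed (simp add: has_integral_refl)
 from this[of N] show ?thesis using p by (simp add: idx_def partition_2pi_def)
qed

text \<open>The trapezoidal rule is exact for linear functions. This is the source of the lumped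
  masses and of the means of |y|^2 in the nodal flux.\<close>

lemma has_integral_linear_mean:
 fixes a b p q c :: real
 assumes "p < q"
 shows "((%v. (a + (v - p) / (q - p) * (b - a)) * (c / (q - p))) has_integral (a + b) / 2 * c) {p..q}"
proof -
 define r where "r = q - p"
 have r: "0 < r" using assms by (simp add: r_def)
 define K D where "K = c / r" and "D = (b - a) / r"
 have K: "K * r = c" and D: "D * r = b - a" using r by (simp_all add: K_def D_def)
 define F where "F v = a * K * v + D * K / 2 * (v - p)^2" for v
 have "((%v. (a + (v - p) / r * (b - a)) * (c / r)) has_integral F q - F p) {p..q}"
 proof (rule fundamental_theorem_of_calculus)
  fix v
  have "(F has_real_derivative a * K + D * K / 2 * (2 * (v - p))) (at v within {p..q})"
   unfolding F_def by (auto intro!: derivative_eq_intros)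
  moreover have "a * K + D * K / 2 * (2 * (v - p)) = (a + (v - p) * D) * K" by (simp add: algebra_simps)
  moreover have "(v - p) / r * (b - a) = (v - p) * D" by (simp add: D_def)
  ultimately show "(F has_vector_derivative (a + (v - p) / r * (b - a)) * (c / r)) (at v within {p..q})"
   by (simp only: has_real_derivative_iff_has_vector_derivative K_def[symmetric])
 qed (use assms in simp)
 moreover have "F q - F p = (a + b) / 2 * c"
 proof -
  have "F q - F p = a * K * r + D * K / 2 * r^2" by (simp add: F_def right_diff_distrib r_def)
  also have "... = a * (K * r) + (D * r) * (K * r) / 2" by (simp add: power2_eq_square mult_ac)
  also have "... = (a + b) / 2 * c" unfolding K D by (simp add: field_simps)
  finally show ?thesis .
 qed
 ultimately show ?thesis by (simp add: r_def)
qed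

section \<open>The nodal form of the semi-discrete problem\<close>

text \<open>The discrete flux of the first equation for an arbitrary nodal field \<open>y\<close> in place of the
 discrete curvature.\<close>

definition weak_flux :: "nat => real => (nat => real) => (nat => 'a::real_inner) => (nat => 'a) => nat => 'a" where
 "weak_flux N lam hh z y j = normal_proj (ptang N z j) (edge N y j) /\<^sub>R norm (edge N z j)
   + (((norm (y j))^2 + (norm (y (prv N j)))^2) / 4) *\<^sub>R ptang N z j
   - (lam / hh j) *\<^sub>R edge N z j"

lemma flux_inner:
 "(a + ((b + e) / 4) *\<^sub>R t - (l / h) *\<^sub>R d) \<bullet> (w::'a::real_inner)
  = a \<bullet> w + 1 / 2 * ((e + b) / 2 * (t \<bullet> w)) - l * ((d /\<^sub>R h) \<bullet> w)"
proof -
 have "(b + e) / 4 * x = 1 / 2 * ((e + b) / 2 * x)" for x :: real by simp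
 moreover have "l / h * x = l * (inverse h * x)" for x by (simp add: divide_inverse)
 ultimately show ?thesis by (simp only: inner_diff_left inner_add_left inner_scaleR_left)
qed

lemma weak_flux_curv: "weak_flux N lam hh z (pcurv N z) = pflux N lam hh z"
 by (simp add: fun_eq_iff weak_flux_def pflux_def)

context
 fixes N :: nat and U :: "nat => real"
 assumes p: "partition_2pi N U"
begin

lemma end_node: "s (U 0) = s (U N) ==> s (U (j - 1)) = s (U (prv N j))"
 by (auto simp: prv_def)

lemma node_in: "j \<in> idx N ==> U j \<in> {0..2 * pi}"
 unfolding mesh_union[OF p] using mesh_width_pos[OF p, of j] mesh_width_eq[of j N U] by (auto intro!: bexI[of _ j])

lemma pl_values:
 assumes f: "\<forall>v\<in>{0..2 * pi}. f v = pl N U a v"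
 shows "f (U 0) = f (U N)" "j \<in> idx N ==> f (U j) = a j" "f (U 0) = a N"
proof -
 have U: "U 0 = 0" "U N = 2 * pi" using p by (auto simp: partition_2pi_def)
 have N: "N \<in> idx N" "1 \<in> idx N" "prv N 1 = N" using partition_pos[OF p] by (auto simp: idx_def prv_def)
 show "f (U 0) = a N" using pl_left_node[OF p N(2), of a] N(3) f U by simp
 then show "f (U 0) = f (U N)" using pl_node[OF p N(1), of a] f U by simp
 show "f (U j) = a j" if "j \<in> idx N" using pl_node[OF p that, of a] f node_in[OF that] by simp
qed

lemma integral_interp:
 fixes s k :: "real => real"
 assumes k: "!!j v. j \<in> idx N ==> v \<in> {U (j - 1)<..<U j} ==> k v = c j / mesh_width N U j"
  and s: "s (U 0) = s (U N)"
 shows "integral {0..2 * pi} (%v. interp N U s v * k v) = (\<Sum>j\<in>idx N. (s (U (prv N j)) + s (U j)) / 2 * c j)"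
proof (rule integral_unique, rule has_integral_mesh[OF p])
 fix j assume j: "j \<in> idx N"
 note hj = mesh_width_eq[OF j, of U]
 have lt: "U (j - 1) < U j" using mesh_width_pos[OF p j] by (simp add: hj)
 from has_integral_linear_mean[OF lt, of "s (U (j - 1))" "s (U j)" "c j"]
 show "((%v. (s (U (prv N j)) + (v - U (j - 1)) / (U j - U (j - 1)) * (s (U j) - s (U (prv N j)))) * (c j / (U j - U (j - 1))))
   has_integral (s (U (prv N j)) + s (U j)) / 2 * c j) {U (j - 1)..U j}"
  unfolding end_node[of s, OF s] .
 fix v assume v: "v \<in> {U (j - 1)<..<U j}"
 then have "v \<in> {U (j - 1)..U j}" by auto
 from interp_on[OF p j this, of s]
 show "interp N U s v * k v = (s (U (prv N j)) + (v - U (j - 1)) / (U j - U (j - 1)) * (s (U j) - s (U (prv N j)))) * (c j / (U j - U (j - 1)))"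
  unfolding k[OF j v] hj end_node[of s, OF s] by simp
qed

lemma integral_piecewise_constant:
 fixes k :: "real => real"
 assumes k: "!!j v. j \<in> idx N ==> v \<in> {U (j - 1)<..<U j} ==> k v = c j / mesh_width N U j"
 shows "integral {0..2 * pi} k = (\<Sum>j\<in>idx N. c j)"
proof -
 have "interp N U (%_. 1 :: real) = (%_. 1)" by (simp add: interp_def Let_def fun_eq_iff)
 then show ?thesis using integral_interp[of k c "%_. 1", OF k] by simp
qed

context
 fixes xh :: "real => real ^ 'n" and z
 assumes xh: "!!v. v \<in> {0..2 * pi} ==> xh v = pl N U z v" and nz: "!!j. j \<in> idx N ==> edge N z j ~= 0"
begin

lemma du_xh:
 assumes j: "j \<in> idx N" and v: "v \<in> {U (j - 1)<..<U j}"
 shows "du xh v = edge N z j /\<^sub>R mesh_width N U j" "norm (du xh v) = norm (edge N z j) / mesh_width N U j"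
  "tangent xh v = ptang N z j"
proof -
 have h: "0 < mesh_width N U j" by (rule mesh_width_pos[OF p j])
 show d: "du xh v = edge N z j /\<^sub>R mesh_width N U j" by (rule fe_deriv[OF p _ j v]) (simp add: xh)
 then show n: "norm (du xh v) = norm (edge N z j) / mesh_width N U j" using h by (simp add: divide_inverse mult.commute)
 show "tangent xh v = ptang N z j" unfolding tangent_def n d ptang_def using h by simp
qed

lemma mass_term:
 assumes s: "s (U 0) = s (U N)"
 shows "integral {0..2 * pi} (%v. interp N U s v * norm (du xh v)) = (\<Sum>j\<in>idx N. pmass N z j * s (U j))"
proof -
 have "integral {0..2 * pi} (%v. interp N U s v * norm (du xh v)) = (\<Sum>j\<in>idx N. (s (U (prv N j)) + s (U j)) / 2 * norm (edge N z j))"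
  by (rule integral_interp[OF du_xh(2) s])
 also have "... = (\<Sum>j\<in>idx N. norm (edge N z j) / 2 * s (U (prv N j))) + (\<Sum>j\<in>idx N. norm (edge N z j) / 2 * s (U j))"
  by (simp add: sum.distrib[symmetric] algebra_simps add_divide_distrib)
 also have "(\<Sum>j\<in>idx N. norm (edge N z j) / 2 * s (U (prv N j))) = (\<Sum>j\<in>idx N. norm (edge N z (nxt N j)) / 2 * s (U (prv N (nxt N j))))"
  by (rule sum_nxt[symmetric])
 also have "... = (\<Sum>j\<in>idx N. norm (edge N z (nxt N j)) / 2 * s (U j))" by (rule sum.cong) auto
 finally show ?thesis by (simp add: pmass_def sum.distrib[symmetric] algebra_simps add_divide_distrib)
qed

text \<open>The right hand side is the nodal residual tested with the nodal values of \<phi>. So the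
  weak equation for all test functions and the nodal scheme imply each other.\<close>

lemma weak_first:
 fixes \<phi> :: "real => real ^ 'n"
 assumes yh: "!!v. v \<in> {0..2 * pi} ==> yh v = pl N U y v" and \<phi>: "!!v. v \<in> {0..2 * pi} ==> \<phi> v = pl N U w v"
  and d: "d (U 0) = d (U N)"
 shows "integral {0..2 * pi} (%v. interp N U (%w. d w \<bullet> \<phi> w) v * norm (du xh v))
    - integral {0..2 * pi} (%v. (normal_proj (tangent xh v) (du yh v) \<bullet> du \<phi> v) / norm (du xh v))
    - 1 / 2 * integral {0..2 * pi} (%v. interp N U (%w. (norm (yh w))^2) v * (tangent xh v \<bullet> du \<phi> v))
    + lam * integral {0..2 * pi} (%v. du xh v \<bullet> du \<phi> v)
  = (\<Sum>j\<in>idx N. (pmass N z j *\<^sub>R d (U j)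
     - (weak_flux N lam (mesh_width N U) z y j - weak_flux N lam (mesh_width N U) z y (nxt N j))) \<bullet> w j)"
proof -
 have y: "\<forall>v\<in>{0..2 * pi}. yh v = pl N U y v" and f: "\<forall>v\<in>{0..2 * pi}. \<phi> v = pl N U w v" using yh \<phi> by auto
 have t1: "integral {0..2 * pi} (%v. interp N U (%w. d w \<bullet> \<phi> w) v * norm (du xh v)) = (\<Sum>j\<in>idx N. pmass N z j * (d (U j) \<bullet> w j))"
 proof -
  have "integral {0..2 * pi} (%v. interp N U (%w. d w \<bullet> \<phi> w) v * norm (du xh v)) = (\<Sum>j\<in>idx N. pmass N z j * (d (U j) \<bullet> \<phi> (U j)))"
   by (rule mass_term) (simp add: d pl_values(1)[OF f])
  also have "... = (\<Sum>j\<in>idx N. pmass N z j * (d (U j) \<bullet> w j))" by (rule sum.cong) (simp_all add: pl_values(2)[OF f])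
  finally show ?thesis .
 qed
 have t2: "integral {0..2 * pi} (%v. (normal_proj (tangent xh v) (du yh v) \<bullet> du \<phi> v) / norm (du xh v))
   = (\<Sum>j\<in>idx N. (normal_proj (ptang N z j) (edge N y j) /\<^sub>R norm (edge N z j)) \<bullet> edge N w j)"
 proof (rule integral_piecewise_constant)
  fix j v assume j: "j \<in> idx N" and v: "v \<in> {U (j - 1)<..<U j}"
  have h: "0 < mesh_width N U j" by (rule mesh_width_pos[OF p j])
  have "normal_proj (ptang N z j) (edge N y j /\<^sub>R mesh_width N U j) = normal_proj (ptang N z j) (edge N y j) /\<^sub>R mesh_width N U j"
   by (simp add: normal_proj_def scaleR_diff_right)
  then show "(normal_proj (tangent xh v) (du yh v) \<bullet> du \<phi> v) / norm (du xh v)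
   = ((normal_proj (ptang N z j) (edge N y j) /\<^sub>R norm (edge N z j)) \<bullet> edge N w j) / mesh_width N U j"
   unfolding du_xh(2,3)[OF j v] fe_deriv[OF p y j v] fe_deriv[OF p f j v] using h nz[OF j] by (simp add: field_simps)
 qed
 have t3: "integral {0..2 * pi} (%v. interp N U (%w. (norm (yh w))^2) v * (tangent xh v \<bullet> du \<phi> v))
   = (\<Sum>j\<in>idx N. ((norm (y (prv N j)))^2 + (norm (y j))^2) / 2 * (ptang N z j \<bullet> edge N w j))"
 proof -
  have "integral {0..2 * pi} (%v. interp N U (%w. (norm (yh w))^2) v * (tangent xh v \<bullet> du \<phi> v))
   = (\<Sum>j\<in>idx N. ((norm (yh (U (prv N j))))^2 + (norm (yh (U j)))^2) / 2 * (ptang N z j \<bullet> edge N w j))"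
  proof (rule integral_interp)
   fix j v assume j: "j \<in> idx N" and v: "v \<in> {U (j - 1)<..<U j}"
   show "tangent xh v \<bullet> du \<phi> v = (ptang N z j \<bullet> edge N w j) / mesh_width N U j"
    unfolding du_xh(3)[OF j v] fe_deriv[OF p f j v] by (simp add: divide_inverse mult.commute)
  qed (simp add: pl_values(1)[OF y])
  also have "... = (\<Sum>j\<in>idx N. ((norm (y (prv N j)))^2 + (norm (y j))^2) / 2 * (ptang N z j \<bullet> edge N w j))"
   by (rule sum.cong) (simp_all add: pl_values(2)[OF y])
  finally show ?thesis .
 qed
 have t4: "integral {0..2 * pi} (%v. du xh v \<bullet> du \<phi> v) = (\<Sum>j\<in>idx N. (edge N z j /\<^sub>R mesh_width N U j) \<bullet> edge N w j)"
 proof (rule integral_piecewise_constant)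
  fix j v assume j: "j \<in> idx N" and v: "v \<in> {U (j - 1)<..<U j}"
  show "du xh v \<bullet> du \<phi> v = ((edge N z j /\<^sub>R mesh_width N U j) \<bullet> edge N w j) / mesh_width N U j"
   unfolding du_xh(1)[OF j v] fe_deriv[OF p f j v] by (simp add: divide_inverse mult.commute)
 qed
 define G where "G = weak_flux N lam (mesh_width N U) z y"
 have "(\<Sum>j\<in>idx N. G j \<bullet> edge N w j) = (\<Sum>j\<in>idx N. (normal_proj (ptang N z j) (edge N y j) /\<^sub>R norm (edge N z j)) \<bullet> edge N w j)
   + 1 / 2 * (\<Sum>j\<in>idx N. ((norm (y (prv N j)))^2 + (norm (y j))^2) / 2 * (ptang N z j \<bullet> edge N w j))
   - lam * (\<Sum>j\<in>idx N. (edge N z j /\<^sub>R mesh_width N U j) \<bullet> edge N w j)"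
  unfolding sum_distrib_left sum.distrib[symmetric] sum_subtractf[symmetric]
 proof (rule sum.cong[OF refl])
  fix j
  show "G j \<bullet> edge N w j = (normal_proj (ptang N z j) (edge N y j) /\<^sub>R norm (edge N z j)) \<bullet> edge N w j
    + 1 / 2 * (((norm (y (prv N j)))^2 + (norm (y j))^2) / 2 * (ptang N z j \<bullet> edge N w j))
    - lam * ((edge N z j /\<^sub>R mesh_width N U j) \<bullet> edge N w j)"
   unfolding G_def weak_flux_def by (rule flux_inner)
 qed
 moreover have "(\<Sum>j\<in>idx N. G j \<bullet> edge N w j) = (\<Sum>j\<in>idx N. (G j - G (nxt N j)) \<bullet> w j)"
  by (rule sum_by_parts)
 moreover have "(\<Sum>j\<in>idx N. (pmass N z j *\<^sub>R d (U j) - (G j - G (nxt N j))) \<bullet> w j)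
   = (\<Sum>j\<in>idx N. pmass N z j * (d (U j) \<bullet> w j)) - (\<Sum>j\<in>idx N. (G j - G (nxt N j)) \<bullet> w j)"
  unfolding sum_subtractf[symmetric] by (rule sum.cong) (simp_all add: inner_diff_left)
 ultimately show ?thesis unfolding t1 t2 t3 t4 G_def[symmetric] by linarith
qed

lemma weak_second:
 fixes \<phi> :: "real => real ^ 'n"
 assumes yh: "!!v. v \<in> {0..2 * pi} ==> yh v = pl N U y v" and \<phi>: "!!v. v \<in> {0..2 * pi} ==> \<phi> v = pl N U w v"
 shows "integral {0..2 * pi} (%v. interp N U (%w. yh w \<bullet> \<phi> w) v * norm (du xh v))
    + integral {0..2 * pi} (%v. tangent xh v \<bullet> du \<phi> v)
  = (\<Sum>j\<in>idx N. (pmass N z j *\<^sub>R y j - (ptang N z (nxt N j) - ptang N z j)) \<bullet> w j)"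
proof -
 have y: "\<forall>v\<in>{0..2 * pi}. yh v = pl N U y v" and f: "\<forall>v\<in>{0..2 * pi}. \<phi> v = pl N U w v" using yh \<phi> by auto
 have t1: "integral {0..2 * pi} (%v. interp N U (%w. yh w \<bullet> \<phi> w) v * norm (du xh v)) = (\<Sum>j\<in>idx N. pmass N z j * (y j \<bullet> w j))"
 proof -
  have "integral {0..2 * pi} (%v. interp N U (%w. yh w \<bullet> \<phi> w) v * norm (du xh v)) = (\<Sum>j\<in>idx N. pmass N z j * (yh (U j) \<bullet> \<phi> (U j)))"
   by (rule mass_term) (simp add: pl_values(1)[OF f] pl_values(1)[OF y])
  also have "... = (\<Sum>j\<in>idx N. pmass N z j * (y j \<bullet> w j))" by (rule sum.cong) (simp_all add: pl_values(2)[OF f] pl_values(2)[OF y])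
  finally show ?thesis .
 qed
 have t2: "integral {0..2 * pi} (%v. tangent xh v \<bullet> du \<phi> v) = (\<Sum>j\<in>idx N. ptang N z j \<bullet> edge N w j)"
 proof (rule integral_piecewise_constant)
  fix j v assume j: "j \<in> idx N" and v: "v \<in> {U (j - 1)<..<U j}"
  show "tangent xh v \<bullet> du \<phi> v = (ptang N z j \<bullet> edge N w j) / mesh_width N U j"
   unfolding du_xh(3)[OF j v] fe_deriv[OF p f j v] by (simp add: divide_inverse mult.commute)
 qed
 have "(\<Sum>j\<in>idx N. ptang N z j \<bullet> edge N w j) = (\<Sum>j\<in>idx N. (ptang N z j - ptang N z (nxt N j)) \<bullet> w j)"
  by (rule sum_by_parts)
 from t1 t2[unfolded this] show ?thesis
  by (simp only: sum.distrib[symmetric]) (rule sum.cong, simp_all add: inner_diff_left)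
qed

end

end

text \<open>Test with \<open>a\<close> itself.\<close>

lemma nodal_zero:
 fixes a :: "nat => 'a::real_inner"
 assumes "!!w. (\<Sum>j\<in>idx N. a j \<bullet> w j) = 0" and j: "j \<in> idx N"
 shows "a j = 0"
 using assms(1)[of a] j by (subst (asm) sum_nonneg_eq_0_iff) auto

lemma weak_flux_cong:
 assumes "!!j. j \<in> idx N ==> y j = y' j" and j: "j \<in> idx N"
 shows "weak_flux N lam hh z y j = weak_flux N lam hh z y' j"
 using assms by (simp add: weak_flux_def edge_def)

lemma mass_eq_curv:
 assumes "edge N z j ~= 0" "edge N z (nxt N j) ~= 0"
 shows "pmass N z j *\<^sub>R y = ptang N z (nxt N j) - ptang N z j \<longleftrightarrow> y = pcurv N z j"
proof -
 have m: "0 < pmass N z j" using assms by (simp add: pmass_def add_pos_pos)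
 show ?thesis
 proof
  assume "pmass N z j *\<^sub>R y = ptang N z (nxt N j) - ptang N z j"
  from arg_cong[OF this, of "%u. u /\<^sub>R pmass N z j"] show "y = pcurv N z j" using m by (simp add: pcurv_def)
 qed (use m in \<open>simp add: pcurv_def\<close>)
qed

lemma semidiscrete_nodal:
 fixes xh yh :: "real => real => real ^ 'n"
 assumes T: "0 < T" and p: "partition_2pi N U" and sol: "semidiscrete_solution T lam x0 N U xh yh" and t: "t \<in> {0..T}"
 shows "\<forall>v\<in>{0..2 * pi}. xh t v = pl N U (%j. xh t (U j)) v"
  and "\<forall>v\<in>{0..2 * pi}. yh t v = pl N U (%j. yh t (U j)) v"
  and "j \<in> idx N ==> edge N (%j. xh t (U j)) j ~= 0"
  and "j \<in> idx N ==> ((%s. xh s (U j)) has_vector_derivative pdt T xh t (U j)) (at t within {0..T})"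
  and "j \<in> idx N ==> yh t (U j) = pcurv N (%j. xh t (U j)) j"
  and "j \<in> idx N ==> pmass N (%j. xh t (U j)) j *\<^sub>R pdt T xh t (U j)
   = pflux N lam (mesh_width N U) (%j. xh t (U j)) j - pflux N lam (mesh_width N U) (%j. xh t (U j)) (nxt N j)"
  and "j \<in> idx N ==> xh 0 (U j) = x0 (U j)"
proof -
 have fe: "xh s \<in> fe_space_vec N U" "yh s \<in> fe_space_vec N U" if "s \<in> {0..T}" for s
  using sol that unfolding semidiscrete_solution_def by auto
 show xp: "\<forall>v\<in>{0..2 * pi}. xh t v = pl N U (%j. xh t (U j)) v" and yp: "\<forall>v\<in>{0..2 * pi}. yh t v = pl N U (%j. yh t (U j)) v"
  using pl_nodal[OF p fe(1)[OF t]] pl_nodal[OF p fe(2)[OF t]] by auto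
 show nz: "edge N (%j. xh t (U j)) j ~= 0" if j: "j \<in> idx N" for j
 proof -
  obtain v where v: "v \<in> {U (j - 1)<..<U j}"
   using dense[of "U (j - 1)" "U j"] mesh_width_pos[OF p j] mesh_width_eq[OF j, of U] by auto
  then have "du (xh t) v ~= 0" using sol t j unfolding semidiscrete_solution_def idx_def by blast
  then show ?thesis using fe_deriv[OF p xp j v] by auto
 qed
 have U: "U 0 = 0" "U N = 2 * pi" using p by (auto simp: partition_2pi_def)
 have dn: "((%s. xh s (U j)) has_vector_derivative pdt T xh t (U j)) (at t within {0..T})" if "j \<in> {0..N}" for j
  using sol t that unfolding semidiscrete_solution_def pdt_def by (simp add: vector_derivative_works)
 then show "((%s. xh s (U j)) has_vector_derivative pdt T xh t (U j)) (at t within {0..T})" if "j \<in> idx N" for j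
  using that by (simp add: idx_def)
 \<comment> \<open>\<open>weak_first\<close> needs the velocity to agree at both ends. Membership in
   the finite element space is known for the positions only, so the agreement is obtained by
   differentiating theirs.\<close>
 have x0N: "pdt T xh t (U 0) = pdt T xh t (U N)"
 proof (rule pdt_eqI[OF _ T t])
  have "xh s (U 0) = xh s (U N)" if "s \<in> {0..T}" for s
   by (rule pl_values(1)[OF p]) (use pl_nodal[OF p fe(1)[OF that]] in auto)
  then show "((%s. xh s (U 0)) has_vector_derivative pdt T xh t (U N)) (at t within {0..T})"
   by (intro has_vector_derivative_transform[OF t _ dn]) auto
 qed
 have yc: "yh t (U j) = pcurv N (%j. xh t (U j)) j" if j: "j \<in> idx N" for j
 proof -
  have "pmass N (%j. xh t (U j)) j *\<^sub>R yh t (U j) - (ptang N (%j. xh t (U j)) (nxt N j) - ptang N (%j. xh t (U j)) j) = 0"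
  proof (rule nodal_zero[OF _ j])
   fix w :: "nat => real ^ 'n"
   have "integral {0..2 * pi} (%v. interp N U (%w'. yh t w' \<bullet> pl N U w w') v * norm (du (xh t) v))
    + integral {0..2 * pi} (%v. tangent (xh t) v \<bullet> du (pl N U w) v) = 0"
    using sol t pl_in_fe_space[OF p, of w] unfolding semidiscrete_solution_def by blast
   then show "(\<Sum>j\<in>idx N. (pmass N (%j. xh t (U j)) j *\<^sub>R yh t (U j)
     - (ptang N (%j. xh t (U j)) (nxt N j) - ptang N (%j. xh t (U j)) j)) \<bullet> w j) = 0"
    by (subst weak_second[OF p _ nz, symmetric, of "xh t" "yh t" _ "pl N U w"]) (use xp yp in auto)
  qed
  then show ?thesis using mass_eq_curv[of N "%j. xh t (U j)" j] nz[OF j] nz[OF nxt_in[OF j]] by simp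
 qed
 show "yh t (U j) = pcurv N (%j. xh t (U j)) j" if j: "j \<in> idx N" for j by (rule yc[OF j])
 show "pmass N (%j. xh t (U j)) j *\<^sub>R pdt T xh t (U j)
   = pflux N lam (mesh_width N U) (%j. xh t (U j)) j - pflux N lam (mesh_width N U) (%j. xh t (U j)) (nxt N j)" if j: "j \<in> idx N" for j
 proof -
  let ?F = "weak_flux N lam (mesh_width N U) (%j. xh t (U j)) (%j. yh t (U j))"
  have "pmass N (%j. xh t (U j)) j *\<^sub>R pdt T xh t (U j) - (?F j - ?F (nxt N j)) = 0"
  proof (rule nodal_zero[OF _ j])
   fix w :: "nat => real ^ 'n"
   have "integral {0..2 * pi} (%v. interp N U (%w'. pdt T xh t w' \<bullet> pl N U w w') v * norm (du (xh t) v))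
    - integral {0..2 * pi}
     (%v. (normal_proj (tangent (xh t) v) (du (yh t) v) \<bullet> du (pl N U w) v) / norm (du (xh t) v))
    - 1 / 2 * integral {0..2 * pi}
     (%v. interp N U (%w. (norm (yh t w))^2) v * (tangent (xh t) v \<bullet> du (pl N U w) v))
    + lam * integral {0..2 * pi} (%v. du (xh t) v \<bullet> du (pl N U w) v) = 0"
    using sol t pl_in_fe_space[OF p, of w] unfolding semidiscrete_solution_def by blast
   then show "(\<Sum>j\<in>idx N. (pmass N (%j. xh t (U j)) j *\<^sub>R pdt T xh t (U j) - (?F j - ?F (nxt N j))) \<bullet> w j) = 0"
    by (subst weak_first[OF p _ nz, symmetric, of "xh t" "yh t" _ "pl N U w"]) (use xp yp x0N in auto)
  qed
  moreover have "?F i = pflux N lam (mesh_width N U) (%j. xh t (U j)) i" if "i \<in> idx N" for i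
   unfolding weak_flux_curv[symmetric] by (rule weak_flux_cong[OF yc that])
  ultimately show ?thesis using j by simp
 qed
 show "xh 0 (U j) = x0 (U j)" if j: "j \<in> idx N" for j
 proof -
  have "U j \<in> {U (j - 1)..U j}" using mesh_width_pos[OF p j] mesh_width_eq[OF j, of U] by auto
  from interp_on[OF p j this, of x0] have "interp N U x0 (U j) = x0 (U j)"
   using mesh_width_pos[OF p j] mesh_width_eq[OF j, of U] by simp
  then show ?thesis using sol node_in[OF p j] unfolding semidiscrete_solution_def by auto
 qed
qed

lemma semidiscrete_of_nodal:
 fixes z z' :: "real => nat => real ^ 'n"
 assumes T: "0 < T" and p: "partition_2pi N U"
  and z': "!!t j. t \<in> {0..T} ==> j \<in> idx N ==> ((%s. z s j) has_vector_derivative z' t j) (at t within {0..T})"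
  and nz: "!!t j. t \<in> {0..T} ==> j \<in> idx N ==> edge N (z t) j ~= 0"
  and scheme: "!!t j. t \<in> {0..T} ==> j \<in> idx N ==> pmass N (z t) j *\<^sub>R z' t j
    = pflux N lam (mesh_width N U) (z t) j - pflux N lam (mesh_width N U) (z t) (nxt N j)"
  and init: "!!j. j \<in> idx N ==> z 0 j = x0 (U j)" and x0: "x0 0 = x0 (2 * pi)"
 shows "semidiscrete_solution T lam x0 N U (%t. pl N U (z t)) (%t. pl N U (pcurv N (z t)))"
  and "t \<in> {0..T} ==> v \<in> {0..2 * pi} ==> pdt T (%t. pl N U (z t)) t v = pl N U (z' t) v"
proof -
 have U: "U 0 = 0" "U N = 2 * pi" using p by (auto simp: partition_2pi_def)
 have N: "N \<in> idx N" using partition_pos[OF p] by (auto simp: idx_def)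
 have nodeval: "pl N U a (U j) = (if j = 0 then a N else a j)" if "j \<in> {0..N}" for a :: "nat => real ^ 'n" and j
  using pl_values(2,3)[OF p, of "pl N U a" a] that by (auto simp: idx_def)
 have dpl: "((%s. pl N U (z s) v) has_vector_derivative pl N U (z' t) v) (at t within {0..T})"
  if t: "t \<in> {0..T}" and v: "v \<in> {0..2 * pi}" for t v
 proof -
  obtain j where j: "j \<in> idx N" "v \<in> {U (j - 1)..U j}" using mesh_cover[OF p v] by blast
  show ?thesis unfolding pl_on[OF p j]
   by (intro has_vector_derivative_add z' t prv_in j(1) bounded_linear.has_vector_derivative[OF bounded_linear_scaleR_right]
     edge_has_vector_derivative)
 qed
 show pdt: "pdt T (%t. pl N U (z t)) t v = pl N U (z' t) v" if "t \<in> {0..T}" "v \<in> {0..2 * pi}" for t v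
  by (rule pdt_eqI) (rule dpl[OF that] T that(1))+
 have node2: "U j \<in> {0..2 * pi}" if "j \<in> {0..N}" for j
  using node_in[OF p, of j] that U by (cases "j = 0") (auto simp: idx_def)
 have pdtU: "pdt T (%t. pl N U (z t)) t (U j) = (if j = 0 then z' t N else z' t j)" if "t \<in> {0..T}" "j \<in> {0..N}" for t j
  using pdt[OF that(1) node2[OF that(2)]] nodeval[OF that(2)] by simp
 have fep: "\<forall>v\<in>{0..2 * pi}. \<phi> v = pl N U (%j. \<phi> (U j)) v" if "\<phi> \<in> fe_space_vec N U" for \<phi> :: "real => real ^ 'n"
  using pl_nodal[OF p that] by auto
 show "semidiscrete_solution T lam x0 N U (%t. pl N U (z t)) (%t. pl N U (pcurv N (z t)))"
  unfolding semidiscrete_solution_def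
 proof (intro conjI ballI)
  fix t assume t: "t \<in> {0..T}"
  show "pl N U (z t) \<in> fe_space_vec N U" "pl N U (pcurv N (z t)) \<in> fe_space_vec N U" by (rule pl_in_fe_space[OF p])+
  show "(%s. pl N U (z s) (U j)) differentiable at t within {0..T}" if "j \<in> {0..N}" for j
   by (rule differentiableI_vector[OF dpl[OF t node2[OF that]]])
  show "(%s. pl N U (pcurv N (z s)) (U j)) differentiable at t within {0..T}" if "j \<in> {0..N}" for j
  proof -
   have "(%s. pcurv N (z s) i) differentiable at t within {0..T}" if "i \<in> idx N" for i
    by (rule differentiableI_vector[OF pcurv_has_vector_derivative[OF z'[OF t] nz[OF t] that]])
   moreover have "(%s. pl N U (pcurv N (z s)) (U j)) = (%s. pcurv N (z s) (if j = 0 then N else j))"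
    by (simp add: fun_eq_iff nodeval[OF that])
   moreover have "(if j = 0 then N else j) \<in> idx N" using that N by (auto simp: idx_def)
   ultimately show ?thesis by metis
  qed
  fix j v assume j: "j \<in> {1..N}" and v: "v \<in> {U (j - 1)<..<U j}"
  then have j: "j \<in> idx N" by (simp add: idx_def)
  have "du (pl N U (z t)) v = edge N (z t) j /\<^sub>R mesh_width N U j" by (rule fe_deriv[OF p _ j v]) simp
  then show "du (pl N U (z t)) v ~= 0" using nz[OF t j] mesh_width_pos[OF p j] by simp
 next
  fix t and \<phi> :: "real => real ^ 'n" assume t: "t \<in> {0..T}" and \<phi>: "\<phi> \<in> fe_space_vec N U"
  have N0: "(0::nat) \<in> {0..N}" "N \<in> {0..N}" "N ~= 0" using partition_pos[OF p] by auto
  have "(\<Sum>j\<in>idx N. (pmass N (z t) j *\<^sub>R pdt T (%t. pl N U (z t)) t (U j)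
     - (weak_flux N lam (mesh_width N U) (z t) (pcurv N (z t)) j
     - weak_flux N lam (mesh_width N U) (z t) (pcurv N (z t)) (nxt N j))) \<bullet> \<phi> (U j)) = 0"
  proof (rule sum.neutral, rule ballI)
   fix j assume j: "j \<in> idx N"
   have "pdt T (%t. pl N U (z t)) t (U j) = z' t j" using pdtU[OF t, of j] j by (auto simp: idx_def)
   then show "(pmass N (z t) j *\<^sub>R pdt T (%t. pl N U (z t)) t (U j)
     - (weak_flux N lam (mesh_width N U) (z t) (pcurv N (z t)) j
     - weak_flux N lam (mesh_width N U) (z t) (pcurv N (z t)) (nxt N j))) \<bullet> \<phi> (U j) = 0"
    unfolding weak_flux_curv using scheme[OF t j] by simp
  qed
  then show "integral {0..2 * pi} (%v. interp N U (%w. pdt T (%t. pl N U (z t)) t w \<bullet> \<phi> w) v * norm (du (pl N U (z t)) v))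
    - integral {0..2 * pi}
     (%v. (normal_proj (tangent (pl N U (z t)) v) (du (pl N U (pcurv N (z t))) v) \<bullet> du \<phi> v) / norm (du (pl N U (z t)) v))
    - 1 / 2 * integral {0..2 * pi}
     (%v. interp N U (%w. (norm (pl N U (pcurv N (z t)) w))^2) v * (tangent (pl N U (z t)) v \<bullet> du \<phi> v))
    + lam * integral {0..2 * pi} (%v. du (pl N U (z t)) v \<bullet> du \<phi> v) = 0"
   by (subst weak_first[OF p _ nz[OF t], of "pl N U (z t)" "pl N U (pcurv N (z t))" "pcurv N (z t)" \<phi> "%j. \<phi> (U j)"])
    (use fep[OF \<phi>] pdtU[OF t N0(1)] pdtU[OF t N0(2)] N0(3) in auto)
  have "(\<Sum>j\<in>idx N. (pmass N (z t) j *\<^sub>R pcurv N (z t) j - (ptang N (z t) (nxt N j) - ptang N (z t) j)) \<bullet> \<phi> (U j)) = 0"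
  proof (rule sum.neutral, rule ballI)
   fix j assume j: "j \<in> idx N"
   show "(pmass N (z t) j *\<^sub>R pcurv N (z t) j - (ptang N (z t) (nxt N j) - ptang N (z t) j)) \<bullet> \<phi> (U j) = 0"
    using mass_eq_curv[OF nz[OF t j] nz[OF t nxt_in[OF j]], of "pcurv N (z t) j"] by simp
  qed
  then show "integral {0..2 * pi} (%v. interp N U (%w. pl N U (pcurv N (z t)) w \<bullet> \<phi> w) v * norm (du (pl N U (z t)) v))
    + integral {0..2 * pi} (%v. tangent (pl N U (z t)) v \<bullet> du \<phi> v) = 0"
   by (subst weak_second[OF p _ nz[OF t], of "pl N U (z t)" "pl N U (pcurv N (z t))" "pcurv N (z t)" \<phi> "%j. \<phi> (U j)"])
    (use fep[OF \<phi>] in auto)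
 next
  fix v :: real assume v: "v \<in> {0..2 * pi}"
  have "pl N U (z 0) v = pl N U (%j. x0 (U j)) v"
  proof -
   obtain j where j: "j \<in> idx N" "v \<in> {U (j - 1)..U j}" using mesh_cover[OF p v] by blast
   show ?thesis unfolding pl_on[OF p j] using j by (simp add: edge_def init)
  qed
  then show "pl N U (z 0) v = interp N U x0 v" using pl_interp[OF _ p v, of x0] x0 U by simp
 qed
qed

section \<open>Uniqueness\<close>

text \<open>Nonvanishing edges on a compact time interval are bounded away from zero; the sum over
  all lengths and their reciprocals treats both bounds at once.\<close>

lemma nodal_edges_bounded:
 fixes z :: "real => nat => 'a::real_normed_vector"
 assumes cont: "!!j. j \<in> idx N ==> continuous_on {0..T} (%t. z t j)"
  and nz: "!!t j. t \<in> {0..T} ==> j \<in> idx N ==> edge N (z t) j ~= 0"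
 shows "\<exists>M>0. \<forall>t\<in>{0..T}. \<forall>j\<in>idx N. 1 / M <= norm (edge N (z t) j) & norm (edge N (z t) j) <= M"
proof -
 define f where "f t = (\<Sum>j\<in>idx N. inverse (norm (edge N (z t) j)) + norm (edge N (z t) j))" for t
 have ce: "continuous_on {0..T} (%t. norm (edge N (z t) j))" if "j \<in> idx N" for j
  unfolding edge_def by (intro continuous_on_norm continuous_on_diff cont that prv_in)
 have "continuous_on {0..T} f" unfolding f_def
  by (intro continuous_on_sum continuous_on_add continuous_on_inverse ce ballI) (use nz in auto)
 then have "bounded (f ` {0..T})" by (intro compact_imp_bounded compact_continuous_image) auto
 then obtain M where M: "0 < M" "!!t. t \<in> {0..T} ==> norm (f t) <= M"
  unfolding bounded_pos by auto
 show ?thesis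
 proof (intro exI[of _ M] conjI ballI M(1))
  fix t j assume t: "t \<in> {0..T}" and j: "j \<in> idx N"
  have "inverse (norm (edge N (z t) j)) + norm (edge N (z t) j) <= f t"
   unfolding f_def using j by (intro member_le_sum[of j]) auto
  then have le: "inverse (norm (edge N (z t) j)) + norm (edge N (z t) j) <= M" using M(2)[OF t] by simp
  have e: "0 < norm (edge N (z t) j)" using nz[OF t j] by simp
  then have "0 < inverse (norm (edge N (z t) j))" by simp
  then show "norm (edge N (z t) j) <= M" using le by linarith
  have "inverse (norm (edge N (z t) j)) <= M" using le e by linarith
  then show "1 / M <= norm (edge N (z t) j)" using e M(1) by (simp add: field_simps)
 qed
qed

text \<open>Take p and q so that the edges of both solutions stay within them. Then both solve the
  same truncated equation, which is globally Lipschitz. The argument works on each mesh separately,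
  without a restriction on its size.\<close>

lemma nodal_scheme_unique:
 fixes z w :: "real => nat => 'a::real_inner"
 assumes z: "!!t j. t \<in> {0..T} ==> j \<in> idx N ==> ((%s. z s j) has_vector_derivative z' t j) (at t within {0..T})"
   "!!t j. t \<in> {0..T} ==> j \<in> idx N ==> edge N (z t) j ~= 0"
   "!!t j. t \<in> {0..T} ==> j \<in> idx N ==> pmass N (z t) j *\<^sub>R z' t j = pflux N lam hh (z t) j - pflux N lam hh (z t) (nxt N j)"
  and w: "!!t j. t \<in> {0..T} ==> j \<in> idx N ==> ((%s. w s j) has_vector_derivative w' t j) (at t within {0..T})"
   "!!t j. t \<in> {0..T} ==> j \<in> idx N ==> edge N (w t) j ~= 0"
   "!!t j. t \<in> {0..T} ==> j \<in> idx N ==> pmass N (w t) j *\<^sub>R w' t j = pflux N lam hh (w t) j - pflux N lam hh (w t) (nxt N j)"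
  and init: "!!j. j \<in> idx N ==> z 0 j = w 0 j" and t: "t \<in> {0..T}" and j: "j \<in> idx N"
 shows "z t j = w t j"
proof -
 have cont: "continuous_on {0..T} (%t. u t j)" if "!!t. t \<in> {0..T} ==> ((%s. u s j) has_vector_derivative u' t j) (at t within {0..T})"
  for u u' :: "real => nat => 'a" and j
  unfolding continuous_on_eq_continuous_within using has_vector_derivative_continuous[OF that] by blast
 have cz: "continuous_on {0..T} (%t. z t j)" and cw: "continuous_on {0..T} (%t. w t j)" if "j \<in> idx N" for j
  by (rule cont[where u' = z'], rule z(1)[OF _ that], assumption) (rule cont[where u' = w'], rule w(1)[OF _ that], assumption)
 obtain M1 where M1: "0 < M1" "\<forall>t\<in>{0..T}. \<forall>j\<in>idx N. 1 / M1 <= norm (edge N (z t) j) & norm (edge N (z t) j) <= M1"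
  using nodal_edges_bounded[of N T z, OF cz z(2)] by auto
 obtain M2 where M2: "0 < M2" "\<forall>t\<in>{0..T}. \<forall>j\<in>idx N. 1 / M2 <= norm (edge N (w t) j) & norm (edge N (w t) j) <= M2"
  using nodal_edges_bounded[of N T w, OF cw w(2)] by auto
 define q where "q = max M1 M2"
 have q: "0 < q" "M1 <= q" "M2 <= q" using M1 by (auto simp: q_def)
 have q': "1 / q <= 1 / M1" "1 / q <= 1 / M2" using q M1 M2 by (auto intro: divide_left_mono)
 define p where "p = 1 / q"
 have p: "0 < p" using q by (simp add: p_def)
 have b: "p <= norm (edge N (z t) j) & norm (edge N (z t) j) <= q" "p <= norm (edge N (w t) j) & norm (edge N (w t) j) <= q"
  if "t \<in> {0..T}" "j \<in> idx N" for t j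
 proof -
  have "1 / M1 <= norm (edge N (z t) j) & norm (edge N (z t) j) <= M1" using M1(2) that by blast
  then show "p <= norm (edge N (z t) j) & norm (edge N (z t) j) <= q" using q q' unfolding p_def by linarith
  have "1 / M2 <= norm (edge N (w t) j) & norm (edge N (w t) j) <= M2" using M2(2) that by blast
  then show "p <= norm (edge N (w t) j) & norm (edge N (w t) j) <= q" using q q' unfolding p_def by linarith
 qed
 have pm: "0 < pmass N u j" if "edge N u j ~= 0" for u :: "nat => 'a" and j
  using that by (simp add: pmass_def add_pos_nonneg)
 have field: "u' = cfield p q N lam hh u j"
  if "!!j. j \<in> idx N ==> p <= norm (edge N u j) & norm (edge N u j) <= q" "j \<in> idx N"
   "pmass N u j *\<^sub>R u' = pflux N lam hh u j - pflux N lam hh u (nxt N j)" for u :: "nat => 'a" and u' j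
 proof -
  have e: "edge N u j ~= 0" using that(1)[OF that(2)] p by auto
  have c: "cfield p q N lam hh u j = (pflux N lam hh u j - pflux N lam hh u (nxt N j)) /\<^sub>R pmass N u j"
   by (rule cutoff_inactive(3)[OF _ p that(2)]) (rule that(1))
  show ?thesis unfolding c that(3)[symmetric] using pm[OF e] by simp
 qed
 obtain L where L: "0 <= L" "\<forall>a b :: nat => 'a. \<forall>j\<in>idx N. norm (cfield p q N lam hh a j - cfield p q N lam hh b j) <= L * (\<Sum>i\<in>idx N. norm (a i - b i))"
  using cfield_lipschitz[OF p less_imp_le[OF q(1)], where N = N and lam = lam and hh = hh and 'a = 'a] by (elim exE conjE) (rule that)
 show ?thesis
 proof (rule discrete_ode_unique[where G = "cfield p q N lam hh" and L = L and x = z and z = w and N = N and T = T])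
  show "norm (cfield p q N lam hh a j - cfield p q N lam hh b j) <= L * (\<Sum>i\<in>idx N. norm (a i - b i))"
   if "j \<in> idx N" for a b :: "nat => 'a" and j using L(2) that by blast
  fix t j assume t: "t \<in> {0..T}" and j: "j \<in> idx N"
  show "((%s. z s j) has_vector_derivative cfield p q N lam hh (z t) j) (at t within {0..T})"
  proof -
   have "z' t j = cfield p q N lam hh (z t) j" by (rule field[OF _ j z(3)[OF t j]]) (rule b(1)[OF t])
   then show ?thesis using z(1)[OF t j] by simp
  qed
  show "((%s. w s j) has_vector_derivative cfield p q N lam hh (w t) j) (at t within {0..T})"
  proof -
   have "w' t j = cfield p q N lam hh (w t) j" by (rule field[OF _ j w(3)[OF t j]]) (rule b(2)[OF t])
   then show ?thesis using w(1)[OF t j] by simp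
  qed
 qed (use L(1) init t j in auto)
qed

lemma semidiscrete_unique:
 fixes xh yh xk yk :: "real => real => real ^ 'n"
 assumes T: "0 < T" and p: "partition_2pi N U"
  and h: "semidiscrete_solution T lam x0 N U xh yh" and k: "semidiscrete_solution T lam x0 N U xk yk"
  and t: "t \<in> {0..T}" and v: "v \<in> {0..2 * pi}"
 shows "xh t v = xk t v & yh t v = yk t v"
proof -
 note H = semidiscrete_nodal[OF T p h] and K = semidiscrete_nodal[OF T p k]
 have zero: "0 \<in> {0..T}" using T by simp
 have init: "xh 0 (U j) = xk 0 (U j)" if "j \<in> idx N" for j
  using H(7)[OF zero that] K(7)[OF zero that] by simp
 have e: "xh t (U j) = xk t (U j)" if "j \<in> idx N" for j
 proof (rule nodal_scheme_unique[where z = "%t j. xh t (U j)" and w = "%t j. xk t (U j)" and N = N and T = T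
     and lam = lam and hh = "mesh_width N U" and z' = "%t j. pdt T xh t (U j)" and w' = "%t j. pdt T xk t (U j)"])
  fix t i assume t: "t \<in> {0..T}" and i: "i \<in> idx N"
  show "((%s. xh s (U i)) has_vector_derivative pdt T xh t (U i)) (at t within {0..T})" by (rule H(4)[OF t i])
  show "((%s. xk s (U i)) has_vector_derivative pdt T xk t (U i)) (at t within {0..T})" by (rule K(4)[OF t i])
  show "edge N (%j. xh t (U j)) i ~= 0" by (rule H(3)[OF t i])
  show "edge N (%j. xk t (U j)) i ~= 0" by (rule K(3)[OF t i])
  show "pmass N (%j. xh t (U j)) i *\<^sub>R pdt T xh t (U i) = pflux N lam (mesh_width N U) (%j. xh t (U j)) i
    - pflux N lam (mesh_width N U) (%j. xh t (U j)) (nxt N i)" by (rule H(6)[OF t i])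
  show "pmass N (%j. xk t (U j)) i *\<^sub>R pdt T xk t (U i) = pflux N lam (mesh_width N U) (%j. xk t (U j)) i
    - pflux N lam (mesh_width N U) (%j. xk t (U j)) (nxt N i)" by (rule K(6)[OF t i])
 next
  show "xh 0 (U i) = xk 0 (U i)" if "i \<in> idx N" for i by (rule init[OF that])
 qed (rule t, rule that)
 have ee: "edge N (%j. xh t (U j)) j = edge N (%j. xk t (U j)) j" if "j \<in> idx N" for j
  using that e by (simp add: edge_def)
 have y: "yh t (U j) = yk t (U j)" if "j \<in> idx N" for j
  unfolding H(5)[OF t that] K(5)[OF t that] pcurv_def ptang_def pmass_def using ee that by simp
 obtain j where j: "j \<in> idx N" "v \<in> {U (j - 1)..U j}" using mesh_cover[OF p v] by blast
 have "pl N U a v = pl N U b v" if "!!j. j \<in> idx N ==> a j = b j" for a b :: "nat => real ^ 'n"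
  unfolding pl_on[OF p j] using that j(1) by (simp add: edge_def)
 from this[OF e] this[OF y] show ?thesis
  using bspec[OF H(1)[OF t] v] bspec[OF H(2)[OF t] v] bspec[OF K(1)[OF t] v] bspec[OF K(2)[OF t] v] by simp
qed

section \<open>Error bounds in the norms of the theorem\<close>

lemma L2_sq_le_mesh:
 assumes p: "partition_2pi N U"
  and b: "!!j v. j \<in> idx N ==> v \<in> {U (j - 1)<..<U j} ==> (norm (g v))^2 <= b j" and b0: "!!j. j \<in> idx N ==> 0 <= b j"
 shows "L2_sq g <= ennreal (\<Sum>j\<in>idx N. mesh_width N U j * b j)"
proof -
 \<comment> \<open>The pointwise bound is available only between the nodes, which form a null
   set.\<close>
 have "finite (U ` {0..N})" by simp
 then have "AE v in lborel. v \<notin> U ` {0..N}" by (intro AE_not_in finite_imp_null_set_lborel)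
 then have "AE v in lborel. ennreal ((norm (g v))^2) * indicator {0..2 * pi} v
   <= (\<Sum>j\<in>idx N. ennreal (b j) * indicator {U (j - 1)..U j} v)"
 proof eventually_elim
  case (elim v)
  show ?case
  proof (cases "v \<in> {0..2 * pi}")
   case True
   then obtain j where j: "j \<in> idx N" "v \<in> {U (j - 1)..U j}" using mesh_cover[OF p] by blast
   have "U j \<in> U ` {0..N}" "U (j - 1) \<in> U ` {0..N}" using j(1) by (auto simp: idx_def)
   then have "v ~= U j" "v ~= U (j - 1)" using elim by auto
   then have "v \<in> {U (j - 1)<..<U j}" using j(2) by auto
   from b[OF j(1) this] have "ennreal ((norm (g v))^2) * indicator {0..2 * pi} v <= ennreal (b j) * indicator {U (j - 1)..U j} v"
    using True j(2) by (simp add: ennreal_leI)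
   also have "... <= (\<Sum>j\<in>idx N. ennreal (b j) * indicator {U (j - 1)..U j} v)"
    using j(1) by (intro member_le_sum[of j]) auto
   finally show ?thesis .
  qed simp
 qed
 then have "L2_sq g <= (\<integral>\<^sup>+ v. (\<Sum>j\<in>idx N. ennreal (b j) * indicator {U (j - 1)..U j} v) \<partial>lborel)"
  unfolding L2_sq_def by (rule nn_integral_mono_AE)
 also have "... = (\<Sum>j\<in>idx N. ennreal (b j) * emeasure lborel {U (j - 1)..U j})"
 proof -
  have "(\<integral>\<^sup>+ v. (\<Sum>j\<in>idx N. ennreal (b j) * indicator {U (j - 1)..U j} v) \<partial>lborel)
   = (\<Sum>j\<in>idx N. \<integral>\<^sup>+ v. ennreal (b j) * indicator {U (j - 1)..U j} v \<partial>lborel)" by (rule nn_integral_sum) simp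
  also have "... = (\<Sum>j\<in>idx N. ennreal (b j) * emeasure lborel {U (j - 1)..U j})"
   by (rule sum.cong[OF refl], rule nn_integral_cmult_indicator) simp
  finally show ?thesis .
 qed
 also have "... = (\<Sum>j\<in>idx N. ennreal (mesh_width N U j * b j))"
 proof (rule sum.cong[OF refl])
  fix j assume j: "j \<in> idx N"
  have h: "U (j - 1) <= U j" "0 <= mesh_width N U j" using mesh_width_pos[OF p j] mesh_width_eq[OF j, of U] by auto
  show "ennreal (b j) * emeasure lborel {U (j - 1)..U j} = ennreal (mesh_width N U j * b j)"
  proof -
   have "emeasure lborel {U (j - 1)..U j} = ennreal (mesh_width N U j)" using h(1) by (simp add: mesh_width_eq[OF j])
   then show ?thesis using h(2) b0[OF j] by (simp add: ennreal_mult'' mult.commute)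
  qed
 qed
 also have "... = ennreal (\<Sum>j\<in>idx N. mesh_width N U j * b j)"
  using b0 mesh_width_pos[OF p] by (intro sum_ennreal) (auto intro: mult_nonneg_nonneg less_imp_le)
 finally show ?thesis .
qed

lemma square_sum3_le: "(a + b + c)^2 <= 3 * a^2 + 3 * b^2 + 3 * c^2" for a b c :: real
proof -
 have "0 <= (a - b)^2 + (b - c)^2 + (a - c)^2" by simp
 then show ?thesis by (simp add: power2_eq_square algebra_simps)
qed

lemma square_sum2_le: "(a + b)^2 <= 2 * a^2 + 2 * b^2" for a b :: real
proof -
 have "0 <= (a - b)^2" by simp
 then show ?thesis by (simp add: power2_eq_square algebra_simps)
qed

lemma L2_sq_values:
 fixes F :: "real => real ^ 'n"
 assumes p: "partition_2pi N U" and w: "!!j. j \<in> idx N ==> mesh_width N U j <= h" and A: "0 <= A" and h: "0 <= h"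
  and F: "!!j v. j \<in> idx N ==> v \<in> {U (j - 1)<..<U j} ==> norm (F v - a j) <= A * h"
  and e: "!!j. j \<in> idx N ==> norm (edge N a j) <= A * h"
  and G: "!!v. v \<in> {0..2 * pi} ==> G v = pl N U z v"
 shows "L2_sq (%v. F v - G v) <= ennreal (24 * pi * A^2 * h^2 + 15 * (\<Sum>j\<in>idx N. h * (norm (z j - a j))^2))"
proof -
 define d where "d j = norm (z j - a j)" for j
 \<comment> \<open>Three times the squares of 2 A h, 2 d_j and d_(j-1). The error at
   \<open>j\<close> counts twice because it enters directly and again through the edge of
   \<open>z\<close>. Summation gives 12 * 2 pi = 24 pi and 12 + 3 = 15.\<close>
 define b where "b j = 12 * A^2 * h^2 + 12 * (d j)^2 + 3 * (d (prv N j))^2" for j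
 have "L2_sq (%v. F v - G v) <= ennreal (\<Sum>j\<in>idx N. mesh_width N U j * b j)"
 proof (rule L2_sq_le_mesh[OF p])
  fix j v assume j: "j \<in> idx N" and v: "v \<in> {U (j - 1)<..<U j}"
  define s where "s = (v - U (j - 1)) / mesh_width N U j"
  have s: "0 <= s" "s <= 1" unfolding s_def mesh_width_eq[OF j] using v by (auto simp: field_simps)
  have vI: "v \<in> {U (j - 1)..U j}" using v by auto
  have v2: "v \<in> {0..2 * pi}" unfolding mesh_union[OF p] using j vI by blast
  have "z j - G v = (1 - s) *\<^sub>R edge N z j"
   unfolding G[OF v2] pl_on[OF p j vI] s_def[symmetric] by (simp add: edge_def algebra_simps)
  then have "norm (z j - G v) <= 1 * norm (edge N z j)"
   using s by (simp only: norm_scaleR) (intro mult_right_mono, auto)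
  moreover have "edge N z j = edge N a j + (z j - a j) - (z (prv N j) - a (prv N j))" by (simp add: edge_def)
  then have "norm (edge N z j) <= norm (edge N a j) + d j + d (prv N j)" unfolding d_def
   by (simp only:) (rule order_trans[OF norm_triangle_ineq4 add_right_mono[OF norm_triangle_ineq]])
  moreover have "F v - G v = (F v - a j) - (z j - a j) + (z j - G v)" by simp
  then have "norm (F v - G v) <= norm (F v - a j) + d j + norm (z j - G v)" unfolding d_def
   by (simp only:) (rule order_trans[OF norm_triangle_ineq add_right_mono[OF norm_triangle_ineq4]])
  ultimately have "norm (F v - G v) <= 2 * (A * h) + 2 * d j + d (prv N j)"
   using F[OF j v] e[OF j] by linarith
  then have "(norm (F v - G v))^2 <= (2 * (A * h) + 2 * d j + d (prv N j))^2" by (intro power_mono) auto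
  also have "... <= 3 * (2 * (A * h))^2 + 3 * (2 * d j)^2 + 3 * (d (prv N j))^2" by (rule square_sum3_le)
  also have "... = b j" by (simp add: b_def power_mult_distrib)
  finally show "(norm (F v - G v))^2 <= b j" .
 qed (simp add: b_def)
 also have "(\<Sum>j\<in>idx N. mesh_width N U j * b j) <= 24 * pi * A^2 * h^2 + 15 * (\<Sum>j\<in>idx N. h * (d j)^2)"
 proof -
  have "(\<Sum>j\<in>idx N. mesh_width N U j * b j)
    <= (\<Sum>j\<in>idx N. mesh_width N U j * (12 * A^2 * h^2) + (12 * (h * (d j)^2) + 3 * (h * (d (prv N j))^2)))"
  proof (rule sum_mono)
   fix j assume j: "j \<in> idx N"
   have "mesh_width N U j * (12 * (d j)^2 + 3 * (d (prv N j))^2) <= h * (12 * (d j)^2 + 3 * (d (prv N j))^2)"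
    by (rule mult_right_mono[OF w[OF j]]) simp
   then show "mesh_width N U j * b j <= mesh_width N U j * (12 * A^2 * h^2) + (12 * (h * (d j)^2) + 3 * (h * (d (prv N j))^2))"
    unfolding b_def by (simp add: algebra_simps)
  qed
  also have "... = 2 * pi * (12 * A^2 * h^2) + 12 * (\<Sum>j\<in>idx N. h * (d j)^2) + 3 * (\<Sum>j\<in>idx N. h * (d (prv N j))^2)"
   by (simp only: sum.distrib sum_distrib_right[symmetric] sum_distrib_left[symmetric] sum_mesh_width[OF p] add.assoc)
  also have "(\<Sum>j\<in>idx N. h * (d (prv N j))^2) = (\<Sum>j\<in>idx N. h * (d j)^2)" by (rule sum_prv)
  finally show ?thesis by simp
 qed
 finally show ?thesis by (simp add: d_def ennreal_leI)
qed

lemma L2_sq_slopes: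
 fixes F G :: "real => real ^ 'n"
 assumes p: "partition_2pi N U" and w: "!!j. j \<in> idx N ==> mesh_width N U j <= h" and A: "0 <= A" and h: "0 < h"
  and w2: "!!j. j \<in> idx N ==> h <= A * mesh_width N U j"
  and F: "!!j v. j \<in> idx N ==> v \<in> {U (j - 1)<..<U j} ==> norm (F v - edge N a j /\<^sub>R mesh_width N U j) <= A * h"
  and G: "!!j v. j \<in> idx N ==> v \<in> {U (j - 1)<..<U j} ==> H v = F v - edge N z j /\<^sub>R mesh_width N U j"
 shows "L2_sq H <= ennreal (4 * pi * A^2 * h^2 + 2 * A^2 * (\<Sum>j\<in>idx N. h * (norm (edge N (%i. z i - a i) j) / h)^2))"
proof -
 define d where "d j = norm (edge N (%i. z i - a i) j) / h" for j
 define b where "b j = 2 * A^2 * h^2 + 2 * A^2 * (d j)^2" for j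
 have "L2_sq H <= ennreal (\<Sum>j\<in>idx N. mesh_width N U j * b j)"
 proof (rule L2_sq_le_mesh[OF p])
  fix j v assume j: "j \<in> idx N" and v: "v \<in> {U (j - 1)<..<U j}"
  have hj: "0 < mesh_width N U j" by (rule mesh_width_pos[OF p j])
  have "inverse (mesh_width N U j) <= A / h" using w2[OF j] hj h by (simp add: field_simps)
  then have "inverse (mesh_width N U j) * norm (edge N (%i. z i - a i) j) <= A / h * norm (edge N (%i. z i - a i) j)"
   by (rule mult_right_mono) simp
  then have "norm (edge N (%i. z i - a i) j /\<^sub>R mesh_width N U j) <= A * d j"
   using hj by (simp add: d_def)
  moreover have "H v = (F v - edge N a j /\<^sub>R mesh_width N U j) - edge N (%i. z i - a i) j /\<^sub>R mesh_width N U j"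
   unfolding G[OF j v] edge_diff by (simp add: scaleR_diff_right)
  then have "norm (H v) <= norm (F v - edge N a j /\<^sub>R mesh_width N U j) + norm (edge N (%i. z i - a i) j /\<^sub>R mesh_width N U j)"
   by (simp only:) (rule norm_triangle_ineq4)
  ultimately have "norm (H v) <= A * h + A * d j" using F[OF j v] by linarith
  then have "(norm (H v))^2 <= (A * h + A * d j)^2" by (intro power_mono) auto
  also have "... <= 2 * (A * h)^2 + 2 * (A * d j)^2" by (rule square_sum2_le)
  also have "... = b j" by (simp add: b_def power_mult_distrib)
  finally show "(norm (H v))^2 <= b j" .
 qed (simp add: b_def)
 also have "(\<Sum>j\<in>idx N. mesh_width N U j * b j) <= 4 * pi * A^2 * h^2 + 2 * A^2 * (\<Sum>j\<in>idx N. h * (d j)^2)"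
 proof -
  have "(\<Sum>j\<in>idx N. mesh_width N U j * b j) <= (\<Sum>j\<in>idx N. mesh_width N U j * (2 * A^2 * h^2) + 2 * A^2 * (h * (d j)^2))"
  proof (rule sum_mono)
   fix j assume j: "j \<in> idx N"
   have "mesh_width N U j * (2 * A^2 * (d j)^2) <= h * (2 * A^2 * (d j)^2)"
    by (rule mult_right_mono[OF w[OF j]]) simp
   then show "mesh_width N U j * b j <= mesh_width N U j * (2 * A^2 * h^2) + 2 * A^2 * (h * (d j)^2)"
    unfolding b_def by (simp add: algebra_simps)
  qed
  also have "... = 2 * pi * (2 * A^2 * h^2) + 2 * A^2 * (\<Sum>j\<in>idx N. h * (d j)^2)"
   by (simp only: sum.distrib sum_distrib_right[symmetric] sum_distrib_left[symmetric] sum_mesh_width[OF p])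
  finally show ?thesis by simp
 qed
 finally show ?thesis by (simp add: d_def ennreal_leI)
qed

text \<open>The error norms are replaced by a continuous majorant in time, so that measurability has
  to be shown for the majorant only.\<close>

lemma nn_integral_le_integral:
 fixes f :: "real => real"
 assumes f: "continuous_on {0..T} f" "!!t. t \<in> {0..T} ==> 0 <= f t" and g: "!!t. t \<in> {0..T} ==> g t <= ennreal (f t)"
 shows "(\<integral>\<^sup>+ t \<in> {0..T}. g t \<partial>lborel) <= ennreal (integral {0..T} f)"
proof -
 define k where "k t = indicator {0..T} t *\<^sub>R f t" for t
 have "(\<integral>\<^sup>+ t \<in> {0..T}. g t \<partial>lborel) <= (\<integral>\<^sup>+ t. ennreal (k t) \<partial>lborel)"
  by (rule nn_integral_mono) (use g in \<open>auto simp: k_def indicator_def\<close>)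
 also have "... = ennreal (integral {0..T} f)"
 proof (rule nn_integral_has_integral_lborel)
  show "k \<in> borel_measurable borel" unfolding k_def[abs_def]
   by (rule borel_measurable_continuous_on_indicator) (use f in auto)
  have "(f has_integral integral {0..T} f) {0..T}" by (intro integrable_integral integrable_continuous_real f)
  then have "((%t. if t \<in> {0..T} then f t else 0) has_integral integral {0..T} f) UNIV" by (simp only: has_integral_restrict_UNIV)
  moreover have "k = (%t. if t \<in> {0..T} then f t else 0)" by (auto simp: k_def indicator_def)
  ultimately show "(k has_integral integral {0..T} f) UNIV" by simp
  show "0 <= k t" for t using f(2) by (simp add: k_def indicator_def)
 qed
 finally show ?thesis .
qed

lemma integral_affine:
 fixes D :: "real => real"
 assumes "continuous_on {0..T} D" "0 <= T"
 shows "integral {0..T} (%t. a + b * D t) = a * T + b * integral {0..T} D"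
proof -
 have D: "D integrable_on {0..T}" by (rule integrable_continuous_real[OF assms(1)])
 have "((%t. a + b * D t) has_integral (T - 0) *\<^sub>R a + b * integral {0..T} D) {0..T}"
  using has_integral_const_real[of a 0 T] assms(2)
  by (intro has_integral_add has_integral_mult_right integrable_integral D) simp
 then show ?thesis by (simp add: integral_unique mult.commute)
qed

section \<open>From nodal bounds to the error estimates\<close>

definition convergent_scheme ::
 "real => real => real => (real => real ^ 'n) => (real => real => real ^ 'n) => nat => (nat => real) => bool" where
 "convergent_scheme K T lam x0 x N U \<longleftrightarrow> (\<exists>xh yh.
      semidiscrete_solution T lam x0 N U xh yh &
      (\<forall>xh' yh'. semidiscrete_solution T lam x0 N U xh' yh' -->
        (\<forall>t\<in>{0..T}. \<forall>v\<in>{0..2 * pi}. xh' t v = xh t v & yh' t v = yh t v)) &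
      (SUP t\<in>{0..T}. H1_sq (%v. x t v - xh t v))
       + (\<integral>\<^sup>+ t \<in> {0..T}. L2_sq (%v. pdt T x t v - pdt T xh t v) \<partial>lborel)
       <= ennreal (K * (mesh_size N U)^2) &
      (SUP t\<in>{0..T}. L2_sq (%v. curvature_vec (x t) v - yh t v))
       + (\<integral>\<^sup>+ t \<in> {0..T}. L2_sq (%v. du (curvature_vec (x t)) v - du (yh t) v) \<partial>lborel)
       <= ennreal (K * (mesh_size N U)^2))"

lemma add_le_ennreal:
 fixes a b :: ennreal
 assumes "a <= ennreal c" "b <= ennreal d" "0 <= c" "0 <= d" "c + d <= e"
 shows "a + b <= ennreal e"
proof -
 have "a + b <= ennreal c + ennreal d" by (rule add_mono[OF assms(1,2)])
 also have "... = ennreal (c + d)" using assms(3,4) by simp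
 also have "... <= ennreal e" by (rule ennreal_leI[OF assms(5)])
 finally show ?thesis .
qed

text \<open>The left sides of \<open>K1\<close> and \<open>K2\<close> collect the constants of
  \<open>L2_sq_values\<close> (24 pi and 15) and \<open>L2_sq_slopes\<close> (4 pi and 2 A^2). Thus
  28 pi stands for values and slopes of the position together. In \<open>K2\<close> the factor A / 2
  is 2 A^2 times the share 1 / (4 A) that \<open>dissipation\<close> assigns to the velocity
  error.\<close>

lemma regular_instance_converges:
 fixes x :: "real => real => real ^ 'n"
 assumes T: "0 < T" and reg: "regular_instance T lam c0 chat cbar B x N U" and A: "1 <= A"
  and cons: "consistent N A (mesh_size N U) lam T (mesh_width N U) (%t j. x t (U j)) (%t j. pdt T x t (U j)) r0 r0' r"
  and interpolation: "\<forall>t\<in>{0..T}. \<forall>j\<in>idx N. \<forall>w\<in>{U (j - 1)..U j}.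
    norm (x t w - x t (U j)) <= A * mesh_size N U
   & norm (du (x t) w - edge N (%j. x t (U j)) j /\<^sub>R mesh_width N U j) <= A * mesh_size N U
   & norm (pdt T x t w - pdt T x t (U j)) <= A * mesh_size N U
   & norm (curvature_vec (x t) w - pcurv N (%j. x t (U j)) j) <= A * mesh_size N U
   & norm (du (curvature_vec (x t)) w - edge N (pcurv N (%j. x t (U j))) j /\<^sub>R mesh_width N U j) <= A * mesh_size N U"
  and small: "energy_const A lam T * A^2 * mesh_size N U < 1"
  and K1: "28 * pi * A^2 + (15 + 2 * A^2) * energy_const A lam T + 24 * pi * A^2 * T + 15 * rate_const A lam T <= K"
  and K2: "24 * pi * A^2 + 15 * energy_const A lam T + 4 * pi * A^2 * T + A / 2 * rate_const A lam T
    + 2 * A^2 * (diss_const A lam * (energy_const A lam T + 1)) * T <= K"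
 shows "convergent_scheme K T lam (x 0) x N U"
proof -
 define h where "h = mesh_size N U"
 interpret C: consistent N A h lam T "mesh_width N U" "%t j. x t (U j)" "%t j. pdt T x t (U j)" r0 r0' r
  using cons by (simp add: h_def)
 define Ke Kr Kd where "Ke = energy_const A lam T" and "Kr = rate_const A lam T" and "Kd = diss_const A lam * (energy_const A lam T + 1)"
 have p: "partition_2pi N U" using reg by (simp add: regular_instance_def admissible_mesh_def)
 have flow: "elastic_flow_solution T lam (x 0) x" using reg by (simp add: regular_instance_def)
 have sm: "smooth_on_strip T x" using flow by (simp add: elastic_flow_solution_def)
 have "periodic_2pi (x 0)" using flow T by (simp add: elastic_flow_solution_def)
 then have x0: "x 0 0 = x 0 (2 * pi)" by (metis periodic_2pi_def add_0)
 have h: "0 < h" "0 <= h" using C.h by auto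
 have A0: "0 <= A" using A by simp
 have w: "mesh_width N U j <= h" "h <= A * mesh_width N U j" if "j \<in> idx N" for j using C.hh[OF that] by auto
 obtain z z' where zz: "\<forall>t\<in>{0..T}. \<forall>j\<in>idx N. ((%s. z s j) has_vector_derivative z' t j) (at t within {0..T})"
   "\<forall>t\<in>{0..T}. C.good (z t)"
   "\<forall>t\<in>{0..T}. \<forall>j\<in>idx N. pmass N (z t) j *\<^sub>R z' t j = pflux N lam (mesh_width N U) (z t) j - pflux N lam (mesh_width N U) (z t) (nxt N j)"
   "\<forall>j\<in>idx N. continuous_on {0..T} (%t. z' t j)" "\<forall>j\<in>idx N. z 0 j = x 0 (U j)"
  using C.existence[OF small[folded h_def]] by (elim exE conjE) (rule that)
 have z': "((%s. z s j) has_vector_derivative z' t j) (at t within {0..T})"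
  and scheme: "pmass N (z t) j *\<^sub>R z' t j = pflux N lam (mesh_width N U) (z t) j - pflux N lam (mesh_width N U) (z t) (nxt N j)"
  and nz: "edge N (z t) j ~= 0" if "t \<in> {0..T}" "j \<in> idx N" for t j
  using zz that C.good_nz by auto
 have good: "C.good (z t)" if "t \<in> {0..T}" for t using zz(2) that by auto
 have cont: "continuous_on {0..T} (%t. z' t j)" and init: "z 0 j = x 0 (U j)" if "j \<in> idx N" for j using zz that by auto
 define xh yh where "xh t = pl N U (z t)" and "yh t = pl N U (pcurv N (z t))" for t
 have sol: "semidiscrete_solution T lam (x 0) N U xh yh"
  and pdt: "!!t v. t \<in> {0..T} ==> v \<in> {0..2 * pi} ==> pdt T xh t v = pl N U (z' t) v"
  unfolding xh_def[abs_def] yh_def[abs_def]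
  by (rule semidiscrete_of_nodal[OF T p z' nz scheme init x0]; assumption)+
 have E: "C.E (z t) t <= Ke * h^2" if t: "t \<in> {0..T}" for t
  unfolding Ke_def by (rule C.energy_bound[of T z z' t]) (use T t good scheme z' init in auto)
 have rate: "(%t. C.D (z' t) t) integrable_on {0..T}"
   "integral {0..T} (%t. C.D (z' t) t) <= rate_const A lam T * h^2"
   "continuous_on {0..T} (%t. C.D (z' t) t)"
  by (rule C.rate_bounds[of z z'], use good scheme z' cont init in auto)+
 have rate4: "C.Z (z t) t <= 1 / (4 * A) * C.D (z' t) t + diss_const A lam * (energy_const A lam T + 1) * h^2" if "t \<in> {0..T}" for t
  by (rule C.rate_bounds(4)[of z z']) (use good scheme z' cont init that in auto)
 have Ip: "norm (x t v - x t (U j)) <= A * h"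
   "norm (du (x t) v - edge N (%j. x t (U j)) j /\<^sub>R mesh_width N U j) <= A * h"
   "norm (pdt T x t v - pdt T x t (U j)) <= A * h"
   "norm (curvature_vec (x t) v - pcurv N (%j. x t (U j)) j) <= A * h"
   "norm (du (curvature_vec (x t)) v - edge N (pcurv N (%j. x t (U j))) j /\<^sub>R mesh_width N U j) <= A * h"
  if "t \<in> {0..T}" "j \<in> idx N" "v \<in> {U (j - 1)<..<U j}" for t j v
 proof -
  have "v \<in> {U (j - 1)..U j}" using that(3) by auto
  from interpolation[rule_format, OF that(1,2) this]
  show "norm (x t v - x t (U j)) <= A * h"
   "norm (du (x t) v - edge N (%j. x t (U j)) j /\<^sub>R mesh_width N U j) <= A * h"
   "norm (pdt T x t v - pdt T x t (U j)) <= A * h"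
   "norm (curvature_vec (x t) v - pcurv N (%j. x t (U j)) j) <= A * h"
   "norm (du (curvature_vec (x t)) v - edge N (pcurv N (%j. x t (U j))) j /\<^sub>R mesh_width N U j) <= A * h"
   unfolding h_def by auto
 qed
 define S1 S2 S3 where "S1 t = (\<Sum>j\<in>idx N. h * (norm (pcurv N (z t) j - pcurv N (%j. x t (U j)) j))^2)"
  and "S2 t = (\<Sum>j\<in>idx N. h * (norm (edge N (%i. z t i - x t (U i)) j) / h)^2)"
  and "S3 t = (\<Sum>j\<in>idx N. h * (norm (z t j - x t (U j)))^2)" for t
 have S0: "0 <= S1 t" "0 <= S2 t" "0 <= S3 t" "0 <= C.D (z' t) t" "0 <= C.Z (z t) t" for t
  unfolding S1_def S2_def S3_def C.D_def C.Z_def using h by (auto intro!: sum_nonneg)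
 have S: "S1 t <= Ke * h^2" "S2 t <= Ke * h^2" "S3 t <= Ke * h^2" if t: "t \<in> {0..T}" for t
 proof -
  have "S1 t + S2 t + S3 t <= Ke * h^2" using E[OF t] unfolding C.E_def S1_def S2_def S3_def .
  then show "S1 t <= Ke * h^2" "S2 t <= Ke * h^2" "S3 t <= Ke * h^2" using S0[of t] by linarith+
 qed
 define q where "q = pi * A^2 * h^2"
 have q: "0 <= q" by (simp add: q_def)
 have v1: "L2_sq (%v. x t v - xh t v) <= ennreal (24 * q + 15 * (Ke * h^2))" if t: "t \<in> {0..T}" for t
 proof -
  have "L2_sq (%v. x t v - xh t v) <= ennreal (24 * pi * A^2 * h^2 + 15 * S3 t)"
   unfolding S3_def by (rule L2_sq_values[OF p w(1) A0 h(2)]) (use Ip(1)[OF t] C.L(2)[OF t] h in \<open>force simp: xh_def\<close>)+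
  also have "... <= ennreal (24 * q + 15 * (Ke * h^2))" by (rule ennreal_leI) (use S[OF t] in \<open>simp add: q_def\<close>)
  finally show ?thesis .
 qed
 have v2: "L2_sq (du (%v. x t v - xh t v)) <= ennreal (4 * q + 2 * A^2 * (Ke * h^2))" if t: "t \<in> {0..T}" for t
 proof -
  have "L2_sq (du (%v. x t v - xh t v)) <= ennreal (4 * pi * A^2 * h^2 + 2 * A^2 * S2 t)"
   unfolding S2_def
  proof (rule L2_sq_slopes[OF p w(1) A0 h(1) w(2)])
   fix j v assume j: "j \<in> idx N" and v: "v \<in> {U (j - 1)<..<U j}"
   show "norm (du (x t) v - edge N (%i. x t (U i)) j /\<^sub>R mesh_width N U j) <= A * h" by (rule Ip(2)[OF t j v])
   have "((%v. x t v - xh t v) has_vector_derivative du (x t) v - edge N (z t) j /\<^sub>R mesh_width N U j) (at v)"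
    using has_vector_derivative_diff[OF smooth_du[OF sm t] pl_deriv[OF p j v]] by (simp add: xh_def pdu_def)
   then show "du (%v. x t v - xh t v) v = du (x t) v - edge N (z t) j /\<^sub>R mesh_width N U j"
    by (simp add: du_def vector_derivative_at)
  qed
  also have "... <= ennreal (4 * q + 2 * A^2 * (Ke * h^2))"
  proof (rule ennreal_leI)
   have "2 * A^2 * S2 t <= 2 * A^2 * (Ke * h^2)" by (rule mult_left_mono[OF S(2)[OF t]]) simp
   then show "4 * pi * A^2 * h^2 + 2 * A^2 * S2 t <= 4 * q + 2 * A^2 * (Ke * h^2)" by (simp add: q_def)
  qed
  finally show ?thesis .
 qed
 have v3: "L2_sq (%v. pdt T x t v - pdt T xh t v) <= ennreal (24 * q + 15 * C.D (z' t) t)" if t: "t \<in> {0..T}" for t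
 proof -
  have "L2_sq (%v. pdt T x t v - pdt T xh t v) <= ennreal (24 * pi * A^2 * h^2 + 15 * C.D (z' t) t)"
   unfolding C.D_def
   by (rule L2_sq_values[OF p w(1) A0 h(2)]) (use Ip(3)[OF t] C.dX'[OF t] pdt[OF t] in auto)
  then show ?thesis by (simp add: q_def mult.assoc)
 qed
 have v4: "L2_sq (%v. curvature_vec (x t) v - yh t v) <= ennreal (24 * q + 15 * (Ke * h^2))" if t: "t \<in> {0..T}" for t
 proof -
  have "L2_sq (%v. curvature_vec (x t) v - yh t v) <= ennreal (24 * pi * A^2 * h^2 + 15 * S1 t)"
   unfolding S1_def by (rule L2_sq_values[OF p w(1) A0 h(2)]) (use Ip(4)[OF t] C.dY[OF t] in \<open>auto simp: yh_def\<close>)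
  also have "... <= ennreal (24 * q + 15 * (Ke * h^2))" by (rule ennreal_leI) (use S[OF t] in \<open>simp add: q_def\<close>)
  finally show ?thesis .
 qed
 define g where "g = 4 * q + 2 * A^2 * (Kd * h^2)"
 have v5: "L2_sq (%v. du (curvature_vec (x t)) v - du (yh t) v) <= ennreal (g + A / 2 * C.D (z' t) t)" if t: "t \<in> {0..T}" for t
 proof -
  have "L2_sq (%v. du (curvature_vec (x t)) v - du (yh t) v) <= ennreal (4 * pi * A^2 * h^2 + 2 * A^2 * C.Z (z t) t)"
   unfolding C.Z_def
  proof (rule L2_sq_slopes[OF p w(1) A0 h(1) w(2)])
   fix j v assume j: "j \<in> idx N" and v: "v \<in> {U (j - 1)<..<U j}"
   show "norm (du (curvature_vec (x t)) v - edge N (pcurv N (%j. x t (U j))) j /\<^sub>R mesh_width N U j) <= A * h" by (rule Ip(5)[OF t j v])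
   have "du (yh t) v = edge N (pcurv N (z t)) j /\<^sub>R mesh_width N U j"
    by (rule fe_deriv[OF p _ j v]) (simp add: yh_def)
   then show "du (curvature_vec (x t)) v - du (yh t) v = du (curvature_vec (x t)) v - edge N (pcurv N (z t)) j /\<^sub>R mesh_width N U j" by simp
  qed
  also have "... <= ennreal (g + A / 2 * C.D (z' t) t)"
  proof (rule ennreal_leI)
   have "2 * A^2 * C.Z (z t) t <= 2 * A^2 * (1 / (4 * A) * C.D (z' t) t + Kd * h^2)"
    using rate4[OF t] unfolding Kd_def by (intro mult_left_mono) auto
   also have "... = A / 2 * C.D (z' t) t + 2 * A^2 * (Kd * h^2)" using A by (simp add: field_simps power2_eq_square)
   finally show "4 * pi * A^2 * h^2 + 2 * A^2 * C.Z (z t) t <= g + A / 2 * C.D (z' t) t" by (simp add: g_def q_def)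
  qed
  finally show ?thesis .
 qed
 have Kpos: "0 <= Ke" "0 <= Kd" using C.consts_pos by (auto simp: Ke_def Kd_def)
 have g0: "0 <= g" using q Kpos by (simp add: g_def)
 have r1: "integral {0..T} (%t. C.D (z' t) t) <= Kr * h^2" using rate(2) by (simp add: Kr_def)
 have r0: "0 <= integral {0..T} (%t. C.D (z' t) t)" by (rule integral_nonneg[OF rate(1)]) (rule S0)
 have i3: "(\<integral>\<^sup>+ t \<in> {0..T}. L2_sq (%v. pdt T x t v - pdt T xh t v) \<partial>lborel) <= ennreal (24 * q * T + 15 * (Kr * h^2))"
 proof -
  have "(\<integral>\<^sup>+ t \<in> {0..T}. L2_sq (%v. pdt T x t v - pdt T xh t v) \<partial>lborel) <= ennreal (integral {0..T} (%t. 24 * q + 15 * C.D (z' t) t))"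
   by (rule nn_integral_le_integral[OF _ _ v3]) (use q S0 in \<open>auto intro!: continuous_on_add continuous_on_mult continuous_on_const rate(3)\<close>)
  also have "... <= ennreal (24 * q * T + 15 * (Kr * h^2))"
   unfolding integral_affine[OF rate(3) less_imp_le[OF T]] by (rule ennreal_leI) (use r1 in simp)
  finally show ?thesis .
 qed
 have i5: "(\<integral>\<^sup>+ t \<in> {0..T}. L2_sq (%v. du (curvature_vec (x t)) v - du (yh t) v) \<partial>lborel) <= ennreal (g * T + A / 2 * (Kr * h^2))"
 proof -
  have "(\<integral>\<^sup>+ t \<in> {0..T}. L2_sq (%v. du (curvature_vec (x t)) v - du (yh t) v) \<partial>lborel) <= ennreal (integral {0..T} (%t. g + A / 2 * C.D (z' t) t))"
  proof (rule nn_integral_le_integral[OF _ _ v5])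
   show "continuous_on {0..T} (%t. g + A / 2 * C.D (z' t) t)"
    by (intro continuous_on_add continuous_on_mult continuous_on_const rate(3))
  qed (use g0 A0 S0 in \<open>auto intro!: add_nonneg_nonneg mult_nonneg_nonneg\<close>)
  also have "... <= ennreal (g * T + A / 2 * (Kr * h^2))"
   unfolding integral_affine[OF rate(3) less_imp_le[OF T]] using mult_left_mono[OF r1, of "A / 2"] A0
   by (intro ennreal_leI) simp
  finally show ?thesis .
 qed
 have s1: "(SUP t\<in>{0..T}. H1_sq (%v. x t v - xh t v)) <= ennreal ((24 * q + 15 * (Ke * h^2)) + (4 * q + 2 * A^2 * (Ke * h^2)))"
  unfolding H1_sq_def by (rule SUP_least, rule add_le_ennreal[OF v1 v2]) (use q Kpos in auto)
 have s4: "(SUP t\<in>{0..T}. L2_sq (%v. curvature_vec (x t) v - yh t v)) <= ennreal (24 * q + 15 * (Ke * h^2))"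
  by (rule SUP_least[OF v4])
 have Kr: "0 <= Kr * h^2" using r0 r1 by linarith
 show ?thesis unfolding convergent_scheme_def h_def[symmetric]
 proof (rule exI[of _ xh], rule exI[of _ yh], intro conjI allI impI ballI sol)
  fix xk yk t v assume k: "semidiscrete_solution T lam (x 0) N U xk yk" and t: "t \<in> {0..T}" and v: "v \<in> {0..2 * pi}"
  show "xk t v = xh t v" "yk t v = yh t v" using semidiscrete_unique[OF T p k sol t v] by auto
 next
  show "(SUP t\<in>{0..T}. H1_sq (%v. x t v - xh t v))
       + (\<integral>\<^sup>+ t \<in> {0..T}. L2_sq (%v. pdt T x t v - pdt T xh t v) \<partial>lborel) <= ennreal (K * h^2)"
  proof (rule add_le_ennreal[OF s1 i3])
   have "(28 * pi * A^2 + (15 + 2 * A^2) * Ke + 24 * pi * A^2 * T + 15 * Kr) * h^2 <= K * h^2"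
    using K1 unfolding Ke_def Kr_def by (rule mult_right_mono) simp
   then show "24 * q + 15 * (Ke * h^2) + (4 * q + 2 * A^2 * (Ke * h^2)) + (24 * q * T + 15 * (Kr * h^2)) <= K * h^2"
    unfolding q_def by (simp add: algebra_simps)
  qed (use q Kpos Kr T in auto)
  show "(SUP t\<in>{0..T}. L2_sq (%v. curvature_vec (x t) v - yh t v))
       + (\<integral>\<^sup>+ t \<in> {0..T}. L2_sq (%v. du (curvature_vec (x t)) v - du (yh t) v) \<partial>lborel) <= ennreal (K * h^2)"
  proof (rule add_le_ennreal[OF s4 i5])
   have "(24 * pi * A^2 + 15 * Ke + 4 * pi * A^2 * T + A / 2 * Kr + 2 * A^2 * Kd * T) * h^2 <= K * h^2"
    using K2 unfolding Ke_def Kr_def Kd_def by (rule mult_right_mono) simp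
   then show "24 * q + 15 * (Ke * h^2) + (g * T + A / 2 * (Kr * h^2)) <= K * h^2"
    unfolding g_def q_def by (simp add: algebra_simps)
   show "0 <= g * T + A / 2 * (Kr * h^2)"
    by (rule add_nonneg_nonneg[OF mult_nonneg_nonneg[OF g0 less_imp_le[OF T]] mult_nonneg_nonneg[OF _ Kr]]) (use A0 in simp)
  qed (use q Kpos in auto)
 qed
qed

lemma error_estimate:
 fixes T lam c0 chat cbar B :: real
 assumes pos: "0 < T" "0 < lam" "0 < c0" "0 < chat" "0 <= B"
 shows "\<exists>K. \<exists>h0>0. \<forall>(x0 :: real => real ^ 'n) x N U. elastic_flow_solution T lam x0 x -->
  (\<forall>t\<in>{0..T}. \<forall>u. c0 <= norm (pdu x t u)) --> Ck_norm T 8 x <= B --> admissible_mesh chat cbar N U -->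
  0 < mesh_size N U --> mesh_size N U <= h0 --> convergent_scheme K T lam x0 x N U"
proof -
 obtain A where A: "1 <= A" "\<forall>(x :: real => real => real ^ 'n) N U. regular_instance T lam c0 chat cbar B x N U -->
  (\<exists>r0 r0' r. consistent N A (mesh_size N U) lam T (mesh_width N U) (%t j. x t (U j)) (%t j. pdt T x t (U j)) r0 r0' r)
  & (\<forall>t\<in>{0..T}. \<forall>j\<in>idx N. \<forall>w\<in>{U (j - 1)..U j}.
    norm (x t w - x t (U j)) <= A * mesh_size N U
   & norm (du (x t) w - edge N (%j. x t (U j)) j /\<^sub>R mesh_width N U j) <= A * mesh_size N U
   & norm (pdt T x t w - pdt T x t (U j)) <= A * mesh_size N U
   & norm (curvature_vec (x t) w - pcurv N (%j. x t (U j)) j) <= A * mesh_size N U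
   & norm (du (curvature_vec (x t)) w - edge N (pcurv N (%j. x t (U j))) j /\<^sub>R mesh_width N U j) <= A * mesh_size N U)"
  using uniform_consistency[OF pos, where cbar = cbar and 'a = "real ^ 'n"] by (elim exE conjE) (rule that)
 define k1 where "k1 = 28 * pi * A^2 + (15 + 2 * A^2) * energy_const A lam T + 24 * pi * A^2 * T + 15 * rate_const A lam T"
 define k2 where "k2 = 24 * pi * A^2 + 15 * energy_const A lam T + 4 * pi * A^2 * T + A / 2 * rate_const A lam T
    + 2 * A^2 * (diss_const A lam * (energy_const A lam T + 1)) * T"
 define e where "e = \<bar>energy_const A lam T * A^2\<bar>"
 \<comment> \<open>The entries ensure h <= 1, 2 B h <= c0 and the smallness condition of
   \<open>existence\<close>. The added ones keep the denominators positive and make the last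
   inequality strict.\<close>
 define h0 where "h0 = min 1 (min (c0 / (2 * B + 1)) (1 / (e + 1)))"
 have e0: "0 <= e" by (simp add: e_def)
 have "0 < h0" using pos e0 by (simp add: h0_def)
 moreover have "convergent_scheme (max k1 k2) T lam x0 x N U"
  if flow: "elastic_flow_solution T lam x0 x" and low: "\<forall>t\<in>{0..T}. \<forall>u. c0 <= norm (pdu x t u)" and Ck: "Ck_norm T 8 x <= B"
   and adm: "admissible_mesh chat cbar N U" and m: "0 < mesh_size N U" "mesh_size N U <= h0"
  for x0 :: "real => real ^ 'n" and x N U
 proof -
  define h where "h = mesh_size N U"
  have h: "0 < h" "h <= 1" "h <= c0 / (2 * B + 1)" "h <= 1 / (e + 1)" using m by (simp_all add: h_def h0_def)
  have x0: "x0 = x 0" using flow by (auto simp: elastic_flow_solution_def)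
  have "h * (2 * B + 1) <= c0" using h(3) pos by (simp add: pos_le_divide_eq)
  then have "2 * B * h <= c0" using h(1) by (simp add: algebra_simps)
  then have reg: "regular_instance T lam c0 chat cbar B x N U"
   using flow low Ck adm m h(2) by (simp add: regular_instance_def x0 h_def)
  have "h * (e + 1) <= 1" using h(4) e0 by (simp add: pos_le_divide_eq)
  then have eh: "e * h < 1" using h(1) by (simp add: algebra_simps)
  have "energy_const A lam T * A^2 * h <= e * h" unfolding e_def using h(1) by (intro mult_right_mono) auto
  then have small: "energy_const A lam T * A^2 * mesh_size N U < 1" using eh unfolding h_def by linarith
  obtain r0 r0' r where c: "consistent N A (mesh_size N U) lam T (mesh_width N U) (%t j. x t (U j)) (%t j. pdt T x t (U j)) r0 r0' r"
   using conjunct1[OF A(2)[THEN spec, THEN spec, THEN spec, THEN mp, OF reg]] by (elim exE) (rule that)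
  show ?thesis unfolding x0
   by (rule regular_instance_converges[OF pos(1) reg A(1) c conjunct2[OF A(2)[THEN spec, THEN spec, THEN spec, THEN mp, OF reg]] small])
    (simp_all only: k1_def[symmetric] k2_def[symmetric] max.cobounded1 max.cobounded2)
 qed
 ultimately show ?thesis by blast
qed

theorem theorem2p5:
  shows "\<exists>(k::nat) (F :: real \<Rightarrow> real \<Rightarrow> real \<Rightarrow> real \<Rightarrow> real \<Rightarrow> real \<Rightarrow> real \<Rightarrow> real).
    \<forall>(T::real) (lam::real) (c0::real) (C0::real) (chat::real) (cbar::real)
      (x0 :: real \<Rightarrow> real ^ 'n) (x :: real \<Rightarrow> real \<Rightarrow> real ^ 'n).
      T > 0 \<longrightarrow> lam > 0 \<longrightarrow> chat > 0 \<longrightarrow> cbar > 0 \<longrightarrow>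
      smooth_curve x0 \<longrightarrow> periodic_2pi x0 \<longrightarrow>
      elastic_flow_solution T lam x0 x \<longrightarrow>
      0 < c0 \<longrightarrow> c0 \<le> C0 \<longrightarrow>
      (\<forall>t\<in>{0..T}. \<forall>u\<in>{0..2 * pi}.
         c0 \<le> norm (du (x t) u) \<and> norm (du (x t) u) \<le> C0 \<and> norm (curvature_vec (x t) u) \<le> C0) \<longrightarrow>
      (\<exists>h0>0. \<forall>N U.
         admissible_mesh chat cbar N U \<longrightarrow> 0 < mesh_size N U \<longrightarrow> mesh_size N U \<le> h0 \<longrightarrow>
         (\<exists>xh yh.
            semidiscrete_solution T lam x0 N U xh yh \<and>
            (\<forall>xh' yh'. semidiscrete_solution T lam x0 N U xh' yh' \<longrightarrow>
               (\<forall>t\<in>{0..T}. \<forall>v\<in>{0..2 * pi}. xh' t v = xh t v \<and> yh' t v = yh t v)) \<and>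
            (SUP t\<in>{0..T}. H1_sq (\<lambda>v. x t v - xh t v))
              + (\<integral>\<^sup>+ t \<in> {0..T}. L2_sq (\<lambda>v. pdt T x t v - pdt T xh t v) \<partial>lborel)
              \<le> ennreal (F T c0 C0 lam chat cbar (Ck_norm T k x) * (mesh_size N U)\<^sup>2) \<and>
            (SUP t\<in>{0..T}. L2_sq (\<lambda>v. curvature_vec (x t) v - yh t v))
              + (\<integral>\<^sup>+ t \<in> {0..T}. L2_sq (\<lambda>v. du (curvature_vec (x t)) v - du (yh t) v) \<partial>lborel)
              \<le> ennreal (F T c0 C0 lam chat cbar (Ck_norm T k x) * (mesh_size N U)\<^sup>2)))"
proof -
 define P where "P T lam c0 chat cbar B K \<longleftrightarrow> (\<exists>h0>0. \<forall>(x0 :: real => real ^ 'n) x N U. elastic_flow_solution T lam x0 x -->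
  (\<forall>t\<in>{0..T}. \<forall>u. c0 <= norm (pdu x t u)) --> Ck_norm T 8 x <= B --> admissible_mesh chat cbar N U -->
  0 < mesh_size N U --> mesh_size N U <= h0 --> convergent_scheme K T lam x0 x N U)" for T lam c0 chat cbar B K
 \<comment> \<open>The constant is chosen from the scalar data before a solution is fixed. This is
   possible because \<open>P\<close> speaks of all solutions and meshes obeying these bounds, with
   \<open>B\<close> in the place of the norm.\<close>
 define F :: "real => real => real => real => real => real => real => real" where
  "F = (%T c0 C0 lam chat cbar B. SOME K. P T lam c0 chat cbar B K)"
 show ?thesis
 \<comment> \<open>Order eight is the one controlled in \<open>node_jets\<close>.\<close>
 proof (rule exI[of _ 8], rule exI[of _ F], intro allI impI)
  fix T lam c0 C0 chat cbar :: real and x0 :: "real => real ^ 'n" and x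
  assume T: "0 < T" and lam: "0 < lam" and chat: "0 < chat" and flow: "elastic_flow_solution T lam x0 x" and c0: "0 < c0"
   and bounds: "\<forall>t\<in>{0..T}. \<forall>u\<in>{0..2 * pi}.
     c0 <= norm (du (x t) u) & norm (du (x t) u) <= C0 & norm (curvature_vec (x t) u) <= C0"
  define B where "B = Ck_norm T 8 x"
  have sm: "smooth_on_strip T x" and per: "\<forall>t\<in>{0..T}. periodic_2pi (x t)"
   using flow by (simp_all add: elastic_flow_solution_def)
  have "norm ((pdt T ^^ 0) ((pdu ^^ 0) x) 0 0) <= B"
   unfolding B_def by (rule Ck_norm_bound[OF sm per T]) (use T in auto)
  then have B: "0 <= B" by (rule order_trans[OF norm_ge_zero])
  have low: "\<forall>t\<in>{0..T}. \<forall>u. c0 <= norm (pdu x t u)"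
  proof (intro ballI allI)
   fix t u assume t: "t \<in> {0..T}"
   have "periodic_2pi (pdu x t)" using periodic_pdu[OF sm per] t by blast
   then obtain w where "w \<in> {0..2 * pi}" "pdu x t u = pdu x t w" using periodic_reduce by blast
   then show "c0 <= norm (pdu x t u)" using bounds t by (simp add: pdu_def)
  qed
  have "\<exists>K. P T lam c0 chat cbar B K" unfolding P_def by (rule error_estimate[OF T lam c0 chat B])
  then have "P T lam c0 chat cbar B (F T c0 C0 lam chat cbar B)" unfolding F_def by (rule someI_ex)
  then obtain h0 where h0: "0 < h0" "\<forall>(x0 :: real => real ^ 'n) x N U. elastic_flow_solution T lam x0 x -->
   (\<forall>t\<in>{0..T}. \<forall>u. c0 <= norm (pdu x t u)) --> Ck_norm T 8 x <= B --> admissible_mesh chat cbar N U -->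
   0 < mesh_size N U --> mesh_size N U <= h0 --> convergent_scheme (F T c0 C0 lam chat cbar B) T lam x0 x N U"
   unfolding P_def by (elim exE conjE) (rule that)
  show "\<exists>h0>0. \<forall>N U.
     admissible_mesh chat cbar N U --> 0 < mesh_size N U --> mesh_size N U <= h0 -->
     (\<exists>xh yh.
      semidiscrete_solution T lam x0 N U xh yh &
      (\<forall>xh' yh'. semidiscrete_solution T lam x0 N U xh' yh' -->
        (\<forall>t\<in>{0..T}. \<forall>v\<in>{0..2 * pi}. xh' t v = xh t v & yh' t v = yh t v)) &
      (SUP t\<in>{0..T}. H1_sq (%v. x t v - xh t v))
       + (\<integral>\<^sup>+ t \<in> {0..T}. L2_sq (%v. pdt T x t v - pdt T xh t v) \<partial>lborel)
       <= ennreal (F T c0 C0 lam chat cbar (Ck_norm T 8 x) * (mesh_size N U)^2) &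
      (SUP t\<in>{0..T}. L2_sq (%v. curvature_vec (x t) v - yh t v))
       + (\<integral>\<^sup>+ t \<in> {0..T}. L2_sq (%v. du (curvature_vec (x t)) v - du (yh t) v) \<partial>lborel)
       <= ennreal (F T c0 C0 lam chat cbar (Ck_norm T 8 x) * (mesh_size N U)^2))"
   unfolding convergent_scheme_def[symmetric] B_def[symmetric]
  proof (intro exI[of _ h0] conjI h0(1) allI impI)
   fix N U assume "admissible_mesh chat cbar N U" "0 < mesh_size N U" "mesh_size N U <= h0"
   then show "convergent_scheme (F T c0 C0 lam chat cbar B) T lam x0 x N U"
    using h0(2)[THEN spec, THEN spec, THEN spec, THEN spec, THEN mp, THEN mp, THEN mp, OF flow low] unfolding B_def by simp
  qed
 qed
qed

end
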